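(* Let $F/K$ be a finite field extension of characteristic $p>0$, and let $L/K$ be its normal closure. Then: (1) For each $M\in\mathcal{N}(F/K)$ we have $M=M^{pi}\otimes M^{gal}$, where $M^{pi}=M\cap L^{pi}$ and $M^{gal}=M\cap L^{gal}$. Moreover, $$\mathcal{N}(F/K)=\{N\otimes\Gamma\mid N\in\mathcal{F}(F^{pi}/K),\ \Gamma\in\mathcal{N}(F^{gal}/K)\}.$$ (2) $\mathcal{A}(E(L/K),L,F,G(L/K))=\{\mathcal{D}(L^{pi}/N)\otimes(L^{gal}\rtimes G(L^{gal}/\Gamma))=E(L^{pi}/N)\otimes(L^{gal}\rtimes G(L^{gal}/\Gamma))\mid N\in\mathcal{F}(F^{pi}/K),\ \Gamma\in\mathcal{N}(F^{gal}/K)\}$. (3) (Analogue of the Galois correspondence for normal subfields.) Consider the map $\mathcal{N}(F/K)\to\mathcal{A}(E(L/K),L,F,G(L/K))$ given by $$M\mapsto C_{E(L/K)}(M)=C_{E(L^{pi}/K)}(M^{pi})\otimes C_{E(L^{gal}/K)}(M^{gal})=E(L^{pi}/M^{pi})\otimes E(L^{gal}/M^{gal})=\mathcal{D}(L^{pi}/M^{pi})\otimes(L^{gal}\rtimes G(L^{gal}/M^{gal})).$$ This map is a bijection, with inverse $$A\mapsto C_{E(L/K)}(A)=(L^{pi})^{A\cap\mathcal{D}(L^{pi}/K)_+}\otimes(L^{gal})^{A\cap G(L^{gal}/K)}.$$ In particular, the inverse sends $\mathcal{D}(L^{pi}/N)\otimes(L^{gal}\rtimes G(L^{gal}/\Gamma))$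 to $(L^{pi})^{\mathcal{D}(L^{pi}/N)_+}\otimes(L^{gal})^{G(L^{gal}/\Gamma)}$.
   Context: Notation and conventions. - For a finite field extension $L/K$ and an intermediate field $M$: - $E(L/M)=\mathrm{End}_M(L)\subseteq E(L/K)$. - $L$ is identified with its multiplication operators. - $G(L/M)$ is the group of $M$-algebra automorphisms of $L$. - $\mathcal{D}(L/M)$ is the algebra of $M$-linear differential operators on $L$. It is defined as $\bigcup_i\mathcal{D}_i$, where $\mathcal{D}_0=L$ and $\mathcal{D}_i=\{\delta\in E(L/M)\mid [\delta,l]\in\mathcal{D}_{i-1}\ \forall l\in L\}$. - $\mathcal{D}(L/M)_+=\{\delta\in\mathcal{D}(L/M)\mid\delta(1)=0\}$. - $D\rtimes H$ denotes the subalgebra $\sum_{h\in H}Dh$; the notation asserts that the sum is direct. - $C_E(S)$ denotes a centralizer. - For a set $S$ of operators on a field $P$ that kill $1$, $P^S=\{x\in P\mid s(x)=0\ \forall s\in S\}$. For a group $H$ of automorphisms of $P$, $P^H$ is the fixed field. - $\mathcal{F}(P/K)$ is the set of intermediate fields of $P/K$, and $\mathcal{N}(P/K)$ is the set of intermediate fields $N$ with $N/K$ normal. - $L^{pi}$ and $L^{gal}$ are the largest purely inseparable and the largest Galois subextensions of $L/K$. $F^{pi}$ and $F^{gal}$ are defined similarly for $F/K$. - For intermediate fields $N,\Gamma$ of $L/K$, $N\otimes\Gamma$ denotes the compositum $N\Gamma$; the notation indicates that the multiplication map $N\otimes_K\Gamma\to N\Gamma$ is an isomorphism. - Since $L/K$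 is normal, multiplication gives an isomorphism $L^{pi}\otimes_K L^{gal}\cong L$. This induces $E(L/K)\cong E(L^{pi}/K)\otimes_K E(L^{gal}/K)$. - Through this isomorphism, $E(L^{pi}/K)$, $E(L^{gal}/K)$, and their subalgebras and subgroups (e.g. $\mathcal{D}(L^{pi}/K)_+$, $G(L^{gal}/K)$) are regarded as subsets of $E(L/K)$. - Tensor products of such subalgebras are regarded as subalgebras of $E(L/K)$. - $\mathcal{A}(E(L/K),L,F,G(L/K))$ is the set of $K$-subalgebras $A\subseteq E(L/K)$ such that: - $L\subseteq A$, - $C_{E(L/K)}(F)\subseteq A$, - $gAg^{-1}=A$ for all $g\in G(L/K)$. *)

theory Defs
  imports "HOL-Algebra.Algebra"
begin

section \<open>Field extensions inside an ambient field\<close>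

text \<open>
  All fields are subfields of one field (a record \<open>R\<close>); a subset \<open>P\<close> regarded as a field of its
  own is \<open>R\<lparr>carrier := P\<rparr>\<close>.
\<close>

definition ring_char :: "('a, 'm) ring_scheme \<Rightarrow> nat"
  where "ring_char R = group.ord (add_monoid R) \<one>\<^bsub>R\<^esub>"

definition intermediate_fields :: "('a, 'm) ring_scheme \<Rightarrow> 'a set \<Rightarrow> 'a set \<Rightarrow> 'a set set"
  where "intermediate_fields R P K = {M. subfield M R \<and> K \<subseteq> M \<and> M \<subseteq> P}"

definition normal_ext :: "('a, 'm) ring_scheme \<Rightarrow> 'a set \<Rightarrow> 'a set \<Rightarrow> bool"
  where "normal_ext R N K \<longleftrightarrow>
    (\<forall>x\<in>N. ring.algebraic R K x) \<and>
    (\<forall>f. f \<in> carrier (K[X]\<^bsub>R\<^esub>) \<and> pirreducible\<^bsub>R\<^esub> K f \<and> (\<exists>x\<in>N. ring.is_root R f x)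
       \<longrightarrow> ring.splitted (R\<lparr>carrier := N\<rparr>) f)"

text \<open>
  The second conjunct is separability: by normality \<open>N\<close> contains a splitting field of the minimal
  polynomial of each of its elements, so multiple roots may be looked for in \<open>N\<close>.
\<close>

definition galois_ext :: "('a, 'm) ring_scheme \<Rightarrow> 'a set \<Rightarrow> 'a set \<Rightarrow> bool"
  where "galois_ext R N K \<longleftrightarrow>
    normal_ext R N K \<and>
    (\<forall>x\<in>N. \<forall>a\<in>N. ring.alg_mult (R\<lparr>carrier := N\<rparr>) (ring.Irr R K x) a \<le> 1)"

definition purely_inseparable_ext :: "('a, 'm) ring_scheme \<Rightarrow> 'a set \<Rightarrow> 'a set \<Rightarrow> bool"
  where "purely_inseparable_ext R N K \<longleftrightarrow>
    (\<forall>x\<in>N. \<exists>n::nat. x [^]\<^bsub>R\<^esub> (ring_char R ^ n) \<in> K)"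

definition normal_closure :: "('a, 'm) ring_scheme \<Rightarrow> 'a set \<Rightarrow> 'a set \<Rightarrow> bool"
  where "normal_closure R F K \<longleftrightarrow>
    normal_ext R (carrier R) K \<and> F \<subseteq> carrier R \<and>
    (\<forall>M \<in> intermediate_fields R (carrier R) K. F \<subseteq> M \<and> normal_ext R M K \<longrightarrow> M = carrier R)"

definition normal_fields :: "('a, 'm) ring_scheme \<Rightarrow> 'a set \<Rightarrow> 'a set \<Rightarrow> 'a set set"
  where "normal_fields R P K = {N \<in> intermediate_fields R P K. normal_ext R N K}"

definition pi_part :: "('a, 'm) ring_scheme \<Rightarrow> 'a set \<Rightarrow> 'a set \<Rightarrow> 'a set"
  where "pi_part R P K =
    (GREATEST N. N \<in> intermediate_fields R P K \<and> purely_inseparable_ext R N K)"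

definition gal_part :: "('a, 'm) ring_scheme \<Rightarrow> 'a set \<Rightarrow> 'a set \<Rightarrow> 'a set"
  where "gal_part R P K =
    (GREATEST N. N \<in> intermediate_fields R P K \<and> galois_ext R N K)"

definition compositum :: "('a, 'm) ring_scheme \<Rightarrow> 'a set \<Rightarrow> 'a set \<Rightarrow> 'a set"
  where "compositum R N \<Gamma> = generate_field R (N \<union> \<Gamma>)"


section \<open>Tensor products over a subfield and the multiplication map\<close>

text \<open>
  \<open>A\<close> and \<open>B\<close> are \<open>K\<close>-subspaces of a ring \<open>R\<close>, and \<open>K \<subseteq> R\<close> is a field which commutes with both.
  \<open>tensor_product\<close> is the free abelian group on \<open>A \<times> B\<close> modulo biadditivity and \<open>K\<close>-balancedness.
\<close>

definition tensor_relators ::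
    "('a, 'm) ring_scheme \<Rightarrow> 'a set \<Rightarrow> 'a set \<Rightarrow> 'a set \<Rightarrow> (('a \<times> 'a) \<Rightarrow>\<^sub>0 int) set"
  where "tensor_relators R K A B =
    {frag_of (a \<oplus>\<^bsub>R\<^esub> a', b) - frag_of (a, b) - frag_of (a', b) | a a' b. a \<in> A \<and> a' \<in> A \<and> b \<in> B} \<union>
    {frag_of (a, b \<oplus>\<^bsub>R\<^esub> b') - frag_of (a, b) - frag_of (a, b') | a b b'. a \<in> A \<and> b \<in> B \<and> b' \<in> B} \<union>
    {frag_of (k \<otimes>\<^bsub>R\<^esub> a, b) - frag_of (a, k \<otimes>\<^bsub>R\<^esub> b) | k a b. k \<in> K \<and> a \<in> A \<and> b \<in> B}"

definition tensor_product ::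
    "('a, 'm) ring_scheme \<Rightarrow> 'a set \<Rightarrow> 'a set \<Rightarrow> 'a set \<Rightarrow> (('a \<times> 'a) \<Rightarrow>\<^sub>0 int) set monoid"
  where "tensor_product R K A B =
    free_Abelian_group (A \<times> B) Mod generate (free_Abelian_group (A \<times> B)) (tensor_relators R K A B)"

text \<open>The formal sum of the \<open>n\<^sub>i (a\<^sub>i, b\<^sub>i)\<close> goes to the sum of the \<open>n\<^sub>i a\<^sub>i b\<^sub>i\<close>.\<close>

definition mult_map :: "('a, 'm) ring_scheme \<Rightarrow> (('a \<times> 'a) \<Rightarrow>\<^sub>0 int) \<Rightarrow> 'a"
  where "mult_map R u =
    (\<Oplus>\<^bsub>R\<^esub>z\<in>Poly_Mapping.keys u. [Poly_Mapping.lookup u z] \<cdot>\<^bsub>R\<^esub> (fst z \<otimes>\<^bsub>R\<^esub> snd z))"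

definition mult_image :: "('a, 'm) ring_scheme \<Rightarrow> 'a set \<Rightarrow> 'a set \<Rightarrow> 'a set"
  where "mult_image R A B = mult_map R ` carrier (free_Abelian_group (A \<times> B))"

text \<open>The map induced by \<open>mult_map\<close> is an isomorphism from the tensor product onto \<open>C\<close>.\<close>

definition tensor_iso ::
    "('a, 'm) ring_scheme \<Rightarrow> 'a set \<Rightarrow> 'a set \<Rightarrow> 'a set \<Rightarrow> 'a set \<Rightarrow> bool"
  where "tensor_iso R K A B C \<longleftrightarrow>
    (\<lambda>U. the_elem (mult_map R ` U)) \<in> iso (tensor_product R K A B) (add_monoid (R\<lparr>carrier := C\<rparr>))"


section \<open>Endomorphisms, automorphisms and differential operators\<close>

text \<open>Operators on \<open>P\<close> are extensional functions, so that equality is equality on \<open>P\<close>.\<close>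

definition End :: "('a, 'm) ring_scheme \<Rightarrow> 'a set \<Rightarrow> 'a set \<Rightarrow> ('a \<Rightarrow> 'a) set"
  where "End R P M = {f \<in> P \<rightarrow>\<^sub>E P.
    (\<forall>x\<in>P. \<forall>y\<in>P. f (x \<oplus>\<^bsub>R\<^esub> y) = f x \<oplus>\<^bsub>R\<^esub> f y) \<and>
    (\<forall>m\<in>M. \<forall>x\<in>P. f (m \<otimes>\<^bsub>R\<^esub> x) = m \<otimes>\<^bsub>R\<^esub> f x)}"

definition End_ring :: "('a, 'm) ring_scheme \<Rightarrow> 'a set \<Rightarrow> 'a set \<Rightarrow> ('a \<Rightarrow> 'a) ring"
  where "End_ring R P M =
    \<lparr>carrier = End R P M,
     monoid.mult = compose P,
     monoid.one = (\<lambda>x\<in>P. x),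
     ring.zero = (\<lambda>x\<in>P. \<zero>\<^bsub>R\<^esub>),
     ring.add = (\<lambda>f g. \<lambda>x\<in>P. f x \<oplus>\<^bsub>R\<^esub> g x)\<rparr>"

definition mult_op :: "('a, 'm) ring_scheme \<Rightarrow> 'a set \<Rightarrow> 'a \<Rightarrow> 'a \<Rightarrow> 'a"
  where "mult_op R P a = (\<lambda>x\<in>P. a \<otimes>\<^bsub>R\<^esub> x)"

definition Aut :: "('a, 'm) ring_scheme \<Rightarrow> 'a set \<Rightarrow> 'a set \<Rightarrow> ('a \<Rightarrow> 'a) set"
  where "Aut R P M = {g \<in> extensional P.
    g \<in> ring_iso (R\<lparr>carrier := P\<rparr>) (R\<lparr>carrier := P\<rparr>) \<and> (\<forall>m\<in>M. g m = m)}"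

primrec diff_ops_upto :: "('a, 'm) ring_scheme \<Rightarrow> 'a set \<Rightarrow> 'a set \<Rightarrow> nat \<Rightarrow> ('a \<Rightarrow> 'a) set"
  where
    "diff_ops_upto R P M 0 = mult_op R P ` P"
  | "diff_ops_upto R P M (Suc i) = {\<delta> \<in> End R P M. \<forall>l \<in> mult_op R P ` P.
       \<delta> \<otimes>\<^bsub>End_ring R P M\<^esub> l \<ominus>\<^bsub>End_ring R P M\<^esub> l \<otimes>\<^bsub>End_ring R P M\<^esub> \<delta> \<in> diff_ops_upto R P M i}"

definition diff_ops :: "('a, 'm) ring_scheme \<Rightarrow> 'a set \<Rightarrow> 'a set \<Rightarrow> ('a \<Rightarrow> 'a) set"
  where "diff_ops R P M = (\<Union>i. diff_ops_upto R P M i)"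

definition diff_ops_plus :: "('a, 'm) ring_scheme \<Rightarrow> 'a set \<Rightarrow> 'a set \<Rightarrow> ('a \<Rightarrow> 'a) set"
  where "diff_ops_plus R P M = {\<delta> \<in> diff_ops R P M. \<delta> \<one>\<^bsub>R\<^esub> = \<zero>\<^bsub>R\<^esub>}"

definition centralizer :: "('a, 'm) ring_scheme \<Rightarrow> 'a set \<Rightarrow> 'a set"
  where "centralizer E S = {x \<in> carrier E. \<forall>s\<in>S. x \<otimes>\<^bsub>E\<^esub> s = s \<otimes>\<^bsub>E\<^esub> x}"

text \<open>The sum of the \<open>D h\<close>, for \<open>h \<in> H\<close>, and its directness.\<close>

definition crossed :: "('a, 'm) ring_scheme \<Rightarrow> 'a set \<Rightarrow> 'a set \<Rightarrow> 'a set"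
  where "crossed E D H = generate (add_monoid E) {d \<otimes>\<^bsub>E\<^esub> h | d h. d \<in> D \<and> h \<in> H}"

definition crossed_direct :: "('a, 'm) ring_scheme \<Rightarrow> 'a set \<Rightarrow> 'a set \<Rightarrow> bool"
  where "crossed_direct E D H \<longleftrightarrow>
    (\<forall>S d. finite S \<and> S \<subseteq> H \<and> d \<in> S \<rightarrow> D \<and> (\<Oplus>\<^bsub>E\<^esub>h\<in>S. d h \<otimes>\<^bsub>E\<^esub> h) = \<zero>\<^bsub>E\<^esub>
       \<longrightarrow> (\<forall>h\<in>S. d h \<otimes>\<^bsub>E\<^esub> h = \<zero>\<^bsub>E\<^esub>))"

definition killed_by :: "('a, 'm) ring_scheme \<Rightarrow> 'a set \<Rightarrow> ('a \<Rightarrow> 'a) set \<Rightarrow> 'a set"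
  where "killed_by R P S = {x \<in> P. \<forall>s\<in>S. s x = \<zero>\<^bsub>R\<^esub>}"

definition fixed_by :: "'a set \<Rightarrow> ('a \<Rightarrow> 'a) set \<Rightarrow> 'a set"
  where "fixed_by P H = {x \<in> P. \<forall>h\<in>H. h x = x}"


section \<open>Operators on the two tensor factors as operators on the whole field\<close>

text \<open>
  Let \<open>P\<close> and \<open>Q\<close> be subfields of the field \<open>R\<close> for which multiplication is an isomorphism from the
  tensor product of \<open>P\<close> and \<open>Q\<close> over \<open>K\<close> onto \<open>R\<close>.  Then \<open>embed_left\<close> is \<open>a \<mapsto> a \<otimes> 1\<close> and
  \<open>embed_right\<close> is \<open>b \<mapsto> 1 \<otimes> b\<close>; the descriptions are then uniquely satisfied.
\<close>

definition embed_left ::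
    "('a, 'm) ring_scheme \<Rightarrow> 'a set \<Rightarrow> 'a set \<Rightarrow> 'a set \<Rightarrow> ('a \<Rightarrow> 'a) \<Rightarrow> 'a \<Rightarrow> 'a"
  where "embed_left R K P Q a = (THE \<phi>. \<phi> \<in> End R (carrier R) K \<and>
    (\<forall>x\<in>P. \<forall>y\<in>Q. \<phi> (x \<otimes>\<^bsub>R\<^esub> y) = a x \<otimes>\<^bsub>R\<^esub> y))"

definition embed_right ::
    "('a, 'm) ring_scheme \<Rightarrow> 'a set \<Rightarrow> 'a set \<Rightarrow> 'a set \<Rightarrow> ('a \<Rightarrow> 'a) \<Rightarrow> 'a \<Rightarrow> 'a"
  where "embed_right R K P Q b = (THE \<phi>. \<phi> \<in> End R (carrier R) K \<and>
    (\<forall>x\<in>P. \<forall>y\<in>Q. \<phi> (x \<otimes>\<^bsub>R\<^esub> y) = x \<otimes>\<^bsub>R\<^esub> b y))"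

text \<open>
  For \<open>A\<close> a set of operators on \<open>P\<close> and \<open>B\<close> one on \<open>Q\<close>: the subset of the endomorphism ring of the
  whole field with which the tensor product of \<open>A\<close> and \<open>B\<close> over \<open>K\<close> is identified, and the
  statement that this identification is an isomorphism.
\<close>

definition op_tensor ::
    "('a, 'm) ring_scheme \<Rightarrow> 'a set \<Rightarrow> 'a set \<Rightarrow> 'a set \<Rightarrow> ('a \<Rightarrow> 'a) set \<Rightarrow> ('a \<Rightarrow> 'a) set
      \<Rightarrow> ('a \<Rightarrow> 'a) set"
  where "op_tensor R K P Q A B =
    mult_image (End_ring R (carrier R) K) (embed_left R K P Q ` A) (embed_right R K P Q ` B)"

definition op_tensor_iso ::
    "('a, 'm) ring_scheme \<Rightarrow> 'a set \<Rightarrow> 'a set \<Rightarrow> 'a set \<Rightarrow> ('a \<Rightarrow> 'a) set \<Rightarrow> ('a \<Rightarrow> 'a) set \<Rightarrow> bool"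
  where "op_tensor_iso R K P Q A B \<longleftrightarrow>
    tensor_iso (End_ring R (carrier R) K) (mult_op R (carrier R) ` K)
      (embed_left R K P Q ` A) (embed_right R K P Q ` B) (op_tensor R K P Q A B)"

definition invariant_algebras :: "('a, 'm) ring_scheme \<Rightarrow> 'a set \<Rightarrow> 'a set \<Rightarrow> ('a \<Rightarrow> 'a) set set"
  where "invariant_algebras R F K = (let E = End_ring R (carrier R) K; m = mult_op R (carrier R) in
    {A. subring A E \<and> subalgebra (m ` K) A E \<and>
        m ` carrier R \<subseteq> A \<and>
        centralizer E (m ` F) \<subseteq> A \<and>
        (\<forall>g \<in> Aut R (carrier R) K. (\<lambda>a. g \<otimes>\<^bsub>E\<^esub> a \<otimes>\<^bsub>E\<^esub> inv\<^bsub>E\<^esub> g) ` A = A)})"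

end

theory Submission
  imports Defs
begin

text \<open>
  The purely inseparable part of \<open>L\<close> is the fixed field \<open>L\<^sup>G\<close> of \<open>G = G(L/K)\<close>, and the Galois part
  is generated over \<open>K\<close> by the \<open>q\<close>-th powers, for \<open>q\<close> a power of \<open>p\<close> that sends \<open>L\<^sup>G\<close> into \<open>K\<close>.
  A finite group of automorphisms has a dual family: elements \<open>u\<^sub>i\<close>, \<open>v\<^sub>i\<close> for which \<open>\<Sum> u\<^sub>i g(v\<^sub>i)\<close> is
  \<open>1\<close> at \<open>g = 1\<close> and \<open>0\<close> elsewhere, so that \<open>x = \<Sum> u\<^sub>i Tr(v\<^sub>i x)\<close>. Its \<open>q\<close>-th powers are again a dual
  family; they split every \<open>G\<close>-stable subfield \<open>M\<close> into \<open>M \<inter> L\<^sup>p\<^sup>i\<close> and \<open>M \<inter> L\<^sup>g\<^sup>a\<^sup>l\<close>, and trace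
  functionals give linear disjointness. The same family expands \<open>\<Gamma>\<close>-linear operators in automorphisms, so
  \<open>E(L\<^sup>g\<^sup>a\<^sup>l/\<Gamma>)\<close> is the crossed product. On the inseparable part \<open>(ad b)\<^sup>q = ad (b\<^sup>q) = 0\<close>; hence the
  commuting operators \<open>ad b\<close> are nilpotent and every \<open>N\<close>-linear operator is differential.
  Finally an algebra between \<open>L\<close> and \<open>E(L/K)\<close> is \<open>E(L/M)\<close> for its centralizer \<open>M\<close>
  (Jacobson--Bourbaki), and conjugation by \<open>g\<close> turns \<open>E(L/M)\<close> into \<open>E(L/gM)\<close>: invariant algebras
  correspond to \<open>G\<close>-stable, that is normal, subfields.
\<close>

section \<open>Frobenius\<close>

text \<open>The members of a dual family are arbitrary elements of \<open>L\<close>, and this is the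
  obstacle to a splitting of \<open>L\<close>. Frobenius removes it: \<open>q\<close>-th powers keep
  the values 0 and 1 of the defining relation and carry the members into the Galois part. The
  outcome, \<open>z = \<Sum> U\<^sub>i Tr(V\<^sub>i z)\<close> with separable
  \<open>U\<^sub>i\<close>, \<open>V\<^sub>i\<close> and fixed coefficients, stands in for separable
  degrees and primitive elements, and it yields closed formulas for \<open>a \<otimes> 1\<close> and
  \<open>1 \<otimes> b\<close>. Tensor products are quotients of free abelian groups here, so
  injectivity of multiplication is reduced to one criterion: if
  \<open>\<Sum> a\<^sub>j b\<^sub>j = 0\<close> and \<open>b\<^sub>i \<noteq> 0\<close>, there are
  \<open>c\<^sub>j \<in> K\<close> with \<open>\<Sum> c\<^sub>j a\<^sub>j = 0\<close> and
  \<open>c\<^sub>i = 1\<close>. As the \<open>c\<^sub>j\<close> can be found from the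
  \<open>b\<^sub>j\<close> alone, the criterion passes from elements to operators by evaluation at a
  point. Finally \<open>F\<close> need not be stable under \<open>G\<close>, so its Galois part is
  not simply an intersection with that of \<open>L\<close>: it consists of the separable elements
  all of whose conjugates lie in \<open>F\<close>.\<close>

lemma (in ring) iterated_bimodule_map:
  assumes x: "x \<in> carrier R" and y: "y \<in> carrier R" and d: "d \<in> carrier R"
  shows "((\<lambda>z. x \<otimes> z \<oplus> z \<otimes> y) ^^ n) d =
    (\<Oplus>i\<in>{..n}. add_pow R (n choose i) (x [^] i \<otimes> (d \<otimes> y [^] (n - i))))"
proof (induction n)
  case 0
  show ?case using assms by (simp add: finsum_0)
next
  case (Suc n)
  define t where "t i j = x [^] i \<otimes> (d \<otimes> y [^] j)" for i j :: nat
  have t: "t i j \<in> carrier R" for i j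
    using assms by (simp add: t_def)
  have xt: "x \<otimes> t i j = t (Suc i) j" for i j
  proof -
    have "x [^] Suc i = x \<otimes> x [^] i"
      using x by (metis nat_pow_Suc2)
    then show ?thesis unfolding t_def using assms by (simp add: m_assoc del: nat_pow_Suc)
  qed
  have ty: "t i j \<otimes> y = t i (Suc j)" for i j
    using assms by (simp add: t_def m_assoc)
  have "((\<lambda>z. x \<otimes> z \<oplus> z \<otimes> y) ^^ Suc n) d =
    x \<otimes> (\<Oplus>i\<in>{..n}. add_pow R (n choose i) (t i (n - i))) \<oplus> (\<Oplus>i\<in>{..n}. add_pow R (n choose i) (t i (n - i))) \<otimes> y"
    using Suc.IH by (simp add: t_def)
  also have "x \<otimes> (\<Oplus>i\<in>{..n}. add_pow R (n choose i) (t i (n - i))) = (\<Oplus>i\<in>{..n}. add_pow R (n choose i) (t (Suc i) (n - i)))"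
    using x t by (subst finsum_rdistr) (auto simp: add_pow_rdistr xt)
  also have "(\<Oplus>i\<in>{..n}. add_pow R (n choose i) (t i (n - i))) \<otimes> y = (\<Oplus>i\<in>{..n}. add_pow R (n choose i) (t i (Suc n - i)))"
    using y t by (subst finsum_ldistr) (auto simp: add_pow_ldistr ty Suc_diff_le intro!: add.finprod_cong')
  \<comment> \<open>The extra term has coefficient \<open>n choose Suc n = 0\<close>. With it, the
    term at 0 can be split off and the rest added to the first sum by Pascal's rule.\<close>
  also have "(\<Oplus>i\<in>{..n}. add_pow R (n choose i) (t i (Suc n - i))) = (\<Oplus>i\<in>{..Suc n}. add_pow R (n choose i) (t i (Suc n - i)))"
    using t by (subst finsum_Suc) (auto simp: Pi_iff binomial_eq_0)
  also have "\<dots> = (\<Oplus>i\<in>{..n}. add_pow R (n choose Suc i) (t (Suc i) (n - i))) \<oplus> t 0 (Suc n)"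
    using t by (subst finsum_Suc2) (auto simp: Pi_iff)
  also have "(\<Oplus>i\<in>{..n}. add_pow R (n choose i) (t (Suc i) (n - i))) \<oplus>
      ((\<Oplus>i\<in>{..n}. add_pow R (n choose Suc i) (t (Suc i) (n - i))) \<oplus> t 0 (Suc n)) =
    (\<Oplus>i\<in>{..n}. add_pow R (Suc n choose Suc i) (t (Suc i) (n - i))) \<oplus> t 0 (Suc n)"
    using t by (subst a_assoc[symmetric]) (auto simp: Pi_iff finsum_addf[symmetric] add.nat_pow_mult)
  also have "\<dots> = (\<Oplus>i\<in>{..Suc n}. add_pow R (Suc n choose i) (t i (Suc n - i)))"
    using t by (subst finsum_Suc2) (auto simp: Pi_iff)
  finally show ?case by (simp only: t_def)
qed

text \<open>Left multiplication by \<open>x\<close> and right multiplication by \<open>y\<close>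
  commute in any ring, so the binomial expansion needs no commutativity of the ring; the inner
  coefficients are divisible by \<open>p\<close>. In a commutative ring with
  \<open>d = \<one>\<close> this is the Frobenius identity; in an endomorphism ring, with
  \<open>x\<close> and \<open>y\<close> the multiplications by \<open>-b\<close> and
  \<open>b\<close>, it computes powers of a commutator.\<close>

lemma (in ring) bimodule_map_prime_power:
  fixes p :: nat
  assumes p: "Factorial_Ring.prime p" and char: "add_pow R p \<one> = \<zero>"
    and x: "x \<in> carrier R" and y: "y \<in> carrier R" and d: "d \<in> carrier R"
  shows "((\<lambda>z. x \<otimes> z \<oplus> z \<otimes> y) ^^ p ^ n) d = x [^] (p ^ n) \<otimes> d \<oplus> d \<otimes> y [^] (p ^ n)"
proof -
  have pz: "add_pow R k z = \<zero>" if "p dvd k" "z \<in> carrier R" for k :: nat and z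
  proof -
    obtain c where c: "k = p * c" using \<open>p dvd k\<close> by (elim dvdE)
    have "add_pow R p z = \<zero>" using add_pow_ldistr[of \<one> z p] char \<open>z \<in> carrier R\<close> by simp
    then show ?thesis using \<open>z \<in> carrier R\<close> by (simp add: c add.nat_pow_pow[symmetric])
  qed
  have step: "((\<lambda>z. x \<otimes> z \<oplus> z \<otimes> y) ^^ p) d = x [^] p \<otimes> d \<oplus> d \<otimes> y [^] p"
    if x: "x \<in> carrier R" and y: "y \<in> carrier R" and d: "d \<in> carrier R" for x y d
  proof -
    define f where "f i = add_pow R (p choose i) (x [^] i \<otimes> (d \<otimes> y [^] (p - i)))" for i
    have f: "f \<in> A \<rightarrow> carrier R" for A using x y d by (auto simp: f_def)
    obtain m where m: "p = Suc (Suc m)" 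
      using prime_ge_2_nat[OF p] by (metis Suc_diff_Suc add_2_eq_Suc' le_add_diff_inverse2 add.commute)
    have "f (Suc i) = \<zero>" if "i \<le> m" for i
      unfolding f_def using that x y d m by (intro pz dvd_choose_prime p) auto
    then have "(\<Oplus>i\<in>{..m}. f (Suc i)) = (\<Oplus>i\<in>{..m}. \<zero>)"
      by (intro finsum_cong') auto
    then have "(\<Oplus>i\<in>{..p}. f i) = f p \<oplus> f 0"
      using f[THEN funcset_mem, OF UNIV_I] finsum_Suc[OF f, of "Suc m"] finsum_Suc2[OF f, of m] by (simp add: m)
    then show ?thesis using x y d by (subst iterated_bimodule_map) (simp_all add: f_def)
  qed
  show ?thesis
    using x y d
  proof (induction n arbitrary: x y d)
    case 0
    then show ?case by simp
  next
    case (Suc n)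
    \<comment> \<open>The \<open>p\<close>-fold iterate of \<open>?T\<close> is a map of the same
      shape, built from the \<open>p\<close>-th powers of \<open>x\<close> and \<open>y\<close>, so
      the induction hypothesis applies to it.\<close>
    let ?T = "\<lambda>z. x \<otimes> z \<oplus> z \<otimes> y" and ?U = "\<lambda>z. x [^] p \<otimes> z \<oplus> z \<otimes> y [^] p"
    have "((?T ^^ p) ^^ k) d = (?U ^^ k) d \<and> (?U ^^ k) d \<in> carrier R" for k
      by (induction k) (use Suc.prems step in auto)
    from this[of "p ^ n"] have "(?T ^^ p ^ Suc n) d = (?U ^^ p ^ n) d"
      by (simp add: funpow_mult mult.commute)
    also have "\<dots> = (x [^] p) [^] (p ^ n) \<otimes> d \<oplus> d \<otimes> (y [^] p) [^] (p ^ n)"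
      by (rule Suc.IH) (use Suc.prems in auto)
    finally show ?case using Suc.prems by (simp add: nat_pow_pow)
  qed
qed

lemma (in cring) frobenius_add:
  fixes p :: nat
  assumes "Factorial_Ring.prime p" and "add_pow R p \<one> = \<zero>" and x: "x \<in> carrier R" and y: "y \<in> carrier R"
  shows "(x \<oplus> y) [^] (p ^ n) = x [^] (p ^ n) \<oplus> y [^] (p ^ n)"
proof -
  have "((\<lambda>z. x \<otimes> z \<oplus> z \<otimes> y) ^^ k) \<one> = (x \<oplus> y) [^] k" for k :: nat
    by (induction k) (use x y in \<open>auto simp: m_comm[of _ "y"] m_comm[of _ "x \<oplus> y"] l_distr\<close>)
  then show ?thesis
    using bimodule_map_prime_power[OF assms(1,2) x y one_closed] x y by simp
qed

text \<open>Subtraction is reached by adding \<open>x \<ominus> y\<close> and \<open>y\<close>, so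
  that the sign of a power of \<open>\<ominus> \<one>\<close>, which depends on the parity of
  \<open>p\<close>, never has to be settled.\<close>

lemma (in cring) frobenius_minus:
  fixes p :: nat
  assumes "Factorial_Ring.prime p" and "add_pow R p \<one> = \<zero>" and x: "x \<in> carrier R" and y: "y \<in> carrier R"
  shows "(x \<ominus> y) [^] (p ^ n) = x [^] (p ^ n) \<ominus> y [^] (p ^ n)"
proof -
  have "x [^] (p ^ n) = (x \<ominus> y) [^] (p ^ n) \<oplus> y [^] (p ^ n)"
    using frobenius_add[OF assms(1,2), of "x \<ominus> y" y n] x y by (simp add: minus_eq a_assoc l_neg)
  then have "x [^] (p ^ n) \<ominus> y [^] (p ^ n) = (x \<ominus> y) [^] (p ^ n) \<oplus> (y [^] (p ^ n) \<ominus> y [^] (p ^ n))"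
    using x y by (simp add: minus_eq a_assoc)
  then show ?thesis using x y by (simp add: minus_eq r_neg del: nat_pow_pow)
qed

text \<open>A remainder modulo \<open>n\<close> would be a smaller annihilator of
  \<open>\<one>\<close>, so \<open>n\<close> divides every annihilator. Integrality then splits the
  annihilator \<open>a * b\<close>.\<close>

lemma (in domain) prime_char:
  assumes n: "n > 0" "add_pow R n \<one> = \<zero>" and least: "\<And>k. 0 < k \<Longrightarrow> add_pow R k \<one> = \<zero> \<Longrightarrow> n \<le> (k::nat)"
  shows "Factorial_Ring.prime n"
proof (rule prime_natI)
  have "n \<noteq> 1" using n(2) by auto
  then show "2 \<le> n" using n(1) by linarith
  fix a b assume "n dvd a * b"
  have dvdI: "n dvd k" if "add_pow R k \<one> = \<zero>" for k
  proof (rule ccontr)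
    assume "\<not> n dvd k"
    then have "k mod n > 0" by (simp add: mod_greater_zero_iff_not_dvd)
    moreover have "add_pow R (k mod n) \<one> = \<zero>"
    proof -
      have "add_pow R k \<one> = add_pow R (n * (k div n)) \<one> \<oplus> add_pow R (k mod n) \<one>"
        by (subst add.nat_pow_mult) auto
      also have "add_pow R (n * (k div n)) \<one> = \<zero>"
        using n(2) by (simp add: add.nat_pow_pow[symmetric])
      finally show ?thesis using that by simp
    qed
    ultimately show False using least[of "k mod n"] n(1) mod_less_divisor[of n k] by linarith
  qed
  obtain c where "a * b = n * c" using \<open>n dvd a * b\<close> by (elim dvdE)
  then have "add_pow R (a * b) \<one> = \<zero>" using n(2) by (simp add: add.nat_pow_pow[symmetric])
  then have "(add_pow R a \<one>) \<otimes> (add_pow R b \<one>) = \<zero>"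
    using add_pow_ldistr[of \<one> "add_pow R b \<one>" a] by (simp add: add.nat_pow_pow mult.commute)
  then have "add_pow R a \<one> = \<zero> \<or> add_pow R b \<one> = \<zero>" using integral by simp
  then show "n dvd a \<or> n dvd b" using dvdI by blast
qed

text \<open>\<open>ring_char\<close> is the order of \<open>\<one>\<close> in the additive group,
  which is 0 when no positive multiple of \<open>\<one>\<close> vanishes; hence \<open>p > 0\<close>
  expresses positive characteristic.\<close>

lemma (in domain) ring_char_prime:
  assumes "ring_char R = p" and "p > 0"
  shows "Factorial_Ring.prime p" and "add_pow R p \<one> = \<zero>"
proof -
  have ord: "group.ord (add_monoid R) \<one> = p" using assms(1) by (simp add: ring_char_def)
  show *: "add_pow R p \<one> = \<zero>"
    using add.group_l_invI ord add.pow_ord_eq_1[of \<one>] by simp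
  show "Factorial_Ring.prime p"
  proof (rule prime_char[OF \<open>p > 0\<close> *])
    fix k :: nat assume "0 < k" "add_pow R k \<one> = \<zero>"
    then have "p dvd k" using ord add.pow_eq_id[of \<one> k] by simp
    then show "p \<le> k" using \<open>0 < k\<close> by (rule dvd_imp_le)
  qed
qed

section \<open>Embeddings of normal extensions\<close>

lemma (in abelian_group) add_minus_cancel:
  assumes "x \<in> carrier G" "y \<in> carrier G"
  shows "y \<oplus> (x \<ominus> y) = x"
  using assms by (simp add: minus_eq a_lcomm r_neg)

text \<open>The inverse of \<open>k\<close> lies in the simple extension of \<open>K\<close> by
  \<open>k\<close>, which is a field because \<open>k\<close> is algebraic, and which is contained
  in every subring containing \<open>K\<close> and \<open>k\<close>. Fields are obtained below in
  this way without exhibiting inverses.\<close>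

lemma (in field) algebraic_subring_is_subfield:
  assumes K: "subfield K R" and B: "subring B R" "K \<subseteq> B" and alg: "\<And>x. x \<in> B \<Longrightarrow> algebraic K x"
  shows "subfield B R"
proof (rule subfieldI'[OF B(1)])
  fix k assume k: "k \<in> B - {\<zero>}"
  then have kR: "k \<in> carrier R" using subringE(1)[OF B(1)] by blast
  have sf: "subfield (simple_extension K k) R"
    using simple_extension_is_subfield[OF K kR] alg k by (simp add: over_def)
  have "k \<in> simple_extension K k - {\<zero>}"
    using simple_extension_mem[OF subfieldE(1)[OF K] kR] k by simp
  then have "inv k \<in> simple_extension K k" using subfield_m_inv(1)[OF sf] by blast
  then show "inv k \<in> B"
    using simple_extension_subring_incl[OF B] k by blast
qed

lemma (in ring) subfield_carrier_poly_subset: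
  assumes "subring K R" "p \<in> carrier (K[X])"
  shows "set p \<subseteq> K" "set p \<subseteq> carrier R" "p \<in> carrier (poly_ring R)"
  using assms(2) subringE(1)[OF assms(1)] unfolding univ_poly_def polynomial_def by auto

lemma (in ring) subfield_poly_mono:
  assumes "K \<subseteq> M" shows "carrier (K[X]) \<subseteq> carrier (M[X])"
  using assms unfolding univ_poly_def polynomial_def by auto

text \<open>Polynomials are coefficient lists with nonzero leading entry. A homomorphism out of a
  field is injective, so it may be applied entrywise without renormalizing the list.\<close>

lemma (in field) map_embedding_poly:
  assumes M: "subfield M R" and \<phi>: "\<phi> \<in> ring_hom (R\<lparr>carrier := M\<rparr>) R"
    and p: "p \<in> carrier (M[X])" and q: "q \<in> carrier (M[X])"
  shows "map \<phi> p \<in> carrier (poly_ring R)"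
    and "map \<phi> (p \<oplus>\<^bsub>M[X]\<^esub> q) = map \<phi> p \<oplus>\<^bsub>poly_ring R\<^esub> map \<phi> q"
    and "map \<phi> (p \<otimes>\<^bsub>M[X]\<^esub> q) = map \<phi> p \<otimes>\<^bsub>poly_ring R\<^esub> map \<phi> q"
proof -
  let ?M = "R\<lparr>carrier := M\<rparr>"
  have sM: "subring M R" by (rule subfieldE(1)[OF M])
  have fM: "field ?M" using M by (rule subfield_iff(2))
  interpret H: ring_hom_ring ?M R \<phi>
    by (rule ring_hom_ringI2[OF field.is_ring[OF fM] ring_axioms \<phi>])
  interpret MX: ring "M[X]" by (rule univ_poly_is_ring[OF sM])
  have closed: "map \<phi> r \<in> carrier (poly_ring R)" if "r \<in> carrier (M[X])" for r
    using polynomial_hom[OF \<phi> fM field_axioms] that by (simp add: univ_poly_consistent[OF sM])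
  have norm: "normalize (map \<phi> r) = map \<phi> r" if "r \<in> carrier (M[X])" for r
    using closed[OF that] normalize_polynomial univ_poly_carrier by blast
  show "map \<phi> p \<in> carrier (poly_ring R)" by (rule closed[OF p])
  have sub: "set p \<subseteq> carrier ?M" "set q \<subseteq> carrier ?M"
    using subfield_carrier_poly_subset(1)[OF sM] p q by auto
  show "map \<phi> (p \<oplus>\<^bsub>M[X]\<^esub> q) = map \<phi> p \<oplus>\<^bsub>poly_ring R\<^esub> map \<phi> q"
    using H.poly_add_hom'[OF sub] norm[OF MX.a_closed[OF p q]]
    by (simp add: univ_poly_add poly_add_consistent[OF sM])
  show "map \<phi> (p \<otimes>\<^bsub>M[X]\<^esub> q) = map \<phi> p \<otimes>\<^bsub>poly_ring R\<^esub> map \<phi> q"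
    using H.poly_mult_hom'[OF sub] norm[OF MX.m_closed[OF p q]]
    by (simp add: univ_poly_mult poly_mult_consistent[OF sM])
qed

text \<open>The extension consists of the values \<open>p(a)\<close>, and \<open>p(a)\<close> is
  sent to the value at \<open>b\<close> of \<open>p\<close> with \<phi> applied to its coefficients.
  This is well defined: polynomials that agree at \<open>a\<close> differ by a multiple of
  \<open>Irr M a\<close>, whose image under \<phi> vanishes at \<open>b\<close>.\<close>

lemma (in field) extend_embedding:
  assumes M: "subfield M R" and \<phi>: "\<phi> \<in> ring_hom (R\<lparr>carrier := M\<rparr>) R"
    and a: "a \<in> carrier R" "algebraic M a"
    and b: "b \<in> carrier R" "eval (map \<phi> (Irr M a)) b = \<zero>"
  obtains \<psi> where "\<psi> \<in> ring_hom (R\<lparr>carrier := simple_extension M a\<rparr>) R"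
    and "\<And>x. x \<in> M \<Longrightarrow> \<psi> x = \<phi> x" and "\<psi> a = b"
proof -
  have sM: "subring M R" by (rule subfieldE(1)[OF M])
  interpret MX: domain "M[X]" by (rule univ_poly_is_domain[OF sM])
  interpret RX: domain "poly_ring R" by (rule univ_poly_is_domain[OF carrier_is_subring])
  note mp = map_embedding_poly[OF M \<phi>]
  have Irr: "Irr M a \<in> carrier (M[X])" using IrrE(1)[OF M a(1)] a(2) by (simp add: over_def)
  have hom_b: "(\<lambda>p. eval p b) \<in> ring_hom (poly_ring R) R" by (rule eval_is_hom[OF carrier_is_subring b(1)])
  have hom_a: "(\<lambda>p. eval p a) \<in> ring_hom (M[X]) R" by (rule eval_is_hom[OF sM a(1)])
  define ev where "ev p = eval (map \<phi> p) b" for p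
  have ev_closed: "ev p \<in> carrier R" if "p \<in> carrier (M[X])" for p
    using ring_hom_memE(1)[OF hom_b mp(1)[OF that that]] by (simp add: ev_def)
  have ev_add: "ev (p \<oplus>\<^bsub>M[X]\<^esub> q) = ev p \<oplus> ev q" if "p \<in> carrier (M[X])" "q \<in> carrier (M[X])" for p q
    using mp(2)[OF that] ring_hom_memE(3)[OF hom_b mp(1)[OF that] mp(1)[OF that(2,1)]] by (simp add: ev_def)
  have ev_mult: "ev (p \<otimes>\<^bsub>M[X]\<^esub> q) = ev p \<otimes> ev q" if "p \<in> carrier (M[X])" "q \<in> carrier (M[X])" for p q
    using mp(3)[OF that] ring_hom_memE(2)[OF hom_b mp(1)[OF that] mp(1)[OF that(2,1)]] by (simp add: ev_def)
  have ev_eq: "ev p = ev q" if pq: "p \<in> carrier (M[X])" "q \<in> carrier (M[X])" and e: "eval p a = eval q a" for p q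
  proof -
    have "eval p a = eval q a \<oplus> eval (p \<ominus>\<^bsub>M[X]\<^esub> q) a"
      using ring_hom_memE(3)[OF hom_a pq(2) MX.minus_closed[OF pq]] MX.add_minus_cancel[OF pq] by simp
    then have "eval q a \<oplus> eval (p \<ominus>\<^bsub>M[X]\<^esub> q) a = eval q a \<oplus> \<zero>"
      using e ring_hom_memE(1)[OF hom_a pq(2)] by simp
    then have "eval (p \<ominus>\<^bsub>M[X]\<^esub> q) a = \<zero>"
      using ring_hom_memE(1)[OF hom_a pq(2)] ring_hom_memE(1)[OF hom_a MX.minus_closed[OF pq]] by simp
    then have "Irr M a pdivides (p \<ominus>\<^bsub>M[X]\<^esub> q)"
      using Irr_minimal[OF M a(1) _ MX.minus_closed[OF pq]] a(2) by (simp add: over_def)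
    then have "Irr M a divides\<^bsub>M[X]\<^esub> (p \<ominus>\<^bsub>M[X]\<^esub> q)"
      using pdivides_iff_shell[OF M Irr MX.minus_closed[OF pq]] by simp
    then obtain r where r: "r \<in> carrier (M[X])" "p \<ominus>\<^bsub>M[X]\<^esub> q = Irr M a \<otimes>\<^bsub>M[X]\<^esub> r"
      unfolding factor_def by blast
    then have "p = q \<oplus>\<^bsub>M[X]\<^esub> Irr M a \<otimes>\<^bsub>M[X]\<^esub> r"
      using MX.add_minus_cancel[OF pq] by simp
    then show ?thesis
      using ev_add[of q "Irr M a \<otimes>\<^bsub>M[X]\<^esub> r"] ev_mult[OF Irr r(1)] b(2) Irr r(1) pq(2) ev_closed by (simp add: ev_def[of "Irr M a"])
  qed
  define \<psi> where "\<psi> z = ev (SOME p. p \<in> carrier (M[X]) \<and> eval p a = z)" for z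
  have \<psi>: "\<psi> (eval p a) = ev p" if p: "p \<in> carrier (M[X])" for p
    unfolding \<psi>_def using someI[of "\<lambda>r. r \<in> carrier (M[X]) \<and> eval r a = eval p a" p] p
    by (intro ev_eq) auto
  have img: "simple_extension M a = (\<lambda>p. eval p a) ` carrier (M[X])"
    by (rule simple_extension_as_eval_img[OF subfieldE(3)[OF M] a(1)])
  have \<psi>M: "\<psi> x = \<phi> x" if x: "x \<in> M" for x
  proof -
    have xR: "x \<in> carrier R" using x subfieldE(3)[OF M] by blast
    have \<phi>x: "\<phi> x \<in> carrier R" using ring_hom_memE(1)[OF \<phi>] x by simp
    have \<phi>0: "\<phi> \<zero> = \<zero>"
      using ring_hom_ring.homh ring_hom_zero[OF \<phi> subring_is_ring[OF sM] ring_axioms] by simp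
    show ?thesis
    proof (cases "x = \<zero>")
      case True
      then show ?thesis using \<psi>[OF MX.zero_closed] \<phi>0 by (simp add: univ_poly_zero ev_def)
    next
      case False
      have "[x] \<in> carrier (M[X])" using False x unfolding univ_poly_def polynomial_def by simp
      then show ?thesis using \<psi>[of "[x]"] xR \<phi>x by (simp add: ev_def)
    qed
  qed
  have "X \<in> carrier (M[X])" using var_closed(1)[OF sM] .
  moreover have "eval X a = a" using eval_var[OF a(1)] .
  moreover have "ev X = b"
  proof -
    have \<phi>0: "\<phi> \<zero> = \<zero>"
      using ring_hom_zero[OF \<phi> subring_is_ring[OF sM] ring_axioms] by simp
    have \<phi>1: "\<phi> \<one> = \<one>" using ring_hom_memE(4)[OF \<phi>] by simp
    show ?thesis using b(1) by (simp add: ev_def var_def \<phi>0 \<phi>1)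
  qed
  ultimately have \<psi>a: "\<psi> a = b" using \<psi>[of X] by simp
  have "\<psi> \<in> ring_hom (R\<lparr>carrier := simple_extension M a\<rparr>) R"
  proof (rule ring_hom_memI)
    fix x assume "x \<in> carrier (R\<lparr>carrier := simple_extension M a\<rparr>)"
    then obtain p where p: "p \<in> carrier (M[X])" "x = eval p a" by (auto simp: img)
    then show "\<psi> x \<in> carrier R" using \<psi> ev_closed by simp
    fix y assume "y \<in> carrier (R\<lparr>carrier := simple_extension M a\<rparr>)"
    then obtain q where q: "q \<in> carrier (M[X])" "y = eval q a" by (auto simp: img)
    have "x \<otimes> y = eval (p \<otimes>\<^bsub>M[X]\<^esub> q) a" "x \<oplus> y = eval (p \<oplus>\<^bsub>M[X]\<^esub> q) a"
      using ring_hom_memE(2,3)[OF hom_a p(1) q(1)] p q by simp_all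
    then show "\<psi> (x \<otimes>\<^bsub>R\<lparr>carrier := simple_extension M a\<rparr>\<^esub> y) = \<psi> x \<otimes> \<psi> y"
      and "\<psi> (x \<oplus>\<^bsub>R\<lparr>carrier := simple_extension M a\<rparr>\<^esub> y) = \<psi> x \<oplus> \<psi> y"
      using p q \<psi> ev_add ev_mult by simp_all
  next
    show "\<psi> \<one>\<^bsub>R\<lparr>carrier := simple_extension M a\<rparr>\<^esub> = \<one>"
      using \<psi>M[of \<one>] subringE(3)[OF sM] ring_hom_memE(4)[OF \<phi>] by simp
  qed
  then show ?thesis using that \<psi>M \<psi>a by blast
qed

lemma (in field) splitted_has_root:
  assumes "p \<in> carrier (poly_ring R)" and "splitted p" and "degree p > 0"
  obtains b where "b \<in> carrier R" "eval p b = \<zero>"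
proof -
  have "roots p \<noteq> {#}" using assms(2,3) by (auto simp: splitted_def)
  then obtain b where "b \<in># roots p" by blast
  then show ?thesis using that roots_mem_iff_is_root[OF assms(1)] by (auto simp: is_root_def)
qed

lemma (in field) normal_ext_algebraic:
  assumes "normal_ext R (carrier R) K" "x \<in> carrier R" shows "algebraic K x"
  using assms by (simp add: normal_ext_def)

lemma (in field) normal_ext_splitted_Irr:
  assumes "normal_ext R (carrier R) K" "subfield K R" and x: "x \<in> carrier R"
  shows "splitted (Irr K x)"
proof -
  have alg: "(algebraic over K) x" using normal_ext_algebraic[OF assms(1) x] by (simp add: over_def)
  note I = IrrE[OF assms(2) x alg]
  have "Irr K x \<noteq> []" using pirreducibleE(1)[OF subfieldE(1)[OF assms(2)] I(1,2)] .
  then have "is_root (Irr K x) x" using I(4) x by (simp add: is_root_def)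
  moreover have "R\<lparr>carrier := carrier R\<rparr> = R" by simp
  ultimately show ?thesis using assms(1) I(1,2) x unfolding normal_ext_def by auto
qed

text \<open>The target is \<open>R\<close> itself, whose normality takes the place of an algebraic
  closure. At each step the minimal polynomial over the field reached divides
  \<open>Irr K a\<close>; the embedding built so far fixes the coefficients of
  \<open>Irr K a\<close>, so the image of the smaller polynomial still divides it, splits, and has a
  root to which \<open>a\<close> can be sent.\<close>

lemma (in field) extend_embedding_list:
  assumes K: "subfield K R" and nrm: "normal_ext R (carrier R) K"
    and M: "subfield M R" "K \<subseteq> M" and \<phi>: "\<phi> \<in> ring_hom (R\<lparr>carrier := M\<rparr>) R"
    and \<phi>K: "\<And>k. k \<in> K \<Longrightarrow> \<phi> k = k" and xs: "set xs \<subseteq> carrier R"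
  shows "\<exists>\<psi>. \<psi> \<in> ring_hom (R\<lparr>carrier := finite_extension M xs\<rparr>) R \<and> (\<forall>x\<in>M. \<psi> x = \<phi> x)"
  using xs
proof (induction xs)
  case Nil
  then show ?case using \<phi> by auto
next
  case (Cons a xs)
  from Cons.prems have "set xs \<subseteq> carrier R" by simp
  from Cons.IH[OF this] obtain \<psi> where \<psi>: "\<psi> \<in> ring_hom (R\<lparr>carrier := finite_extension M xs\<rparr>) R" "\<And>x. x \<in> M \<Longrightarrow> \<psi> x = \<phi> x"
    by blast
  have a: "a \<in> carrier R" and xs: "set xs \<subseteq> carrier R" using Cons.prems by auto
  let ?M = "finite_extension M xs"
  have MM: "M \<subseteq> ?M" by (rule finite_extension_incl[OF subfieldE(3)[OF M(1)] xs])
  have KM: "K \<subseteq> ?M" by (rule subset_trans[OF M(2) MM])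
  have algK: "(algebraic over K) x" if "x \<in> carrier R" for x
    using normal_ext_algebraic[OF nrm that] unfolding over_def .
  have algM: "(algebraic over M) x" if "x \<in> carrier R" for x
    by (rule algebraic_mono[OF M(2) algK[OF that]])
  have M': "subfield ?M R"
    by (rule finite_extension_is_subfield[OF M(1) xs algM]) (rule subsetD[OF xs])
  have alga: "(algebraic over ?M) a" by (rule algebraic_mono[OF MM algM[OF a]])
  have algaK: "(algebraic over K) a" by (rule algK[OF a])
  note IK = IrrE[OF K a algaK] and IM = IrrE[OF M' a alga]
  have IKM: "Irr K a \<in> carrier (?M[X])" by (rule subsetD[OF subfield_poly_mono[OF KM] IK(1)])
  have "Irr ?M a pdivides Irr K a"
    by (rule Irr_minimal[OF M' a alga IKM IK(4)])
  then have "Irr ?M a divides\<^bsub>?M[X]\<^esub> Irr K a" unfolding pdivides_iff_shell[OF M' IM(1) IKM] .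
  then obtain r where r: "r \<in> carrier (?M[X])" "Irr K a = Irr ?M a \<otimes>\<^bsub>?M[X]\<^esub> r" unfolding factor_def by blast
  have "\<psi> c = c" if "c \<in> set (Irr K a)" for c
  proof -
    have "c \<in> K" using that subfield_carrier_poly_subset(1)[OF subfieldE(1)[OF K] IK(1)] by (rule subsetD[rotated])
    then show ?thesis using \<psi>(2)[OF subsetD[OF M(2)]] \<phi>K by simp
  qed
  then have "map \<psi> (Irr K a) = Irr K a" by (rule map_idI)
  then have eq: "Irr K a = map \<psi> (Irr ?M a) \<otimes>\<^bsub>poly_ring R\<^esub> map \<psi> r"
    using map_embedding_poly(3)[OF M' \<psi>(1) IM(1) r(1)] r(2) by simp
  have cl: "map \<psi> (Irr ?M a) \<in> carrier (poly_ring R)" "map \<psi> r \<in> carrier (poly_ring R)"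
    using map_embedding_poly(1)[OF M' \<psi>(1)] IM(1) r(1) by blast+
  have "map \<psi> (Irr ?M a) pdivides Irr K a"
    unfolding pdivides_def factor_def using eq cl(2) by blast
  moreover have IKR: "Irr K a \<in> carrier (poly_ring R)" 
    using subfield_carrier_poly_subset(3)[OF subfieldE(1)[OF K] IK(1)] .
  moreover have "Irr K a \<noteq> []" using pirreducibleE(1)[OF subfieldE(1)[OF K] IK(1,2)] .
  ultimately have spl: "splitted (map \<psi> (Irr ?M a))"
    using pdivides_imp_splitted[OF cl(1) IKR] normal_ext_splitted_Irr[OF nrm K a] by blast
  have "degree (map \<psi> (Irr ?M a)) > 0"
    using pirreducible_degree[OF M' IM(1,2)] unfolding length_map by linarith
  then obtain b where b: "b \<in> carrier R" "eval (map \<psi> (Irr ?M a)) b = \<zero>"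
    using splitted_has_root[OF cl(1) spl] by blast
  have alga': "algebraic ?M a" using alga unfolding over_def .
  obtain \<chi> where \<chi>: "\<chi> \<in> ring_hom (R\<lparr>carrier := simple_extension ?M a\<rparr>) R" "\<And>x. x \<in> ?M \<Longrightarrow> \<chi> x = \<psi> x"
    using extend_embedding[OF M' \<psi>(1) a alga' b] by blast
  have "finite_extension M (a # xs) = simple_extension ?M a" by simp
  then have "\<chi> \<in> ring_hom (R\<lparr>carrier := finite_extension M (a # xs)\<rparr>) R" using \<chi>(1) by (simp only:)
  moreover have "\<forall>x\<in>M. \<chi> x = \<phi> x" using \<chi>(2) \<psi>(2) MM by (metis subsetD)
  ultimately show ?case by blast
qed

text \<open>The identity of \<open>K\<close> is extended by \<open>x \<mapsto> y\<close>, then to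
  the elements of \<open>xs\<close>. Adjoining \<open>xs\<close> after \<open>x\<close> is what
  leaves the image of \<open>x\<close> free to choose.\<close>

lemma (in field) conjugate_embedding:
  assumes K: "subfield K R" and nrm: "normal_ext R (carrier R) K"
    and x: "x \<in> carrier R" and y: "is_root (Irr K x) y" and xs: "set xs \<subseteq> carrier R"
  obtains \<psi> where "\<psi> \<in> ring_hom (R\<lparr>carrier := finite_extension (simple_extension K x) xs\<rparr>) R"
    and "\<And>k. k \<in> K \<Longrightarrow> \<psi> k = k" and "\<psi> x = y"
proof -
  have alg: "algebraic K x" by (rule normal_ext_algebraic[OF nrm x])
  have id: "id \<in> ring_hom (R\<lparr>carrier := K\<rparr>) R"
    using subfieldE(3)[OF K] by (auto intro!: ring_hom_memI)
  have y': "y \<in> carrier R" "eval (map id (Irr K x)) y = \<zero>" using y by (auto simp: is_root_def)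
  obtain \<phi> where \<phi>: "\<phi> \<in> ring_hom (R\<lparr>carrier := simple_extension K x\<rparr>) R"
    "\<And>k. k \<in> K \<Longrightarrow> \<phi> k = k" "\<phi> x = y"
    using extend_embedding[OF K id x alg y'] by auto
  have sf: "subfield (simple_extension K x) R"
    using simple_extension_is_subfield[OF K x] alg by (simp add: over_def)
  have inc: "K \<subseteq> simple_extension K x" by (rule simple_extension_incl[OF subfieldE(3)[OF K] x])
  have mem: "x \<in> simple_extension K x" by (rule simple_extension_mem[OF subfieldE(1)[OF K] x])
  obtain \<psi> where \<psi>: "\<psi> \<in> ring_hom (R\<lparr>carrier := finite_extension (simple_extension K x) xs\<rparr>) R"
    "\<forall>z\<in>simple_extension K x. \<psi> z = \<phi> z"
    using extend_embedding_list[OF K nrm sf inc \<phi>(1,2) xs] by blast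
  show ?thesis
    by (rule that[OF \<psi>(1)]) (use \<psi>(2) \<phi>(2,3) inc mem in auto)
qed

section \<open>Roots and splitting in a subfield; the root criterion for normality\<close>

lemma (in ring) a_inv_subring:
  assumes "subring M R" "a \<in> M" shows "\<ominus>\<^bsub>R\<lparr>carrier := M\<rparr>\<^esub> a = \<ominus> a"
  using add.m_inv_consistent[OF subring.axioms(1)[OF assms(1)] assms(2)] by (simp add: a_inv_def)

lemma (in ring) univ_poly_nat_pow:
  "p [^]\<^bsub>M[X]\<^esub> (n::nat) = p [^]\<^bsub>K[X]\<^esub> n"
  by (simp add: nat_pow_def univ_poly_one univ_poly_mult)

text \<open>Divisibility between polynomials over \<open>M\<close> does not change in the larger
  field, and a multiplicity is the largest power of a linear factor that divides. Multiplicities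
  inside \<open>M\<close>, as \<open>galois_ext\<close> asks for, can therefore be read off in
  \<open>R\<close>.\<close>

lemma (in field) alg_mult_subfield:
  assumes M: "subfield M R" and f: "f \<in> carrier (M[X])" and a: "a \<in> M"
  shows "ring.alg_mult (R\<lparr>carrier := M\<rparr>) f a = alg_mult f a"
proof -
  have sM: "subring M R" by (rule subfieldE(1)[OF M])
  have aR: "a \<in> carrier R" using a subfieldE(3)[OF M] by blast
  interpret MX: domain "M[X]" by (rule univ_poly_is_domain[OF sM])
  have lin: "[\<one>, \<ominus> a] \<in> carrier (M[X])"
    using a subringE(3,5)[OF sM] unfolding univ_poly_def polynomial_def by simp
  have "[\<one>, \<ominus> a] [^]\<^bsub>M[X]\<^esub> n pdivides\<^bsub>R\<lparr>carrier := M\<rparr>\<^esub> f \<longleftrightarrow>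
      [\<one>, \<ominus> a] [^]\<^bsub>poly_ring R\<^esub> n pdivides f" for n :: nat
    using pdivides_iff_shell[OF M MX.nat_pow_closed[OF lin] f, of n]
    by (simp add: pdivides_def univ_poly_consistent[OF sM] univ_poly_nat_pow[where M = M and K = "carrier R"])
  then show ?thesis
    using a aR
    by (simp add: ring.alg_mult_def[OF subring_is_ring[OF sM]] alg_mult_def a_inv_subring[OF sM]
        univ_poly_consistent[OF sM])
qed

lemma (in field) roots_subfield:
  assumes M: "subfield M R" and f: "f \<in> carrier (M[X])"
  shows "count (ring.roots (R\<lparr>carrier := M\<rparr>) f) a = (if a \<in> M then count (roots f) a else 0)"
proof -
  have sM: "subring M R" by (rule subfieldE(1)[OF M])
  interpret M: field "R\<lparr>carrier := M\<rparr>" by (rule subfield_iff(2)[OF M])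
  have f': "f \<in> carrier (poly_ring (R\<lparr>carrier := M\<rparr>))" using f by (simp add: univ_poly_consistent[OF sM])
  show ?thesis
    using alg_mult_subfield[OF M f, of a]
    by (simp flip: M.alg_mult_eq_count_roots[OF f']
        alg_mult_eq_count_roots[OF subfield_carrier_poly_subset(3)[OF sM f]]) (simp add: M.alg_mult_def)
qed

text \<open>The roots found in \<open>M\<close> form a sub-multiset of those in \<open>R\<close>,
  whose number is the degree because \<open>f\<close> splits there; equality of sizes is then
  equality of multisets.\<close>

lemma (in field) splitted_subfield_iff:
  assumes M: "subfield M R" and f: "f \<in> carrier (M[X])" and spl: "splitted f"
  shows "ring.splitted (R\<lparr>carrier := M\<rparr>) f \<longleftrightarrow> (\<forall>y. is_root f y \<longrightarrow> y \<in> M)"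
proof -
  have sM: "subring M R" by (rule subfieldE(1)[OF M])
  interpret M: field "R\<lparr>carrier := M\<rparr>" by (rule subfield_iff(2)[OF M])
  have fR: "f \<in> carrier (poly_ring R)" by (rule subfield_carrier_poly_subset(3)[OF sM f])
  have sub: "M.roots f \<subseteq># roots f"
    by (rule mset_subset_eqI) (simp add: roots_subfield[OF M f])
  have "M.splitted f \<longleftrightarrow> size (M.roots f) = size (roots f)"
    using spl by (simp add: splitted_def M.splitted_def)
  also have "\<dots> \<longleftrightarrow> M.roots f = roots f"
    using sub by (metis mset_subset_size order_less_irrefl subset_mset.less_le)
  also have "\<dots> \<longleftrightarrow> (\<forall>y. y \<in># roots f \<longrightarrow> y \<in> M)"
    by (auto simp: multiset_eq_iff roots_subfield[OF M f] count_eq_zero_iff)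
  finally show ?thesis by (simp add: roots_mem_iff_is_root[OF fR])
qed

text \<open>The polynomials over \<open>K\<close> vanishing at \<open>x\<close> form the ideal
  generated by \<open>Irr K x\<close>, and an irreducible element of it is associated to the
  generator. This lets minimal polynomials replace the arbitrary irreducible ones of
  \<open>normal_ext\<close>.\<close>

lemma (in field) irreducible_roots_eq_Irr_roots:
  assumes K: "subfield K R" and x: "x \<in> carrier R" "algebraic K x"
    and f: "f \<in> carrier (K[X])" "pirreducible K f" "eval f x = \<zero>"
  shows "is_root f y \<longleftrightarrow> is_root (Irr K x) y"
proof -
  have alg: "(algebraic over K) x" using x(2) unfolding over_def .
  have sK: "subring K R" by (rule subfieldE(1)[OF K])
  interpret KX: principal_domain "K[X]" by (rule univ_poly_is_principal[OF K])
  note I = IrrE[OF K x(1) alg]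
  have "f \<in> PIdl\<^bsub>K[X]\<^esub> (Irr K x)"
    using Irr_generates_ker[OF K x(1) alg] f(1,3) by (auto simp: a_kernel_def')
  then have "Irr K x \<sim>\<^bsub>K[X]\<^esub> f"
    using cgenideal_pirreducible[OF K I(1,2) f(2)] by blast
  then have "Irr K x divides\<^bsub>K[X]\<^esub> f" "f divides\<^bsub>K[X]\<^esub> Irr K x" by (auto simp: associated_def)
  then have "Irr K x \<sim>\<^bsub>poly_ring R\<^esub> f"
    using pdivides_iff_shell[OF K I(1) f(1)] pdivides_iff_shell[OF K f(1) I(1)]
    by (auto simp: associated_def pdivides_def)
  then show ?thesis
    using associated_polynomials_imp_same_is_root[OF subfield_carrier_poly_subset(3)[OF sK I(1)]
        subfield_carrier_poly_subset(3)[OF sK f(1)]] by blast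
qed

text \<open>Minimal polynomials over \<open>K\<close> already split in the normal field
  \<open>R\<close>, so splitting over \<open>M\<close> is only a question of where the roots
  lie.\<close>

lemma (in field) normal_ext_subfield_iff:
  assumes K: "subfield K R" and nrm: "normal_ext R (carrier R) K" and M: "subfield M R" "K \<subseteq> M"
  shows "normal_ext R M K \<longleftrightarrow> (\<forall>x\<in>M. \<forall>y. is_root (Irr K x) y \<longrightarrow> y \<in> M)"
proof
  assume nM: "normal_ext R M K"
  show "\<forall>x\<in>M. \<forall>y. is_root (Irr K x) y \<longrightarrow> y \<in> M"
  proof
    fix x assume x: "x \<in> M"
    then have xR: "x \<in> carrier R" using subfieldE(3)[OF M(1)] by blast
    have alg: "(algebraic over K) x" using normal_ext_algebraic[OF nrm xR] unfolding over_def .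
    note I = IrrE[OF K xR alg]
    have "is_root (Irr K x) x"
      using I(4) xR pirreducibleE(1)[OF subfieldE(1)[OF K] I(1,2)] by (simp add: is_root_def)
    then have "ring.splitted (R\<lparr>carrier := M\<rparr>) (Irr K x)"
      using nM I(1,2) x unfolding normal_ext_def by blast
    then show "\<forall>y. is_root (Irr K x) y \<longrightarrow> y \<in> M"
      using splitted_subfield_iff[OF M(1) subsetD[OF subfield_poly_mono[OF M(2)] I(1)]
          normal_ext_splitted_Irr[OF nrm K xR]] by simp
  qed
next
  assume *: "\<forall>x\<in>M. \<forall>y. is_root (Irr K x) y \<longrightarrow> y \<in> M"
  have MR: "M \<subseteq> carrier R" by (rule subfieldE(3)[OF M(1)])
  show "normal_ext R M K"
    unfolding normal_ext_def
  proof (intro conjI allI impI ballI)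
    show "algebraic K x" if "x \<in> M" for x
      using normal_ext_algebraic[OF nrm] that MR by blast
    fix f assume "f \<in> carrier (K[X]) \<and> pirreducible K f \<and> (\<exists>x\<in>M. is_root f x)"
    then obtain x where f: "f \<in> carrier (K[X])" "pirreducible K f" and x: "x \<in> M" "is_root f x" by blast
    have xR: "x \<in> carrier R" using x MR by blast
    have "splitted f"
      using nrm f x(2) xR unfolding normal_ext_def by auto
    moreover have "\<forall>y. is_root f y \<longrightarrow> y \<in> M"
      using irreducible_roots_eq_Irr_roots[OF K xR normal_ext_algebraic[OF nrm xR] f] x *
      by (auto simp: is_root_def)
    ultimately show "ring.splitted (R\<lparr>carrier := M\<rparr>) f"
      using splitted_subfield_iff[OF M(1) subsetD[OF subfield_poly_mono[OF M(2)] f(1)]] by blast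
  qed
qed

lemma (in field) embedding_root:
  assumes K: "subring K R" and M: "subring M R" "K \<subseteq> M" and h: "h \<in> ring_hom (R\<lparr>carrier := M\<rparr>) R"
    and hK: "\<And>k. k \<in> K \<Longrightarrow> h k = k" and p: "p \<in> carrier (K[X])" and x: "x \<in> M" "is_root p x"
  shows "is_root p (h x)"
proof -
  let ?M = "R\<lparr>carrier := M\<rparr>"
  have rM: "ring ?M" by (rule subring_is_ring[OF M(1)])
  interpret H: ring_hom_ring ?M R h
    by (rule ring_hom_ringI2[OF rM ring_axioms h])
  have pK: "set p \<subseteq> K" by (rule subfield_carrier_poly_subset(1)[OF K p])
  have "map h p = p" using pK hK by (intro map_idI) blast
  moreover have "set p \<subseteq> carrier ?M" using pK M(2) by simp
  ultimately have "h (eval p x) = eval p (h x)"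
    using H.eval_hom'[of x p] x(1) by (simp add: eval_consistent[OF M(1)])
  moreover have "h \<zero> = \<zero>" using ring_hom_zero[OF h rM ring_axioms] by simp
  moreover have "h x \<in> carrier R" using ring_hom_memE(1)[OF h] x(1) by simp
  ultimately show ?thesis using x(2) by (auto simp: is_root_def)
qed

lemma (in field) Irr_root_self:
  assumes K: "subfield K R" and x: "x \<in> carrier R" "algebraic K x"
  shows "is_root (Irr K x) x" "Irr K x \<in> carrier (K[X])" "Irr K x \<in> carrier (poly_ring R)" "Irr K x \<noteq> []"
proof -
  have alg: "(algebraic over K) x" using x(2) unfolding over_def .
  note I = IrrE[OF K x(1) alg]
  show "Irr K x \<noteq> []" using pirreducibleE(1)[OF subfieldE(1)[OF K] I(1,2)] .
  then show "is_root (Irr K x) x" using I(4) x by (simp add: is_root_def)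
  show "Irr K x \<in> carrier (K[X])" by (rule I(1))
  then show "Irr K x \<in> carrier (poly_ring R)" by (rule subfield_carrier_poly_subset(3)[OF subfieldE(1)[OF K]])
qed

text \<open>Adjoin to \<open>K\<close> the finite set \<open>Z\<close> of all conjugates of a
  spanning list of \<open>F\<close>. The result is finite-dimensional and contains \<open>F\<close>,
  and it is normal because embeddings over \<open>K\<close> map \<open>Z\<close> into itself.
  Minimality of the normal closure makes it everything.\<close>

lemma (in field) normal_closure_finite_dimension:
  assumes K: "subfield K R" and F: "finite_dimension K F" "K \<subseteq> F" and cl: "normal_closure R F K"
  shows "finite_dimension K (carrier R)"
proof -
  have nrm: "normal_ext R (carrier R) K" using cl by (simp add: normal_closure_def)
  obtain n Us where Us: "set Us \<subseteq> carrier R" "Span K Us = F"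
    using F(1) exists_base[OF K] by (metis finite_dimensionE')
  have alg: "algebraic K x" if "x \<in> carrier R" for x using normal_ext_algebraic[OF nrm that] .
  define Z where "Z = (\<Union>u\<in>set Us. {y. is_root (Irr K u) y})"
  have "finite Z"
    unfolding Z_def using finite_number_of_roots Irr_root_self(3)[OF K] alg Us(1) by auto
  then obtain zs where zs: "set zs = Z" using finite_list by blast
  have ZR: "set zs \<subseteq> carrier R" by (auto simp: zs Z_def is_root_def)
  have UZ: "set Us \<subseteq> Z" using Irr_root_self(1)[OF K] alg Us(1) by (auto simp: Z_def)
  let ?M = "finite_extension K zs"
  have algz: "\<And>x. x \<in> set zs \<Longrightarrow> (algebraic over K) x" using alg ZR by (auto simp: over_def)
  have M: "subfield ?M R" by (rule finite_extension_is_subfield[OF K ZR algz])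
  have fin: "finite_dimension K ?M" by (rule finite_extension_finite_dimension(1)[OF K ZR algz])
  have KM: "K \<subseteq> ?M" by (rule finite_extension_incl[OF subfieldE(3)[OF K] ZR])
  have zM: "set zs \<subseteq> ?M" by (rule finite_extension_mem[OF subfieldE(1)[OF K] ZR])
  have FM: "F \<subseteq> ?M"
    using subalgebra_Span_incl[OF K finite_dimension_imp_subalgebra[OF K fin], of Us] UZ zM zs Us(2) by auto
  have "normal_ext R ?M K"
    unfolding normal_ext_subfield_iff[OF K nrm M KM]
  proof (intro ballI allI impI)
    fix x y assume x: "x \<in> ?M" and y: "is_root (Irr K x) y"
    have xR: "x \<in> carrier R" using x subfieldE(3)[OF M] by blast
    let ?Kx = "simple_extension K x"
    obtain \<psi> where \<psi>: "\<psi> \<in> ring_hom (R\<lparr>carrier := finite_extension ?Kx zs\<rparr>) R"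
      "\<And>k. k \<in> K \<Longrightarrow> \<psi> k = k" "\<psi> x = y"
      using conjugate_embedding[OF K nrm xR y ZR] by blast
    let ?D = "finite_extension ?Kx zs"
    have sKx: "subring ?Kx R" by (rule simple_extension_is_subring[OF subfieldE(1)[OF K] xR])
    have sD: "subring ?D R" by (rule finite_extension_is_subring[OF sKx ZR])
    have KxD: "?Kx \<subseteq> ?D" by (rule finite_extension_incl[OF subringE(1)[OF sKx] ZR])
    have KD: "K \<subseteq> ?D" using simple_extension_incl[OF subfieldE(3)[OF K] xR] KxD by (rule subset_trans)
    have zD: "set zs \<subseteq> ?D" by (rule finite_extension_mem[OF sKx ZR])
    have sM: "subring ?M R" by (rule subfieldE(1)[OF M])
    interpret H: ring_hom_ring "R\<lparr>carrier := ?D\<rparr>" R \<psi>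
      by (rule ring_hom_ringI2[OF subring_is_ring[OF sD] ring_axioms \<psi>(1)])
    \<comment> \<open>The part of the domain of \<psi> that is mapped into \<open>?M\<close>. The
      domain was built over the extension by \<open>x\<close>, not over \<open>?M\<close>; but
      \<open>B\<close> is a subring containing \<open>K\<close> and \<open>Z\<close>, hence contains
      \<open>?M\<close> and with it \<open>x\<close>.\<close>
    define B where "B = {z \<in> ?D. \<psi> z \<in> ?M}"
    have "subring B R"
    proof (rule subringI)
      show "B \<subseteq> carrier R" using subringE(1)[OF sD] by (auto simp: B_def)
      show "\<one> \<in> B" using H.hom_one subringE(3)[OF sD] subringE(3)[OF sM] by (simp add: B_def)
      fix h1 assume h1: "h1 \<in> B"
      show "\<ominus> h1 \<in> B"
        using h1 H.hom_a_inv[of h1] subringE(5)[OF sD] subringE(5)[OF sM]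
        by (simp add: B_def a_inv_subring[OF sD] del: finite_extension.simps)
      fix h2 assume h2: "h2 \<in> B"
      show "h1 \<otimes> h2 \<in> B" "h1 \<oplus> h2 \<in> B"
        using h1 h2 H.hom_mult[of h1 h2] H.hom_add[of h1 h2] subringE(6,7)[OF sD] subringE(6,7)[OF sM]
        by (simp_all add: B_def del: finite_extension.simps)
    qed
    moreover have "K \<subseteq> B" using KD KM \<psi>(2) by (auto simp: B_def)
    moreover have "set zs \<subseteq> B"
    proof
      fix z assume z: "z \<in> set zs"
      then obtain u where u: "u \<in> set Us" "is_root (Irr K u) z" by (auto simp: zs Z_def)
      have "is_root (Irr K u) (\<psi> z)"
        using embedding_root[OF subfieldE(1)[OF K] sD KD \<psi>(1,2) Irr_root_self(2)[OF K _ alg]] u Us(1) z zD by blast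
      then have "\<psi> z \<in> set zs" using u by (auto simp: zs Z_def)
      then show "z \<in> B" using z zD zM by (auto simp: B_def)
    qed
    ultimately have "?M \<subseteq> B" by (rule finite_extension_subring_incl)
    then show "y \<in> ?M" using x \<psi>(3) by (auto simp: B_def)
  qed
  then have "?M = carrier R"
    using cl M KM FM subfieldE(3)[OF M] unfolding normal_closure_def intermediate_fields_def by blast
  then show ?thesis using fin by simp
qed

section \<open>Automorphisms of a finite normal extension\<close>

lemma AutD:
  assumes "g \<in> Aut R M K"
  shows "g \<in> extensional M" "g \<in> ring_hom (R\<lparr>carrier := M\<rparr>) (R\<lparr>carrier := M\<rparr>)"
    "bij_betw g M M" "\<And>k. k \<in> K \<Longrightarrow> g k = k"
    "\<And>x. x \<in> M \<Longrightarrow> g x \<in> M"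
    "\<And>x y. x \<in> M \<Longrightarrow> y \<in> M \<Longrightarrow> g (x \<oplus>\<^bsub>R\<^esub> y) = g x \<oplus>\<^bsub>R\<^esub> g y"
    "\<And>x y. x \<in> M \<Longrightarrow> y \<in> M \<Longrightarrow> g (x \<otimes>\<^bsub>R\<^esub> y) = g x \<otimes>\<^bsub>R\<^esub> g y"
    "g \<one>\<^bsub>R\<^esub> = \<one>\<^bsub>R\<^esub>"
  using assms unfolding Aut_def ring_iso_def ring_hom_def by auto

lemma AutI:
  assumes "g \<in> extensional M" "bij_betw g M M" "\<And>k. k \<in> K \<Longrightarrow> g k = k" "g \<one>\<^bsub>R\<^esub> = \<one>\<^bsub>R\<^esub>"
    "\<And>x y. x \<in> M \<Longrightarrow> y \<in> M \<Longrightarrow> g (x \<oplus>\<^bsub>R\<^esub> y) = g x \<oplus>\<^bsub>R\<^esub> g y"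
    "\<And>x y. x \<in> M \<Longrightarrow> y \<in> M \<Longrightarrow> g (x \<otimes>\<^bsub>R\<^esub> y) = g x \<otimes>\<^bsub>R\<^esub> g y"
  shows "g \<in> Aut R M K"
proof -
  have "g \<in> M \<rightarrow> M" using bij_betwE[OF assms(2)] by blast
  then have "g \<in> ring_hom (R\<lparr>carrier := M\<rparr>) (R\<lparr>carrier := M\<rparr>)"
    using assms(4-6) unfolding ring_hom_def by simp
  then show ?thesis using assms(1-3) unfolding Aut_def ring_iso_def by simp
qed

lemma (in ring) Aut_zero_minus:
  assumes "g \<in> Aut R M K" and M: "subring M R"
  shows "g \<zero> = \<zero>" "\<And>x. x \<in> M \<Longrightarrow> g (\<ominus> x) = \<ominus> g x"
proof -
  interpret H: ring_hom_ring "R\<lparr>carrier := M\<rparr>" "R\<lparr>carrier := M\<rparr>" g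
    by (rule ring_hom_ringI2[OF subring_is_ring[OF M] subring_is_ring[OF M] AutD(2)[OF assms(1)]])
  show "g \<zero> = \<zero>" using H.hom_zero by simp
  show "g (\<ominus> x) = \<ominus> g x" if "x \<in> M" for x
    using H.hom_a_inv[of x] that AutD(5)[OF assms(1)] by (simp add: a_inv_subring[OF M])
qed

lemma (in ring) Aut_pow:
  assumes g: "g \<in> Aut R M K" and M: "subring M R" and x: "x \<in> M"
  shows "g (x [^] (n::nat)) = g x [^] n"
proof -
  have "x [^] n \<in> M \<and> g (x [^] n) = g x [^] n"
    by (induction n) (use subringE(3,6)[OF M] AutD(5,7,8)[OF g] x in auto)
  then show ?thesis ..
qed

lemma Aut_id:
  assumes "K \<subseteq> M" "\<one>\<^bsub>R\<^esub> \<in> M" "\<And>x y. x \<in> M \<Longrightarrow> y \<in> M \<Longrightarrow> x \<oplus>\<^bsub>R\<^esub> y \<in> M \<and> x \<otimes>\<^bsub>R\<^esub> y \<in> M"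
  shows "(\<lambda>x\<in>M. x) \<in> Aut R M K"
  using assms by (intro AutI) (auto simp: bij_betw_def inj_on_def)

lemma (in ring) Aut_compose:
  assumes M: "subring M R" "K \<subseteq> M" and g: "g \<in> Aut R M K" and h: "h \<in> Aut R M K"
  shows "compose M g h \<in> Aut R M K"
proof (rule AutI)
  show "compose M g h \<in> extensional M" by (rule compose_extensional)
  show "bij_betw (compose M g h) M M" using bij_betw_compose[OF AutD(3)[OF h] AutD(3)[OF g]] .
  show "compose M g h k = k" if "k \<in> K" for k
    using that M(2) AutD(4)[OF g] AutD(4)[OF h] by (auto simp: compose_def)
  show "compose M g h \<one> = \<one>" using subringE(3)[OF M(1)] AutD(8)[OF g] AutD(8)[OF h] by (simp add: compose_def)
  show "compose M g h (x \<oplus> y) = compose M g h x \<oplus> compose M g h y"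
    "compose M g h (x \<otimes> y) = compose M g h x \<otimes> compose M g h y" if "x \<in> M" "y \<in> M" for x y
    using that subringE(6,7)[OF M(1)] AutD(5-7)[OF g] AutD(5-7)[OF h] by (simp_all add: compose_def)
qed

lemma (in ring) Aut_inverse:
  assumes M: "subring M R" "K \<subseteq> M" and g: "g \<in> Aut R M K"
  obtains h where "h \<in> Aut R M K" "\<And>x. x \<in> M \<Longrightarrow> h (g x) = x" "\<And>x. x \<in> M \<Longrightarrow> g (h x) = x"
proof -
  define h where "h = restrict (inv_into M g) M"
  note bij = AutD(3)[OF g]
  have hg: "h (g x) = x" if "x \<in> M" for x
    using that bij AutD(5)[OF g] by (simp add: h_def bij_betw_def)
  have gh: "g (h x) = x" "h x \<in> M" if "x \<in> M" for x
    using that bij by (auto simp: h_def bij_betw_def f_inv_into_f intro: inv_into_into)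
  have inj: "x = y" if "g x = g y" "x \<in> M" "y \<in> M" for x y using hg that by metis
  have "h \<in> Aut R M K"
  proof (rule AutI)
    show "h \<in> extensional M" by (simp add: h_def)
    show "bij_betw h M M" using bij_betw_inv_into[OF bij] bij_betw_cong[of M h "inv_into M g"] by (simp add: h_def)
    show "h k = k" if "k \<in> K" for k using hg[of k] AutD(4)[OF g that] that M(2) by auto
    show "h \<one> = \<one>" using hg[of \<one>] AutD(8)[OF g] subringE(3)[OF M(1)] by simp
    fix x y assume xy: "x \<in> M" "y \<in> M"
    show "h (x \<oplus> y) = h x \<oplus> h y"
      by (rule inj) (use xy gh AutD(6)[OF g] subringE(7)[OF M(1)] in auto)
    show "h (x \<otimes> y) = h x \<otimes> h y"
      by (rule inj) (use xy gh AutD(7)[OF g] subringE(6)[OF M(1)] in auto)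
  qed
  then show ?thesis using that hg gh by blast
qed

lemma (in ring) combine_hom_fixing:
  assumes K: "subfield K R" and M: "subring M R" "K \<subseteq> M" and g: "g \<in> Aut R M K"
    and Us: "set Us \<subseteq> M" and Ks: "set Ks \<subseteq> K"
  shows "combine Ks Us \<in> M \<and> g (combine Ks Us) = combine Ks (map g Us)"
  using Us Ks
proof (induction Ks Us rule: combine.induct)
  case (1 k Ks u Us)
  then show ?case
    using AutD(4-7)[OF g] subringE(6,7)[OF M(1)] M(2) by (auto simp: subset_iff)
qed (use Aut_zero_minus[OF g M(1)] subringE(2)[OF M(1)] in auto)

text \<open>An automorphism is determined by its values on a spanning list of \<open>M\<close>, and
  each value is one of the finitely many roots of a minimal polynomial.\<close>

lemma (in field) finite_Aut:
  assumes K: "subfield K R" and M: "subfield M R" "K \<subseteq> M" and fin: "finite_dimension K M"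
  shows "finite (Aut R M K)"
proof -
  have sM: "subring M R" by (rule subfieldE(1)[OF M(1)])
  have MR: "M \<subseteq> carrier R" by (rule subfieldE(3)[OF M(1)])
  obtain n Us where Us: "set Us \<subseteq> carrier R" "Span K Us = M"
    using fin exists_base[OF K] by (metis finite_dimensionE')
  have UM: "set Us \<subseteq> M" using Span_base_incl[OF K Us(1)] Us(2) by simp
  have alg: "algebraic K x" if "x \<in> M" for x
    using finite_dimension_imp_algebraic[OF K sM fin that] by (simp add: over_def)
  define Z where "Z = (\<Union>u\<in>set Us. {y. is_root (Irr K u) y})"
  have "finite {y. is_root (Irr K u) y}" if "u \<in> set Us" for u
    using finite_number_of_roots[OF Irr_root_self(3)[OF K _ alg]] that UM MR by blast
  then have "finite Z" by (simp add: Z_def)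
  then have "finite {zs. set zs \<subseteq> Z \<and> length zs = length Us}" by (rule finite_lists_length_eq)
  moreover have "(\<lambda>g. map g Us) ` Aut R M K \<subseteq> {zs. set zs \<subseteq> Z \<and> length zs = length Us}"
  proof clarsimp
    fix g u assume g: "g \<in> Aut R M K" and u: "u \<in> set Us"
    have uM: "u \<in> M" using u UM by blast
    have "g \<in> ring_hom (R\<lparr>carrier := M\<rparr>) R" using AutD(2)[OF g] MR unfolding ring_hom_def by auto
    then have "is_root (Irr K u) (g u)"
      using embedding_root[OF subfieldE(1)[OF K] sM M(2) _ AutD(4)[OF g] Irr_root_self(2)[OF K _ alg]]
        Irr_root_self(1)[OF K _ alg] uM MR by blast
    then show "g u \<in> Z" using u by (auto simp: Z_def)
  qed
  moreover have "inj_on (\<lambda>g. map g Us) (Aut R M K)"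
  proof (rule inj_onI)
    fix g h assume g: "g \<in> Aut R M K" and h: "h \<in> Aut R M K" and eq: "map g Us = map h Us"
    show "g = h"
    proof (rule extensionalityI[OF AutD(1)[OF g] AutD(1)[OF h]])
      fix x assume "x \<in> M"
      then obtain Ks where "set Ks \<subseteq> K" "x = combine Ks Us"
        using Span_eq_combine_set[OF K Us(1)] Us(2) by auto
      then have "g x = combine Ks (map g Us)" "h x = combine Ks (map h Us)"
        using combine_hom_fixing[OF K sM M(2) _ UM] g h by blast+
      then show "g x = h x" using eq by (simp only:)
    qed
  qed
  ultimately show ?thesis by (meson finite_imageD finite_subset)
qed

text \<open>\<open>F\<close> is absent: this is the situation of \<open>L\<close> over
  \<open>K\<close> once the normal closure is known to be finite-dimensional. The characteristic is
  recorded as the vanishing of \<open>p\<close> times \<open>\<one>\<close>, the form in which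
  additivity of Frobenius uses it.\<close>

locale normal_extension = field +
  fixes K and p :: nat
  assumes K: "subfield K R"
    and nrm: "normal_ext R (carrier R) K"
    and fin: "finite_dimension K (carrier R)"
    and p: "Factorial_Ring.prime p"
    and char: "add_pow R p \<one> = \<zero>"
begin

abbreviation G where "G \<equiv> Aut R (carrier R) K"

lemma KR: "K \<subseteq> carrier R"
  by (rule subfieldE(3)[OF K])

lemma G_hom: "g \<in> G \<Longrightarrow> g \<in> ring_hom R R"
  using AutD(2)[of g R "carrier R" K] by simp

lemma finite_G: "finite G"
  by (rule finite_Aut[OF K carrier_is_subfield KR fin])

lemma alg: "x \<in> carrier R \<Longrightarrow> algebraic K x"
  by (rule normal_ext_algebraic[OF nrm])

lemma root_image:
  assumes "h \<in> ring_hom R R" "\<And>k. k \<in> K \<Longrightarrow> h k = k" and x: "x \<in> carrier R" and y: "is_root (Irr K x) y"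
  shows "is_root (Irr K x) (h y)"
  using embedding_root[OF subfieldE(1)[OF K] carrier_is_subring KR _ assms(2) Irr_root_self(2)[OF K x alg[OF x]] _ y]
    assms(1) y by (simp add: is_root_def)

text \<open>The embedding with \<open>x \<mapsto> y\<close> is extended over a spanning list of
  \<open>R\<close>, so that its domain is all of \<open>R\<close>. It is injective as a homomorphism
  of fields, and onto because it permutes the finite root set of each minimal polynomial.\<close>

lemma conjugate:
  assumes x: "x \<in> carrier R" and y: "is_root (Irr K x) y"
  obtains g where "g \<in> G" "g x = y"
proof -
  obtain n Us where Us: "set Us \<subseteq> carrier R" "Span K Us = carrier R"
    using fin exists_base[OF K] by (metis finite_dimensionE')
  let ?Kx = "simple_extension K x"
  define D where "D = finite_extension ?Kx Us"
  obtain \<psi> where \<psi>: "\<psi> \<in> ring_hom (R\<lparr>carrier := D\<rparr>) R" "\<And>k. k \<in> K \<Longrightarrow> \<psi> k = k" "\<psi> x = y"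
    using conjugate_embedding[OF K nrm x y Us(1)] unfolding D_def by blast
  have sKx: "subring ?Kx R" by (rule simple_extension_is_subring[OF subfieldE(1)[OF K] x])
  have sD: "subring D R" unfolding D_def by (rule finite_extension_is_subring[OF sKx Us(1)])
  have KD: "K \<subseteq> D"
    unfolding D_def
    by (rule subset_trans[OF simple_extension_incl[OF KR x] finite_extension_incl[OF subringE(1)[OF sKx] Us(1)]])
  have "subalgebra K D R"
    using subring.axioms(1)[OF sD] subringE(6)[OF sD] KD
    by (intro subalgebra.intro) (auto simp: subalgebra_axioms_def)
  moreover have "set Us \<subseteq> D" unfolding D_def by (rule finite_extension_mem[OF sKx Us(1)])
  ultimately have "carrier R \<subseteq> D"
    using subalgebra_Span_incl[OF K] Us(2) by metis
  then have "D = carrier R" using subringE(1)[OF sD] by (rule equalityI[rotated])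
  then have \<psi>R: "\<psi> \<in> ring_hom R R" using \<psi>(1) by simp
  have inj: "inj_on \<psi> (carrier R)" by (rule non_trivial_field_hom_is_inj[OF \<psi>R field_axioms field_axioms])
  have surj: "\<psi> ` carrier R = carrier R"
  proof
    show "\<psi> ` carrier R \<subseteq> carrier R" using ring_hom_memE(1)[OF \<psi>R] by blast
    show "carrier R \<subseteq> \<psi> ` carrier R"
    proof
      fix z assume z: "z \<in> carrier R"
      let ?Z = "{w. is_root (Irr K z) w}"
      have Z: "finite ?Z" "?Z \<subseteq> carrier R"
        using finite_number_of_roots[OF Irr_root_self(3)[OF K z alg[OF z]]] by (auto simp: is_root_def)
      have "\<psi> ` ?Z \<subseteq> ?Z" using root_image[OF \<psi>R \<psi>(2) z] by blast
      then have "\<psi> ` ?Z = ?Z" using endo_inj_surj[OF Z(1)] inj_on_subset[OF inj Z(2)] by blast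
      moreover have "z \<in> ?Z" using Irr_root_self(1)[OF K z alg[OF z]] by simp
      ultimately show "z \<in> \<psi> ` carrier R" using Z(2) by blast
    qed
  qed
  have "restrict \<psi> (carrier R) \<in> G"
  proof (rule AutI)
    show "bij_betw (restrict \<psi> (carrier R)) (carrier R) (carrier R)"
      using inj surj by (simp add: bij_betw_def)
    show "restrict \<psi> (carrier R) k = k" if "k \<in> K" for k
      using \<psi>(2)[OF that] subsetD[OF KR that] by simp
  qed (use ring_hom_memE[OF \<psi>R] in simp_all)
  then show ?thesis using that[of "restrict \<psi> (carrier R)"] \<psi>(3) x by simp
qed

definition stable where "stable M \<longleftrightarrow> (\<forall>g\<in>G. \<forall>x\<in>M. g x \<in> M)"

text \<open>\<open>G\<close> is transitive on the roots of a minimal polynomial, so the conjugates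
  of \<open>x\<close> are its images under \<open>G\<close>. The root criterion for normality
  becomes stability, the form used from here on.\<close>

lemma normal_iff_stable:
  assumes M: "subfield M R" "K \<subseteq> M"
  shows "normal_ext R M K \<longleftrightarrow> stable M"
proof -
  have MR: "M \<subseteq> carrier R" by (rule subfieldE(3)[OF M(1)])
  have root: "is_root (Irr K x) (g x)" if "x \<in> carrier R" "g \<in> G" for x g
    by (rule root_image[OF G_hom[OF that(2)] AutD(4)[OF that(2)] that(1) Irr_root_self(1)[OF K that(1) alg[OF that(1)]]])
  show ?thesis
    unfolding normal_ext_subfield_iff[OF K nrm M] stable_def
  proof (intro iffI ballI allI impI)
    fix g x assume "\<forall>x\<in>M. \<forall>y. is_root (Irr K x) y \<longrightarrow> y \<in> M" "g \<in> G" "x \<in> M"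
    then show "g x \<in> M" using root[of x g] MR by blast
  next
    fix x y assume st: "\<forall>g\<in>G. \<forall>x\<in>M. g x \<in> M" and x: "x \<in> M" and y: "is_root (Irr K x) y"
    obtain g where "g \<in> G" "g x = y" using conjugate[OF subsetD[OF MR x] y] .
    then show "y \<in> M" using st x by blast
  qed
qed

abbreviation Fix where "Fix \<equiv> fixed_by (carrier R) G"

lemma fixed_roots:
  assumes x: "x \<in> Fix" shows "is_root (Irr K x) y \<longleftrightarrow> y = x"
proof -
  have xR: "x \<in> carrier R" using x by (simp add: fixed_by_def)
  show ?thesis
  proof
    assume "is_root (Irr K x) y"
    then obtain g where "g \<in> G" "g x = y" using conjugate[OF xR] by blast
    then show "y = x" using x unfolding fixed_by_def by blast
  qed (use Irr_root_self(1)[OF K xR alg[OF xR]] in simp)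
qed

lemma restrict_Aut:
  assumes M: "subfield M R" "K \<subseteq> M" "stable M" and g: "g \<in> G"
  shows "restrict g M \<in> Aut R M K"
proof (rule AutI)
  have MR: "M \<subseteq> carrier R" by (rule subfieldE(3)[OF M(1)])
  have sM: "subring M R" by (rule subfieldE(1)[OF M(1)])
  show "restrict g M \<in> extensional M" by simp
  obtain h where h: "h \<in> G" "\<And>x. x \<in> carrier R \<Longrightarrow> g (h x) = x"
    using Aut_inverse[OF carrier_is_subring KR g] by metis
  have "inj_on g M" using AutD(3)[OF g] MR by (meson bij_betw_def inj_on_subset)
  moreover have "g ` M = M"
  proof
    show "g ` M \<subseteq> M" using M(3) g by (auto simp: stable_def)
    show "M \<subseteq> g ` M"
    proof
      fix x assume x: "x \<in> M"
      then have "x = g (h x)" "h x \<in> M" using h MR M(3) by (auto simp: stable_def)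
      then show "x \<in> g ` M" by blast
    qed
  qed
  ultimately show "bij_betw (restrict g M) M M" by (simp add: bij_betw_def)
  show "restrict g M k = k" if "k \<in> K" for k using AutD(4)[OF g that] that M(2) by auto
  show "restrict g M \<one> = \<one>" using AutD(8)[OF g] subringE(3)[OF sM] by simp
  show "restrict g M (x \<oplus> y) = restrict g M x \<oplus> restrict g M y"
    "restrict g M (x \<otimes> y) = restrict g M x \<otimes> restrict g M y" if "x \<in> M" "y \<in> M" for x y
    using that MR subringE(6,7)[OF sM] AutD(6,7)[OF g] by (auto simp: subset_iff)
qed

end

section \<open>Minimal polynomials of fixed elements\<close>

lemma (in domain) poly_ring_char:
  assumes "add_pow R n \<one> = \<zero>" shows "add_pow (poly_ring R) (n::nat) \<one>\<^bsub>poly_ring R\<^esub> = \<zero>\<^bsub>poly_ring R\<^esub>"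
proof -
  interpret UP: domain "poly_ring R" by (rule univ_poly_is_domain[OF carrier_is_subring])
  interpret C: ring_hom_ring R "poly_ring R" poly_of_const
    using canonical_embedding_ring_hom[OF carrier_is_subring] by simp
  have "poly_of_const (add_pow R k \<one>) = add_pow (poly_ring R) k \<one>\<^bsub>poly_ring R\<^esub>" for k :: nat
    by (induction k) (simp_all add: C.hom_one C.hom_zero)
  from this[of n] show ?thesis using assms C.hom_zero by simp
qed

lemma (in domain) linear_poly:
  assumes "a \<in> carrier R"
  shows "[\<one>, \<ominus> a] \<in> carrier (poly_ring R)"
    and "[\<one>, \<ominus> a] = X \<ominus>\<^bsub>poly_ring R\<^esub> poly_of_const a"
proof -
  interpret UP: domain "poly_ring R" by (rule univ_poly_is_domain[OF carrier_is_subring])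
  show "[\<one>, \<ominus> a] \<in> carrier (poly_ring R)"
    using assms unfolding univ_poly_def polynomial_def by simp
  interpret C: ring_hom_ring R "poly_ring R" poly_of_const
    using canonical_embedding_ring_hom[OF carrier_is_subring] by simp
  have "X \<ominus>\<^bsub>poly_ring R\<^esub> poly_of_const a = poly_add [\<one>, \<zero>] (poly_of_const (\<ominus> a))"
    using assms C.hom_a_inv[OF assms] by (simp add: UP.minus_eq univ_poly_add var_def)
  also have "\<dots> = [\<one>, \<ominus> a]"
    using assms by (auto simp: poly_of_const_def)
  finally show "[\<one>, \<ominus> a] = X \<ominus>\<^bsub>poly_ring R\<^esub> poly_of_const a" ..
qed

text \<open>The power of the linear factor divides \<open>f\<close> with a cofactor of degree 0,
  which is a unit; so the divisibility can be reversed.\<close>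

lemma (in field) linear_power_pdivides:
  assumes f: "f \<in> carrier (poly_ring R)" "f \<noteq> []" and a: "a \<in> carrier R"
    and "alg_mult f a = degree f"
  shows "f pdivides [\<one>, \<ominus> a] [^]\<^bsub>poly_ring R\<^esub> degree f"
proof -
  interpret UP: domain "poly_ring R" by (rule univ_poly_is_domain[OF carrier_is_subring])
  define l where "l = [\<one>, \<ominus> a] [^]\<^bsub>poly_ring R\<^esub> degree f"
  note lin = linear_poly(1)[OF a]
  have l: "l \<in> carrier (poly_ring R)" using lin by (simp add: l_def)
  have "l pdivides f" using alg_multE(1)[OF a f] assms(4) by (simp add: l_def)
  then obtain r where r: "r \<in> carrier (poly_ring R)" "f = l \<otimes>\<^bsub>poly_ring R\<^esub> r"
    unfolding pdivides_def factor_def by blast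
  have l0: "l \<noteq> []" using polynomial_pow_not_zero[OF lin] by (simp add: l_def)
  have r0: "r \<noteq> []" using r f(2) UP.r_null[OF l] by (auto simp: univ_poly_zero)
  have "degree l = degree f" using polynomial_pow_degree[OF lin, of "degree f"] by (simp add: l_def)
  moreover have "degree f = degree l + degree r"
    using poly_mult_degree_eq[OF carrier_is_subring, of l r] l r l0 r0
    by (simp add: univ_poly_carrier univ_poly_mult)
  ultimately have "degree r = 0" by simp
  then have "r \<in> Units (poly_ring R)"
    using r(1) r0 univ_poly_units'[OF carrier_is_subfield, of r] by simp
  then obtain s where s: "s \<in> carrier (poly_ring R)" "r \<otimes>\<^bsub>poly_ring R\<^esub> s = \<one>\<^bsub>poly_ring R\<^esub>"
    unfolding Units_def by blast
  have "f \<otimes>\<^bsub>poly_ring R\<^esub> s = l" unfolding r(2) using r(1) s l by (simp add: UP.m_assoc)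
  then show ?thesis unfolding pdivides_def factor_def l_def[symmetric] using s by blast
qed

context normal_extension begin

text \<open>
  The minimal polynomial \<open>f\<close> of a fixed element \<open>x\<close> is a power of \<open>X - x\<close>, hence divides
  \<open>X\<^sup>q - x\<^sup>q\<close> for a large power \<open>q\<close> of \<open>p\<close>; so \<open>x\<^sup>q\<close> is the remainder of \<open>X\<^sup>q\<close> modulo \<open>f\<close>,
  which has coefficients in \<open>K\<close>.
\<close>

lemma fixed_purely_inseparable:
  assumes x: "x \<in> Fix" obtains n where "x [^] (p ^ n) \<in> K"
proof -
  have xR: "x \<in> carrier R" using x by (simp add: fixed_by_def)
  interpret UP: domain "poly_ring R" by (rule univ_poly_is_domain[OF carrier_is_subring])
  interpret C: ring_hom_ring R "poly_ring R" poly_of_const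
    using canonical_embedding_ring_hom[OF carrier_is_subring] by simp
  have sK: "subring K R" by (rule subfieldE(1)[OF K])
  define f where "f = Irr K x"
  note I = Irr_root_self[OF K xR alg[OF xR], folded f_def]
  have "set_mset (roots f) = {x}"
    using roots_mem_iff_is_root[OF I(3)] fixed_roots[OF x] by (auto simp: f_def)
  then have "size (roots f) = count (roots f) x" by (simp add: size_multiset_overloaded_eq)
  then have mult: "alg_mult f x = degree f"
    using normal_ext_splitted_Irr[OF nrm K xR] alg_mult_eq_count_roots[OF I(3)]
    by (simp add: splitted_def f_def)
  \<comment> \<open>Only \<open>degree f \<le> q\<close> matters;
    \<open>n < 2 ^ n \<le> p ^ n\<close> shows that this power is large enough.\<close>
  define q where "q = p ^ degree f"
  have "degree f < 2 ^ degree f" by (rule less_exp)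
  also have "\<dots> \<le> p ^ degree f" using prime_ge_2_nat[OF p] by (intro power_mono) auto
  finally have "degree f \<le> q" unfolding q_def by simp
  then have "[\<one>, \<ominus> x] [^]\<^bsub>poly_ring R\<^esub> degree f pdivides [\<one>, \<ominus> x] [^]\<^bsub>poly_ring R\<^esub> q"
    by (rule polynomial_pow_division[OF linear_poly(1)[OF xR]])
  then have "f pdivides [\<one>, \<ominus> x] [^]\<^bsub>poly_ring R\<^esub> q"
    using linear_power_pdivides[OF I(3,4) xR mult] UP.divides_trans[OF _ _ I(3)]
    unfolding pdivides_def by blast
  also have "[\<one>, \<ominus> x] [^]\<^bsub>poly_ring R\<^esub> q =
      X [^]\<^bsub>poly_ring R\<^esub> q \<ominus>\<^bsub>poly_ring R\<^esub> poly_of_const x [^]\<^bsub>poly_ring R\<^esub> q"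
    unfolding linear_poly(2)[OF xR] q_def
    by (rule UP.frobenius_minus[OF p poly_ring_char[OF char]])
      (use var_closed(1)[OF carrier_is_subring] xR in auto)
  also have "poly_of_const x [^]\<^bsub>poly_ring R\<^esub> q = poly_of_const (x [^] q)"
    using C.hom_nat_pow[OF xR] by simp
  finally have "f pdivides (X [^]\<^bsub>poly_ring R\<^esub> q \<ominus>\<^bsub>poly_ring R\<^esub> poly_of_const (x [^] q))" .
  moreover have Xq: "X [^]\<^bsub>poly_ring R\<^esub> q \<in> carrier (poly_ring R)"
    using var_closed(1)[OF carrier_is_subring] by simp
  moreover have Cx: "poly_of_const (x [^] q) \<in> carrier (poly_ring R)" using xR by simp
  ultimately have "X [^]\<^bsub>poly_ring R\<^esub> q pmod f = poly_of_const (x [^] q) pmod f"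
    using same_pmod_iff_pdivides[OF carrier_is_subfield _ _ I(3)] by blast
  also have "\<dots> = poly_of_const (x [^] q)"
  proof (rule pmod_const(2)[OF carrier_is_subfield Cx I(3)])
    have "degree f > 0"
      using pirreducible_degree[OF K I(2)] IrrE(2)[OF K xR] alg[OF xR] by (simp add: f_def over_def)
    then show "degree (poly_of_const (x [^] q)) < degree f" by (simp add: poly_of_const_def)
  qed
  \<comment> \<open>The powers of \<open>X\<close> are the same lists over \<open>K\<close> and over
    \<open>R\<close>, and division by \<open>f\<close>, which has coefficients in \<open>K\<close>,
    does not leave \<open>K[X]\<close>.\<close>
  finally have "poly_of_const (x [^] q) = X [^]\<^bsub>K[X]\<^esub> q pmod f"
    using univ_poly_nat_pow[where M = K and K = "carrier R"] by simp
  moreover have "X [^]\<^bsub>K[X]\<^esub> q pmod f \<in> carrier (K[X])"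
    by (rule long_division_closed(2)[OF K _ I(2)]) (rule var_pow_closed[OF sK])
  ultimately have "poly_of_const (x [^] q) \<in> carrier (K[X])" by simp
  then have "x [^] q \<in> K"
    using subringE(2)[OF sK] by (auto simp: poly_of_const_def univ_poly_def polynomial_def split: if_splits)
  then show ?thesis using that q_def by blast
qed

section \<open>Orbit polynomials and the fixed-point criterion for Galois extensions\<close>

lemma roots_finprod_linear:
  assumes "finite Z" "Z \<subseteq> carrier R"
  shows "finprod (poly_ring R) (\<lambda>y. [\<one>, \<ominus> y]) Z \<in> carrier (poly_ring R) - {[]} \<and>
    roots (finprod (poly_ring R) (\<lambda>y. [\<one>, \<ominus> y]) Z) = mset_set Z"
  using assms
proof (induction Z rule: finite_induct)
  interpret UP: domain "poly_ring R" by (rule univ_poly_is_domain[OF carrier_is_subring])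
  case empty
  have "[\<one>] \<in> carrier (poly_ring R)" unfolding univ_poly_def polynomial_def by simp
  then show ?case using degree_zero_imp_empty_roots[of "[\<one>]"] by (simp add: univ_poly_one)
next
  interpret UP: domain "poly_ring R" by (rule univ_poly_is_domain[OF carrier_is_subring])
  case (insert y Z)
  have y: "y \<in> carrier R" and Z: "Z \<subseteq> carrier R" using insert.prems by auto
  have lin: "(\<lambda>y. [\<one>, \<ominus> y]) \<in> Z \<rightarrow> carrier (poly_ring R)" using linear_poly(1) Z by blast
  note IH = insert.IH[OF Z]
  have eq: "finprod (poly_ring R) (\<lambda>y. [\<one>, \<ominus> y]) (insert y Z) =
    [\<one>, \<ominus> y] \<otimes>\<^bsub>poly_ring R\<^esub> finprod (poly_ring R) (\<lambda>y. [\<one>, \<ominus> y]) Z"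
    using insert.hyps lin linear_poly(1)[OF y] by (simp add: UP.finprod_insert)
  have "[\<one>, \<ominus> y] \<otimes>\<^bsub>poly_ring R\<^esub> finprod (poly_ring R) (\<lambda>y. [\<one>, \<ominus> y]) Z \<noteq> []"
    using UP.integral[OF _ linear_poly(1)[OF y]] IH by (auto simp: univ_poly_zero)
  moreover have "[\<one>, \<ominus> y] \<otimes>\<^bsub>poly_ring R\<^esub> finprod (poly_ring R) (\<lambda>y. [\<one>, \<ominus> y]) Z \<in> carrier (poly_ring R)"
    using linear_poly(1)[OF y] IH by blast
  ultimately show ?case
    unfolding eq using poly_mult_degree_one_monic_imp_same_roots[OF y] IH insert.hyps by simp
qed

lemma map_G_hom:
  assumes g: "g \<in> G" shows "map g \<in> ring_hom (poly_ring R) (poly_ring R)"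
proof (rule ring_hom_memI)
  have gR: "g \<in> ring_hom (R\<lparr>carrier := carrier R\<rparr>) R" using G_hom[OF g] by simp
  note mp = map_embedding_poly[OF carrier_is_subfield gR]
  fix u v assume u: "u \<in> carrier (poly_ring R)" and v: "v \<in> carrier (poly_ring R)"
  show "map g u \<in> carrier (poly_ring R)" by (rule mp(1)[OF u u])
  show "map g (u \<otimes>\<^bsub>poly_ring R\<^esub> v) = map g u \<otimes>\<^bsub>poly_ring R\<^esub> map g v" by (rule mp(3)[OF u v])
  show "map g (u \<oplus>\<^bsub>poly_ring R\<^esub> v) = map g u \<oplus>\<^bsub>poly_ring R\<^esub> map g v" by (rule mp(2)[OF u v])
next
  show "map g \<one>\<^bsub>poly_ring R\<^esub> = \<one>\<^bsub>poly_ring R\<^esub>"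
    using AutD(8)[OF g] by (simp add: univ_poly_one)
qed

text \<open>An automorphism permutes the orbit of \<open>a\<close>, so the coefficients of the
  product are fixed; they lie in \<open>N\<close> because the orbit does, hence in \<open>K\<close>.
  The product runs over the orbit as a set: each conjugate counts once, and the roots are
  simple.\<close>

lemma orbit_poly:
  assumes N: "subfield N R" "stable N" "N \<inter> Fix \<subseteq> K" and a: "a \<in> N"
  defines "h \<equiv> finprod (poly_ring R) (\<lambda>y. [\<one>, \<ominus> y]) ((\<lambda>g. g a) ` G)"
  shows "h \<in> carrier (K[X])"
proof -
  interpret UP: domain "poly_ring R" by (rule univ_poly_is_domain[OF carrier_is_subring])
  have sN: "subring N R" by (rule subfieldE(1)[OF N(1)])
  interpret NX: domain "N[X]" by (rule univ_poly_is_domain[OF sN])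
  let ?O = "(\<lambda>g. g a) ` G"
  have NR: "N \<subseteq> carrier R" by (rule subfieldE(3)[OF N(1)])
  have ON: "?O \<subseteq> N" using N(2) a by (auto simp: stable_def)
  have finO: "finite ?O" using finite_G by simp
  have h: "h \<in> carrier (poly_ring R)" "h \<noteq> []"
    unfolding h_def using roots_finprod_linear[OF finO] ON NR by auto
  have "finprod (poly_ring R) (\<lambda>y. [\<one>, \<ominus> y]) Z \<in> carrier (N[X])" if "finite Z" "Z \<subseteq> N" for Z
    using that
  proof (induction Z rule: finite_induct)
    case empty
    show ?case using NX.one_closed by (simp add: univ_poly_one)
  next
    case (insert y Z)
    have lin: "[\<one>, \<ominus> z] \<in> carrier (N[X])" if "z \<in> insert y Z" for z
      using that insert.prems subringE(3,5)[OF sN] unfolding univ_poly_def polynomial_def by auto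
    have "(\<lambda>y. [\<one>, \<ominus> y]) \<in> Z \<rightarrow> carrier (poly_ring R)" "[\<one>, \<ominus> y] \<in> carrier (poly_ring R)"
      using linear_poly(1) insert.prems NR by auto
    then have "finprod (poly_ring R) (\<lambda>y. [\<one>, \<ominus> y]) (insert y Z) =
        [\<one>, \<ominus> y] \<otimes>\<^bsub>N[X]\<^esub> finprod (poly_ring R) (\<lambda>y. [\<one>, \<ominus> y]) Z"
      using insert.hyps by (simp add: UP.finprod_insert univ_poly_mult)
    then show ?case using lin[of y] insert by simp
  qed
  then have "set h \<subseteq> N"
    unfolding h_def using subfield_carrier_poly_subset(1)[OF sN] finO ON by blast
  moreover have "set h \<subseteq> Fix"
  proof
    fix c assume c: "c \<in> set h"
    have "g c = c" if g: "g \<in> G" for g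
    proof -
      interpret g: ring_hom_cring "poly_ring R" "poly_ring R" "map g"
        using map_G_hom[OF g] UP.is_cring by (simp add: ring_hom_cring_def ring_hom_cring_axioms_def)
      have gO: "g ` ?O = ?O"
      proof (rule endo_inj_surj[OF finO])
        show "inj_on g ?O" using AutD(3)[OF g] ON NR by (meson bij_betw_def inj_on_subset)
        show "g ` ?O \<subseteq> ?O"
        proof clarify
          fix k assume k: "k \<in> G"
          have "compose (carrier R) g k \<in> G" by (rule Aut_compose[OF carrier_is_subring KR g k])
          moreover have "g (k a) = compose (carrier R) g k a" using a NR by (auto simp: compose_def)
          ultimately show "g (k a) \<in> ?O" by blast
        qed
      qed
      have inj: "inj_on g ?O" using AutD(3)[OF g] ON NR by (meson bij_betw_def inj_on_subset)
      have lin: "(\<lambda>y. [\<one>, \<ominus> y]) \<in> ?O \<rightarrow> carrier (poly_ring R)" using linear_poly(1) ON NR by blast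
      have "map g h = finprod (poly_ring R) (map g \<circ> (\<lambda>y. [\<one>, \<ominus> y])) ?O"
        unfolding h_def by (rule g.hom_finprod[OF lin])
      also have "\<dots> = finprod (poly_ring R) (\<lambda>y. [\<one>, \<ominus> g y]) ?O"
      proof (rule UP.finprod_cong'[OF refl])
        have OR: "?O \<subseteq> carrier R" using ON NR by (rule subset_trans)
        show "(\<lambda>y. [\<one>, \<ominus> g y]) \<in> ?O \<rightarrow> carrier (poly_ring R)"
          by (rule funcsetI, rule linear_poly(1), rule AutD(5)[OF g]) (rule subsetD[OF OR])
        show "(map g \<circ> (\<lambda>y. [\<one>, \<ominus> y])) y = [\<one>, \<ominus> g y]" if "y \<in> ?O" for y
          using Aut_zero_minus(2)[OF g carrier_is_subring subsetD[OF OR that]] AutD(8)[OF g] by simp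
      qed
      also have "\<dots> = finprod (poly_ring R) (\<lambda>y. [\<one>, \<ominus> y]) (g ` ?O)"
        using UP.finprod_reindex[OF _ inj, of "\<lambda>y. [\<one>, \<ominus> y]"] lin unfolding gO by simp
      also have "\<dots> = map id h" unfolding gO h_def by simp
      finally show "g c = c" using c by (simp only: map_eq_conv id_apply)
    qed
    moreover have "c \<in> carrier R" using c subfield_carrier_poly_subset(2)[OF carrier_is_subring h(1)] by blast
    ultimately show "c \<in> Fix" by (simp add: fixed_by_def)
  qed
  ultimately have "set h \<subseteq> K" using N(3) by blast
  then show ?thesis using h unfolding univ_poly_def polynomial_def by simp
qed

text \<open>If \<open>N\<close> is Galois, a fixed \<open>x\<close> in \<open>N\<close> is the only
  root of its minimal polynomial and a simple one, so the degree is 1 and \<open>x\<close> lies in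
  \<open>K\<close>. Conversely \<open>Irr K x\<close> divides the orbit polynomial, whose roots are
  simple.\<close>

lemma galois_ext_iff:
  assumes N: "subfield N R" "K \<subseteq> N"
  shows "galois_ext R N K \<longleftrightarrow> stable N \<and> N \<inter> Fix \<subseteq> K"
proof -
  have NR: "N \<subseteq> carrier R" by (rule subfieldE(3)[OF N(1)])
  have Irr: "Irr K x \<in> carrier (N[X])" "Irr K x \<in> carrier (poly_ring R)" if "x \<in> N" for x
    using Irr_root_self(2,3)[OF K _ alg] that NR subfield_poly_mono[OF N(2)] by blast+
  show ?thesis
  proof
    assume gal: "galois_ext R N K"
    show "stable N \<and> N \<inter> Fix \<subseteq> K"
    proof
      show "stable N" using gal normal_iff_stable[OF N] by (simp add: galois_ext_def)
      show "N \<inter> Fix \<subseteq> K"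
      proof
        fix x assume x: "x \<in> N \<inter> Fix"
        have xR: "x \<in> carrier R" using x NR by blast
        have "alg_mult (Irr K x) x \<le> 1"
          using gal x alg_mult_subfield[OF N(1) Irr(1)] unfolding galois_ext_def by auto
        then have "count (roots (Irr K x)) x \<le> 1"
          using alg_mult_eq_count_roots[OF Irr(2)] x by simp
        moreover have "set_mset (roots (Irr K x)) = {x}"
          using roots_mem_iff_is_root[OF Irr(2)] fixed_roots x by auto
        ultimately have "degree (Irr K x) \<le> 1"
          using normal_ext_splitted_Irr[OF nrm K xR] by (simp add: splitted_def size_multiset_overloaded_eq)
        moreover have al: "(algebraic over K) x" using alg[OF xR] by (simp add: over_def)
        moreover have "degree (Irr K x) \<ge> 1"
          using pirreducible_degree[OF K IrrE(1,2)[OF K xR al]] .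
        ultimately have d: "degree (Irr K x) = 1" by simp
        \<comment> \<open>The root of a linear polynomial over \<open>K\<close>, written down from
          its two coefficients; it lies in \<open>K\<close> and has to coincide with the only root
          \<open>x\<close>.\<close>
        have "\<ominus> (inv lead_coeff (Irr K x) \<otimes> const_term (Irr K x)) \<in> K"
          using degree_one_root(2)[OF K IrrE(1)[OF K xR al] d] subringE(5)[OF subfieldE(1)[OF K]] by blast
        moreover have "is_root (Irr K x) (\<ominus> (inv lead_coeff (Irr K x) \<otimes> const_term (Irr K x)))"
          using degree_one_root[OF K IrrE(1)[OF K xR al] d] calculation KR Irr_root_self(4)[OF K xR alg[OF xR]]
          by (auto simp: is_root_def)
        ultimately show "x \<in> K" using fixed_roots x by auto
      qed
    qed
  next
    assume st: "stable N \<and> N \<inter> Fix \<subseteq> K"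
    show "galois_ext R N K"
      unfolding galois_ext_def
    proof (intro conjI ballI)
      show "normal_ext R N K" using st normal_iff_stable[OF N] by blast
      fix x a assume x: "x \<in> N" and a: "a \<in> N"
      have xR: "x \<in> carrier R" using x NR by blast
      have al: "(algebraic over K) x" using alg[OF xR] by (simp add: over_def)
      let ?O = "(\<lambda>g. g x) ` G"
      have O: "finite ?O" "?O \<subseteq> carrier R"
        using finite_G AutD(5)[of _ R "carrier R" K] xR by auto
      define h where "h = finprod (poly_ring R) (\<lambda>y. [\<one>, \<ominus> y]) ?O"
      have h: "h \<in> carrier (K[X])" unfolding h_def by (rule orbit_poly[OF N(1) _ _ x]) (use st in auto)
      have hR: "h \<in> carrier (poly_ring R)" "h \<noteq> []" "roots h = mset_set ?O"
        using roots_finprod_linear[OF O] by (auto simp: h_def)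
      have "(\<lambda>z\<in>carrier R. z) \<in> G" by (rule Aut_id[OF KR]) auto
      then have "x \<in> ?O" using xR by (intro image_eqI[of _ _ "\<lambda>z\<in>carrier R. z"]) auto
      then have "is_root h x" using roots_mem_iff_is_root[OF hR(1)] hR(3) O(1) by auto
      then have "Irr K x pdivides h" using Irr_minimal[OF K xR al h] by (simp add: is_root_def)
      then have "roots (Irr K x) \<subseteq># mset_set ?O"
        using pdivides_imp_roots_incl[OF Irr(2)[OF x] hR(1,2)] hR(3) by simp
      then have "count (roots (Irr K x)) a \<le> count (mset_set ?O) a" by (rule mset_subset_eq_count)
      also have "\<dots> \<le> 1" by (simp add: count_mset_set')
      finally show "ring.alg_mult (R\<lparr>carrier := N\<rparr>) (Irr K x) a \<le> 1"
        using alg_mult_subfield[OF N(1) Irr(1)[OF x] a] alg_mult_eq_count_roots[OF Irr(2)[OF x]] by simp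
    qed
  qed
qed

end

section \<open>Sums of products\<close>

lemma (in abelian_monoid) finsum_swap:
  assumes "finite A" "finite B" and f: "\<And>x y. x \<in> A \<Longrightarrow> y \<in> B \<Longrightarrow> f x y \<in> carrier G"
  shows "(\<Oplus>x\<in>A. \<Oplus>y\<in>B. f x y) = (\<Oplus>y\<in>B. \<Oplus>x\<in>A. f x y)"
  using assms(1) f
proof (induction A rule: finite_induct)
  case empty
  then show ?case by simp
next
  case (insert a A)
  have ff: "\<And>y. y \<in> B \<Longrightarrow> (\<lambda>x. f x y) \<in> A \<rightarrow> carrier G" "\<And>x. x \<in> insert a A \<Longrightarrow> f x \<in> B \<rightarrow> carrier G"
    using insert.prems by auto
  have "(\<Oplus>x\<in>insert a A. \<Oplus>y\<in>B. f x y) = (\<Oplus>y\<in>B. f a y) \<oplus> (\<Oplus>x\<in>A. \<Oplus>y\<in>B. f x y)"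
    using insert.hyps ff(2) by (intro finsum_insert) (auto intro!: finsum_closed)
  also have "\<dots> = (\<Oplus>y\<in>B. f a y) \<oplus> (\<Oplus>y\<in>B. \<Oplus>x\<in>A. f x y)"
    using insert.IH insert.prems by simp
  also have "\<dots> = (\<Oplus>y\<in>B. f a y \<oplus> (\<Oplus>x\<in>A. f x y))"
    using ff by (intro finsum_addf[symmetric]) (auto intro!: finsum_closed)
  also have "\<dots> = (\<Oplus>y\<in>B. \<Oplus>x\<in>insert a A. f x y)"
  proof (rule finsum_cong'[OF refl])
    show "(\<lambda>y. \<Oplus>x\<in>insert a A. f x y) \<in> B \<rightarrow> carrier G"
      using insert.prems by (auto intro!: finsum_closed)
    show "f a y \<oplus> (\<Oplus>x\<in>A. f x y) = (\<Oplus>x\<in>insert a A. f x y)" if "y \<in> B" for y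
      using insert.hyps insert.prems that ff(1)[OF that] by (subst finsum_insert) auto
  qed
  finally show ?case .
qed

lemma (in abelian_monoid) finsum_lessThan_add:
  assumes f: "\<And>i. f i \<in> carrier G"
  shows "(\<Oplus>i\<in>{..<n + m::nat}. f i) = (\<Oplus>i\<in>{..<n}. f i) \<oplus> (\<Oplus>i\<in>{..<m}. f (n + i))"
proof (induction m)
  case 0
  show ?case using f by simp
next
  case (Suc m)
  have "(\<Oplus>i\<in>{..<n + Suc m}. f i) = f (n + m) \<oplus> (\<Oplus>i\<in>{..<n + m}. f i)"
    using f by (simp add: lessThan_Suc)
  also have "\<dots> = (\<Oplus>i\<in>{..<n}. f i) \<oplus> (f (n + m) \<oplus> (\<Oplus>i\<in>{..<m}. f (n + i)))"
    using f Suc.IH by (simp add: a_lcomm)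
  finally show ?case using f by (simp add: lessThan_Suc)
qed

lemma (in ring) finsum_in_subgroup:
  assumes H: "subgroup H (add_monoid R)" and f: "\<And>i. i \<in> A \<Longrightarrow> f i \<in> H"
  shows "finsum R f A \<in> H"
proof (cases "finite A")
  case True
  have HR: "H \<subseteq> carrier R" using subgroup.subset[OF H] by simp
  show ?thesis
    using True f
  proof (induction A rule: finite_induct)
    case empty
    show ?case using subgroup.one_closed[OF H] by simp
  next
    case (insert a A)
    then have "finsum R f (insert a A) = f a \<oplus> finsum R f A" using HR by (intro finsum_insert) auto
    then show ?case using insert subgroup.m_closed[OF H, of "f a"] by simp
  qed
next
  case False
  then show ?thesis using subgroup.one_closed[OF H] by (simp add: finsum_infinite)
qed

text \<open>One additive span for several objects: the field \<open>S\<close>, the compositum of a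
  purely inseparable and a Galois subfield, the crossed product, and the image of
  \<open>mult_map\<close>.\<close>

definition prod_span :: "('a, 'm) ring_scheme \<Rightarrow> 'a set \<Rightarrow> 'a set \<Rightarrow> 'a set"
  where "prod_span R A B = generate (add_monoid R) {a \<otimes>\<^bsub>R\<^esub> b | a b. a \<in> A \<and> b \<in> B}"

lemma crossed_eq_prod_span: "crossed E D H = prod_span E D H"
  by (simp add: crossed_def prod_span_def)

lemma (in ring) prod_span_subgroup:
  assumes "A \<subseteq> carrier R" "B \<subseteq> carrier R" shows "subgroup (prod_span R A B) (add_monoid R)"
  unfolding prod_span_def by (rule add.generate_is_subgroup) (use assms in auto)

lemma (in ring) prod_span_subset:
  assumes "subgroup H (add_monoid R)" "\<And>a b. a \<in> A \<Longrightarrow> b \<in> B \<Longrightarrow> a \<otimes> b \<in> H"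
  shows "prod_span R A B \<subseteq> H"
  unfolding prod_span_def by (rule add.generate_subgroup_incl[OF _ assms(1)]) (use assms(2) in auto)

lemma (in ring) prod_in_prod_span: "a \<in> A \<Longrightarrow> b \<in> B \<Longrightarrow> a \<otimes> b \<in> prod_span R A B"
  unfolding prod_span_def by (rule generate.incl) auto

lemma (in ring) sum_in_prod_span:
  assumes "A \<subseteq> carrier R" "B \<subseteq> carrier R" "\<And>i. i \<in> I \<Longrightarrow> a i \<in> A" "\<And>i. i \<in> I \<Longrightarrow> b i \<in> B"
  shows "(\<Oplus>i\<in>I. a i \<otimes> b i) \<in> prod_span R A B"
  by (rule finsum_in_subgroup[OF prod_span_subgroup[OF assms(1,2)]]) (use assms(3,4) prod_in_prod_span in blast)

text \<open>Signs are absorbed into \<open>A\<close>, which is closed under negation. The families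
  are total, with values in \<open>A\<close> and \<open>B\<close> at every index, so that later
  steps carry no bound on the index.\<close>

lemma (in ring) prod_span_sumE:
  assumes A: "A \<subseteq> carrier R" "A \<noteq> {}" "\<And>a. a \<in> A \<Longrightarrow> \<ominus> a \<in> A" and B: "B \<subseteq> carrier R" "B \<noteq> {}"
    and x: "x \<in> prod_span R A B"
  obtains n :: nat and a b where "\<And>i. a i \<in> A" "\<And>i. b i \<in> B" "x = (\<Oplus>i\<in>{..<n}. a i \<otimes> b i)"
proof -
  have "\<exists>(n::nat) a b. (\<forall>i. a i \<in> A) \<and> (\<forall>i. b i \<in> B) \<and> x = (\<Oplus>i\<in>{..<n}. a i \<otimes> b i)"
    using x unfolding prod_span_def
  proof (induction x rule: generate.induct)
    case one
    obtain a b where "a \<in> A" "b \<in> B" using A B by blast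
    then show ?case by - (rule exI[of _ "0::nat"], rule exI[of _ "\<lambda>_. a"], rule exI[of _ "\<lambda>_. b"], simp)
  next
    case (incl h)
    then obtain a b where "a \<in> A" "b \<in> B" "h = a \<otimes> b" by blast
    then show ?case using A(1) B(1)
      by - (rule exI[of _ "1::nat"], rule exI[of _ "\<lambda>_. a"], rule exI[of _ "\<lambda>_. b"], auto simp: lessThan_Suc subset_iff)
  next
    case (inv h)
    then obtain a b where ab: "a \<in> A" "b \<in> B" "h = a \<otimes> b" by blast
    then have "inv\<^bsub>add_monoid R\<^esub> h = \<ominus> a \<otimes> b"
      using A(1) B(1) by (simp add: a_inv_def[symmetric] l_minus subset_iff)
    then show ?case using A(1,3) B(1) ab
      by - (rule exI[of _ "1::nat"], rule exI[of _ "\<lambda>_. \<ominus> a"], rule exI[of _ "\<lambda>_. b"], auto simp: lessThan_Suc subset_iff)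
  next
    case (eng x y)
    from eng.IH(1) obtain n :: nat and a b where 1: "\<And>i. a i \<in> A" "\<And>i. b i \<in> B" "x = (\<Oplus>i\<in>{..<n}. a i \<otimes> b i)" by blast
    from eng.IH(2) obtain m :: nat and c d where 2: "\<And>i. c i \<in> A" "\<And>i. d i \<in> B" "y = (\<Oplus>i\<in>{..<m}. c i \<otimes> d i)" by blast
    define e where "e i = (if i < n then a i else c (i - n))" for i
    define f where "f i = (if i < n then b i else d (i - n))" for i
    have ef: "e i \<in> A" "f i \<in> B" for i using 1 2 by (auto simp: e_def f_def)
    have "(\<Oplus>i\<in>{..<n + m}. e i \<otimes> f i) = (\<Oplus>i\<in>{..<n}. e i \<otimes> f i) \<oplus> (\<Oplus>i\<in>{..<m}. e (n + i) \<otimes> f (n + i))"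
      by (rule finsum_lessThan_add) (rule m_closed[OF subsetD[OF A(1) ef(1)] subsetD[OF B(1) ef(2)]])
    also have "(\<Oplus>i\<in>{..<n}. e i \<otimes> f i) = x"
      unfolding 1(3) by (rule finsum_cong'[OF refl]) (use 1(1,2) A(1) B(1) in \<open>auto simp: e_def f_def intro!: m_closed\<close>)
    also have "(\<Oplus>i\<in>{..<m}. e (n + i) \<otimes> f (n + i)) = y"
      unfolding 2(3) by (rule finsum_cong'[OF refl]) (use 2(1,2) A(1) B(1) in \<open>auto simp: e_def f_def intro!: m_closed\<close>)
    finally show ?case using ef
      by - (rule exI[of _ "n + m"], rule exI[of _ e], rule exI[of _ f], simp)
  qed
  then show ?thesis using that by blast
qed

section \<open>Dual families for a finite group of automorphisms\<close>

text \<open>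
  The function \<open>h \<mapsto> (h y - g y) / (y - g y)\<close> is \<open>1\<close> at the identity and \<open>0\<close> at \<open>g\<close>; a product of
  such functions is a finite sum of functions \<open>h \<mapsto> u (h v)\<close>.
\<close>

lemma (in field) dual_family_aux:
  assumes M: "subfield M R" and H: "finite H" "H \<subseteq> Aut R M K - {\<lambda>x\<in>M. x}"
  shows "\<exists>(n::nat) u v. (\<forall>i. u i \<in> M \<and> v i \<in> M) \<and> (\<Oplus>i\<in>{..<n}. u i \<otimes> v i) = \<one> \<and>
    (\<forall>g\<in>H. (\<Oplus>i\<in>{..<n}. u i \<otimes> g (v i)) = \<zero>)"
  using H
proof (induction H rule: finite_induct)
  case empty
  have "\<one> \<in> M" using subringE(3)[OF subfieldE(1)[OF M]] .
  then show ?case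
    by - (rule exI[of _ "1::nat"], rule exI[of _ "\<lambda>_. \<one>"], auto simp: lessThan_Suc)
next
  case (insert g H)
  have sM: "subring M R" by (rule subfieldE(1)[OF M])
  have MR: "\<And>x. x \<in> M \<Longrightarrow> x \<in> carrier R" using subfieldE(3)[OF M] by blast
  have "H \<subseteq> Aut R M K - {\<lambda>x\<in>M. x}" using insert.prems by blast
  from insert.IH[OF this] obtain n :: nat and u v where uv: "\<And>i. u i \<in> M" "\<And>i. v i \<in> M"
    and one: "(\<Oplus>i\<in>{..<n}. u i \<otimes> v i) = \<one>" and zero: "\<And>h. h \<in> H \<Longrightarrow> (\<Oplus>i\<in>{..<n}. u i \<otimes> h (v i)) = \<zero>"
    by blast
  have g: "g \<in> Aut R M K" "g \<noteq> (\<lambda>x\<in>M. x)" using insert.prems by auto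
  then obtain y where y: "y \<in> M" "g y \<noteq> y"
    using extensionalityI[OF AutD(1)[OF g(1)], of "\<lambda>x\<in>M. x"] by auto
  have gy: "g y \<in> M" by (rule AutD(5)[OF g(1) y(1)])
  define c where "c = inv (y \<ominus> g y)"
  define d where "d = \<ominus> (c \<otimes> g y)"
  have "y \<ominus> g y \<in> M" using y gy subringE(5,7)[OF sM] by (simp add: minus_eq)
  moreover have "y \<ominus> g y \<noteq> \<zero>" using y gy MR by auto
  ultimately have c: "c \<in> M" "c \<otimes> (y \<ominus> g y) = \<one>"
    using subfield_m_inv(1,3)[OF M, of "y \<ominus> g y"] by (auto simp: c_def)
  have d: "d \<in> M" using c gy subringE(5,6)[OF sM] by (simp add: d_def)
  \<comment> \<open>The old sum multiplied by \<open>c (h y) + d\<close>, the function that is 1 at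
    the identity and 0 at \<open>g\<close>, written again as a sum of products. The first
    \<open>n\<close> indices carry the term with \<open>h y\<close>, where \<open>y\<close> can
    enter \<open>v\<close> because \<open>h\<close> is multiplicative; the last \<open>n\<close>
    carry the constant term.\<close>
  define u' where "u' i = (if i < n then c \<otimes> u i else d \<otimes> u (i - n))" for i
  define v' where "v' i = (if i < n then v i \<otimes> y else v (i - n))" for i
  have uv': "u' i \<in> M" "v' i \<in> M" for i
    using uv c d y subringE(6)[OF sM] by (auto simp: u'_def v'_def)
  have key: "(\<Oplus>i\<in>{..<n + n}. u' i \<otimes> h (v' i)) = (\<Oplus>i\<in>{..<n}. u i \<otimes> h (v i)) \<otimes> (c \<otimes> h y \<oplus> d)"
    if hM: "\<And>x. x \<in> M \<Longrightarrow> h x \<in> M" and hm: "\<And>x y. x \<in> M \<Longrightarrow> y \<in> M \<Longrightarrow> h (x \<otimes> y) = h x \<otimes> h y" for h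
  proof -
    have cl: "u i \<otimes> h (v i) \<in> carrier R" "h (v i) \<in> carrier R" "u i \<in> carrier R" "h y \<in> carrier R"
      "c \<in> carrier R" "d \<in> carrier R" for i
      using uv hM y c d MR by auto
    have "(\<Oplus>i\<in>{..<n + n}. u' i \<otimes> h (v' i)) =
        (\<Oplus>i\<in>{..<n}. u' i \<otimes> h (v' i)) \<oplus> (\<Oplus>i\<in>{..<n}. u' (n + i) \<otimes> h (v' (n + i)))"
      by (rule finsum_lessThan_add) (use uv' hM MR in blast)
    also have "(\<Oplus>i\<in>{..<n}. u' i \<otimes> h (v' i)) = (\<Oplus>i\<in>{..<n}. (u i \<otimes> h (v i)) \<otimes> (c \<otimes> h y))"
    proof (rule finsum_cong'[OF refl])
      fix i assume "i \<in> {..<n}"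
      then have "u' i \<otimes> h (v' i) = (c \<otimes> u i) \<otimes> (h (v i) \<otimes> h y)"
        using hm[OF uv(2) y(1), of i] by (simp add: u'_def v'_def)
      also have "\<dots> = (u i \<otimes> h (v i)) \<otimes> (c \<otimes> h y)"
        using cl by (simp add: m_ac)
      finally show "u' i \<otimes> h (v' i) = (u i \<otimes> h (v i)) \<otimes> (c \<otimes> h y)" .
    qed (use cl in simp)
    also have "\<dots> = (\<Oplus>i\<in>{..<n}. u i \<otimes> h (v i)) \<otimes> (c \<otimes> h y)"
      by (rule finsum_ldistr[symmetric]) (use cl in simp_all)
    also have "(\<Oplus>i\<in>{..<n}. u' (n + i) \<otimes> h (v' (n + i))) = (\<Oplus>i\<in>{..<n}. (u i \<otimes> h (v i)) \<otimes> d)"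
      by (rule finsum_cong'[OF refl]) (use cl in \<open>simp_all add: u'_def v'_def m_ac\<close>)
    also have "\<dots> = (\<Oplus>i\<in>{..<n}. u i \<otimes> h (v i)) \<otimes> d"
      by (rule finsum_ldistr[symmetric]) (use cl in simp_all)
    also have "(\<Oplus>i\<in>{..<n}. u i \<otimes> h (v i)) \<otimes> (c \<otimes> h y) \<oplus> (\<Oplus>i\<in>{..<n}. u i \<otimes> h (v i)) \<otimes> d =
        (\<Oplus>i\<in>{..<n}. u i \<otimes> h (v i)) \<otimes> (c \<otimes> h y \<oplus> d)"
      by (rule r_distr[symmetric]) (use cl in simp_all)
    finally show ?thesis .
  qed
  have cR: "c \<in> carrier R" and yR: "y \<in> carrier R" and gyR: "g y \<in> carrier R" using c y gy MR by auto
  have cy: "c \<otimes> y \<oplus> d = \<one>" and cg: "c \<otimes> g y \<oplus> d = \<zero>"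
    using c(2) cR yR gyR by (simp_all add: d_def minus_eq r_distr r_minus r_neg)
  have "(\<Oplus>i\<in>{..<n + n}. u' i \<otimes> v' i) = \<one>"
    using key[of "\<lambda>x. x"] one cy by simp
  moreover have "(\<Oplus>i\<in>{..<n + n}. u' i \<otimes> h (v' i)) = \<zero>" if "h \<in> insert g H" for h
  proof -
    have h: "h \<in> Aut R M K" using that insert.prems by auto
    have cl: "(\<Oplus>i\<in>{..<n}. u i \<otimes> h (v i)) \<in> carrier R" "c \<otimes> h y \<oplus> d \<in> carrier R"
      using uv AutD(5)[OF h] MR y c d by simp_all
    have "h = g \<or> (\<Oplus>i\<in>{..<n}. u i \<otimes> h (v i)) = \<zero>" using that zero by auto
    then have "(\<Oplus>i\<in>{..<n}. u i \<otimes> h (v i)) \<otimes> (c \<otimes> h y \<oplus> d) = \<zero>"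
      using cg cl by auto
    moreover have "(\<Oplus>i\<in>{..<n + n}. u' i \<otimes> h (v' i)) = (\<Oplus>i\<in>{..<n}. u i \<otimes> h (v i)) \<otimes> (c \<otimes> h y \<oplus> d)"
      by (rule key) (rule AutD(5)[OF h], assumption, rule AutD(7)[OF h])
    ultimately show ?thesis by (simp only:)
  qed
  ultimately show ?case
    by (intro exI[where x = "n + n"] exI[where x = u'] exI[where x = v'] conjI allI ballI uv')
qed

text \<open>These are Galois coordinates in the sense of Chase, Harrison and Rosenberg. The identity
  is a restricted function because automorphisms are extensional.\<close>

definition (in ring) dual_family :: "'a set \<Rightarrow> 'a set \<Rightarrow> nat \<Rightarrow> (nat \<Rightarrow> 'a) \<Rightarrow> (nat \<Rightarrow> 'a) \<Rightarrow> bool"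
  where "dual_family M K n u v \<longleftrightarrow> (\<forall>i. u i \<in> M \<and> v i \<in> M) \<and>
    (\<forall>g\<in>Aut R M K. (\<Oplus>i\<in>{..<n}. u i \<otimes> g (v i)) = (if g = (\<lambda>x\<in>M. x) then \<one> else \<zero>))"

lemma (in field) exists_dual_family:
  assumes M: "subfield M R" "K \<subseteq> M" and finA: "finite (Aut R M K)"
  obtains n u v where "dual_family M K n u v"
proof -
  obtain n :: nat and u v where uv: "\<forall>i. u i \<in> M \<and> v i \<in> M" "(\<Oplus>i\<in>{..<n}. u i \<otimes> v i) = \<one>"
    "\<forall>g\<in>Aut R M K - {\<lambda>x\<in>M. x}. (\<Oplus>i\<in>{..<n}. u i \<otimes> g (v i)) = \<zero>"
    using dual_family_aux[OF M(1) finite_Diff[OF finA] subset_refl] by blast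
  have "dual_family M K n u v" unfolding dual_family_def using uv by auto
  then show ?thesis by (rule that)
qed

text \<open>The sum runs over the automorphism group, and its values lie in the fixed field. Unlike
  the field trace over \<open>K\<close>, which is identically zero for an inseparable extension, it
  takes the value 1 on the whole normal extension; see \<open>exists_trace_one\<close>.\<close>

definition (in ring) trace_on :: "'a set \<Rightarrow> 'a set \<Rightarrow> 'a \<Rightarrow> 'a"
  where "trace_on M K x = (\<Oplus>g\<in>Aut R M K. g x)"

lemma (in field) trace_on_in:
  assumes M: "subfield M R" and x: "x \<in> M" shows "trace_on M K x \<in> M"
  unfolding trace_on_def
  using finsum_in_subgroup[OF subring.axioms(1)[OF subfieldE(1)[OF M]]] AutD(5) x by metis

lemma (in field) trace_on_fixed:
  assumes M: "subfield M R" "K \<subseteq> M" and finA: "finite (Aut R M K)" and x: "x \<in> M"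
  shows "trace_on M K x \<in> fixed_by M (Aut R M K)"
  unfolding fixed_by_def
proof (intro CollectI conjI ballI)
  have sM: "subring M R" by (rule subfieldE(1)[OF M(1)])
  have MR: "\<And>x. x \<in> M \<Longrightarrow> x \<in> carrier R" using subfieldE(3)[OF M(1)] by blast
  show "trace_on M K x \<in> M" by (rule trace_on_in[OF M(1) x])
  fix h assume h: "h \<in> Aut R M K"
  have sum: "h (\<Oplus>g\<in>B. g x) = (\<Oplus>g\<in>B. h (g x)) \<and> (\<Oplus>g\<in>B. g x) \<in> M"
    if "finite B" "B \<subseteq> Aut R M K" for B
    using that
  proof (induction B rule: finite_induct)
    case empty
    then show ?case using Aut_zero_minus(1)[OF h sM] subringE(2)[OF sM] by simp
  next
    case (insert g B)
    have "g \<in> Aut R M K" using insert.prems by blast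
    then have gx: "g x \<in> M" "h (g x) \<in> M" by (rule AutD(5)[OF _ x], rule AutD(5)[OF h AutD(5)[OF _ x]])
    have "\<And>k. k \<in> B \<Longrightarrow> k x \<in> M \<and> h (k x) \<in> M" using insert.prems AutD(5)[OF _ x] AutD(5)[OF h] by blast
    then have cl: "(\<lambda>k. k x) \<in> B \<rightarrow> carrier R" "(\<lambda>k. h (k x)) \<in> B \<rightarrow> carrier R" using MR by blast+
    have IH: "h (\<Oplus>g\<in>B. g x) = (\<Oplus>g\<in>B. h (g x))" "(\<Oplus>g\<in>B. g x) \<in> M" using insert by auto
    have eq: "(\<Oplus>k\<in>insert g B. k x) = g x \<oplus> (\<Oplus>k\<in>B. k x)"
      by (intro finsum_insert insert.hyps cl) (use MR[OF gx(1)] in simp)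
    have "(\<Oplus>k\<in>insert g B. h (k x)) = h (g x) \<oplus> (\<Oplus>k\<in>B. h (k x))"
      by (intro finsum_insert insert.hyps cl) (use MR[OF gx(2)] in simp)
    then show ?case unfolding eq using IH AutD(6)[OF h gx(1) IH(2)] subringE(7)[OF sM gx(1) IH(2)] by simp
  qed
  have inj: "inj_on (compose M h) (Aut R M K)"
  proof (rule inj_onI)
    fix a b assume a: "a \<in> Aut R M K" and b: "b \<in> Aut R M K" and eq: "compose M h a = compose M h b"
    show "a = b"
    proof (rule extensionalityI[OF AutD(1)[OF a] AutD(1)[OF b]])
      fix z assume z: "z \<in> M"
      then have "h (a z) = h (b z)" using fun_cong[OF eq, of z] by (simp add: compose_def)
      then show "a z = b z"
        using AutD(3)[OF h] AutD(5)[OF a z] AutD(5)[OF b z] by (auto simp: bij_betw_def inj_on_def)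
    qed
  qed
  have img: "compose M h ` Aut R M K = Aut R M K"
    by (rule endo_inj_surj[OF finA _ inj]) (use Aut_compose[OF sM M(2) h] in blast)
  have "h (trace_on M K x) = (\<Oplus>g\<in>Aut R M K. compose M h g x)"
    using sum[OF finA subset_refl] x by (simp add: trace_on_def compose_def)
  also have "\<dots> = (\<Oplus>g\<in>compose M h ` Aut R M K. g x)"
  proof (rule finsum_reindex[OF _ inj, symmetric])
    show "(\<lambda>g. g x) \<in> compose M h ` Aut R M K \<rightarrow> carrier R"
      unfolding img by (rule funcsetI) (rule MR[OF AutD(5)[OF _ x]])
  qed
  finally show "h (trace_on M K x) = trace_on M K x" by (simp add: img trace_on_def)
qed

lemma (in field) trace_on_linear:
  assumes M: "subfield M R" and finA: "finite (Aut R M K)"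
  shows "x \<in> M \<Longrightarrow> y \<in> M \<Longrightarrow> trace_on M K (x \<oplus> y) = trace_on M K x \<oplus> trace_on M K y"
    and "c \<in> fixed_by M (Aut R M K) \<Longrightarrow> x \<in> M \<Longrightarrow> trace_on M K (c \<otimes> x) = c \<otimes> trace_on M K x"
proof -
  have MR: "\<And>x. x \<in> M \<Longrightarrow> x \<in> carrier R" using subfieldE(3)[OF M] by blast
  have gR: "g x \<in> carrier R" if "g \<in> Aut R M K" "x \<in> M" for g x using that AutD(5) MR by metis
  show "trace_on M K (x \<oplus> y) = trace_on M K x \<oplus> trace_on M K y" if "x \<in> M" "y \<in> M"
    unfolding trace_on_def
  proof -
    have "(\<Oplus>g\<in>Aut R M K. g (x \<oplus> y)) = (\<Oplus>g\<in>Aut R M K. g x \<oplus> g y)"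
      by (rule finsum_cong'[OF refl]) (use that gR AutD(6)[OF _ that] in auto)
    also have "\<dots> = (\<Oplus>g\<in>Aut R M K. g x) \<oplus> (\<Oplus>g\<in>Aut R M K. g y)"
      by (rule finsum_addf) (use that gR in auto)
    finally show "(\<Oplus>g\<in>Aut R M K. g (x \<oplus> y)) = (\<Oplus>g\<in>Aut R M K. g x) \<oplus> (\<Oplus>g\<in>Aut R M K. g y)" .
  qed
  show "trace_on M K (c \<otimes> x) = c \<otimes> trace_on M K x" if c: "c \<in> fixed_by M (Aut R M K)" and x: "x \<in> M"
  proof -
    have cM: "c \<in> M" and gc: "\<And>g. g \<in> Aut R M K \<Longrightarrow> g c = c" using c by (auto simp: fixed_by_def)
    have "trace_on M K (c \<otimes> x) = (\<Oplus>g\<in>Aut R M K. c \<otimes> g x)"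
      unfolding trace_on_def
    proof (rule finsum_cong'[OF refl])
      fix g assume g: "g \<in> Aut R M K"
      show "g (c \<otimes> x) = c \<otimes> g x" unfolding AutD(7)[OF g cM x] gc[OF g] ..
    qed (use gR x cM MR in auto)
    also have "\<dots> = c \<otimes> trace_on M K x"
      unfolding trace_on_def using gR x cM MR finA by (intro finsum_rdistr[symmetric]) auto
    finally show ?thesis .
  qed
qed

text \<open>After an interchange of sums, \<open>g x\<close> has the coefficient
  \<open>\<Sum> u\<^sub>i g(v\<^sub>i)\<close>, which is 1 at the identity and 0 elsewhere.\<close>

lemma (in field) dual_family_expansion:
  assumes M: "subfield M R" "K \<subseteq> M" and finA: "finite (Aut R M K)" and uv: "dual_family M K n u v" and x: "x \<in> M"
  shows "x = (\<Oplus>i\<in>{..<n}. u i \<otimes> trace_on M K (v i \<otimes> x))"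
proof -
  have sM: "subring M R" by (rule subfieldE(1)[OF M(1)])
  have MR: "\<And>x. x \<in> M \<Longrightarrow> x \<in> carrier R" using subfieldE(3)[OF M(1)] by blast
  have gR: "g x \<in> carrier R" if "g \<in> Aut R M K" "x \<in> M" for g x using that AutD(5) MR by metis
  have u: "\<And>i. u i \<in> M" and v: "\<And>i. v i \<in> M" using uv by (auto simp: dual_family_def)
  let ?id = "\<lambda>x\<in>M. x"
  have id: "?id \<in> Aut R M K" using Aut_id[OF M(2)] subringE(3,6,7)[OF sM] by metis
  have "(\<Oplus>i\<in>{..<n}. u i \<otimes> trace_on M K (v i \<otimes> x)) = (\<Oplus>i\<in>{..<n}. \<Oplus>g\<in>Aut R M K. u i \<otimes> g (v i) \<otimes> g x)"
  proof (rule finsum_cong'[OF refl])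
    fix i
    have cl: "(\<lambda>g. g (v i) \<otimes> g x) \<in> Aut R M K \<rightarrow> carrier R"
      by (rule funcsetI) (rule m_closed[OF gR[OF _ v] gR[OF _ x]])
    have "trace_on M K (v i \<otimes> x) = (\<Oplus>g\<in>Aut R M K. g (v i) \<otimes> g x)"
      unfolding trace_on_def by (rule finsum_cong'[OF refl cl]) (rule AutD(7)[OF _ v x])
    then have "u i \<otimes> trace_on M K (v i \<otimes> x) = (\<Oplus>g\<in>Aut R M K. u i \<otimes> (g (v i) \<otimes> g x))"
      using finsum_rdistr[OF finA MR[OF u] cl] by simp
    also have "\<dots> = (\<Oplus>g\<in>Aut R M K. u i \<otimes> g (v i) \<otimes> g x)"
      by (rule finsum_cong'[OF refl]) (use gR[OF _ v] gR[OF _ x] u[THEN MR] in \<open>auto simp: m_assoc\<close>)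
    finally show "u i \<otimes> trace_on M K (v i \<otimes> x) = (\<Oplus>g\<in>Aut R M K. u i \<otimes> g (v i) \<otimes> g x)" .
  next
    show "(\<lambda>i. \<Oplus>g\<in>Aut R M K. u i \<otimes> g (v i) \<otimes> g x) \<in> {..<n} \<rightarrow> carrier R"
      by (intro funcsetI finsum_closed m_closed) (use gR[OF _ v] gR[OF _ x] u[THEN MR] in auto)
  qed
  also have "\<dots> = (\<Oplus>g\<in>Aut R M K. \<Oplus>i\<in>{..<n}. u i \<otimes> g (v i) \<otimes> g x)"
    by (rule finsum_swap) (use finA gR[OF _ v] gR[OF _ x] u[THEN MR] in auto)
  also have "\<dots> = (\<Oplus>g\<in>Aut R M K. if ?id = g then x else \<zero>)"
  proof (rule finsum_cong'[OF refl])
    fix g assume g: "g \<in> Aut R M K"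
    have "(\<Oplus>i\<in>{..<n}. u i \<otimes> g (v i) \<otimes> g x) = (\<Oplus>i\<in>{..<n}. u i \<otimes> g (v i)) \<otimes> g x"
      using gR[OF g] v x u[THEN MR] by (intro finsum_ldistr[symmetric]) auto
    also have "(\<Oplus>i\<in>{..<n}. u i \<otimes> g (v i)) = (if g = ?id then \<one> else \<zero>)"
      using uv g by (auto simp: dual_family_def)
    finally show "(\<Oplus>i\<in>{..<n}. u i \<otimes> g (v i) \<otimes> g x) = (if ?id = g then x else \<zero>)"
      using gR[OF g x] x by auto
  qed (use x MR in auto)
  also have "\<dots> = x"
    using finsum_singleton[OF id finA, of "\<lambda>_. x"] x MR by simp
  finally show ?thesis ..
qed

lemma (in cring) frobenius_sum:
  fixes p :: nat
  assumes "Factorial_Ring.prime p" "add_pow R p \<one> = \<zero>" and f: "\<And>i. i \<in> A \<Longrightarrow> f i \<in> carrier R" and fin: "finite A"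
  shows "(\<Oplus>i\<in>A. f i) [^] (p ^ n) = (\<Oplus>i\<in>A. f i [^] (p ^ n))"
  using fin f
proof (induction A rule: finite_induct)
  case empty
  have "p ^ n \<noteq> 0" using prime_gt_0_nat[OF assms(1)] by simp
  then have "\<zero> [^] (p ^ n) = \<zero>" by (rule nat_pow_zero)
  then show ?case by simp
next
  case (insert a A)
  have fa: "f a \<in> carrier R" and fA: "f \<in> A \<rightarrow> carrier R" using insert.prems by auto
  have fp: "(\<lambda>i. f i [^] (p ^ n)) \<in> A \<rightarrow> carrier R" using fA by auto
  have "(\<Oplus>i\<in>insert a A. f i) [^] (p ^ n) = (f a \<oplus> (\<Oplus>i\<in>A. f i)) [^] (p ^ n)"
    unfolding finsum_insert[OF insert.hyps fA fa] ..
  also have "\<dots> = f a [^] (p ^ n) \<oplus> (\<Oplus>i\<in>A. f i) [^] (p ^ n)"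
    by (rule frobenius_add[OF assms(1,2) fa finsum_closed[OF fA]])
  also have "(\<Oplus>i\<in>A. f i) [^] (p ^ n) = (\<Oplus>i\<in>A. f i [^] (p ^ n))"
    by (rule insert.IH) (use insert.prems in blast)
  also have "f a [^] (p ^ n) \<oplus> \<dots> = (\<Oplus>i\<in>insert a A. f i [^] (p ^ n))"
    by (intro finsum_insert[symmetric] insert.hyps fp) (use fa in simp)
  finally show ?case .
qed

text \<open>Frobenius is additive, commutes with automorphisms, and fixes the values 0 and 1. Powers
  thus move the family into a smaller subfield and keep the expansion formula.\<close>

lemma (in field) dual_family_power:
  fixes p :: nat
  assumes p: "Factorial_Ring.prime p" "add_pow R p \<one> = \<zero>" and M: "subfield M R" "K \<subseteq> M" and uv: "dual_family M K n u v"
  shows "dual_family M K n (\<lambda>i. u i [^] (p ^ k)) (\<lambda>i. v i [^] (p ^ k))"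
  unfolding dual_family_def
proof (intro conjI allI ballI)
  have sM: "subring M R" by (rule subfieldE(1)[OF M(1)])
  have MR: "\<And>x. x \<in> M \<Longrightarrow> x \<in> carrier R" using subfieldE(3)[OF M(1)] by blast
  have u: "\<And>i. u i \<in> M" and v: "\<And>i. v i \<in> M" using uv by (auto simp: dual_family_def)
  have pow: "x [^] (j::nat) \<in> M" if "x \<in> M" for x j
    by (induction j) (use that subringE(3,6)[OF sM] in auto)
  show "u i [^] (p ^ k) \<in> M" "v i [^] (p ^ k) \<in> M" for i by (rule pow[OF u], rule pow[OF v])
  fix g assume g: "g \<in> Aut R M K"
  have gv: "g (v i) \<in> carrier R" "u i \<in> carrier R" for i using AutD(5)[OF g v] u MR by auto
  have "(\<Oplus>i\<in>{..<n}. u i [^] (p ^ k) \<otimes> g (v i [^] (p ^ k))) = (\<Oplus>i\<in>{..<n}. (u i \<otimes> g (v i)) [^] (p ^ k))"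
    by (rule finsum_cong'[OF refl]) (use gv in \<open>simp_all add: Aut_pow[OF g sM v] nat_pow_distrib\<close>)
  also have "\<dots> = (\<Oplus>i\<in>{..<n}. u i \<otimes> g (v i)) [^] (p ^ k)"
    by (rule frobenius_sum[OF p, symmetric]) (use gv in simp_all)
  also have "(\<Oplus>i\<in>{..<n}. u i \<otimes> g (v i)) = (if g = (\<lambda>x\<in>M. x) then \<one> else \<zero>)"
    using uv g unfolding dual_family_def by blast
  also have "(if g = (\<lambda>x\<in>M. x) then \<one> else \<zero>) [^] (p ^ k) = (if g = (\<lambda>x\<in>M. x) then \<one> else \<zero>)"
    using nat_pow_zero[of "p ^ k"] prime_gt_0_nat[OF p(1)] by simp
  finally show "(\<Oplus>i\<in>{..<n}. u i [^] (p ^ k) \<otimes> g (v i [^] (p ^ k))) = (if g = (\<lambda>x\<in>M. x) then \<one> else \<zero>)" .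
qed

section \<open>Linear operators, products of commuting subsets, fixed fields\<close>

lemma EndD:
  assumes "f \<in> End R P M"
  shows "\<And>x. x \<in> P \<Longrightarrow> f x \<in> P" "f \<in> extensional P"
    "\<And>x y. x \<in> P \<Longrightarrow> y \<in> P \<Longrightarrow> f (x \<oplus>\<^bsub>R\<^esub> y) = f x \<oplus>\<^bsub>R\<^esub> f y"
    "\<And>m x. m \<in> M \<Longrightarrow> x \<in> P \<Longrightarrow> f (m \<otimes>\<^bsub>R\<^esub> x) = m \<otimes>\<^bsub>R\<^esub> f x"
  using assms unfolding End_def by (auto simp: PiE_def)

lemma EndI:
  assumes "\<And>x. x \<in> P \<Longrightarrow> f x \<in> P" "f \<in> extensional P"
    "\<And>x y. x \<in> P \<Longrightarrow> y \<in> P \<Longrightarrow> f (x \<oplus>\<^bsub>R\<^esub> y) = f x \<oplus>\<^bsub>R\<^esub> f y"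
    "\<And>m x. m \<in> M \<Longrightarrow> x \<in> P \<Longrightarrow> f (m \<otimes>\<^bsub>R\<^esub> x) = m \<otimes>\<^bsub>R\<^esub> f x"
  shows "f \<in> End R P M"
  using assms unfolding End_def by (simp add: PiE_def)

lemma End_mono: "M \<subseteq> M' \<Longrightarrow> End R P M' \<subseteq> End R P M"
  unfolding End_def by blast

lemma (in ring) End_zero:
  assumes f: "f \<in> End R P M" and P: "subgroup P (add_monoid R)" shows "f \<zero> = \<zero>"
proof -
  have PR: "P \<subseteq> carrier R" using subgroup.subset[OF P] by simp
  have 0: "\<zero> \<in> P" using subgroup.one_closed[OF P] by simp
  have "f \<zero> \<oplus> f \<zero> = f \<zero>" using EndD(3)[OF f 0 0] by simp
  then show ?thesis using EndD(1)[OF f 0] PR by (metis add.r_cancel_one' subsetD)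
qed

lemma (in ring) End_sum:
  assumes f: "f \<in> End R P M" and P: "subgroup P (add_monoid R)" and h: "\<And>i. i \<in> I \<Longrightarrow> h i \<in> P"
    and fin: "finite I"
  shows "f (\<Oplus>i\<in>I. h i) = (\<Oplus>i\<in>I. f (h i))"
proof -
  have PR: "P \<subseteq> carrier R" using subgroup.subset[OF P] by simp
  show ?thesis
    using fin h
  proof (induction I rule: finite_induct)
    case empty
    then show ?case using End_zero[OF f P] by simp
  next
    case (insert i I)
    have hi: "h i \<in> P" "f (h i) \<in> P" and hI: "\<And>j. j \<in> I \<Longrightarrow> h j \<in> P" using insert.prems EndD(1)[OF f] by auto
    have cl: "h \<in> I \<rightarrow> carrier R" "(\<lambda>j. f (h j)) \<in> I \<rightarrow> carrier R" using hI EndD(1)[OF f] PR by blast+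
    have "f (\<Oplus>j\<in>insert i I. h j) = f (h i \<oplus> (\<Oplus>j\<in>I. h j))"
      using finsum_insert[OF insert.hyps cl(1)] hi PR by (simp add: subset_iff)
    also have "\<dots> = f (h i) \<oplus> f (\<Oplus>j\<in>I. h j)"
      by (rule EndD(3)[OF f hi(1) finsum_in_subgroup[OF P hI]])
    also have "\<dots> = f (h i) \<oplus> (\<Oplus>j\<in>I. f (h j))" using insert.IH[OF hI] by simp
    also have "\<dots> = (\<Oplus>j\<in>insert i I. f (h j))"
      using finsum_insert[OF insert.hyps cl(2)] hi PR by (simp add: subset_iff)
    finally show ?case .
  qed
qed

text \<open>The two factors commute with each other, so \<open>(a b)(c d) = (a c)(b d)\<close>. The
  elements whose product with a given one stays in the span form an additive subgroup, which reduces
  both sides to generators.\<close>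

lemma (in ring) prod_span_mult_closed:
  assumes A: "A \<subseteq> carrier R" "\<And>a a'. a \<in> A \<Longrightarrow> a' \<in> A \<Longrightarrow> a \<otimes> a' \<in> A"
    and B: "B \<subseteq> carrier R" "\<And>b b'. b \<in> B \<Longrightarrow> b' \<in> B \<Longrightarrow> b \<otimes> b' \<in> B"
    and comm: "\<And>a b. a \<in> A \<Longrightarrow> b \<in> B \<Longrightarrow> a \<otimes> b = b \<otimes> a"
    and x: "x \<in> prod_span R A B" and y: "y \<in> prod_span R A B"
  shows "x \<otimes> y \<in> prod_span R A B"
proof -
  let ?P = "prod_span R A B"
  have P: "subgroup ?P (add_monoid R)" by (rule prod_span_subgroup[OF A(1) B(1)])
  have PR: "?P \<subseteq> carrier R" using subgroup.subset[OF P] by simp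
  have sgl: "subgroup {y \<in> carrier R. z \<otimes> y \<in> ?P} (add_monoid R)" if "z \<in> carrier R" for z
    using that subgroup.one_closed[OF P] subgroup.m_closed[OF P] subgroup.m_inv_closed[OF P]
    by (intro add.subgroupI) (auto simp: r_distr r_minus a_inv_def[symmetric])
  have sgr: "subgroup {y \<in> carrier R. y \<otimes> z \<in> ?P} (add_monoid R)" if "z \<in> carrier R" for z
    using that subgroup.one_closed[OF P] subgroup.m_closed[OF P] subgroup.m_inv_closed[OF P]
    by (intro add.subgroupI) (auto simp: l_distr l_minus a_inv_def[symmetric])
  have "a \<otimes> b \<otimes> y \<in> ?P" if ab: "a \<in> A" "b \<in> B" for a b
  proof -
    have abR: "a \<in> carrier R" "b \<in> carrier R" using ab A(1) B(1) by auto
    have "?P \<subseteq> {y \<in> carrier R. (a \<otimes> b) \<otimes> y \<in> ?P}"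
    proof (rule prod_span_subset[OF sgl])
      show "a \<otimes> b \<in> carrier R" using abR by simp
      fix c d assume cd: "c \<in> A" "d \<in> B"
      then have cdR: "c \<in> carrier R" "d \<in> carrier R" using A(1) B(1) by auto
      have "(a \<otimes> b) \<otimes> (c \<otimes> d) = a \<otimes> (b \<otimes> c) \<otimes> d" using abR cdR by (simp add: m_assoc)
      also have "b \<otimes> c = c \<otimes> b" using comm[OF cd(1) ab(2)] by simp
      also have "a \<otimes> (c \<otimes> b) \<otimes> d = (a \<otimes> c) \<otimes> (b \<otimes> d)" using abR cdR by (simp add: m_assoc)
      also have "\<dots> \<in> ?P" using A(2)[OF ab(1) cd(1)] B(2)[OF ab(2) cd(2)] by (rule prod_in_prod_span)
      finally show "c \<otimes> d \<in> {y \<in> carrier R. (a \<otimes> b) \<otimes> y \<in> ?P}" using cdR by simp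
    qed
    then show ?thesis using y by blast
  qed
  moreover have yR: "y \<in> carrier R" using y PR by blast
  ultimately have "?P \<subseteq> {x \<in> carrier R. x \<otimes> y \<in> ?P}"
    using A(1) B(1) by (intro prod_span_subset[OF sgr[OF yR]]) auto
  then show ?thesis using x by blast
qed

lemma (in field) subfield_inter:
  assumes "subfield M R" "subfield N R" shows "subfield (M \<inter> N) R"
proof (rule subfieldI')
  show "subring (M \<inter> N) R" by (rule subring_inter[OF subfieldE(1)[OF assms(1)] subfieldE(1)[OF assms(2)]])
qed (use subfield_m_inv(1)[OF assms(1)] subfield_m_inv(1)[OF assms(2)] in blast)

lemma (in field) fixed_subfield:
  assumes M: "subfield M R" and H: "H \<subseteq> Aut R M K"
  shows "subfield (fixed_by M H) R"
proof (rule subfieldI')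
  have sM: "subring M R" by (rule subfieldE(1)[OF M])
  have MR: "M \<subseteq> carrier R" by (rule subfieldE(3)[OF M])
  have hA: "h \<in> Aut R M K" if "h \<in> H" for h using that H by blast
  show "subring (fixed_by M H) R"
  proof (rule subringI)
    show "fixed_by M H \<subseteq> carrier R" using MR by (auto simp: fixed_by_def)
    show "\<one> \<in> fixed_by M H" using AutD(8)[OF hA] subringE(3)[OF sM] by (simp add: fixed_by_def)
    fix x assume x: "x \<in> fixed_by M H"
    show "\<ominus> x \<in> fixed_by M H"
      using x subringE(5)[OF sM] by (auto simp: fixed_by_def Aut_zero_minus(2)[OF hA sM])
    fix y assume y: "y \<in> fixed_by M H"
    have fx: "x \<in> M" "\<And>h. h \<in> H \<Longrightarrow> h x = x" and fy: "y \<in> M" "\<And>h. h \<in> H \<Longrightarrow> h y = y"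
      using x y by (auto simp: fixed_by_def)
    have "h (x \<otimes> y) = x \<otimes> y" "h (x \<oplus> y) = x \<oplus> y" if "h \<in> H" for h
      using AutD(6,7)[OF hA[OF that] fx(1) fy(1)] fx(2)[OF that] fy(2)[OF that] by simp_all
    then show "x \<otimes> y \<in> fixed_by M H" "x \<oplus> y \<in> fixed_by M H"
      using subringE(6,7)[OF sM fx(1) fy(1)] by (simp_all add: fixed_by_def)
  qed
  fix x assume x: "x \<in> fixed_by M H - {\<zero>}"
  then have xM: "x \<in> M - {\<zero>}" by (auto simp: fixed_by_def)
  have ix: "inv x \<in> M" "x \<otimes> inv x = \<one>" using subfield_m_inv[OF M xM] by auto
  have "h (inv x) = inv x" if h: "h \<in> H" for h
  proof -
    have "x \<otimes> h (inv x) = \<one>"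
      using AutD(7)[OF hA[OF h], of x "inv x"] AutD(8)[OF hA[OF h]] ix xM x h by (auto simp: fixed_by_def)
    then show ?thesis
      using comm_inv_char[of x "h (inv x)"] xM MR AutD(5)[OF hA[OF h] ix(1)] by (auto dest: sym)
  qed
  then show "inv x \<in> fixed_by M H" using ix by (simp add: fixed_by_def)
qed

lemma (in domain) pow_eq_zeroD:
  assumes "x \<in> carrier R" "x [^] (n::nat) = \<zero>" shows "x = \<zero>"
  using assms(2) by (induction n) (use assms(1) in \<open>auto simp: integral_iff\<close>)

section \<open>The fixed field, the separable closure and the trace\<close>

context normal_extension begin

abbreviation Tr where "Tr \<equiv> trace_on (carrier R) K"

lemma Fix_subfield: "subfield Fix R"
  by (rule fixed_subfield[OF carrier_is_subfield subset_refl])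

lemma K_Fix: "K \<subseteq> Fix"
proof
  fix x assume x: "x \<in> K"
  then have "x \<in> carrier R" using KR by blast
  moreover have "g x = x" if "g \<in> G" for g by (rule AutD(4)[OF that x])
  ultimately show "x \<in> Fix" by (simp add: fixed_by_def)
qed

lemma Fix_R: "x \<in> Fix \<Longrightarrow> x \<in> carrier R"
  by (simp add: fixed_by_def)

lemma pow_K: "x \<in> K \<Longrightarrow> x [^] (n::nat) \<in> K"
  by (induction n) (use subringE(3,6)[OF subfieldE(1)[OF K]] in auto)

lemma pow_K_mono:
  assumes "x \<in> carrier R" "x [^] (p ^ n) \<in> K" "n \<le> m" shows "x [^] (p ^ m) \<in> K"
proof -
  have "p ^ m = p ^ n * p ^ (m - n)" using assms(3) by (simp add: power_add[symmetric])
  then have "x [^] (p ^ m) = (x [^] (p ^ n)) [^] (p ^ (m - n))" using assms(1) by (simp add: nat_pow_pow)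
  then show ?thesis using pow_K[OF assms(2)] by simp
qed

text \<open>The fixed field has a finite spanning list over \<open>K\<close>. By additivity of
  Frobenius, the sum of the exponents of its members serves every combination with coefficients in
  \<open>K\<close>, since exponents may be enlarged.\<close>

lemma uniform_exponent: "\<exists>n. \<forall>x\<in>Fix. x [^] (p ^ n) \<in> K"
proof -
  have sF: "subring Fix R" by (rule subfieldE(1)[OF Fix_subfield])
  have sK: "subring K R" by (rule subfieldE(1)[OF K])
  have "subalgebra K Fix R"
    using subring.axioms(1)[OF sF] subringE(6)[OF sF] K_Fix
    by (intro subalgebra.intro) (auto simp: subalgebra_axioms_def)
  then have "finite_dimension K Fix"
    by (rule subalbegra_incl_imp_finite_dimension[OF K fin]) (use Fix_R in blast)
  then obtain n Us where Us: "set Us \<subseteq> carrier R" "Span K Us = Fix"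
    using exists_base[OF K] by (metis finite_dimensionE')
  have "set Us \<subseteq> Fix" using Span_base_incl[OF K Us(1)] Us(2) by simp
  then have "\<exists>n. \<forall>Ks. set Ks \<subseteq> K \<longrightarrow> combine Ks Us [^] (p ^ n) \<in> K"
  proof (induction Us)
    case Nil
    have "combine Ks [] = \<zero>" for Ks by (cases Ks) auto
    then show ?case using subringE(2)[OF sK] by (auto intro!: exI[of _ "0::nat"])
  next
    case (Cons u Us)
    from Cons obtain n where n: "\<And>Ks. set Ks \<subseteq> K \<Longrightarrow> combine Ks Us [^] (p ^ n) \<in> K" by auto
    obtain m where m: "u [^] (p ^ m) \<in> K" using fixed_purely_inseparable Cons.prems by (metis list.set_intros(1) subsetD)
    have uR: "u \<in> carrier R" and UR: "set Us \<subseteq> carrier R" using Cons.prems Fix_R by auto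
    let ?N = "n + m"
    have "combine Ks (u # Us) [^] (p ^ ?N) \<in> K" if Ks: "set Ks \<subseteq> K" for Ks
    proof (cases Ks)
      case Nil
      have "\<zero> [^] (p ^ ?N) = \<zero>" using prime_gt_0_nat[OF p] by (intro nat_pow_zero) simp
      then show ?thesis using Nil subringE(2)[OF sK] by simp
    next
      case (Cons k Ks')
      then have k: "k \<in> K" "k \<in> carrier R" and Ks': "set Ks' \<subseteq> K" "set Ks' \<subseteq> carrier R" using Ks KR by auto
      have cR: "combine Ks' Us \<in> carrier R" using combine_in_carrier[OF Ks'(2) UR] .
      have "combine Ks (u # Us) [^] (p ^ ?N) = (k \<otimes> u) [^] (p ^ ?N) \<oplus> combine Ks' Us [^] (p ^ ?N)"
        using frobenius_add[OF p char, of "k \<otimes> u" "combine Ks' Us" ?N] k uR cR Cons by simp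
      also have "(k \<otimes> u) [^] (p ^ ?N) = k [^] (p ^ ?N) \<otimes> u [^] (p ^ ?N)"
        using k uR by (simp add: nat_pow_distrib)
      finally show ?thesis
        using pow_K[OF k(1)] pow_K_mono[OF uR m, of ?N] pow_K_mono[OF cR n[OF Ks'(1)], of ?N]
          subringE(6,7)[OF sK] by simp
    qed
    then show ?case by blast
  qed
  then obtain n where n: "\<And>Ks. set Ks \<subseteq> K \<Longrightarrow> combine Ks Us [^] (p ^ n) \<in> K" by blast
  have "x [^] (p ^ n) \<in> K" if "x \<in> Fix" for x
  proof -
    obtain Ks where "set Ks \<subseteq> K" "x = combine Ks Us"
      using Span_eq_combine_set[OF K Us(1)] \<open>x \<in> Fix\<close> unfolding Us(2) by blast
    then show ?thesis using n by simp
  qed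
  then show ?thesis by blast
qed

definition q where "q = p ^ (SOME n. \<forall>x\<in>Fix. x [^] (p ^ n) \<in> K)"

lemma q_Fix: "x \<in> Fix \<Longrightarrow> x [^] q \<in> K"
  using someI_ex[OF uniform_exponent] unfolding q_def by blast

lemma q_pow_closed: "subring M R \<Longrightarrow> x \<in> M \<Longrightarrow> x [^] (n::nat) \<in> M"
  by (induction n) (use subringE(3,6) in auto)

text \<open>The separable closure of \<open>K\<close>, as the field generated over \<open>K\<close> by the \<open>q\<close>-th powers.\<close>

definition S where "S = prod_span R K ((\<lambda>x. x [^] q) ` carrier R)"

text \<open>The \<open>q\<close>-th powers are closed under multiplication, so the span is a ring,
  and being algebraic over \<open>K\<close> it is a field. Automorphisms fix \<open>K\<close> and
  commute with powers, whence stability.\<close>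

lemma S_props:
  shows S_subfield: "subfield S R" and K_S: "K \<subseteq> S" and q_S: "\<And>x. x \<in> carrier R \<Longrightarrow> x [^] q \<in> S"
    and S_stable: "stable S"
proof -
  let ?B = "(\<lambda>x. x [^] q) ` carrier R"
  have BR: "?B \<subseteq> carrier R" by auto
  have P: "subgroup S (add_monoid R)" unfolding S_def by (rule prod_span_subgroup[OF KR BR])
  have SR: "S \<subseteq> carrier R" using subgroup.subset[OF P] by simp
  have 1: "\<one> \<in> ?B" by (rule image_eqI[of _ _ \<one>]) auto
  have oneK: "\<one> \<in> K" by (rule subringE(3)[OF subfieldE(1)[OF K]])
  show KS: "K \<subseteq> S"
  proof
    fix k assume k: "k \<in> K"
    then have "k \<otimes> \<one> \<in> S" unfolding S_def using 1 by (intro prod_in_prod_span)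
    then show "k \<in> S" using k KR by auto
  qed
  show qS: "x [^] q \<in> S" if "x \<in> carrier R" for x
    using prod_in_prod_span[OF oneK, of "x [^] q" ?B] that by (simp add: S_def)
  have mult: "x \<otimes> y \<in> S" if "x \<in> S" "y \<in> S" for x y
    using that unfolding S_def
  proof (rule prod_span_mult_closed[OF KR _ BR, rotated -2])
    show "b \<otimes> b' \<in> ?B" if "b \<in> ?B" "b' \<in> ?B" for b b'
    proof -
      obtain x y where "x \<in> carrier R" "y \<in> carrier R" "b = x [^] q" "b' = y [^] q" using \<open>b \<in> ?B\<close> \<open>b' \<in> ?B\<close> by blast
      then have "b \<otimes> b' = (x \<otimes> y) [^] q" "x \<otimes> y \<in> carrier R" by (simp_all add: nat_pow_distrib)
      then show ?thesis by blast
    qed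
  qed (use subringE(6)[OF subfieldE(1)[OF K]] KR in \<open>auto intro!: m_comm\<close>)
  have "subring S R"
    using SR KS oneK mult subgroup.m_closed[OF P] subgroup.m_inv_closed[OF P]
    by (intro subringI) (auto simp: a_inv_def)
  then show "subfield S R"
    by (rule algebraic_subring_is_subfield[OF K _ KS]) (use alg SR in blast)
  show "stable S"
    unfolding stable_def
  proof (intro ballI)
    fix g x assume g: "g \<in> G" and x: "x \<in> S"
    have "subgroup {x \<in> carrier R. g x \<in> S} (add_monoid R)"
      using subgroup.one_closed[OF P] subgroup.m_closed[OF P] subgroup.m_inv_closed[OF P]
        Aut_zero_minus[OF g carrier_is_subring] AutD(6)[OF g]
      by (intro add.subgroupI) (auto simp: a_inv_def[symmetric])
    then have "S \<subseteq> {x \<in> carrier R. g x \<in> S}"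
      unfolding S_def
    proof (rule prod_span_subset[folded S_def])
      fix k b assume k: "k \<in> K" and b: "b \<in> ?B"
      then obtain y where y: "y \<in> carrier R" "b = y [^] q" by blast
      have kR: "k \<in> carrier R" using k KR by blast
      have "g (k \<otimes> b) = k \<otimes> (g y) [^] q"
        using AutD(7)[OF g kR] AutD(4)[OF g k] y Aut_pow[OF g carrier_is_subring y(1)] by simp
      also have "\<dots> \<in> S" unfolding S_def using k AutD(5)[OF g y(1)] by (intro prod_in_prod_span) auto
      finally show "k \<otimes> b \<in> {x \<in> carrier R. g x \<in> prod_span R K ?B}" using kR y by (simp add: S_def)
    qed
    then show "g x \<in> S" using x by blast
  qed
qed

lemma S_R: "x \<in> S \<Longrightarrow> x \<in> carrier R"
  using subfieldE(3)[OF S_subfield] by blast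

lemma Tr_Fix: "x \<in> carrier R \<Longrightarrow> Tr x \<in> Fix"
  by (rule trace_on_fixed[OF carrier_is_subfield KR finite_G])

lemmas Tr_add = trace_on_linear(1)[OF carrier_is_subfield finite_G]
  and Tr_mult = trace_on_linear(2)[OF carrier_is_subfield finite_G]

lemma Tr_pow: "x \<in> carrier R \<Longrightarrow> Tr (x [^] q) = (Tr x) [^] q"
proof -
  assume x: "x \<in> carrier R"
  have gx: "g x \<in> carrier R" if "g \<in> G" for g using AutD(5)[OF that x] .
  have "Tr (x [^] q) = (\<Oplus>g\<in>G. g x [^] q)"
    unfolding trace_on_def
    by (rule finsum_cong'[OF refl]) (use gx Aut_pow[OF _ carrier_is_subring x] in auto)
  also have "\<dots> = (Tr x) [^] q"
    unfolding trace_on_def q_def by (rule frobenius_sum[OF p char gx finite_G, symmetric])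
  finally show ?thesis .
qed

text \<open>If every \<open>Tr (v i)\<close> vanished, the expansion of \<open>\<one>\<close> would
  give \<open>\<one> = \<zero>\<close>. A nonzero value is a fixed element, so it can be scaled to 1
  inside the trace.\<close>

lemma exists_trace_one: obtains t where "t \<in> carrier R" "Tr t = \<one>"
proof -
  obtain n u v where uv: "dual_family (carrier R) K n u v"
    using exists_dual_family[OF carrier_is_subfield KR finite_G] .
  have uR: "\<And>i. u i \<in> carrier R" and vR: "\<And>i. v i \<in> carrier R" using uv by (auto simp: dual_family_def)
  have "\<exists>i. Tr (v i) \<noteq> \<zero>"
  proof (rule ccontr)
    assume "\<nexists>i. Tr (v i) \<noteq> \<zero>"
    then have "(\<Oplus>i\<in>{..<n}. u i \<otimes> Tr (v i \<otimes> \<one>)) = (\<Oplus>i\<in>{..<n}. \<zero>)"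
      using uR vR by (intro finsum_cong') auto
    then show False using dual_family_expansion[OF carrier_is_subfield KR finite_G uv one_closed] by simp
  qed
  then obtain i where i: "Tr (v i) \<in> Fix - {\<zero>}" using Tr_Fix[OF vR] by blast
  note inv = subfield_m_inv[OF Fix_subfield i]
  have "Tr (inv (Tr (v i)) \<otimes> v i) = \<one>" using Tr_mult[of "inv (Tr (v i))" "v i"] inv vR by auto
  moreover have "inv (Tr (v i)) \<otimes> v i \<in> carrier R" using inv(1) Fix_R vR by auto
  ultimately show ?thesis using that by blast
qed

text \<open>If \<open>Tr t = 1\<close> then \<open>s = s (Tr t)\<^sup>q = Tr (s t\<^sup>q)\<close> for \<open>s\<close> fixed, and \<open>Tr (k x\<^sup>q t\<^sup>q) = k (Tr (x t))\<^sup>q\<close>.\<close>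

lemma S_Fix: "S \<inter> Fix \<subseteq> K"
proof
  fix s assume s: "s \<in> S \<inter> Fix"
  obtain t where t: "t \<in> carrier R" "Tr t = \<one>" by (rule exists_trace_one)
  have sK: "subgroup K (add_monoid R)" by (rule subring.axioms(1)[OF subfieldE(1)[OF K]])
  have tq: "t [^] q \<in> carrier R" using t by simp
  \<comment> \<open>That \<open>Tr(x t\<^sup>q)\<close> belongs to \<open>K\<close> is an additive
    condition on \<open>x\<close>, so it only has to be checked on the generators of
    \<open>S\<close>.\<close>
  have sub: "subgroup {x \<in> carrier R. Tr (x \<otimes> t [^] q) \<in> K} (add_monoid R)"
  proof (rule add.subgroupI)
    have z: "Tr \<zero> = \<zero>" using Tr_mult[of \<zero> \<zero>] subringE(2)[OF subfieldE(1)[OF Fix_subfield]] Fix_R[OF Tr_Fix[OF zero_closed]] by simp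
    then have "\<zero> \<in> {x \<in> carrier R. Tr (x \<otimes> t [^] q) \<in> K}" using tq subgroup.one_closed[OF sK] by simp
    then show "{x \<in> carrier R. Tr (x \<otimes> t [^] q) \<in> K} \<noteq> {}" by blast
    fix x assume x: "x \<in> {x \<in> carrier R. Tr (x \<otimes> t [^] q) \<in> K}"
    have m1: "\<ominus> \<one> \<in> Fix" by (rule subringE(5)[OF subfieldE(1)[OF Fix_subfield] subringE(3)[OF subfieldE(1)[OF Fix_subfield]]])
    have "\<ominus> x \<otimes> t [^] q = \<ominus> \<one> \<otimes> (x \<otimes> t [^] q)" using x tq by (simp add: l_minus)
    then have "Tr (\<ominus> x \<otimes> t [^] q) = \<ominus> \<one> \<otimes> Tr (x \<otimes> t [^] q)" using Tr_mult[OF m1] x tq by simp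
    also have "\<dots> = \<ominus> Tr (x \<otimes> t [^] q)" using x KR by (auto simp: l_minus)
    finally show "\<ominus> x \<in> {x \<in> carrier R. Tr (x \<otimes> t [^] q) \<in> K}"
      using x subgroup.m_inv_closed[OF sK] by (simp add: a_inv_def[symmetric])
    fix y assume y: "y \<in> {x \<in> carrier R. Tr (x \<otimes> t [^] q) \<in> K}"
    show "x \<oplus> y \<in> {x \<in> carrier R. Tr (x \<otimes> t [^] q) \<in> K}"
      using x y tq Tr_add[of "x \<otimes> t [^] q" "y \<otimes> t [^] q"] subgroup.m_closed[OF sK] by (simp add: l_distr)
  qed auto
  have "S \<subseteq> {x \<in> carrier R. Tr (x \<otimes> t [^] q) \<in> K}"
    unfolding S_def
  proof (rule prod_span_subset[OF sub])
    fix k b assume k: "k \<in> K" and "b \<in> (\<lambda>x. x [^] q) ` carrier R"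
    then obtain x where x: "x \<in> carrier R" "b = x [^] q" by blast
    have kR: "k \<in> carrier R" "k \<in> Fix" using k KR K_Fix by auto
    have "(k \<otimes> b) \<otimes> t [^] q = k \<otimes> (x \<otimes> t) [^] q"
      using kR x t by (simp add: nat_pow_distrib m_assoc)
    then have "Tr ((k \<otimes> b) \<otimes> t [^] q) = k \<otimes> (Tr (x \<otimes> t)) [^] q"
      using Tr_mult[OF kR(2)] Tr_pow[of "x \<otimes> t"] x t by simp
    also have "\<dots> \<in> K" using k q_Fix[OF Tr_Fix[of "x \<otimes> t"]] x t subringE(6)[OF subfieldE(1)[OF K]] by simp
    finally show "k \<otimes> b \<in> {x \<in> carrier R. Tr (x \<otimes> t [^] q) \<in> K}" using kR x by simp
  qed
  moreover have "Tr (s \<otimes> t [^] q) = s"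
    using Tr_mult[of s "t [^] q"] s tq Tr_pow[OF t(1)] t(2) Fix_R by simp
  ultimately show "s \<in> K" using s by auto
qed

text \<open>The trace of an element of the stable field \<open>S\<close> stays in \<open>S\<close>
  and is fixed, and \<open>S\<close> meets the fixed field only in \<open>K\<close>.\<close>

lemma Tr_S: "x \<in> S \<Longrightarrow> Tr x \<in> K"
proof -
  assume x: "x \<in> S"
  have "Tr x \<in> S"
    unfolding trace_on_def
    by (rule finsum_in_subgroup[OF subring.axioms(1)[OF subfieldE(1)[OF S_subfield]]])
      (use S_stable x in \<open>auto simp: stable_def\<close>)
  then show "Tr x \<in> K" using S_Fix Tr_Fix[OF S_R[OF x]] by blast
qed

text \<open>The \<open>q\<close>-th powers of a dual family of \<open>R\<close> lie in
  \<open>S\<close>. Every element thus becomes an explicit combination of elements of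
  \<open>S\<close> with fixed coefficients; both the existence and the uniqueness of the operators
  \<open>a \<otimes> 1\<close> and \<open>1 \<otimes> b\<close> rest on this formula.\<close>

lemma exists_S_family:
  obtains n :: nat and U V where "\<And>i. U i \<in> S" "\<And>i. V i \<in> S"
    "\<And>z. z \<in> carrier R \<Longrightarrow> z = (\<Oplus>i\<in>{..<n}. U i \<otimes> Tr (V i \<otimes> z))"
proof -
  obtain n u v where uv: "dual_family (carrier R) K n u v"
    using exists_dual_family[OF carrier_is_subfield KR finite_G] .
  have uR: "\<And>i. u i \<in> carrier R" and vR: "\<And>i. v i \<in> carrier R" using uv by (auto simp: dual_family_def)
  have "dual_family (carrier R) K n (\<lambda>i. u i [^] q) (\<lambda>i. v i [^] q)"
    unfolding q_def by (rule dual_family_power[OF p char carrier_is_subfield KR uv])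
  note exp = dual_family_expansion[OF carrier_is_subfield KR finite_G this]
  show ?thesis
    by (rule that[of "\<lambda>i. u i [^] q" "\<lambda>i. v i [^] q" n]) (use q_S uR vR exp in auto)
qed

text \<open>Every \<open>g \<in> G\<close> restricts to an automorphism of the stable field
  \<open>M\<close>, so what all automorphisms of \<open>M\<close> fix is fixed by
  \<open>G\<close>.\<close>

lemma fixed_by_Aut_stable:
  assumes M: "subfield M R" "K \<subseteq> M" "stable M"
  shows "fixed_by M (Aut R M K) \<subseteq> Fix"
proof
  fix x assume x: "x \<in> fixed_by M (Aut R M K)"
  then have xM: "x \<in> M" by (simp add: fixed_by_def)
  have "g x = x" if "g \<in> G" for g
    using restrict_Aut[OF M that] x xM by (auto simp: fixed_by_def)
  then show "x \<in> Fix" using xM subfieldE(3)[OF M(1)] by (auto simp: fixed_by_def)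
qed

lemma finite_Aut_intermediate:
  assumes M: "subfield M R" "K \<subseteq> M" shows "finite (Aut R M K)" "finite_dimension K M"
proof -
  have sM: "subring M R" by (rule subfieldE(1)[OF M(1)])
  have "subalgebra K M R"
    using subring.axioms(1)[OF sM] subringE(6)[OF sM] M(2)
    by (intro subalgebra.intro) (auto simp: subalgebra_axioms_def)
  then show fin': "finite_dimension K M"
    by (rule subalbegra_incl_imp_finite_dimension[OF K fin]) (rule subfieldE(3)[OF M(1)])
  show "finite (Aut R M K)" by (rule finite_Aut[OF K M fin'])
qed

text \<open>The dual family is one of \<open>M\<close> itself, since both factors have to lie in
  \<open>M\<close>. The coefficients are traces from \<open>M\<close>, hence fixed; the
  \<open>q\<close>-th powers put the other factors into \<open>S\<close>.\<close>

lemma stable_decomposition: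
  assumes M: "subfield M R" "K \<subseteq> M" "stable M" and x: "x \<in> M"
  obtains n :: nat and a b where "\<And>i. a i \<in> M \<inter> Fix" "\<And>i. b i \<in> M \<inter> S" "x = (\<Oplus>i\<in>{..<n}. a i \<otimes> b i)"
proof -
  have sM: "subring M R" by (rule subfieldE(1)[OF M(1)])
  have MR: "M \<subseteq> carrier R" by (rule subfieldE(3)[OF M(1)])
  note finM = finite_Aut_intermediate(1)[OF M(1,2)]
  obtain n u v where uv: "dual_family M K n u v" using exists_dual_family[OF M(1,2) finM] .
  have uM: "\<And>i. u i \<in> M" and vM: "\<And>i. v i \<in> M" using uv by (auto simp: dual_family_def)
  have uv': "dual_family M K n (\<lambda>i. u i [^] q) (\<lambda>i. v i [^] q)"
    unfolding q_def by (rule dual_family_power[OF p char M(1,2) uv])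
  define a where "a i = trace_on M K (v i [^] q \<otimes> x)" for i
  have vx: "v i [^] q \<otimes> x \<in> M" for i using subringE(6)[OF sM q_pow_closed[OF sM vM] x] .
  have a: "a i \<in> M \<inter> Fix" for i
    using trace_on_fixed[OF M(1,2) finM vx] fixed_by_Aut_stable[OF M] trace_on_in[OF M(1) vx] by (auto simp: a_def)
  have b: "u i [^] q \<in> M \<inter> S" for i using q_pow_closed[OF sM uM] q_S uM MR by blast
  have "x = (\<Oplus>i\<in>{..<n}. u i [^] q \<otimes> a i)"
    unfolding a_def by (rule dual_family_expansion[OF M(1,2) finM uv' x])
  also have "\<dots> = (\<Oplus>i\<in>{..<n}. a i \<otimes> u i [^] q)"
    by (rule finsum_cong'[OF refl]) (use a b MR S_R in \<open>auto intro!: m_comm\<close>)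
  finally show ?thesis by (rule that[OF a b])
qed

text \<open>For a Galois extension the coefficients of the decomposition lie in
  \<open>M \<inter> Fix \<subseteq> K\<close>, so only a combination of elements of \<open>S\<close>
  over \<open>K\<close> is left.\<close>

lemma galois_subset_S:
  assumes M: "subfield M R" "K \<subseteq> M" and gal: "galois_ext R M K"
  shows "M \<subseteq> S"
proof
  have st: "stable M" "M \<inter> Fix \<subseteq> K" using galois_ext_iff[OF M] gal by auto
  fix x assume "x \<in> M"
  then obtain n :: nat and a b where ab: "\<And>i. a i \<in> M \<inter> Fix" "\<And>i. b i \<in> M \<inter> S" "x = (\<Oplus>i\<in>{..<n}. a i \<otimes> b i)"
    using stable_decomposition[OF M st(1)] by blast
  have "a i \<otimes> b i \<in> S" for i
    using ab(1,2)[of i] st(2) K_S subringE(6)[OF subfieldE(1)[OF S_subfield]] by blast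
  then show "x \<in> S"
    unfolding ab(3) by (intro finsum_in_subgroup[OF subring.axioms(1)[OF subfieldE(1)[OF S_subfield]]])
qed

section \<open>The largest purely inseparable and the largest Galois subextension\<close>

lemma pi_part_eq:
  assumes P: "subfield P R" "K \<subseteq> P" and rc: "ring_char R = p"
  shows "pi_part R P K = P \<inter> Fix"
  unfolding pi_part_def
proof (rule Greatest_equality)
  have "subfield (P \<inter> Fix) R" by (rule subfield_inter[OF P(1) Fix_subfield])
  moreover have "purely_inseparable_ext R (P \<inter> Fix) K"
    unfolding purely_inseparable_ext_def rc using fixed_purely_inseparable by (metis IntD2)
  ultimately show "P \<inter> Fix \<in> intermediate_fields R P K \<and> purely_inseparable_ext R (P \<inter> Fix) K"
    using P(2) K_Fix by (auto simp: intermediate_fields_def)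
  fix N assume N: "N \<in> intermediate_fields R P K \<and> purely_inseparable_ext R N K"
  show "N \<subseteq> P \<inter> Fix"
  proof
    fix x assume x: "x \<in> N"
    have xP: "x \<in> P" using N x by (auto simp: intermediate_fields_def)
    have xR: "x \<in> carrier R" by (rule subsetD[OF subfieldE(3)[OF P(1)] xP])
    obtain n where n: "x [^] (p ^ n) \<in> K" using N x by (auto simp: purely_inseparable_ext_def rc)
    \<comment> \<open>The power of \<open>x\<close> that lies in \<open>K\<close> is fixed by
      \<open>g\<close>, so \<open>(g x - x)\<close> has a vanishing power: Frobenius is
      injective.\<close>
    have "g x = x" if g: "g \<in> G" for g
    proof -
      have gx: "g x \<in> carrier R" by (rule AutD(5)[OF g xR])
      have "(g x) [^] (p ^ n) = x [^] (p ^ n)"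
        using Aut_pow[OF g carrier_is_subring xR] AutD(4)[OF g n] by simp
      then have "(g x \<ominus> x) [^] (p ^ n) = \<zero>"
        using frobenius_minus[OF p char gx xR] xR by (simp add: minus_eq r_neg)
      then have "g x \<ominus> x = \<zero>" using pow_eq_zeroD[OF minus_closed[OF gx xR]] by blast
      then show ?thesis using gx xR by simp
    qed
    then show "x \<in> P \<inter> Fix" using xR xP by (simp add: fixed_by_def)
  qed
qed

text \<open>\<open>P\<close> need not be stable, and then \<open>P \<inter> S\<close> need not be
  normal over \<open>K\<close>. The elements of \<open>S\<close> that stay in \<open>P\<close> under
  all of \<open>G\<close> form the largest stable subfield inside
  \<open>P \<inter> S\<close>.\<close>

lemma gal_part_eq:
  assumes P: "subfield P R" "K \<subseteq> P"
  shows "gal_part R P K = {x \<in> S. \<forall>g\<in>G. g x \<in> P}" (is "_ = ?Q")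
  unfolding gal_part_def
proof (rule Greatest_equality)
  have sP: "subring P R" by (rule subfieldE(1)[OF P(1)])
  have sS: "subring S R" by (rule subfieldE(1)[OF S_subfield])
  have idG: "(\<lambda>x\<in>carrier R. x) \<in> G" by (rule Aut_id[OF KR]) auto
  have sQ: "subring ?Q R"
  proof (rule subringI)
    show "?Q \<subseteq> carrier R" using S_R by blast
    have "g \<one> \<in> P" if "g \<in> G" for g using AutD(8)[OF that] subringE(3)[OF sP] by simp
    then show "\<one> \<in> ?Q" using subringE(3)[OF sS] by simp
    fix x assume "x \<in> ?Q"
    then have x: "x \<in> S" "x \<in> carrier R" "\<And>g. g \<in> G \<Longrightarrow> g x \<in> P" using S_R by auto
    have "g (\<ominus> x) \<in> P" if "g \<in> G" for g
      using Aut_zero_minus(2)[OF that carrier_is_subring x(2)] subringE(5)[OF sP x(3)[OF that]] by simp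
    then show "\<ominus> x \<in> ?Q" using subringE(5)[OF sS x(1)] by simp
    fix y assume "y \<in> ?Q"
    then have y: "y \<in> S" "y \<in> carrier R" "\<And>g. g \<in> G \<Longrightarrow> g y \<in> P" using S_R by auto
    have "g (x \<otimes> y) \<in> P" "g (x \<oplus> y) \<in> P" if "g \<in> G" for g
      using AutD(6,7)[OF that x(2) y(2)] subringE(6,7)[OF sP x(3)[OF that] y(3)[OF that]] by simp_all
    then show "x \<otimes> y \<in> ?Q" "x \<oplus> y \<in> ?Q" using subringE(6,7)[OF sS x(1) y(1)] by simp_all
  qed
  have KQ: "K \<subseteq> ?Q"
  proof
    fix x assume x: "x \<in> K"
    have "g x \<in> P" if "g \<in> G" for g using AutD(4)[OF that x] x P(2) by auto
    then show "x \<in> ?Q" using x K_S by auto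
  qed
  have fQ: "subfield ?Q R"
    by (rule algebraic_subring_is_subfield[OF K sQ KQ]) (use alg S_R in blast)
  have "?Q \<subseteq> P"
  proof
    fix x assume x: "x \<in> ?Q"
    then have "(\<lambda>x\<in>carrier R. x) x \<in> P" using idG by blast
    then show "x \<in> P" using x S_R by simp
  qed
  moreover have "stable ?Q"
    unfolding stable_def
  proof (intro ballI)
    fix g x assume g: "g \<in> G" and x: "x \<in> ?Q"
    have "h (g x) \<in> P" if h: "h \<in> G" for h
    proof -
      have "compose (carrier R) h g x \<in> P" using x Aut_compose[OF carrier_is_subring KR h g] by blast
      then show ?thesis using x S_R by (simp add: compose_def)
    qed
    then show "g x \<in> ?Q" using S_stable g x by (simp add: stable_def)
  qed
  ultimately show "?Q \<in> intermediate_fields R P K \<and> galois_ext R ?Q K"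
    using fQ KQ galois_ext_iff[OF fQ KQ] S_Fix by (auto simp: intermediate_fields_def)
  fix N assume N: "N \<in> intermediate_fields R P K \<and> galois_ext R N K"
  then have N': "subfield N R" "K \<subseteq> N" "N \<subseteq> P" by (auto simp: intermediate_fields_def)
  then show "N \<subseteq> ?Q"
    using galois_subset_S[OF N'(1,2)] galois_ext_iff[OF N'(1,2)] N unfolding stable_def by blast
qed

end

section \<open>The multiplication map on a tensor product\<close>

lemma (in ring) mult_map_superset:
  assumes "finite Z" "Poly_Mapping.keys u \<subseteq> Z" "\<And>z. z \<in> Z \<Longrightarrow> fst z \<in> carrier R \<and> snd z \<in> carrier R"
  shows "mult_map R u = (\<Oplus>z\<in>Z. add_pow R (Poly_Mapping.lookup u z) (fst z \<otimes> snd z))"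
  unfolding mult_map_def
proof (rule add.finprod_mono_neutral_cong_left[OF assms(1,2)])
  show "add_pow R (Poly_Mapping.lookup u z) (fst z \<otimes> snd z) = \<zero>" if "z \<in> Z - Poly_Mapping.keys u" for z
    using that by (simp add: in_keys_iff add_pow_int_ge)
qed (use assms(3) in auto)

lemma (in ring) mult_map_add:
  assumes "Poly_Mapping.keys u \<subseteq> A \<times> B" "Poly_Mapping.keys v \<subseteq> A \<times> B" "A \<subseteq> carrier R" "B \<subseteq> carrier R"
  shows "mult_map R (u + v) = mult_map R u \<oplus> mult_map R v" and "mult_map R u \<in> carrier R"
proof -
  let ?Z = "Poly_Mapping.keys u \<union> Poly_Mapping.keys v"
  have Z: "fst z \<in> carrier R \<and> snd z \<in> carrier R" if "z \<in> ?Z" for z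
  proof -
    have "z \<in> A \<times> B" using that assms(1,2) by blast
    then show ?thesis using assms(3,4) by auto
  qed
  have sup: "mult_map R w = (\<Oplus>z\<in>?Z. add_pow R (Poly_Mapping.lookup w z) (fst z \<otimes> snd z))"
    if "Poly_Mapping.keys w \<subseteq> ?Z" for w
    by (rule mult_map_superset[OF _ that Z]) auto
  have cl: "fst z \<otimes> snd z \<in> carrier R" if "z \<in> ?Z" for z using Z[OF that] by simp
  have "mult_map R (u + v) = (\<Oplus>z\<in>?Z. add_pow R (Poly_Mapping.lookup (u + v) z) (fst z \<otimes> snd z))"
    using keys_add[of u v] by (intro sup) auto
  also have "\<dots> = (\<Oplus>z\<in>?Z. add_pow R (Poly_Mapping.lookup u z) (fst z \<otimes> snd z) \<oplus>
      add_pow R (Poly_Mapping.lookup v z) (fst z \<otimes> snd z))"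
    by (rule finsum_cong'[OF refl]) (use cl in \<open>auto simp: lookup_add add.int_pow_mult\<close>)
  also have "\<dots> = (\<Oplus>z\<in>?Z. add_pow R (Poly_Mapping.lookup u z) (fst z \<otimes> snd z)) \<oplus>
      (\<Oplus>z\<in>?Z. add_pow R (Poly_Mapping.lookup v z) (fst z \<otimes> snd z))"
    by (rule finsum_addf) (use cl in auto)
  finally show "mult_map R (u + v) = mult_map R u \<oplus> mult_map R v" using sup by simp
  show "mult_map R u \<in> carrier R" unfolding mult_map_def by (rule finsum_closed) (use cl in auto)
qed

lemma (in ring) mult_map_of:
  assumes "a \<in> carrier R" "b \<in> carrier R" shows "mult_map R (frag_of (a, b)) = a \<otimes> b"
  using assms by (simp add: mult_map_def)

lemma (in ring) mult_map_0: "mult_map R 0 = \<zero>"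
  by (simp add: mult_map_def)

lemma (in ring) mult_map_hom:
  assumes "A \<subseteq> carrier R" "B \<subseteq> carrier R"
  shows "group_hom (free_Abelian_group (A \<times> B)) (add_monoid R) (mult_map R)"
  using mult_map_add[OF _ _ assms] add.is_group
  by (simp add: group_hom_def group_hom_axioms_def hom_def)

lemma (in ring) mult_image_eq_prod_span:
  assumes "A \<subseteq> carrier R" "B \<subseteq> carrier R"
  shows "mult_image R A B = prod_span R A B"
proof -
  let ?F = "free_Abelian_group (A \<times> B)"
  interpret h: group_hom ?F "add_monoid R" "mult_map R" by (rule mult_map_hom[OF assms])
  have P: "subgroup (prod_span R A B) (add_monoid R)" by (rule prod_span_subgroup[OF assms])
  show ?thesis
  proof
    show "mult_image R A B \<subseteq> prod_span R A B"
    proof (clarsimp simp: mult_image_def)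
      fix u :: "('a \<times> 'a) \<Rightarrow>\<^sub>0 int" assume "Poly_Mapping.keys u \<subseteq> A \<times> B"
      then show "mult_map R u \<in> prod_span R A B"
      proof (induction u rule: free_Abelian_group_induct[consumes 1, case_names zero diff of])
        case zero
        then show ?case using subgroup.one_closed[OF P] by (simp add: mult_map_0)
      next
        case (diff u v)
        have uv: "Poly_Mapping.keys (u - v) \<subseteq> A \<times> B" using diff(1,2) keys_diff[of u v] by blast
        have "mult_map R u = mult_map R (u - v) \<oplus> mult_map R v"
          using mult_map_add(1)[OF uv diff(2) assms] by simp
        then have "mult_map R (u - v) = mult_map R u \<oplus> \<ominus> mult_map R v"
          using mult_map_add(2)[OF uv diff(2) assms] mult_map_add(2)[OF diff(2,2) assms] by (simp add: a_assoc r_neg)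
        then show ?case using diff(3,4) subgroup.m_closed[OF P] subgroup.m_inv_closed[OF P] by (simp add: a_inv_def)
      next
        case (of z)
        then obtain a b where "z = (a, b)" "a \<in> A" "b \<in> B" by blast
        then show ?case using assms prod_in_prod_span[of a A b B] by (simp add: mult_map_of subset_iff)
      qed
    qed
    have "subgroup (mult_image R A B) (add_monoid R)"
      unfolding mult_image_def by (rule h.img_is_subgroup)
    then show "prod_span R A B \<subseteq> mult_image R A B"
    proof (rule prod_span_subset)
      fix a b assume ab: "a \<in> A" "b \<in> B"
      then have "a \<otimes> b = mult_map R (frag_of (a, b))" using assms by (subst mult_map_of) auto
      then show "a \<otimes> b \<in> mult_image R A B" unfolding mult_image_def using ab by auto
    qed
  qed
qed

text \<open>
  \<open>ld\<close> is linear disjointness; it allows to shorten a formal sum of pairs whose product sum vanishes.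
\<close>

lemma (in ring) tensor_isoI:
  assumes A: "subgroup A (add_monoid R)" and B: "subgroup B (add_monoid R)" and KR: "K \<subseteq> carrier R"
    and KA: "\<And>k a. k \<in> K \<Longrightarrow> a \<in> A \<Longrightarrow> k \<otimes> a \<in> A" and KB: "\<And>k b. k \<in> K \<Longrightarrow> b \<in> B \<Longrightarrow> k \<otimes> b \<in> B"
    and comm: "\<And>k a. k \<in> K \<Longrightarrow> a \<in> A \<Longrightarrow> k \<otimes> a = a \<otimes> k"
    and ld: "\<And>(I :: nat set) a b i. finite I \<Longrightarrow> (\<And>i. i \<in> I \<Longrightarrow> a i \<in> A) \<Longrightarrow> (\<And>i. i \<in> I \<Longrightarrow> b i \<in> B) \<Longrightarrow>
      (\<Oplus>i\<in>I. a i \<otimes> b i) = \<zero> \<Longrightarrow> i \<in> I \<Longrightarrow> b i \<noteq> \<zero> \<Longrightarrow>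
      \<exists>c. (\<forall>j\<in>I. c j \<in> K) \<and> (\<Oplus>j\<in>I. c j \<otimes> a j) = \<zero> \<and> c i = \<one>"
  shows "tensor_iso R K A B (prod_span R A B)"
proof -
  define F where "F = free_Abelian_group (A \<times> B)"
  define N where "N = generate F (tensor_relators R K A B)"
  have AR: "A \<subseteq> carrier R" and BR: "B \<subseteq> carrier R" using subgroup.subset[OF A] subgroup.subset[OF B] by auto
  have A0: "\<zero> \<in> A" and B0: "\<zero> \<in> B" using subgroup.one_closed[OF A] subgroup.one_closed[OF B] by auto
  have Aadd: "x \<oplus> y \<in> A" if "x \<in> A" "y \<in> A" for x y using subgroup.m_closed[OF A that] by simp
  have Badd: "x \<oplus> y \<in> B" "x \<ominus> y \<in> B" if "x \<in> B" "y \<in> B" for x y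
    using subgroup.m_closed[OF B] subgroup.m_inv_closed[OF B] that by (auto simp: a_inv_def a_minus_def)
  interpret F: comm_group F unfolding F_def by (rule abelian_free_Abelian_group)
  have carF: "x \<in> carrier F \<longleftrightarrow> Poly_Mapping.keys x \<subseteq> A \<times> B" for x by (simp add: F_def)
  have ofF: "frag_of (a, b) \<in> carrier F" if "a \<in> A" "b \<in> B" for a b using that by (simp add: F_def)
  have Fadd: "x + y \<in> carrier F" "x - y \<in> carrier F" if "x \<in> carrier F" "y \<in> carrier F" for x y
    using that keys_add[of x y] keys_diff[of x y] by (auto simp: carF)
  have rel: "tensor_relators R K A B \<subseteq> carrier F"
    unfolding tensor_relators_def using Aadd Badd KA KB by (auto intro!: Fadd ofF)
  have N: "subgroup N F" unfolding N_def by (rule F.generate_is_subgroup[OF rel])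
  have N0: "0 \<in> N" using subgroup.one_closed[OF N] by (simp add: F_def)
  have Nadd: "x + y \<in> N" if "x \<in> N" "y \<in> N" for x y using subgroup.m_closed[OF N that] by (simp add: F_def)
  have Nneg: "- x \<in> N" if "x \<in> N" for x
    using subgroup.m_inv_closed[OF N that] subgroup.subset[OF N] that by (auto simp: F_def)
  have Nsub: "x - y \<in> N" if "x \<in> N" "y \<in> N" for x y using Nadd[OF that(1) Nneg[OF that(2)]] by simp
  have Ncancel: "x \<in> N" if "x - y \<in> N" "y \<in> N" for x y using Nadd[OF that] by simp
  have Nsum: "(\<Sum>i\<in>I. f i) \<in> N" if "\<And>i. i \<in> I \<Longrightarrow> f i \<in> N" for I :: "nat set" and f
    using that by (induction I rule: infinite_finite_induct) (auto intro: N0 Nadd)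
  have r1: "frag_of (a \<oplus> a', b) - frag_of (a, b) - frag_of (a', b) \<in> N" if "a \<in> A" "a' \<in> A" "b \<in> B" for a a' b
    unfolding N_def by (rule generate.incl) (use that in \<open>auto simp: tensor_relators_def\<close>)
  have r2: "frag_of (a, b \<oplus> b') - frag_of (a, b) - frag_of (a, b') \<in> N" if "a \<in> A" "b \<in> B" "b' \<in> B" for a b b'
    unfolding N_def by (rule generate.incl) (use that in \<open>auto simp: tensor_relators_def\<close>)
  have r3: "frag_of (k \<otimes> a, b) - frag_of (a, k \<otimes> b) \<in> N" if "k \<in> K" "a \<in> A" "b \<in> B" for k a b
    unfolding N_def by (rule generate.incl) (use that in \<open>auto simp: tensor_relators_def\<close>)
  have z1: "frag_of (\<zero>, b) \<in> N" if "b \<in> B" for b using Nneg[OF r1[OF A0 A0 that]] by simp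
  have z2: "frag_of (a, \<zero>) \<in> N" if "a \<in> A" for a using Nneg[OF r2[OF that B0 B0]] by simp
  have sum1: "frag_of (\<Oplus>i\<in>I. a i, b) - (\<Sum>i\<in>I. frag_of (a i, b)) \<in> N"
    if "finite I" "\<And>i. i \<in> I \<Longrightarrow> a i \<in> A" and b: "b \<in> B" for I :: "nat set" and a b
    using that(1,2)
  proof (induction I rule: finite_induct)
    case empty
    then show ?case using z1[OF b] by simp
  next
    case (insert i I)
    have "(\<Oplus>i\<in>I. a i) \<in> A" by (rule finsum_in_subgroup[OF A]) (use insert.prems in blast)
    then have "frag_of (a i \<oplus> (\<Oplus>i\<in>I. a i), b) - frag_of (a i, b) - frag_of (\<Oplus>i\<in>I. a i, b) \<in> N"
      using r1 insert.prems b by blast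
    moreover have "(\<Oplus>i\<in>insert i I. a i) = a i \<oplus> (\<Oplus>i\<in>I. a i)"
      by (rule finsum_insert) (use insert AR in auto)
    moreover have "frag_of (\<Oplus>i\<in>I. a i, b) - (\<Sum>i\<in>I. frag_of (a i, b)) \<in> N" using insert by blast
    ultimately have "frag_of (\<Oplus>i\<in>insert i I. a i, b) - frag_of (a i, b) - frag_of (\<Oplus>i\<in>I. a i, b) +
        (frag_of (\<Oplus>i\<in>I. a i, b) - (\<Sum>i\<in>I. frag_of (a i, b))) \<in> N"
      by (intro Nadd) simp_all
    then show ?case using insert.hyps by (simp add: algebra_simps)
  qed
  interpret h: group_hom F "add_monoid R" "mult_map R" unfolding F_def by (rule mult_map_hom[OF AR BR])
  have h_add: "mult_map R (x + y) = mult_map R x \<oplus> mult_map R y" if "x \<in> carrier F" "y \<in> carrier F" for x y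
    using h.hom_mult[OF that] by (simp add: F_def)
  have h_diff: "mult_map R (x - y) = mult_map R x \<ominus> mult_map R y" if "x \<in> carrier F" "y \<in> carrier F" for x y
  proof -
    have "mult_map R x = mult_map R (x - y) \<oplus> mult_map R y"
      using h_add[OF Fadd(2)[OF that] that(2)] by simp
    then show ?thesis using h.hom_closed[OF Fadd(2)[OF that]] h.hom_closed[OF that(2)]
      by (simp add: minus_eq a_assoc r_neg)
  qed
  have h_of: "mult_map R (frag_of (a, b)) = a \<otimes> b" if "a \<in> A" "b \<in> B" for a b
    using mult_map_of that AR BR by blast
  have "tensor_relators R K A B \<subseteq> kernel F (add_monoid R) (mult_map R)"
  proof
    fix u assume u: "u \<in> tensor_relators R K A B"
    then consider a a' b where "u = frag_of (a \<oplus> a', b) - frag_of (a, b) - frag_of (a', b)" "a \<in> A" "a' \<in> A" "b \<in> B"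
      | a b b' where "u = frag_of (a, b \<oplus> b') - frag_of (a, b) - frag_of (a, b')" "a \<in> A" "b \<in> B" "b' \<in> B"
      | k a b where "u = frag_of (k \<otimes> a, b) - frag_of (a, k \<otimes> b)" "k \<in> K" "a \<in> A" "b \<in> B"
      unfolding tensor_relators_def by blast
    then have "mult_map R u = \<zero>"
    proof cases
      case 1
      have R: "a \<in> carrier R" "a' \<in> carrier R" "b \<in> carrier R" using 1 AR BR by auto
      have "mult_map R u = (a \<oplus> a') \<otimes> b \<ominus> a \<otimes> b \<ominus> a' \<otimes> b"
        unfolding 1(1) using 1(2-4) by (simp add: h_diff h_of ofF Fadd Aadd)
      also have "\<dots> = \<zero>" using R by (simp add: l_distr minus_eq a_ac r_neg r_neg1)
      finally show ?thesis .
    next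
      case 2
      have R: "a \<in> carrier R" "b \<in> carrier R" "b' \<in> carrier R" using 2 AR BR by auto
      have "mult_map R u = a \<otimes> (b \<oplus> b') \<ominus> a \<otimes> b \<ominus> a \<otimes> b'"
        unfolding 2(1) using 2(2-4) by (simp add: h_diff h_of ofF Fadd Badd)
      also have "\<dots> = \<zero>" using R by (simp add: r_distr minus_eq a_ac r_neg r_neg1)
      finally show ?thesis .
    next
      case 3
      have R: "a \<in> carrier R" "b \<in> carrier R" "k \<in> carrier R" using 3 AR BR KR by auto
      have "mult_map R u = (k \<otimes> a) \<otimes> b \<ominus> a \<otimes> (k \<otimes> b)"
        unfolding 3(1) using 3(2-4) by (simp add: h_diff h_of ofF Fadd KA KB)
      also have "\<dots> = \<zero>" using R comm[OF 3(2,3)] by (simp add: m_assoc[symmetric] minus_eq r_neg)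
      finally show ?thesis .
    qed
    then show "u \<in> kernel F (add_monoid R) (mult_map R)" using u rel by (auto simp: kernel_def)
  qed
  then have N_ker: "N \<subseteq> kernel F (add_monoid R) (mult_map R)"
    unfolding N_def by (rule F.generate_subgroup_incl[OF _ h.subgroup_kernel])
  have sumF: "(\<Sum>i\<in>I. frag_of (a i, b i)) \<in> carrier F \<and> mult_map R (\<Sum>i\<in>I. frag_of (a i, b i)) = (\<Oplus>i\<in>I. a i \<otimes> b i)"
    if "finite I" "\<And>i. i \<in> I \<Longrightarrow> a i \<in> A" "\<And>i. i \<in> I \<Longrightarrow> b i \<in> B" for I :: "nat set" and a b
    using that
  proof (induction I rule: finite_induct)
    case empty
    then show ?case by (simp add: mult_map_0 carF)
  next
    case (insert i I)
    have "(\<Oplus>i\<in>insert i I. a i \<otimes> b i) = a i \<otimes> b i \<oplus> (\<Oplus>i\<in>I. a i \<otimes> b i)"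
    proof (rule finsum_insert[OF insert.hyps])
      show "(\<lambda>i. a i \<otimes> b i) \<in> I \<rightarrow> carrier R" using insert.prems AR BR by (auto intro!: m_closed)
      show "a i \<otimes> b i \<in> carrier R" using insert.prems AR BR by (auto intro!: m_closed)
    qed
    then show ?case using insert by (simp add: h_add h_of ofF Fadd)
  qed
  \<comment> \<open>Induction on the number of terms: a term with nonzero second entry is eliminated
    by means of \<open>ld\<close>, and when none is left every summand is a pair
    \<open>(a, \<zero>)\<close>, which lies in \<open>N\<close>.\<close>
  have zero_sum: "(\<Sum>i\<in>I. frag_of (a i, b i)) \<in> N"
    if "finite I" "\<And>i. i \<in> I \<Longrightarrow> a i \<in> A" "\<And>i. i \<in> I \<Longrightarrow> b i \<in> B" "(\<Oplus>i\<in>I. a i \<otimes> b i) = \<zero>"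
    for I :: "nat set" and a b
    using that
  proof (induction "card I" arbitrary: I b rule: less_induct)
    case less
    note a = less.prems(2) and b = less.prems(3)
    show ?case
    proof (cases "\<forall>i\<in>I. b i = \<zero>")
      case True
      then show ?thesis using z2 a by (intro Nsum) simp
    next
      case False
      then obtain i0 where i0: "i0 \<in> I" "b i0 \<noteq> \<zero>" by blast
      from ld[OF less.prems(1) a b less.prems(4) i0] obtain c
        where c: "\<And>j. j \<in> I \<Longrightarrow> c j \<in> K" "(\<Oplus>j\<in>I. c j \<otimes> a j) = \<zero>" "c i0 = \<one>" by blast
      \<comment> \<open>Since \<open>\<Sum> c\<^sub>i a\<^sub>i = 0\<close>, taking away the pairs
        with entries \<open>a i\<close> and \<open>c i \<otimes> b i0\<close> changes nothing modulo
        \<open>N\<close>; and \<open>c i0 = \<one>\<close> makes the new second entry at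
        \<open>i0\<close> vanish.\<close>
      define b' where "b' i = b i \<ominus> c i \<otimes> b i0" for i
      have cb: "c i \<otimes> b i0 \<in> B" "b' i \<in> B" if "i \<in> I" for i
        using KB[OF c(1)[OF that] b[OF i0(1)]] Badd b[OF that] by (auto simp: b'_def)
      have "frag_of (\<Oplus>i\<in>I. c i \<otimes> a i, b i0) - (\<Sum>i\<in>I. frag_of (c i \<otimes> a i, b i0)) \<in> N"
        by (rule sum1[OF less.prems(1)]) (use KA c(1) a b i0(1) in auto)
      then have "(\<Sum>i\<in>I. frag_of (c i \<otimes> a i, b i0)) \<in> N"
        using Nsub[OF z1[OF b[OF i0(1)]], of "frag_of (\<zero>, b i0) - (\<Sum>i\<in>I. frag_of (c i \<otimes> a i, b i0))"]
        by (simp add: c(2))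
      moreover have "(\<Sum>i\<in>I. frag_of (c i \<otimes> a i, b i0) - frag_of (a i, c i \<otimes> b i0)) \<in> N"
        by (rule Nsum) (rule r3[OF c(1) a b[OF i0(1)]])
      ultimately have "(\<Sum>i\<in>I. frag_of (c i \<otimes> a i, b i0)) -
          (\<Sum>i\<in>I. frag_of (c i \<otimes> a i, b i0) - frag_of (a i, c i \<otimes> b i0)) \<in> N"
        by (rule Nsub)
      then have 1: "(\<Sum>i\<in>I. frag_of (a i, c i \<otimes> b i0)) \<in> N"
        by (simp add: sum_subtractf)
      have "frag_of (a i, b i) - frag_of (a i, c i \<otimes> b i0) - frag_of (a i, b' i) \<in> N" if i: "i \<in> I" for i
      proof -
        have "c i \<otimes> b i0 \<oplus> b' i = b i"
          unfolding b'_def using cb(1)[OF i] b[OF i] BR by (intro add_minus_cancel) auto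
        then show ?thesis using r2[OF a[OF i] cb[OF i]] by simp
      qed
      then have "(\<Sum>i\<in>I. frag_of (a i, b i) - frag_of (a i, c i \<otimes> b i0) - frag_of (a i, b' i)) \<in> N"
        by (rule Nsum)
      from Nadd[OF this 1] have 2: "(\<Sum>i\<in>I. frag_of (a i, b i)) - (\<Sum>i\<in>I. frag_of (a i, b' i)) \<in> N"
        by (simp add: sum_subtractf sum.distrib algebra_simps)
      have b'0: "b' i0 = \<zero>" using b[OF i0(1)] BR by (auto simp: b'_def c(3) minus_eq r_neg)
      let ?J = "I - {i0}"
      have split: "(\<Sum>i\<in>I. frag_of (a i, b' i)) = frag_of (a i0, \<zero>) + (\<Sum>i\<in>?J. frag_of (a i, b' i))"
        using less.prems(1) i0(1) b'0 by (simp add: sum.remove)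
      have "mult_map R ((\<Sum>i\<in>I. frag_of (a i, b i)) - (\<Sum>i\<in>I. frag_of (a i, b' i))) = \<zero>"
        using 2 N_ker by (auto simp: kernel_def)
      moreover have s1: "(\<Sum>i\<in>I. frag_of (a i, b i)) \<in> carrier F" "mult_map R (\<Sum>i\<in>I. frag_of (a i, b i)) = \<zero>"
        using sumF[OF less.prems(1) a b] less.prems(4) by auto
      moreover have s2: "(\<Sum>i\<in>I. frag_of (a i, b' i)) \<in> carrier F" using sumF[OF less.prems(1) a cb(2)] by auto
      ultimately have h0: "mult_map R (\<Sum>i\<in>I. frag_of (a i, b' i)) = \<zero>"
        using h_diff[OF s1(1) s2] h.hom_closed[OF s2] by (simp add: minus_eq)
      have J: "(\<Sum>i\<in>?J. frag_of (a i, b' i)) \<in> carrier F"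
        "mult_map R (\<Sum>i\<in>?J. frag_of (a i, b' i)) = (\<Oplus>i\<in>?J. a i \<otimes> b' i)"
        using sumF[of ?J a b'] less.prems(1) a cb(2) by auto
      have "mult_map R (frag_of (a i0, \<zero>)) = \<zero>" using h_of[OF a[OF i0(1)] B0] a[OF i0(1)] AR by auto
      then have "(\<Oplus>i\<in>?J. a i \<otimes> b' i) = \<zero>"
        using h0 h_add[OF ofF[OF a[OF i0(1)] B0] J(1)] J(2) h.hom_closed[OF J(1)] unfolding split by simp
      then have "(\<Sum>i\<in>?J. frag_of (a i, b' i)) \<in> N"
        using card_Diff1_less[OF less.prems(1) i0(1)] less.prems(1) a cb(2) by (intro less.hyps) simp_all
      then have "(\<Sum>i\<in>I. frag_of (a i, b' i)) \<in> N" unfolding split using z2[OF a[OF i0(1)]] by (rule Nadd[rotated])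
      then show ?thesis using 2 Ncancel by blast
    qed
  qed
  have repr: "\<exists>(n::nat) a b. (\<forall>i. a i \<in> A) \<and> (\<forall>i. b i \<in> B) \<and> u - (\<Sum>i<n. frag_of (a i, b i)) \<in> N"
    if "u \<in> carrier F" for u
  proof -
    have "Poly_Mapping.keys u \<subseteq> A \<times> B" using that by (simp add: carF)
    then show ?thesis
    proof (induction u rule: free_Abelian_group_induct[consumes 1, case_names zero diff of])
      case zero
      show ?case using A0 B0 N0
        by - (rule exI[where x = 0], rule exI[where x = "\<lambda>_. \<zero>"], rule exI[where x = "\<lambda>_. \<zero>"], simp)
    next
      case (diff u v)
      from diff(3) obtain n :: nat and a b where u: "\<And>i. a i \<in> A" "\<And>i. b i \<in> B" "u - (\<Sum>i<n. frag_of (a i, b i)) \<in> N" by blast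
      from diff(4) obtain m :: nat and c d where v: "\<And>i. c i \<in> A" "\<And>i. d i \<in> B" "v - (\<Sum>i<m. frag_of (c i, d i)) \<in> N" by blast
      have cn: "\<ominus> c i \<in> A" for i using subgroup.m_inv_closed[OF A v(1)] by (simp add: a_inv_def)
      \<comment> \<open>A difference of two sums of pairs is again a sum of pairs modulo
        \<open>N\<close>, once the sign is moved into the first entry.\<close>
      define e where "e i = (if i < n then a i else \<ominus> c (i - n))" for i
      define f where "f i = (if i < n then b i else d (i - n))" for i
      have ef: "e i \<in> A" "f i \<in> B" for i using u v cn by (auto simp: e_def f_def)
      have neg: "frag_of (c i, d i) + frag_of (\<ominus> c i, d i) \<in> N" for i
      proof -
        have "frag_of (\<zero>, d i) - (frag_of (c i \<oplus> \<ominus> c i, d i) - frag_of (c i, d i) - frag_of (\<ominus> c i, d i)) \<in> N"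
          by (rule Nsub[OF z1[OF v(2)] r1[OF v(1) cn v(2)]])
        moreover have "c i \<oplus> \<ominus> c i = \<zero>" using v(1)[of i] AR by (auto simp: r_neg)
        ultimately show ?thesis by (simp add: add.commute)
      qed
      have U: "{..<n + m} = {..<n} \<union> {n..<n + m}" by auto
      have "(\<Sum>i<n + m. frag_of (e i, f i)) = (\<Sum>i<n. frag_of (e i, f i)) + (\<Sum>i\<in>{n..<n + m}. frag_of (e i, f i))"
        unfolding U by (rule sum.union_disjoint) auto
      also have "(\<Sum>i<n. frag_of (e i, f i)) = (\<Sum>i<n. frag_of (a i, b i))"
        by (simp add: e_def f_def)
      also have "(\<Sum>i\<in>{n..<n + m}. frag_of (e i, f i)) = (\<Sum>i<m. frag_of (\<ominus> c i, d i))"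
        using sum.shift_bounds_nat_ivl[of "\<lambda>i. frag_of (e i, f i)" 0 n m]
        by (simp add: e_def f_def lessThan_atLeast0 add.commute)
      finally have s: "(\<Sum>i<n + m. frag_of (e i, f i)) = (\<Sum>i<n. frag_of (a i, b i)) + (\<Sum>i<m. frag_of (\<ominus> c i, d i))" .
      have "(\<Sum>i<m. frag_of (c i, d i) + frag_of (\<ominus> c i, d i)) \<in> N" by (rule Nsum) (rule neg)
      then have n': "(\<Sum>i<m. frag_of (c i, d i)) + (\<Sum>i<m. frag_of (\<ominus> c i, d i)) \<in> N" by (simp add: sum.distrib)
      have "u - v - (\<Sum>i<n + m. frag_of (e i, f i)) =
          (u - (\<Sum>i<n. frag_of (a i, b i))) - (v - (\<Sum>i<m. frag_of (c i, d i))) -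
          ((\<Sum>i<m. frag_of (c i, d i)) + (\<Sum>i<m. frag_of (\<ominus> c i, d i)))"
        unfolding s by (simp add: algebra_simps)
      also have "\<dots> \<in> N" by (rule Nsub[OF Nsub[OF u(3) v(3)] n'])
      finally show ?case using ef by blast
    next
      case (of z)
      then obtain a b where z: "z = (a, b)" "a \<in> A" "b \<in> B" by blast
      then show ?case using N0
        by - (rule exI[where x = 1], rule exI[where x = "\<lambda>_. a"], rule exI[where x = "\<lambda>_. b"], simp)
    qed
  qed
  have "kernel F (add_monoid R) (mult_map R) \<subseteq> N"
  proof
    fix u assume u: "u \<in> kernel F (add_monoid R) (mult_map R)"
    then have uF: "u \<in> carrier F" and u0: "mult_map R u = \<zero>" by (auto simp: kernel_def)
    obtain n :: nat and a b where ab: "\<And>i. a i \<in> A" "\<And>i. b i \<in> B" "u - (\<Sum>i<n. frag_of (a i, b i)) \<in> N"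
      using repr[OF uF] by blast
    let ?s = "\<Sum>i<n. frag_of (a i, b i)"
    have s: "?s \<in> carrier F" "mult_map R ?s = (\<Oplus>i\<in>{..<n}. a i \<otimes> b i)" using sumF[of "{..<n}" a b] ab by auto
    have "mult_map R (u - ?s) = \<zero>" using ab(3) N_ker by (auto simp: kernel_def)
    then have "mult_map R ?s = \<zero>" using h_diff[OF uF s(1)] u0 h.hom_closed[OF s(1)] by (simp add: minus_eq)
    then have "?s \<in> N" using s(2) ab by (intro zero_sum) auto
    then show "u \<in> N" using ab(3) Ncancel by blast
  qed
  then have ker: "kernel F (add_monoid R) (mult_map R) = N" using N_ker by blast
  let ?C = "R\<lparr>carrier := prod_span R A B\<rparr>"
  have P: "subgroup (prod_span R A B) (add_monoid R)" by (rule prod_span_subgroup[OF AR BR])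
  have img: "mult_map R ` carrier F = prod_span R A B"
    using mult_image_eq_prod_span[OF AR BR] by (simp add: mult_image_def F_def)
  have grpC: "group (add_monoid ?C)" using add.subgroup_imp_group[OF P] by simp
  have homC: "mult_map R \<in> hom F (add_monoid ?C)"
    using h_add img by (auto simp: hom_def F_def)
  interpret hC: group_hom F "add_monoid ?C" "mult_map R"
    using homC grpC by (simp add: group_hom_def group_hom_axioms_def F.is_group)
  \<comment> \<open>The first isomorphism theorem supplies exactly the map in
    \<open>tensor_iso\<close>: on a coset, \<open>the_elem\<close> of its image under
    \<open>mult_map\<close>.\<close>
  have "kernel F (add_monoid ?C) (mult_map R) = N" using ker by (simp add: kernel_def)
  then show ?thesis
    using hC.FactGroup_iso_set img
    by (simp add: tensor_iso_def tensor_product_def N_def F_def)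
qed

section \<open>Endomorphism rings\<close>

lemma End_ring_simps [simp]:
  "carrier (End_ring R P M) = End R P M"
  "f \<otimes>\<^bsub>End_ring R P M\<^esub> g = compose P f g"
  "f \<oplus>\<^bsub>End_ring R P M\<^esub> g = (\<lambda>x\<in>P. f x \<oplus>\<^bsub>R\<^esub> g x)"
  "\<one>\<^bsub>End_ring R P M\<^esub> = (\<lambda>x\<in>P. x)"
  "\<zero>\<^bsub>End_ring R P M\<^esub> = (\<lambda>x\<in>P. \<zero>\<^bsub>R\<^esub>)"
  by (simp_all add: End_ring_def)

lemma End_eqI:
  assumes "f \<in> End R P M" "g \<in> End R P M'" "\<And>x. x \<in> P \<Longrightarrow> f x = g x"
  shows "f = g"
  using extensionalityI[OF EndD(2)[OF assms(1)] EndD(2)[OF assms(2)]] assms(3) by blast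

lemma End_compose:
  assumes "f \<in> End R P M" "g \<in> End R P M"
    and "\<And>x y. x \<in> P \<Longrightarrow> y \<in> P \<Longrightarrow> x \<oplus>\<^bsub>R\<^esub> y \<in> P" "\<And>m x. m \<in> M \<Longrightarrow> x \<in> P \<Longrightarrow> m \<otimes>\<^bsub>R\<^esub> x \<in> P"
  shows "compose P f g \<in> End R P M"
  by (rule EndI) (use assms EndD[OF assms(1)] EndD[OF assms(2)] in \<open>simp_all add: compose_def\<close>)

context cring begin

lemma End_add:
  assumes P: "subring P R" and M: "M \<subseteq> P" and f: "f \<in> End R P M" and g: "g \<in> End R P M"
  shows "(\<lambda>x\<in>P. f x \<oplus> g x) \<in> End R P M"
proof (rule EndI)
  have PR: "\<And>x. x \<in> P \<Longrightarrow> x \<in> carrier R" using subringE(1)[OF P] by blast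
  have fR: "\<And>x. x \<in> P \<Longrightarrow> f x \<in> carrier R" and gR: "\<And>x. x \<in> P \<Longrightarrow> g x \<in> carrier R"
    using EndD(1)[OF f] EndD(1)[OF g] PR by auto
  show "(\<lambda>x\<in>P. f x \<oplus> g x) (x \<oplus> y) = (\<lambda>x\<in>P. f x \<oplus> g x) x \<oplus> (\<lambda>x\<in>P. f x \<oplus> g x) y"
    if xy: "x \<in> P" "y \<in> P" for x y
    using xy subringE(7)[OF P xy] EndD(3)[OF f xy] EndD(3)[OF g xy] fR[OF xy(1)] fR[OF xy(2)] gR[OF xy(1)] gR[OF xy(2)]
    by (simp add: a_ac)
  show "(\<lambda>x\<in>P. f x \<oplus> g x) (m \<otimes> x) = m \<otimes> (\<lambda>x\<in>P. f x \<oplus> g x) x" if mx: "m \<in> M" "x \<in> P" for m x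
    using mx M subringE(6)[OF P, of m x] EndD(4)[OF f mx] EndD(4)[OF g mx] fR[OF mx(2)] gR[OF mx(2)] PR[of m]
    by (auto simp: r_distr)
qed (use EndD(1)[OF f] EndD(1)[OF g] subringE(7)[OF P] in auto)

lemma End_uminus:
  assumes P: "subring P R" and M: "M \<subseteq> P" and f: "f \<in> End R P M"
  shows "(\<lambda>x\<in>P. \<ominus> f x) \<in> End R P M"
proof (rule EndI)
  have PR: "\<And>x. x \<in> P \<Longrightarrow> x \<in> carrier R" using subringE(1)[OF P] by blast
  have fR: "\<And>x. x \<in> P \<Longrightarrow> f x \<in> carrier R" using EndD(1)[OF f] PR by auto
  show "(\<lambda>x\<in>P. \<ominus> f x) (x \<oplus> y) = (\<lambda>x\<in>P. \<ominus> f x) x \<oplus> (\<lambda>x\<in>P. \<ominus> f x) y" if xy: "x \<in> P" "y \<in> P" for x y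
    using xy subringE(7)[OF P xy] EndD(3)[OF f xy] fR[OF xy(1)] fR[OF xy(2)] by (simp add: minus_add)
  show "(\<lambda>x\<in>P. \<ominus> f x) (m \<otimes> x) = m \<otimes> (\<lambda>x\<in>P. \<ominus> f x) x" if mx: "m \<in> M" "x \<in> P" for m x
    using mx M subringE(6)[OF P, of m x] EndD(4)[OF f mx] fR[OF mx(2)] PR[of m] by (auto simp: r_minus)
qed (use EndD(1)[OF f] subringE(5)[OF P] in auto)

lemma End_ring_is_ring:
  assumes P: "subring P R" and M: "M \<subseteq> P"
  shows "ring (End_ring R P M)"
proof (rule ringI)
  have PR: "\<And>x. x \<in> P \<Longrightarrow> x \<in> carrier R" using subringE(1)[OF P] by blast
  have zero: "(\<lambda>x\<in>P. \<zero>) \<in> End R P M"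
  proof (rule EndI)
    show "(\<lambda>x\<in>P. \<zero>) (m \<otimes> x) = m \<otimes> (\<lambda>x\<in>P. \<zero>) x" if "m \<in> M" "x \<in> P" for m x
      using that M subringE(6)[OF P, of m x] PR[of m] by auto
  qed (use subringE(2,7)[OF P] in auto)
  have one: "(\<lambda>x\<in>P. x) \<in> End R P M"
  proof (rule EndI)
    show "(\<lambda>x\<in>P. x) (m \<otimes> x) = m \<otimes> (\<lambda>x\<in>P. x) x" if "m \<in> M" "x \<in> P" for m x
      using that M subringE(6)[OF P, of m x] by auto
  qed (use subringE(7)[OF P] in auto)
  have comp: "compose P f g \<in> End R P M" if "f \<in> End R P M" "g \<in> End R P M" for f g
    using End_compose[OF that] subringE(6,7)[OF P] M by blast
  show "abelian_group (End_ring R P M)"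
  proof (rule abelian_groupI; simp only: End_ring_simps)
    fix f g h assume f: "f \<in> End R P M"
    have fR: "\<And>x. x \<in> P \<Longrightarrow> f x \<in> carrier R" using EndD(1)[OF f] PR by auto
    show "(\<lambda>x\<in>P. (\<lambda>x\<in>P. \<zero>) x \<oplus> f x) = f"
      by (rule extensionalityI[of _ P]) (use fR EndD(2)[OF f] in auto)
    show "\<exists>y\<in>End R P M. (\<lambda>x\<in>P. y x \<oplus> f x) = (\<lambda>x\<in>P. \<zero>)"
      by (rule bexI[OF _ End_uminus[OF P M f]]) (use fR in \<open>auto simp: l_neg\<close>)
    assume g: "g \<in> End R P M"
    have gR: "\<And>x. x \<in> P \<Longrightarrow> g x \<in> carrier R" using EndD(1)[OF g] PR by auto
    show "(\<lambda>x\<in>P. f x \<oplus> g x) \<in> End R P M" by (rule End_add[OF P M f g])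
    show "(\<lambda>x\<in>P. f x \<oplus> g x) = (\<lambda>x\<in>P. g x \<oplus> f x)" using fR gR by (auto simp: a_comm)
    assume h: "h \<in> End R P M"
    have hR: "\<And>x. x \<in> P \<Longrightarrow> h x \<in> carrier R" using EndD(1)[OF h] PR by auto
    show "(\<lambda>x\<in>P. (\<lambda>x\<in>P. f x \<oplus> g x) x \<oplus> h x) = (\<lambda>x\<in>P. f x \<oplus> (\<lambda>x\<in>P. g x \<oplus> h x) x)"
      using fR gR hR by (auto simp: a_assoc)
  qed (rule zero)
  show "monoid (End_ring R P M)"
  proof (rule monoidI; simp only: End_ring_simps)
    fix f g h assume f: "f \<in> End R P M"
    show "compose P (\<lambda>x\<in>P. x) f = f" "compose P f (\<lambda>x\<in>P. x) = f"
      by (rule extensionalityI[of _ P]; use EndD(1,2)[OF f] in \<open>simp add: compose_def\<close>)+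
    assume g: "g \<in> End R P M"
    show "compose P f g \<in> End R P M" by (rule comp[OF f g])
    assume h: "h \<in> End R P M"
    show "compose P (compose P f g) h = compose P f (compose P g h)"
      by (rule extensionalityI[of _ P]) (use EndD(1)[OF h] in \<open>simp_all add: compose_def\<close>)
  qed (rule one)
  fix f g h assume "f \<in> carrier (End_ring R P M)" "g \<in> carrier (End_ring R P M)" "h \<in> carrier (End_ring R P M)"
  then have f: "f \<in> End R P M" and g: "g \<in> End R P M" and h: "h \<in> End R P M" by simp_all
  show "(f \<oplus>\<^bsub>End_ring R P M\<^esub> g) \<otimes>\<^bsub>End_ring R P M\<^esub> h =
      f \<otimes>\<^bsub>End_ring R P M\<^esub> h \<oplus>\<^bsub>End_ring R P M\<^esub> g \<otimes>\<^bsub>End_ring R P M\<^esub> h"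
    by (rule extensionalityI[of _ P]) (use EndD(1)[OF h] in \<open>simp_all add: compose_def\<close>)
  show "h \<otimes>\<^bsub>End_ring R P M\<^esub> (f \<oplus>\<^bsub>End_ring R P M\<^esub> g) =
      h \<otimes>\<^bsub>End_ring R P M\<^esub> f \<oplus>\<^bsub>End_ring R P M\<^esub> h \<otimes>\<^bsub>End_ring R P M\<^esub> g"
    by (rule extensionalityI[of _ P])
      (use EndD(1)[OF f] EndD(1)[OF g] EndD(3)[OF h] in \<open>simp_all add: compose_def\<close>)
qed

lemma End_ring_a_inv:
  assumes P: "subring P R" and M: "M \<subseteq> P" and f: "f \<in> End R P M"
  shows "\<ominus>\<^bsub>End_ring R P M\<^esub> f = (\<lambda>x\<in>P. \<ominus> f x)"
proof -
  interpret E: ring "End_ring R P M" by (rule End_ring_is_ring[OF P M])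
  have "\<And>x. x \<in> P \<Longrightarrow> f x \<in> carrier R" using EndD(1)[OF f] subringE(1)[OF P] by auto
  then have "(\<lambda>x\<in>P. \<ominus> f x) \<oplus>\<^bsub>End_ring R P M\<^esub> f = \<zero>\<^bsub>End_ring R P M\<^esub>"
    by (auto simp: l_neg)
  then show ?thesis using E.minus_equality[of "\<lambda>x\<in>P. \<ominus> f x" f] f End_uminus[OF P M f] by simp
qed

lemma End_ring_finsum:
  assumes P: "subring P R" and M: "M \<subseteq> P" and "finite I" and f: "\<And>i. i \<in> I \<Longrightarrow> f i \<in> End R P M" and x: "x \<in> P"
  shows "(\<Oplus>\<^bsub>End_ring R P M\<^esub>i\<in>I. f i) x = (\<Oplus>i\<in>I. f i x)"
proof -
  interpret E: ring "End_ring R P M" by (rule End_ring_is_ring[OF P M])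
  show ?thesis
    using assms(3) f
  proof (induction I rule: finite_induct)
    case empty
    then show ?case using x by simp
  next
    case (insert i I)
    have "(\<lambda>i. f i x) \<in> I \<rightarrow> carrier R" "f i x \<in> carrier R"
      using EndD(1)[OF insert.prems x] subringE(1)[OF P] by auto
    then have "(\<Oplus>i\<in>insert i I. f i x) = f i x \<oplus> (\<Oplus>i\<in>I. f i x)" using insert.hyps by (intro finsum_insert)
    moreover have "(\<Oplus>\<^bsub>End_ring R P M\<^esub>i\<in>insert i I. f i) = f i \<oplus>\<^bsub>End_ring R P M\<^esub> (\<Oplus>\<^bsub>End_ring R P M\<^esub>i\<in>I. f i)"
      using insert by (intro E.finsum_insert) auto
    ultimately show ?case using insert x by simp
  qed
qed

lemma mult_op_End:
  assumes P: "subring P R" and M: "M \<subseteq> P" and a: "a \<in> P"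
  shows "mult_op R P a \<in> End R P M"
proof (rule EndI)
  have PR: "\<And>x. x \<in> P \<Longrightarrow> x \<in> carrier R" using subringE(1)[OF P] by blast
  show "mult_op R P a (m \<otimes> x) = m \<otimes> mult_op R P a x" if "m \<in> M" "x \<in> P" for m x
    using that M subringE(6)[OF P, of m x] PR[of m] PR[of x] PR[OF a] by (auto simp: mult_op_def m_lcomm)
  show "mult_op R P a (x \<oplus> y) = mult_op R P a x \<oplus> mult_op R P a y" if "x \<in> P" "y \<in> P" for x y
    using that subringE(7)[OF P that] PR[OF a] PR[of x] PR[of y] by (simp add: mult_op_def r_distr)
qed (use a subringE(6)[OF P] in \<open>auto simp: mult_op_def\<close>)

lemma centralizer_mult_op:
  assumes P: "subring P R" and M: "K \<subseteq> M" "M \<subseteq> P"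
  shows "centralizer (End_ring R P K) (mult_op R P ` M) = End R P M"
proof (rule equalityI; rule subsetI)
  fix f assume f: "f \<in> centralizer (End_ring R P K) (mult_op R P ` M)"
  then have fE: "f \<in> End R P K" by (simp add: centralizer_def)
  show "f \<in> End R P M"
  proof (rule EndI)
    fix m x assume mx: "m \<in> M" "x \<in> P"
    have "compose P f (mult_op R P m) = compose P (mult_op R P m) f"
      using f mx(1) by (simp add: centralizer_def)
    from fun_cong[OF this, of x] show "f (m \<otimes> x) = m \<otimes> f x"
      using mx M EndD(1)[OF fE mx(2)] by (simp add: compose_def mult_op_def)
  qed (use EndD[OF fE] in auto)
next
  fix f assume f: "f \<in> End R P M"
  have "compose P f (mult_op R P m) = compose P (mult_op R P m) f" if "m \<in> M" for m
    by (rule extensionalityI[of _ P]) (use EndD(1,4)[OF f] that in \<open>simp_all add: compose_def mult_op_def\<close>)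
  then show "f \<in> centralizer (End_ring R P K) (mult_op R P ` M)"
    using f End_mono[OF M(1)] by (auto simp: centralizer_def)
qed

end

section \<open>Dual bases and the double centralizer theorem\<close>

lemma (in ring) combine_eq_finsum:
  assumes "length Ks = length Us" "set Ks \<subseteq> carrier R" "set Us \<subseteq> carrier R"
  shows "combine Ks Us = (\<Oplus>i\<in>{..<length Us}. (Ks ! i) \<otimes> (Us ! i))"
  using assms
proof (induction Us arbitrary: Ks)
  case Nil
  then show ?case by simp
next
  case (Cons u Us)
  then obtain k Ks' where Ks: "Ks = k # Ks'" by (cases Ks) auto
  \<comment> \<open>Extended by zero beyond the list, because \<open>finsum_lessThan_add\<close>
    asks for values in the carrier at every index.\<close>
  define f where "f i = (if i < length (u # Us) then (Ks ! i) \<otimes> ((u # Us) ! i) else \<zero>)" for i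
  have f: "f i \<in> carrier R" for i
    using subsetD[OF Cons.prems(2) nth_mem[of i Ks]] subsetD[OF Cons.prems(3) nth_mem[of i "u # Us"]] Cons.prems(1)
    by (simp add: f_def)
  have "(\<Oplus>i\<in>{..<length (u # Us)}. (Ks ! i) \<otimes> ((u # Us) ! i)) = (\<Oplus>i\<in>{..<1 + length Us}. f i)"
    by (rule finsum_cong') (use f in \<open>auto simp: f_def\<close>)
  also have "\<dots> = (\<Oplus>i\<in>{..<1}. f i) \<oplus> (\<Oplus>i\<in>{..<length Us}. f (1 + i))" by (rule finsum_lessThan_add[OF f])
  also have "(\<Oplus>i\<in>{..<1}. f i) = k \<otimes> u" using f[of 0] by (simp add: f_def Ks lessThan_Suc)
  also have "(\<Oplus>i\<in>{..<length Us}. f (1 + i)) = (\<Oplus>i\<in>{..<length Us}. (Ks' ! i) \<otimes> (Us ! i))"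
  proof (rule finsum_cong'[OF refl])
    show "(\<lambda>i. (Ks' ! i) \<otimes> (Us ! i)) \<in> {..<length Us} \<rightarrow> carrier R"
      using Cons.prems Ks by (auto intro!: m_closed simp: subset_iff)
    show "f (1 + i) = (Ks' ! i) \<otimes> (Us ! i)" if "i \<in> {..<length Us}" for i
      using that by (simp add: f_def Ks)
  qed
  finally show ?case using Cons.IH[of Ks'] Cons.prems by (simp add: Ks)
qed

text \<open>The coordinates with respect to a basis; they are additive and \<open>M\<close>-linear
  because they are unique. Their values lie in \<open>M\<close>, a part of \<open>V\<close>, so that
  they count as operators on \<open>V\<close>.\<close>

lemma (in field) exists_dual_basis:
  assumes M: "subfield M R" and V: "subring V R" "M \<subseteq> V" and fin: "finite_dimension M V"
  obtains n :: nat and e T where "\<And>i. i < n \<Longrightarrow> e i \<in> V" "\<And>i. i < n \<Longrightarrow> T i \<in> End R V M"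
    "\<And>i x. i < n \<Longrightarrow> x \<in> V \<Longrightarrow> T i x \<in> M" "\<And>x. x \<in> V \<Longrightarrow> x = (\<Oplus>i\<in>{..<n}. T i x \<otimes> e i)"
proof -
  obtain d Us where Us: "set Us \<subseteq> carrier R" "independent M Us" "Span M Us = V"
    using fin exists_base[OF M] by (metis finite_dimensionE')
  have MR: "M \<subseteq> carrier R" by (rule subfieldE(3)[OF M])
  have sM: "subring M R" by (rule subfieldE(1)[OF M])
  define is_c where "is_c Ks x \<longleftrightarrow> set Ks \<subseteq> M \<and> length Ks = length Us \<and> x = combine Ks Us" for Ks x
  define c where "c x = (THE Ks. is_c Ks x)" for x
  have ex1: "\<exists>!Ks. is_c Ks x" if "x \<in> V" for x
    using unique_decomposition[OF M Us(2)] that unfolding is_c_def Us(3) by blast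
  have c: "is_c (c x) x" if "x \<in> V" for x unfolding c_def by (rule theI'[OF ex1[OF that]])
  have c_eq: "c x = Ks" if "x \<in> V" "is_c Ks x" for x Ks using ex1[OF that(1)] c[OF that(1)] that(2) by blast
  define T where "T i = (\<lambda>x\<in>V. c x ! i)" for i
  have UV: "set Us \<subseteq> V" using Span_base_incl[OF M Us(1)] Us(3) by simp
  have TM: "T i x \<in> M" if "i < length Us" "x \<in> V" for i x
    using c[OF that(2)] that by (auto simp: T_def is_c_def subset_iff)
  have "T i \<in> End R V M" if i: "i < length Us" for i
  proof (rule EndI)
    show "T i x \<in> V" if "x \<in> V" for x using TM[OF i that] V(2) by blast
    show "T i \<in> extensional V" by (simp add: T_def)
    fix x assume x: "x \<in> V"
    note cx = c[OF x, unfolded is_c_def]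
    show "T i (m \<otimes> x) = m \<otimes> T i x" if m: "m \<in> M" for m
    proof -
      have mx: "m \<otimes> x \<in> V" using subringE(6)[OF V(1)] m V(2) x by blast
      have "m \<otimes> x = combine (map ((\<otimes>) m) (c x)) Us"
        using combine_r_distr[of "c x" Us m] cx MR m Us(1) by auto
      then have "is_c (map ((\<otimes>) m) (c x)) (m \<otimes> x)"
        using cx m subringE(6)[OF sM] by (auto simp: is_c_def)
      then show ?thesis using c_eq[OF mx] mx x i cx by (simp add: T_def)
    qed
    fix y assume y: "y \<in> V"
    note cy = c[OF y, unfolded is_c_def]
    have xy: "x \<oplus> y \<in> V" by (rule subringE(7)[OF V(1) x y])
    have "x \<oplus> y = combine (map2 (\<oplus>) (c x) (c y)) Us"
      using combine_add[of "c x" Us "c y"] cx cy MR Us(1) by auto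
    moreover have "set (map2 (\<oplus>) (c x) (c y)) \<subseteq> M"
    proof clarsimp
      fix a b assume ab: "(a, b) \<in> set (zip (c x) (c y))"
      show "a \<oplus> b \<in> M"
        using set_zip_leftD[OF ab] set_zip_rightD[OF ab] cx cy by (intro subringE(7)[OF sM]) auto
    qed
    ultimately have "is_c (map2 (\<oplus>) (c x) (c y)) (x \<oplus> y)"
      using cx cy by (simp add: is_c_def)
    then show "T i (x \<oplus> y) = T i x \<oplus> T i y" using c_eq[OF xy] xy x y i cx cy by (simp add: T_def)
  qed
  moreover have "x = (\<Oplus>i\<in>{..<length Us}. T i x \<otimes> (Us ! i))" if x: "x \<in> V" for x
  proof -
    note cx = c[OF x, unfolded is_c_def]
    have "x = combine (c x) Us" using cx by blast
    also have "\<dots> = (\<Oplus>i\<in>{..<length Us}. (c x ! i) \<otimes> (Us ! i))"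
      by (rule combine_eq_finsum) (use cx MR Us(1) in auto)
    finally show ?thesis using x by (simp add: T_def)
  qed
  ultimately show ?thesis using that[of "length Us" "\<lambda>i. Us ! i" T] UV TM by (auto simp: subset_iff)
qed

text \<open>Some coordinate functional is nonzero at \<open>\<one>\<close> and can be rescaled
  within \<open>M\<close>. The resulting projection onto \<open>M\<close> is the test operator for
  membership in \<open>M\<close>.\<close>

lemma (in field) exists_retraction:
  assumes M: "subfield M R" and V: "subring V R" "M \<subseteq> V" and fin: "finite_dimension M V"
  obtains T where "T \<in> End R V M" "\<And>x. x \<in> V \<Longrightarrow> T x \<in> M" "T \<one> = \<one>"
proof -
  obtain n :: nat and e T where e: "\<And>i. i < n \<Longrightarrow> e i \<in> V" and T: "\<And>i. i < n \<Longrightarrow> T i \<in> End R V M"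
    "\<And>i x. i < n \<Longrightarrow> x \<in> V \<Longrightarrow> T i x \<in> M" and exp: "\<And>x. x \<in> V \<Longrightarrow> x = (\<Oplus>i\<in>{..<n}. T i x \<otimes> e i)"
    by (rule exists_dual_basis[OF M V fin]) (rule that)
  have one: "\<one> \<in> V" by (rule subringE(3)[OF V(1)])
  have VR: "\<And>x. x \<in> V \<Longrightarrow> x \<in> carrier R" using subringE(1)[OF V(1)] by blast
  have "\<exists>i<n. T i \<one> \<noteq> \<zero>"
  proof (rule ccontr)
    assume "\<not> (\<exists>i<n. T i \<one> \<noteq> \<zero>)"
    then have "(\<Oplus>i\<in>{..<n}. T i \<one> \<otimes> e i) = (\<Oplus>i\<in>{..<n}. \<zero>)"
      by (intro finsum_cong'[OF refl]) (use e VR in auto)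
    then show False using exp[OF one] by simp
  qed
  then obtain i where i: "i < n" "T i \<one> \<noteq> \<zero>" by blast
  have t: "T i \<one> \<in> M - {\<zero>}" using T(2)[OF i(1) one] i(2) by blast
  define k where "k = inv (T i \<one>)"
  have k: "k \<in> M" "k \<otimes> T i \<one> = \<one>" using subfield_m_inv[OF M t] by (auto simp: k_def)
  define U where "U = (\<lambda>x\<in>V. k \<otimes> T i x)"
  have kV: "k \<in> V" using k V(2) by blast
  have TR: "\<And>x. x \<in> V \<Longrightarrow> T i x \<in> carrier R" using EndD(1)[OF T(1)[OF i(1)]] VR by blast
  have "U \<in> End R V M"
  proof (rule EndI)
    show "U x \<in> V" if "x \<in> V" for x
      using that subringE(6)[OF V(1) kV] EndD(1)[OF T(1)[OF i(1)]] by (simp add: U_def)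
    show "U (x \<oplus> y) = U x \<oplus> U y" if "x \<in> V" "y \<in> V" for x y
      using that subringE(7)[OF V(1) that] EndD(3)[OF T(1)[OF i(1)] that] TR[OF that(1)] TR[OF that(2)] VR[OF kV]
      by (simp add: U_def r_distr)
    show "U (m \<otimes> x) = m \<otimes> U x" if "m \<in> M" "x \<in> V" for m x
    proof -
      have m: "m \<in> V" using that V(2) by blast
      show ?thesis
        using that subringE(6)[OF V(1) m that(2)] EndD(4)[OF T(1)[OF i(1)] that] TR[OF that(2)] VR[OF kV] VR[OF m]
        by (simp add: U_def m_lcomm)
    qed
  qed (simp add: U_def)
  moreover have "U x \<in> M" if "x \<in> V" for x
    using that subringE(6)[OF subfieldE(1)[OF M] k(1) T(2)[OF i(1) that]] by (simp add: U_def)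
  moreover have "U \<one> = \<one>" using one k by (simp add: U_def)
  ultimately show ?thesis using that by blast
qed

text \<open>For a retraction \<open>T\<close> onto \<open>M\<close> the condition reads
  \<open>T x = x\<close>, and \<open>T x\<close> lies in \<open>M\<close>. This is the nontrivial
  half of the double centralizer property.\<close>

lemma (in field) commutes_with_End:
  assumes M: "subfield M R" and V: "subring V R" "M \<subseteq> V" and fin: "finite_dimension M V"
    and x: "x \<in> V" and comm: "\<And>f. f \<in> End R V M \<Longrightarrow> f x = x \<otimes> f \<one>"
  shows "x \<in> M"
proof -
  obtain T where T: "T \<in> End R V M" "\<And>x. x \<in> V \<Longrightarrow> T x \<in> M" "T \<one> = \<one>" by (rule exists_retraction[OF M V fin]) (rule that)
  have "T x = x" using comm[OF T(1)] T(3) x subringE(1)[OF V(1)] by auto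
  then show ?thesis using T(2)[OF x] by simp
qed

text \<open>
  The Jacobson--Bourbaki theorem. A maximal family of operators \<open>T\<^sub>i \<in> A\<close> and elements \<open>x\<^sub>i\<close> with
  \<open>T\<^sub>i x\<^sub>j = \<delta>\<^sub>i\<^sub>j\<close> is a basis of \<open>A\<close> over \<open>R\<close>, and the \<open>T\<^sub>i\<close> take values in the centralizer of \<open>A\<close>.
\<close>

lemma (in field) jacobson_bourbaki:
  assumes K: "subfield K R" and fin: "finite_dimension K (carrier R)"
    and A: "subring A (End_ring R (carrier R) K)" and mA: "mult_op R (carrier R) ` carrier R \<subseteq> A"
  shows "A = End R (carrier R) {x \<in> carrier R. \<forall>a\<in>A. \<forall>y\<in>carrier R. a (x \<otimes> y) = x \<otimes> a y}"
proof -
  let ?L = "carrier R"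
  define E where "E = End_ring R ?L K"
  define M where "M = {x \<in> carrier R. \<forall>a\<in>A. \<forall>y\<in>carrier R. a (x \<otimes> y) = x \<otimes> a y}"
  have KR: "K \<subseteq> ?L" by (rule subfieldE(3)[OF K])
  interpret E: ring E unfolding E_def by (rule End_ring_is_ring[OF carrier_is_subring KR])
  have A': "subring A E" using A by (simp add: E_def)
  have AE: "a \<in> End R ?L K" if "a \<in> A" for a using subringE(1)[OF A'] that by (auto simp: E_def)
  have cl: "a x \<in> ?L" if "a \<in> A" "x \<in> ?L" for a x using EndD(1)[OF AE[OF that(1)] that(2)] .
  have mult: "compose ?L a b \<in> A" if "a \<in> A" "b \<in> A" for a b using subringE(6)[OF A' that] by (simp add: E_def)
  have scal: "(\<lambda>x\<in>?L. k \<otimes> a x) \<in> A" if "a \<in> A" "k \<in> ?L" for a k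
  proof -
    have "mult_op R ?L k \<in> A" using mA that(2) by (rule subsetD[OF _ imageI])
    then have "compose ?L (mult_op R ?L k) a \<in> A" by (rule mult[OF _ that(1)])
    moreover have "compose ?L (mult_op R ?L k) a = (\<lambda>x\<in>?L. k \<otimes> a x)"
      by (rule extensionalityI[of _ ?L]) (use cl[OF that(1)] in \<open>simp_all add: compose_def mult_op_def\<close>)
    ultimately show ?thesis by simp
  qed
  have minus: "(\<lambda>x\<in>?L. a x \<ominus> b x) \<in> A" if "a \<in> A" "b \<in> A" for a b
  proof -
    have "a \<oplus>\<^bsub>E\<^esub> (\<ominus>\<^bsub>E\<^esub> b) \<in> A" using subringE(5,7)[OF A'] that by blast
    moreover have "a \<oplus>\<^bsub>E\<^esub> (\<ominus>\<^bsub>E\<^esub> b) = (\<lambda>x\<in>?L. a x \<ominus> b x)"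
      by (rule extensionalityI[of _ ?L])
        (simp_all add: E_def minus_eq End_ring_a_inv[OF carrier_is_subring KR AE[OF that(2)]])
    ultimately show ?thesis by simp
  qed
  have sums: "(\<lambda>x\<in>?L. \<Oplus>i\<in>{..<n}. f i x) \<in> A" if f: "\<And>i. i < n \<Longrightarrow> f i \<in> A" for n :: nat and f
  proof -
    have "(\<Oplus>\<^bsub>E\<^esub>i\<in>{..<n}. f i) \<in> A" by (rule E.finsum_in_subgroup[OF subring.axioms(1)[OF A']]) (use f in auto)
    moreover have "(\<Oplus>\<^bsub>E\<^esub>i\<in>{..<n}. f i) = (\<lambda>x\<in>?L. \<Oplus>i\<in>{..<n}. f i x)"
    proof (rule extensionalityI[of _ ?L])
      show "(\<Oplus>\<^bsub>E\<^esub>i\<in>{..<n}. f i) \<in> extensional ?L" using EndD(2)[OF AE] calculation by blast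
      show "(\<Oplus>\<^bsub>E\<^esub>i\<in>{..<n}. f i) x = (\<lambda>x\<in>?L. \<Oplus>i\<in>{..<n}. f i x) x" if "x \<in> ?L" for x
        unfolding E_def using End_ring_finsum[OF carrier_is_subring KR _ AE that, of "{..<n}" f] f that by simp
    qed simp
    ultimately show ?thesis by simp
  qed
  define fam where "fam n x T \<longleftrightarrow> (\<forall>i<n. x i \<in> ?L \<and> T i \<in> A) \<and> (\<forall>i<n. \<forall>j<n. T i (x j) = (if i = j then \<one> else \<zero>))"
    for n :: nat and x :: "nat \<Rightarrow> 'a" and T
  obtain d where d: "dimension d K ?L" using fin by blast
  \<comment> \<open>Applying \<open>T j\<close> to a relation among the \<open>x i\<close> with
    coefficients in \<open>K\<close> isolates the \<open>j\<close>-th coefficient. So the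
    \<open>x i\<close> are independent, families have bounded length, and a longest one
    exists.\<close>
  have bound: "n \<le> d" if "fam n x T" for n x T
  proof -
    have xL: "x i \<in> ?L" "T i \<in> A" if "i < n" for i using \<open>fam n x T\<close> that by (auto simp: fam_def)
    let ?Us = "map x [0..<n]"
    have Us: "set ?Us \<subseteq> ?L" using xL by auto
    have "independent K ?Us"
    proof (rule ccontr)
      assume "dependent K ?Us"
      then obtain Ks where Ks: "length Ks = length ?Us" "combine Ks ?Us = \<zero>" "set Ks \<subseteq> K" "set Ks \<noteq> {\<zero>}"
        using dependent_imp_non_trivial_combine[OF K Us] by blast
      have KsR: "Ks ! i \<in> ?L" "Ks ! i \<in> K" if "i < n" for i using Ks(1,3) KR that by (auto simp: subset_iff)
      have sum0: "(\<Oplus>i\<in>{..<n}. (Ks ! i) \<otimes> x i) = \<zero>"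
      proof -
        have "(\<Oplus>i\<in>{..<n}. (Ks ! i) \<otimes> x i) = (\<Oplus>i\<in>{..<length ?Us}. (Ks ! i) \<otimes> (?Us ! i))"
          by (rule finsum_cong') (use KsR xL in auto)
        then show ?thesis using combine_eq_finsum[OF Ks(1) _ Us] Ks(2,3) KR by auto
      qed
      have "Ks ! j = \<zero>" if j: "j < n" for j
      proof -
        have TE: "T j \<in> End R ?L K" using AE xL j by blast
        have "T j (\<Oplus>i\<in>{..<n}. (Ks ! i) \<otimes> x i) = (\<Oplus>i\<in>{..<n}. T j ((Ks ! i) \<otimes> x i))"
          by (rule End_sum[OF TE subring.axioms(1)[OF carrier_is_subring]]) (use KsR xL in auto)
        also have "\<dots> = (\<Oplus>i\<in>{..<n}. if j = i then Ks ! i else \<zero>)"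
          by (rule finsum_cong'[OF refl])
            (use KsR xL j EndD(4)[OF TE] \<open>fam n x T\<close> in \<open>auto simp: fam_def\<close>)
        also have "\<dots> = Ks ! j" using finsum_singleton[of j "{..<n}" "\<lambda>i. Ks ! i"] j KsR by auto
        finally show ?thesis using sum0 End_zero[OF TE subring.axioms(1)[OF carrier_is_subring]] by simp
      qed
      then have "set Ks \<subseteq> {\<zero>}" using Ks(1) by (auto simp: in_set_conv_nth)
      then have "Ks = []" using Ks(4) subset_singletonD[of "set Ks" \<zero>] by auto
      then have "?Us = []" using Ks(1) by simp
      then show False using \<open>dependent K ?Us\<close> by simp
    qed
    then show ?thesis using independent_length_le_dimension[OF K d _ Us] by simp
  qed
  have "fam 0 (\<lambda>_. \<zero>) (\<lambda>_. \<lambda>x\<in>?L. x)" by (simp add: fam_def)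
  then have P0: "\<exists>x T. fam 0 x T" by blast
  define n where "n = (GREATEST n. \<exists>x T. fam n x T)"
  have Pb: "\<And>m. \<exists>x T. fam m x T \<Longrightarrow> m \<le> d" using bound by blast
  have n: "\<exists>x T. fam n x T" "\<And>m. \<exists>x T. fam m x T \<Longrightarrow> m \<le> n"
    unfolding n_def
    by (rule GreatestI_nat[of "\<lambda>n. \<exists>x T. fam n x T", OF P0 Pb], assumption,
        rule Greatest_le_nat[of "\<lambda>n. \<exists>x T. fam n x T", OF _ Pb])
  from n(1) obtain x T where xT: "fam n x T" by blast
  have xL: "x i \<in> ?L" and TA: "T i \<in> A" if "i < n" for i using xT that by (auto simp: fam_def)
  have del: "T i (x j) = (if i = j then \<one> else \<zero>)" if "i < n" "j < n" for i j using xT that by (auto simp: fam_def)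
  \<comment> \<open>Otherwise the family could be enlarged by \<open>z\<close> and the multiple
    \<open>U\<close> of \<open>D\<close> with \<open>U z = \<one>\<close>: subtracting
    \<open>T i z\<close> times \<open>U\<close> from \<open>T i\<close> makes it vanish at
    \<open>z\<close> and keeps its values at the \<open>x j\<close>.\<close>
  have vanish: "D z = \<zero>" if D: "D \<in> A" "\<And>i. i < n \<Longrightarrow> D (x i) = \<zero>" and z: "z \<in> ?L" for D z
  proof (rule ccontr)
    assume nz: "D z \<noteq> \<zero>"
    have Dz: "D z \<in> ?L - {\<zero>}" using cl[OF D(1) z] nz by blast
    define k where "k = inv (D z)"
    have k: "k \<in> ?L" "k \<otimes> D z = \<one>" using subfield_m_inv[OF carrier_is_subfield Dz] by (auto simp: k_def)
    define U where "U = (\<lambda>y\<in>?L. k \<otimes> D y)"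
    have U: "U \<in> A" "U z = \<one>" "\<And>i. i < n \<Longrightarrow> U (x i) = \<zero>"
      using scal[OF D(1) k(1)] k D(2) z xL by (auto simp: U_def)
    define x' where "x' i = (if i < n then x i else z)" for i
    define T' where "T' i = (if i < n then (\<lambda>y\<in>?L. T i y \<ominus> (\<lambda>y\<in>?L. T i z \<otimes> U y) y) else U)" for i
    have "fam (Suc n) x' T'"
      unfolding fam_def
    proof (intro conjI allI impI)
      fix i assume "i < Suc n"
      show "x' i \<in> ?L" using xL z by (simp add: x'_def)
      show "T' i \<in> A"
        using minus[OF TA scal[OF U(1) cl[OF TA z]]] U(1) by (simp add: T'_def)
    next
      fix i j assume "i < Suc n" "j < Suc n"
      then consider "i < n" "j < n" | "i < n" "j = n" | "i = n" "j < n" | "i = n" "j = n" by linarith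
      then show "T' i (x' j) = (if i = j then \<one> else \<zero>)"
      proof cases
        case 1
        then show ?thesis using del[OF 1] U(3)[OF 1(2)] xL[OF 1(2)] cl[OF TA[OF 1(1)] z]
          by (simp add: T'_def x'_def minus_eq)
      next
        case 2
        then show ?thesis using U(2) z cl[OF TA[OF 2(1)] z] by (simp add: T'_def x'_def minus_eq r_neg)
      qed (use U in \<open>auto simp: T'_def x'_def\<close>)
    qed
    then show False using n(2)[of "Suc n"] by auto
  qed
  \<comment> \<open>The difference of the two sides is an operator of \<open>A\<close> that vanishes
    at every \<open>x j\<close>, so it is zero by maximality.\<close>
  have expand: "a z = (\<Oplus>i\<in>{..<n}. a (x i) \<otimes> T i z)" if a: "a \<in> A" and z: "z \<in> ?L" for a z
  proof -
    define B where "B = (\<lambda>z\<in>?L. \<Oplus>i\<in>{..<n}. (\<lambda>z\<in>?L. a (x i) \<otimes> T i z) z)"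
    have B: "B \<in> A" unfolding B_def by (rule sums) (rule scal[OF TA cl[OF a xL]])
    have Bz: "B z = (\<Oplus>i\<in>{..<n}. a (x i) \<otimes> T i z)" if "z \<in> ?L" for z
      using that by (simp add: B_def)
    have "(\<lambda>z\<in>?L. a z \<ominus> B z) z = \<zero>"
    proof (rule vanish[OF minus[OF a B] _ z])
      fix j assume j: "j < n"
      have "B (x j) = (\<Oplus>i\<in>{..<n}. if j = i then a (x i) else \<zero>)"
        unfolding Bz[OF xL[OF j]]
        by (rule finsum_cong'[OF refl]) (use del j cl[OF a] xL in auto)
      also have "\<dots> = a (x j)" using finsum_singleton[of j "{..<n}" "\<lambda>i. a (x i)"] j cl[OF a] xL by auto
      finally show "(\<lambda>z\<in>?L. a z \<ominus> B z) (x j) = \<zero>" using xL[OF j] cl[OF a xL[OF j]] by (simp add: minus_eq r_neg)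
    qed
    then show ?thesis using z cl[OF a z] cl[OF B z] Bz[OF z] by simp
  qed
  \<comment> \<open>The operator \<open>b\<close>, which is \<open>a\<close> after \<open>y\<close>
    times \<open>T j\<close>, belongs to \<open>A\<close> and takes the value \<open>a y\<close> at
    \<open>x j\<close> and 0 at the other \<open>x i\<close>. Expanding \<open>b z\<close> gives
    \<open>a(y T\<^sub>j(z)) = a(y) T\<^sub>j(z)\<close>.\<close>
  have TM: "T j z \<in> M" if j: "j < n" and z: "z \<in> ?L" for j z
    unfolding M_def
  proof (intro CollectI conjI ballI)
    show TL: "T j z \<in> ?L" by (rule cl[OF TA[OF j] z])
    fix a y assume a: "a \<in> A" and y: "y \<in> ?L"
    define b where "b = compose ?L a (\<lambda>z\<in>?L. y \<otimes> T j z)"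
    have b: "b \<in> A" unfolding b_def by (rule mult[OF a scal[OF TA[OF j] y]])
    have bx: "b w = a (y \<otimes> T j w)" if "w \<in> ?L" for w using that by (simp add: b_def compose_def)
    have a0: "a \<zero> = \<zero>" by (rule End_zero[OF AE[OF a] subring.axioms(1)[OF carrier_is_subring]])
    have "a (y \<otimes> T j z) = (\<Oplus>i\<in>{..<n}. b (x i) \<otimes> T i z)" using expand[OF b z] bx[OF z] by simp
    also have "\<dots> = (\<Oplus>i\<in>{..<n}. if j = i then a y \<otimes> T i z else \<zero>)"
    proof (rule finsum_cong'[OF refl])
      fix i assume i: "i \<in> {..<n}"
      then show "b (x i) \<otimes> T i z = (if j = i then a y \<otimes> T i z else \<zero>)"
        using bx[OF xL] del[OF j] a0 y cl[OF TA z] by auto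
    qed (use cl[OF a y] cl[OF TA z] in auto)
    also have "\<dots> = a y \<otimes> T j z"
      using finsum_singleton[of j "{..<n}" "\<lambda>i. a y \<otimes> T i z"] j cl[OF a y] cl[OF TA z] by auto
    finally show "a (T j z \<otimes> y) = T j z \<otimes> a y" using y TL cl[OF a y] by (simp add: m_comm)
  qed
  have "A \<subseteq> End R ?L M"
  proof
    fix a assume a: "a \<in> A"
    show "a \<in> End R ?L M" by (rule EndI) (use EndD[OF AE[OF a]] a in \<open>auto simp: M_def\<close>)
  qed
  moreover have "End R ?L M \<subseteq> A"
  proof
    fix f assume f: "f \<in> End R ?L M"
    have id: "(\<lambda>z\<in>?L. z) \<in> A" using subringE(3)[OF A'] by (simp add: E_def)
    \<comment> \<open>The expansion of the identity, an element of \<open>A\<close>, is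
      \<open>z = \<Sum> T\<^sub>i(z) x\<^sub>i\<close>; its coefficients lie in \<open>M\<close>,
      and the \<open>M\<close>-linear \<open>f\<close> pulls them out.\<close>
    have "f = (\<lambda>z\<in>?L. \<Oplus>i\<in>{..<n}. (\<lambda>z\<in>?L. f (x i) \<otimes> T i z) z)"
    proof (rule extensionalityI[of _ ?L])
      fix z assume z: "z \<in> ?L"
      have "z = (\<Oplus>i\<in>{..<n}. T i z \<otimes> x i)"
      proof -
        have "z = (\<Oplus>i\<in>{..<n}. (\<lambda>z\<in>?L. z) (x i) \<otimes> T i z)" using expand[OF id z] z by simp
        also have "\<dots> = (\<Oplus>i\<in>{..<n}. T i z \<otimes> x i)"
          by (rule finsum_cong'[OF refl]) (use xL cl[OF TA z] in \<open>auto simp: m_comm\<close>)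
        finally show ?thesis .
      qed
      then have "f z = f (\<Oplus>i\<in>{..<n}. T i z \<otimes> x i)" by simp
      also have "\<dots> = (\<Oplus>i\<in>{..<n}. f (T i z \<otimes> x i))"
        by (rule End_sum[OF f subring.axioms(1)[OF carrier_is_subring]]) (use cl[OF TA z] xL in auto)
      also have "\<dots> = (\<Oplus>i\<in>{..<n}. f (x i) \<otimes> T i z)"
        by (rule finsum_cong'[OF refl]) (use EndD(4)[OF f TM[OF _ z] xL] EndD(1)[OF f xL] cl[OF TA z] in \<open>auto simp: m_comm\<close>)
      finally show "f z = (\<lambda>z\<in>?L. \<Oplus>i\<in>{..<n}. (\<lambda>z\<in>?L. f (x i) \<otimes> T i z) z) z" using z by simp
    qed (use EndD(2)[OF f] in auto)
    also have "\<dots> \<in> A" by (rule sums) (rule scal[OF TA EndD(1)[OF f xL]])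
    finally show "f \<in> A" .
  qed
  ultimately show ?thesis unfolding M_def by blast
qed

lemma (in field) finite_dimension_over_intermediate:
  assumes K: "subfield K R" and M: "subfield M R" "K \<subseteq> M" and V: "subring V R" "M \<subseteq> V" and fin: "finite_dimension K V"
  shows "finite_dimension M V"
proof -
  obtain d Us where Us: "set Us \<subseteq> carrier R" "Span K Us = V"
    using fin exists_base[OF K] by (metis finite_dimensionE')
  have UV: "set Us \<subseteq> V" using Span_base_incl[OF K Us(1)] Us(2) by simp
  have sa: "subalgebra M V R"
    using subring.axioms(1)[OF V(1)] subringE(6)[OF V(1)] V(2)
    by (intro subalgebra.intro) (auto simp: subalgebra_axioms_def)
  have "subalgebra K (Span M Us) R"
    using Span_is_subalgebra[OF M(1) Us(1)] M(2) by (auto simp: subalgebra_def subalgebra_axioms_def)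
  then have "V \<subseteq> Span M Us"
    using subalgebra_Span_incl[OF K _ Span_base_incl[OF M(1) Us(1)]] unfolding Us(2) by blast
  then have "V = Span M Us" using subalgebra_Span_incl[OF M(1) sa UV] by blast
  then show ?thesis using Span_finite_dimension[OF M(1) Us(1)] by simp
qed

context normal_extension begin

section \<open>Linear disjointness of the inseparable and the separable part\<close>

lemma Tr_lin_comb:
  assumes "finite I" "\<And>i. i \<in> I \<Longrightarrow> a i \<in> Fix" "\<And>i. i \<in> I \<Longrightarrow> c i \<in> carrier R"
  shows "Tr (\<Oplus>i\<in>I. a i \<otimes> c i) = (\<Oplus>i\<in>I. a i \<otimes> Tr (c i))"
  using assms
proof (induction I rule: finite_induct)
  case empty
  have "Tr \<zero> = Tr (\<zero> \<otimes> \<zero>)" by simp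
  also have "\<dots> = \<zero> \<otimes> Tr \<zero>"
    by (rule Tr_mult[OF subringE(2)[OF subfieldE(1)[OF Fix_subfield]] zero_closed])
  also have "\<dots> = \<zero>" using Fix_R[OF Tr_Fix[OF zero_closed]] by simp
  finally show ?case by simp
next
  case (insert i I)
  have cl: "\<And>j. j \<in> insert i I \<Longrightarrow> a j \<otimes> c j \<in> carrier R" "\<And>j. j \<in> insert i I \<Longrightarrow> a j \<otimes> Tr (c j) \<in> carrier R"
    using insert.prems Fix_R Tr_Fix by blast+
  have "(\<Oplus>j\<in>insert i I. a j \<otimes> c j) = a i \<otimes> c i \<oplus> (\<Oplus>j\<in>I. a j \<otimes> c j)"
    by (rule finsum_insert) (use insert.hyps cl in auto)
  moreover have "Tr (a i \<otimes> c i \<oplus> (\<Oplus>j\<in>I. a j \<otimes> c j)) = Tr (a i \<otimes> c i) \<oplus> Tr (\<Oplus>j\<in>I. a j \<otimes> c j)"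
    by (rule Tr_add) (use cl in auto)
  moreover have "Tr (a i \<otimes> c i) = a i \<otimes> Tr (c i)" by (rule Tr_mult) (use insert.prems in auto)
  moreover have "Tr (\<Oplus>j\<in>I. a j \<otimes> c j) = (\<Oplus>j\<in>I. a j \<otimes> Tr (c j))" by (rule insert.IH) (use insert.prems in auto)
  moreover have "(\<Oplus>j\<in>insert i I. a j \<otimes> Tr (c j)) = a i \<otimes> Tr (c i) \<oplus> (\<Oplus>j\<in>I. a j \<otimes> Tr (c j))"
    by (rule finsum_insert) (use insert.hyps cl in auto)
  ultimately show ?case by simp
qed

text \<open>With \<open>Tr t = \<one>\<close> take \<open>w = s\<^sup>-\<^sup>1 t\<^sup>q\<close>:
  then \<open>w s = t\<^sup>q\<close> has trace \<open>(Tr t)\<^sup>q\<close>. The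
  \<open>q\<close>-th power keeps \<open>w\<close> inside \<open>S\<close>.\<close>

lemma exists_trace_functional:
  assumes s: "s \<in> S" "s \<noteq> \<zero>"
  obtains w where "w \<in> S" "Tr (w \<otimes> s) = \<one>"
proof -
  obtain t where t: "t \<in> carrier R" "Tr t = \<one>" by (rule exists_trace_one)
  have inv: "inv s \<in> S" "inv s \<otimes> s = \<one>" using subfield_m_inv[OF S_subfield, of s] s by auto
  have "inv s \<otimes> t [^] q \<in> S" by (rule subringE(6)[OF subfieldE(1)[OF S_subfield] inv(1) q_S[OF t(1)]])
  moreover have "(inv s \<otimes> t [^] q) \<otimes> s = t [^] q"
    using inv S_R[OF inv(1)] S_R[OF s(1)] t(1) by (metis m_assoc m_comm nat_pow_closed l_one)
  ultimately show ?thesis using that Tr_pow[OF t(1)] t(2) by simp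
qed

text \<open>The map \<open>x \<mapsto> Tr(w x)\<close> is linear over \<open>Fix\<close>, sends
  \<open>S\<close> into \<open>K\<close>, and is normalized to 1 at \<open>b i\<close>; it turns the
  relation into one with the coefficients \<open>c\<^sub>j = Tr(w b\<^sub>j)\<close>. They are found
  before the \<open>a\<^sub>j\<close> are given: for operators a single choice has to serve the
  relations at all points.\<close>

lemma linearly_disjoint:
  assumes I: "finite I" and b: "\<And>i. i \<in> I \<Longrightarrow> b i \<in> S" and i: "i \<in> I" "b i \<noteq> \<zero>"
  shows "\<exists>c. (\<forall>j\<in>I. c j \<in> K) \<and> c i = \<one> \<and>
    (\<forall>a. (\<forall>j\<in>I. a j \<in> Fix) \<longrightarrow> (\<Oplus>j\<in>I. a j \<otimes> b j) = \<zero> \<longrightarrow> (\<Oplus>j\<in>I. c j \<otimes> a j) = \<zero>)"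
proof -
  obtain w where w: "w \<in> S" "Tr (w \<otimes> b i) = \<one>" using exists_trace_functional[OF b[OF i(1)] i(2)] .
  have wR: "w \<in> carrier R" by (rule S_R[OF w(1)])
  define c where "c j = Tr (w \<otimes> b j)" for j
  have c: "c j \<in> K" if "j \<in> I" for j
    unfolding c_def by (rule Tr_S[OF subringE(6)[OF subfieldE(1)[OF S_subfield] w(1) b[OF that]]])
  have "(\<Oplus>j\<in>I. c j \<otimes> a j) = \<zero>" if a: "\<And>j. j \<in> I \<Longrightarrow> a j \<in> Fix" and sum: "(\<Oplus>j\<in>I. a j \<otimes> b j) = \<zero>" for a
  proof -
    have bR: "\<And>j. j \<in> I \<Longrightarrow> b j \<in> carrier R" and aR: "\<And>j. j \<in> I \<Longrightarrow> a j \<in> carrier R" using b S_R a Fix_R by auto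
    have cR: "\<And>j. j \<in> I \<Longrightarrow> c j \<in> carrier R" using c KR by blast
    have "(\<Oplus>j\<in>I. c j \<otimes> a j) = (\<Oplus>j\<in>I. a j \<otimes> c j)"
      by (rule finsum_cong'[OF refl]) (use aR cR in \<open>auto simp: m_comm\<close>)
    also have "\<dots> = Tr (\<Oplus>j\<in>I. a j \<otimes> (w \<otimes> b j))"
      unfolding c_def by (rule Tr_lin_comb[OF I a, symmetric]) (use wR bR in auto)
    also have "(\<Oplus>j\<in>I. a j \<otimes> (w \<otimes> b j)) = (\<Oplus>j\<in>I. w \<otimes> (a j \<otimes> b j))"
      by (rule finsum_cong'[OF refl]) (use wR bR aR in \<open>auto simp: m_lcomm\<close>)
    also have "\<dots> = w \<otimes> (\<Oplus>j\<in>I. a j \<otimes> b j)"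
      by (rule finsum_rdistr[OF I wR, symmetric]) (use bR aR in auto)
    also have "\<dots> = \<zero>" using sum wR by simp
    also have "Tr \<zero> = \<zero>" using Tr_lin_comb[of "{}" "\<lambda>_. \<zero>" "\<lambda>_. \<zero>"] by simp
    finally show ?thesis .
  qed
  moreover have "c i = \<one>" using w(2) by (simp add: c_def)
  ultimately show ?thesis using c by blast
qed

text \<open>Products from the two fields span a ring that is algebraic over \<open>K\<close>, hence
  a field, and so the compositum consists of sums of products. Injectivity is
  \<open>linearly_disjoint\<close>, read for elements of the two subfields.\<close>

lemma tensor_iso_fields:
  assumes N: "subfield N R" "K \<subseteq> N" "N \<subseteq> Fix" and \<Gamma>: "subfield \<Gamma> R" "K \<subseteq> \<Gamma>" "\<Gamma> \<subseteq> S"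
  shows "tensor_iso R K N \<Gamma> (compositum R N \<Gamma>)" and "compositum R N \<Gamma> = prod_span R N \<Gamma>"
proof -
  have sN: "subring N R" and sG: "subring \<Gamma> R" by (rule subfieldE(1)[OF N(1)], rule subfieldE(1)[OF \<Gamma>(1)])
  have NR: "N \<subseteq> carrier R" and GR: "\<Gamma> \<subseteq> carrier R" by (rule subfieldE(3)[OF N(1)], rule subfieldE(3)[OF \<Gamma>(1)])
  let ?P = "prod_span R N \<Gamma>"
  have sgP: "subgroup ?P (add_monoid R)" by (rule prod_span_subgroup[OF NR GR])
  have PR: "?P \<subseteq> carrier R" using subgroup.subset[OF sgP] by simp
  have one: "\<one> \<in> N" "\<one> \<in> \<Gamma>" by (rule subringE(3)[OF sN], rule subringE(3)[OF sG])
  have NP: "N \<subseteq> ?P"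
  proof
    fix x assume x: "x \<in> N"
    then have "x \<otimes> \<one> \<in> ?P" using one(2) by (rule prod_in_prod_span)
    then show "x \<in> ?P" using x NR by auto
  qed
  have GP: "\<Gamma> \<subseteq> ?P"
  proof
    fix x assume x: "x \<in> \<Gamma>"
    have "\<one> \<otimes> x \<in> ?P" using one(1) x by (rule prod_in_prod_span)
    then show "x \<in> ?P" using x GR by auto
  qed
  have mult: "x \<otimes> y \<in> ?P" if "x \<in> ?P" "y \<in> ?P" for x y
    by (rule prod_span_mult_closed[OF NR subringE(6)[OF sN] GR subringE(6)[OF sG] _ that])
      (use NR GR in \<open>auto intro: m_comm\<close>)
  have "subring ?P R"
  proof (rule subringI[OF PR])
    show "\<one> \<in> ?P" using one NP by blast
    show "\<ominus> h \<in> ?P" if "h \<in> ?P" for h using subgroup.m_inv_closed[OF sgP that] by (simp add: a_inv_def)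
    show "h \<oplus> k \<in> ?P" if "h \<in> ?P" "k \<in> ?P" for h k using subgroup.m_closed[OF sgP that] by simp
  qed (rule mult)
  then have fP: "subfield ?P R"
    by (rule algebraic_subring_is_subfield[OF K _ subset_trans[OF N(2) NP] alg]) (use PR in blast)
  show eq: "compositum R N \<Gamma> = ?P"
    unfolding compositum_def
  proof
    have NGR: "N \<union> \<Gamma> \<subseteq> carrier R" using NR GR by blast
    show "generate_field R (N \<union> \<Gamma>) \<subseteq> ?P"
      by (rule generate_field_min_subfield1[OF NGR fP]) (use NP GP in blast)
    have g: "subfield (generate_field R (N \<union> \<Gamma>)) R" by (rule generate_field_is_subfield[OF NGR])
    show "?P \<subseteq> generate_field R (N \<union> \<Gamma>)"
      by (rule prod_span_subset[OF subring.axioms(1)[OF subfieldE(1)[OF g]]])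
        (intro generate_field.eng_mult generate_field.incl UnI1 UnI2)
  qed
  have "tensor_iso R K N \<Gamma> ?P"
  proof (rule tensor_isoI)
    show "subgroup N (add_monoid R)" "subgroup \<Gamma> (add_monoid R)"
      by (rule subring.axioms(1)[OF sN], rule subring.axioms(1)[OF sG])
    show "K \<subseteq> carrier R" by (rule KR)
    show "k \<otimes> a \<in> N" if "k \<in> K" "a \<in> N" for k a using subringE(6)[OF sN] that N(2) by blast
    show "k \<otimes> a \<in> \<Gamma>" if "k \<in> K" "a \<in> \<Gamma>" for k a using subringE(6)[OF sG] that \<Gamma>(2) by blast
    show "k \<otimes> a = a \<otimes> k" if "k \<in> K" "a \<in> N" for k a using that KR NR by (intro m_comm) auto
    fix I :: "nat set" and a b i
    assume I: "finite I" and a: "\<And>i. i \<in> I \<Longrightarrow> a i \<in> N" and b: "\<And>i. i \<in> I \<Longrightarrow> b i \<in> \<Gamma>"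
      and sum: "(\<Oplus>i\<in>I. a i \<otimes> b i) = \<zero>" and i: "i \<in> I" "b i \<noteq> \<zero>"
    have bS: "\<And>i. i \<in> I \<Longrightarrow> b i \<in> S" and aF: "\<And>i. i \<in> I \<Longrightarrow> a i \<in> Fix" using a b N(3) \<Gamma>(3) by blast+
    obtain c where c: "\<forall>j\<in>I. c j \<in> K" "c i = \<one>"
      "\<forall>a. (\<forall>j\<in>I. a j \<in> Fix) \<longrightarrow> (\<Oplus>j\<in>I. a j \<otimes> b j) = \<zero> \<longrightarrow> (\<Oplus>j\<in>I. c j \<otimes> a j) = \<zero>"
      using linearly_disjoint[of I b i, OF I bS i] by blast
    then show "\<exists>c. (\<forall>j\<in>I. c j \<in> K) \<and> (\<Oplus>j\<in>I. c j \<otimes> a j) = \<zero> \<and> c i = \<one>"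
      using sum aF by blast
  qed
  then show "tensor_iso R K N \<Gamma> (compositum R N \<Gamma>)" unfolding eq .
qed

section \<open>Operators on the two factors\<close>

abbreviation E where "E \<equiv> End_ring R (carrier R) K"
abbreviation eL where "eL \<equiv> embed_left R K Fix S"
abbreviation eR where "eR \<equiv> embed_right R K Fix S"

lemma E_ring: "ring E"
  by (rule End_ring_is_ring[OF carrier_is_subring KR])

lemma add_sub: "subgroup (carrier R) (add_monoid R)" "subgroup Fix (add_monoid R)" "subgroup S (add_monoid R)"
  using subring.axioms(1)[OF carrier_is_subring] subring.axioms(1)[OF subfieldE(1)[OF Fix_subfield]]
    subring.axioms(1)[OF subfieldE(1)[OF S_subfield]] by blast+

text \<open>Every element is a sum of products of a fixed element and an element of
  \<open>S\<close>. This is the uniqueness behind the definite descriptions of the embedded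
  operators.\<close>

lemma End_product_eqI:
  assumes f: "f \<in> End R (carrier R) K" and g: "g \<in> End R (carrier R) K"
    and eq: "\<And>x y. x \<in> Fix \<Longrightarrow> y \<in> S \<Longrightarrow> f (x \<otimes> y) = g (x \<otimes> y)"
  shows "f = g"
proof (rule End_eqI[OF f g])
  fix z assume z: "z \<in> carrier R"
  obtain n :: nat and U V where UV: "\<And>i. U i \<in> S" "\<And>i. V i \<in> S"
    "\<And>z. z \<in> carrier R \<Longrightarrow> z = (\<Oplus>i\<in>{..<n}. U i \<otimes> Tr (V i \<otimes> z))"
    by (rule exists_S_family) (rule that)
  have tr: "Tr (V i \<otimes> z) \<in> Fix" "Tr (V i \<otimes> z) \<in> carrier R" for i using Tr_Fix Fix_R z S_R[OF UV(2)] by auto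
  have "z = (\<Oplus>i\<in>{..<n}. U i \<otimes> Tr (V i \<otimes> z))" by (rule UV(3)[OF z])
  also have "\<dots> = (\<Oplus>i\<in>{..<n}. Tr (V i \<otimes> z) \<otimes> U i)"
    by (rule finsum_cong'[OF refl]) (use tr S_R[OF UV(1)] in \<open>auto simp: m_comm\<close>)
  finally have z': "z = (\<Oplus>i\<in>{..<n}. Tr (V i \<otimes> z) \<otimes> U i)" .
  have "h z = (\<Oplus>i\<in>{..<n}. h (Tr (V i \<otimes> z) \<otimes> U i))" if "h \<in> End R (carrier R) K" for h
    by (subst z', rule End_sum[OF that add_sub(1)]) (use tr S_R[OF UV(1)] in auto)
  from this[OF f] this[OF g] show "f z = g z" using eq[OF tr(1) UV(1)] by simp
qed

text \<open>The formula \<open>z \<mapsto> \<Sum> U\<^sub>i a(Tr(V\<^sub>i z))\<close> defines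
  \<open>a \<otimes> 1\<close>: on a product, \<open>Tr(V\<^sub>i x y) = x Tr(V\<^sub>i y)\<close>
  with \<open>Tr(V\<^sub>i y) \<in> K\<close>, so the \<open>K\<close>-linear \<open>a\<close> gives
  \<open>a(x) Tr(V\<^sub>i y)\<close>, and the expansion of \<open>y\<close> reassembles.\<close>

lemma embed_left_ex:
  assumes a: "a \<in> End R Fix K"
  shows "\<exists>\<phi>. \<phi> \<in> End R (carrier R) K \<and> (\<forall>x\<in>Fix. \<forall>y\<in>S. \<phi> (x \<otimes> y) = a x \<otimes> y)"
proof -
  obtain n :: nat and U V where UV: "\<And>i. U i \<in> S" "\<And>i. V i \<in> S"
    "\<And>z. z \<in> carrier R \<Longrightarrow> z = (\<Oplus>i\<in>{..<n}. U i \<otimes> Tr (V i \<otimes> z))"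
    by (rule exists_S_family) (rule that)
  note U = S_R[OF UV(1)] and V = S_R[OF UV(2)]
  have tr: "Tr (V i \<otimes> z) \<in> Fix" if "z \<in> carrier R" for i z using Tr_Fix V that by auto
  have aR: "a x \<in> carrier R" if "x \<in> Fix" for x using Fix_R[OF EndD(1)[OF a that]] .
  define \<phi> where "\<phi> = (\<lambda>z\<in>carrier R. \<Oplus>i\<in>{..<n}. U i \<otimes> a (Tr (V i \<otimes> z)))"
  have cl: "(\<lambda>i. U i \<otimes> a (Tr (V i \<otimes> z))) \<in> {..<n} \<rightarrow> carrier R" if "z \<in> carrier R" for z
    using U aR[OF tr[OF that]] by auto
  have "\<phi> \<in> End R (carrier R) K"
  proof (rule EndI)
    show "\<phi> z \<in> carrier R" if "z \<in> carrier R" for z using finsum_closed[OF cl[OF that]] that by (simp add: \<phi>_def)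
    show "\<phi> \<in> extensional (carrier R)" by (simp add: \<phi>_def)
    fix x assume x: "x \<in> carrier R"
    show "\<phi> (x \<oplus> y) = \<phi> x \<oplus> \<phi> y" if y: "y \<in> carrier R" for y
    proof -
      have "U i \<otimes> a (Tr (V i \<otimes> (x \<oplus> y))) = U i \<otimes> a (Tr (V i \<otimes> x)) \<oplus> U i \<otimes> a (Tr (V i \<otimes> y))" for i
        using EndD(3)[OF a tr[OF x] tr[OF y], of i i] Tr_add[of "V i \<otimes> x" "V i \<otimes> y"] V[of i] U[of i] x y
          aR[OF tr[OF x]] aR[OF tr[OF y]] by (simp add: r_distr)
      then show ?thesis using x y finsum_addf[OF cl[OF x] cl[OF y]] by (simp add: \<phi>_def)
    qed
    show "\<phi> (k \<otimes> x) = k \<otimes> \<phi> x" if k: "k \<in> K" for k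
    proof -
      have kR: "k \<in> carrier R" "k \<in> Fix" using k KR K_Fix by auto
      have "U i \<otimes> a (Tr (V i \<otimes> (k \<otimes> x))) = k \<otimes> (U i \<otimes> a (Tr (V i \<otimes> x)))" for i
      proof -
        have "V i \<otimes> (k \<otimes> x) = k \<otimes> (V i \<otimes> x)" using V[of i] kR x by (simp add: m_lcomm)
        then have "a (Tr (V i \<otimes> (k \<otimes> x))) = k \<otimes> a (Tr (V i \<otimes> x))"
          using Tr_mult[OF kR(2), of "V i \<otimes> x"] V x EndD(4)[OF a k tr[OF x]] by simp
        then show ?thesis using U[of i] kR aR[OF tr[OF x]] by (simp add: m_lcomm)
      qed
      then show ?thesis using kR x finsum_rdistr[OF _ kR(1) cl[OF x]] by (simp add: \<phi>_def)
    qed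
  qed
  moreover have "\<phi> (x \<otimes> y) = a x \<otimes> y" if x: "x \<in> Fix" and y: "y \<in> S" for x y
  proof -
    have xR: "x \<in> carrier R" and yR: "y \<in> carrier R" by (rule Fix_R[OF x], rule S_R[OF y])
    have cK: "Tr (V i \<otimes> y) \<in> K" for i
      by (rule Tr_S[OF subringE(6)[OF subfieldE(1)[OF S_subfield] UV(2) y]])
    have cR: "Tr (V i \<otimes> y) \<in> carrier R" for i using cK KR by blast
    have "U i \<otimes> a (Tr (V i \<otimes> (x \<otimes> y))) = a x \<otimes> (U i \<otimes> Tr (V i \<otimes> y))" for i
    proof -
      have "V i \<otimes> (x \<otimes> y) = x \<otimes> (V i \<otimes> y)" using V[of i] xR yR by (simp add: m_lcomm)
      then have "Tr (V i \<otimes> (x \<otimes> y)) = Tr (V i \<otimes> y) \<otimes> x"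
        using Tr_mult[OF x, of "V i \<otimes> y"] V yR xR cR by (simp add: m_comm)
      then have "a (Tr (V i \<otimes> (x \<otimes> y))) = Tr (V i \<otimes> y) \<otimes> a x" using EndD(4)[OF a cK x] by simp
      then show ?thesis using U[of i] cR aR[OF x] by (simp add: m_ac)
    qed
    then have "\<phi> (x \<otimes> y) = (\<Oplus>i\<in>{..<n}. a x \<otimes> (U i \<otimes> Tr (V i \<otimes> y)))" using xR yR by (simp add: \<phi>_def)
    also have "\<dots> = a x \<otimes> (\<Oplus>i\<in>{..<n}. U i \<otimes> Tr (V i \<otimes> y))"
      by (rule finsum_rdistr[symmetric]) (use aR[OF x] U cR in auto)
    also have "(\<Oplus>i\<in>{..<n}. U i \<otimes> Tr (V i \<otimes> y)) = y" by (rule UV(3)[OF yR, symmetric])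
    finally show ?thesis .
  qed
  ultimately show ?thesis by blast
qed

text \<open>Here the operator acts on the separable members:
  \<open>z \<mapsto> \<Sum> b(U\<^sub>i) Tr(V\<^sub>i z)\<close>. On a product the scalars
  \<open>Tr(V\<^sub>i y) \<in> K\<close> can be moved inside \<open>b\<close>, where the expansion
  of \<open>y\<close> appears.\<close>

lemma embed_right_ex:
  assumes b: "b \<in> End R S K"
  shows "\<exists>\<phi>. \<phi> \<in> End R (carrier R) K \<and> (\<forall>x\<in>Fix. \<forall>y\<in>S. \<phi> (x \<otimes> y) = x \<otimes> b y)"
proof -
  obtain n :: nat and U V where UV: "\<And>i. U i \<in> S" "\<And>i. V i \<in> S"
    "\<And>z. z \<in> carrier R \<Longrightarrow> z = (\<Oplus>i\<in>{..<n}. U i \<otimes> Tr (V i \<otimes> z))"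
    by (rule exists_S_family) (rule that)
  note U = S_R[OF UV(1)] and V = S_R[OF UV(2)]
  have tr: "Tr (V i \<otimes> z) \<in> carrier R" if "z \<in> carrier R" for i z using Fix_R Tr_Fix V that by auto
  have bR: "b y \<in> carrier R" if "y \<in> S" for y using S_R[OF EndD(1)[OF b that]] .
  define \<phi> where "\<phi> = (\<lambda>z\<in>carrier R. \<Oplus>i\<in>{..<n}. b (U i) \<otimes> Tr (V i \<otimes> z))"
  have cl: "(\<lambda>i. b (U i) \<otimes> Tr (V i \<otimes> z)) \<in> {..<n} \<rightarrow> carrier R" if "z \<in> carrier R" for z
    using bR[OF UV(1)] tr[OF that] by auto
  have "\<phi> \<in> End R (carrier R) K"
  proof (rule EndI)
    show "\<phi> z \<in> carrier R" if "z \<in> carrier R" for z using finsum_closed[OF cl[OF that]] that by (simp add: \<phi>_def)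
    show "\<phi> \<in> extensional (carrier R)" by (simp add: \<phi>_def)
    fix x assume x: "x \<in> carrier R"
    show "\<phi> (x \<oplus> y) = \<phi> x \<oplus> \<phi> y" if y: "y \<in> carrier R" for y
    proof -
      have "b (U i) \<otimes> Tr (V i \<otimes> (x \<oplus> y)) = b (U i) \<otimes> Tr (V i \<otimes> x) \<oplus> b (U i) \<otimes> Tr (V i \<otimes> y)" for i
        using Tr_add[of "V i \<otimes> x" "V i \<otimes> y"] V[of i] bR[OF UV(1)[of i]] x y
          tr[OF x] tr[OF y] by (simp add: r_distr)
      then show ?thesis using x y finsum_addf[OF cl[OF x] cl[OF y]] by (simp add: \<phi>_def)
    qed
    show "\<phi> (k \<otimes> x) = k \<otimes> \<phi> x" if k: "k \<in> K" for k
    proof -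
      have kR: "k \<in> carrier R" "k \<in> Fix" using k KR K_Fix by auto
      have "b (U i) \<otimes> Tr (V i \<otimes> (k \<otimes> x)) = k \<otimes> (b (U i) \<otimes> Tr (V i \<otimes> x))" for i
      proof -
        have "V i \<otimes> (k \<otimes> x) = k \<otimes> (V i \<otimes> x)" using V[of i] kR x by (simp add: m_lcomm)
        then have "Tr (V i \<otimes> (k \<otimes> x)) = k \<otimes> Tr (V i \<otimes> x)"
          using Tr_mult[OF kR(2), of "V i \<otimes> x"] V x by simp
        then show ?thesis using bR[OF UV(1)[of i]] kR tr[OF x] by (simp add: m_lcomm)
      qed
      then show ?thesis using kR x finsum_rdistr[OF _ kR(1) cl[OF x]] by (simp add: \<phi>_def)
    qed
  qed
  moreover have "\<phi> (x \<otimes> y) = x \<otimes> b y" if x: "x \<in> Fix" and y: "y \<in> S" for x y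
  proof -
    have xR: "x \<in> carrier R" and yR: "y \<in> carrier R" by (rule Fix_R[OF x], rule S_R[OF y])
    have cK: "Tr (V i \<otimes> y) \<in> K" for i
      by (rule Tr_S[OF subringE(6)[OF subfieldE(1)[OF S_subfield] UV(2) y]])
    have cR: "Tr (V i \<otimes> y) \<in> carrier R" and cS: "Tr (V i \<otimes> y) \<in> S" for i using cK KR K_S by blast+
    have "b (U i) \<otimes> Tr (V i \<otimes> (x \<otimes> y)) = x \<otimes> b (Tr (V i \<otimes> y) \<otimes> U i)" for i
    proof -
      have "V i \<otimes> (x \<otimes> y) = x \<otimes> (V i \<otimes> y)" using V[of i] xR yR by (simp add: m_lcomm)
      then have "Tr (V i \<otimes> (x \<otimes> y)) = x \<otimes> Tr (V i \<otimes> y)"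
        using Tr_mult[OF x, of "V i \<otimes> y"] V yR by simp
      moreover have "b (Tr (V i \<otimes> y) \<otimes> U i) = Tr (V i \<otimes> y) \<otimes> b (U i)" by (rule EndD(4)[OF b cK UV(1)])
      ultimately show ?thesis using cR[of i] xR bR[OF UV(1)[of i]] by (simp add: m_ac)
    qed
    then have "\<phi> (x \<otimes> y) = (\<Oplus>i\<in>{..<n}. x \<otimes> b (Tr (V i \<otimes> y) \<otimes> U i))" using xR yR by (simp add: \<phi>_def)
    also have "\<dots> = x \<otimes> (\<Oplus>i\<in>{..<n}. b (Tr (V i \<otimes> y) \<otimes> U i))"
      by (rule finsum_rdistr[symmetric])
        (use xR bR subringE(6)[OF subfieldE(1)[OF S_subfield] cS UV(1)] in auto)
    also have "(\<Oplus>i\<in>{..<n}. b (Tr (V i \<otimes> y) \<otimes> U i)) = b (\<Oplus>i\<in>{..<n}. Tr (V i \<otimes> y) \<otimes> U i)"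
      by (rule End_sum[OF b add_sub(3), symmetric]) (use subringE(6)[OF subfieldE(1)[OF S_subfield] cS UV(1)] in auto)
    also have "(\<Oplus>i\<in>{..<n}. Tr (V i \<otimes> y) \<otimes> U i) = (\<Oplus>i\<in>{..<n}. U i \<otimes> Tr (V i \<otimes> y))"
      by (rule finsum_cong'[OF refl]) (use U cR in \<open>auto simp: m_comm\<close>)
    also have "\<dots> = y" by (rule UV(3)[OF yR, symmetric])
    finally show ?thesis .
  qed
  ultimately show ?thesis by blast
qed

lemma embed_left:
  assumes a: "a \<in> End R Fix K"
  shows "eL a \<in> End R (carrier R) K" and "\<And>x y. x \<in> Fix \<Longrightarrow> y \<in> S \<Longrightarrow> eL a (x \<otimes> y) = a x \<otimes> y"
    and "\<And>f. f \<in> End R (carrier R) K \<Longrightarrow> (\<And>x y. x \<in> Fix \<Longrightarrow> y \<in> S \<Longrightarrow> f (x \<otimes> y) = a x \<otimes> y) \<Longrightarrow> eL a = f"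
proof -
  have "\<exists>!\<phi>. \<phi> \<in> End R (carrier R) K \<and> (\<forall>x\<in>Fix. \<forall>y\<in>S. \<phi> (x \<otimes> y) = a x \<otimes> y)"
    using embed_left_ex[OF a] by (auto intro: End_product_eqI)
  from theI'[OF this] have *: "eL a \<in> End R (carrier R) K \<and> (\<forall>x\<in>Fix. \<forall>y\<in>S. eL a (x \<otimes> y) = a x \<otimes> y)"
    unfolding embed_left_def .
  then show "eL a \<in> End R (carrier R) K" and "\<And>x y. x \<in> Fix \<Longrightarrow> y \<in> S \<Longrightarrow> eL a (x \<otimes> y) = a x \<otimes> y" by auto
  then show "eL a = f" if "f \<in> End R (carrier R) K" "\<And>x y. x \<in> Fix \<Longrightarrow> y \<in> S \<Longrightarrow> f (x \<otimes> y) = a x \<otimes> y" for f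
    using that by (intro End_product_eqI) auto
qed

lemma embed_right:
  assumes b: "b \<in> End R S K"
  shows "eR b \<in> End R (carrier R) K" and "\<And>x y. x \<in> Fix \<Longrightarrow> y \<in> S \<Longrightarrow> eR b (x \<otimes> y) = x \<otimes> b y"
    and "\<And>f. f \<in> End R (carrier R) K \<Longrightarrow> (\<And>x y. x \<in> Fix \<Longrightarrow> y \<in> S \<Longrightarrow> f (x \<otimes> y) = x \<otimes> b y) \<Longrightarrow> eR b = f"
proof -
  have "\<exists>!\<phi>. \<phi> \<in> End R (carrier R) K \<and> (\<forall>x\<in>Fix. \<forall>y\<in>S. \<phi> (x \<otimes> y) = x \<otimes> b y)"
    using embed_right_ex[OF b] by (auto intro: End_product_eqI)
  from theI'[OF this] have *: "eR b \<in> End R (carrier R) K \<and> (\<forall>x\<in>Fix. \<forall>y\<in>S. eR b (x \<otimes> y) = x \<otimes> b y)"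
    unfolding embed_right_def .
  then show "eR b \<in> End R (carrier R) K" and "\<And>x y. x \<in> Fix \<Longrightarrow> y \<in> S \<Longrightarrow> eR b (x \<otimes> y) = x \<otimes> b y" by auto
  then show "eR b = f" if "f \<in> End R (carrier R) K" "\<And>x y. x \<in> Fix \<Longrightarrow> y \<in> S \<Longrightarrow> f (x \<otimes> y) = x \<otimes> b y" for f
    using that by (intro End_product_eqI) auto
qed

lemma product_closed: "x \<in> Fix \<Longrightarrow> y \<in> S \<Longrightarrow> x \<otimes> y \<in> carrier R"
  using Fix_R S_R by simp

lemma embed_product:
  assumes "a \<in> End R Fix K" "b \<in> End R S K" "x \<in> Fix" "y \<in> S"
  shows "(eL a \<otimes>\<^bsub>E\<^esub> eR b) (x \<otimes> y) = a x \<otimes> b y"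
  using embed_left(2)[OF assms(1,3) EndD(1)[OF assms(2,4)]] embed_right(2)[OF assms(2-4)] product_closed[OF assms(3,4)]
  by (simp add: compose_def)

end

lemma (in cring) End_subgroup:
  assumes P: "subring P R" and M: "K \<subseteq> M" "M \<subseteq> P"
  shows "subgroup (End R P M) (add_monoid (End_ring R P K))"
proof -
  have KP: "K \<subseteq> P" using M by blast
  interpret E: ring "End_ring R P K" by (rule End_ring_is_ring[OF P KP])
  interpret EM: ring "End_ring R P M" by (rule End_ring_is_ring[OF P M(2)])
  have sub: "f \<in> End R P K" if "f \<in> End R P M" for f using that End_mono[OF M(1)] by blast
  show ?thesis
  proof (rule E.add.subgroupI)
    show "End R P M \<subseteq> carrier (End_ring R P K)" using sub by auto
    show "End R P M \<noteq> {}" using EM.zero_closed by auto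
    fix f assume f: "f \<in> End R P M"
    show "\<ominus>\<^bsub>End_ring R P K\<^esub> f \<in> End R P M"
      unfolding End_ring_a_inv[OF P KP sub[OF f]] by (rule End_uminus[OF P M(2) f])
    fix g assume g: "g \<in> End R P M"
    show "f \<oplus>\<^bsub>End_ring R P K\<^esub> g \<in> End R P M" using End_add[OF P M(2) f g] by simp
  qed
qed

context normal_extension begin

lemma sFix: "subring Fix R" and sS: "subring S R"
  by (rule subfieldE(1)[OF Fix_subfield], rule subfieldE(1)[OF S_subfield])

text \<open>Both sides of each identity agree on products, and an embedded operator is determined by
  its values there. The identities make embedded sets of operators additive groups stable under
  \<open>K\<close>.\<close>

lemma embed_left_ops:
  assumes a: "a \<in> End R Fix K" and b: "b \<in> End R Fix K" and k: "k \<in> K"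
  shows "eL (\<lambda>x\<in>Fix. \<ominus> a x) = \<ominus>\<^bsub>E\<^esub> eL a"
    and "eL (\<lambda>x\<in>Fix. a x \<oplus> b x) = eL a \<oplus>\<^bsub>E\<^esub> eL b"
    and "eL (compose Fix (mult_op R Fix k) a) = mult_op R (carrier R) k \<otimes>\<^bsub>E\<^esub> eL a"
proof -
  interpret E: ring E by (rule E_ring)
  have KP: "K \<subseteq> Fix" by (rule K_Fix)
  interpret EP: ring "End_ring R Fix K" by (rule End_ring_is_ring[OF sFix KP])
  have kP: "k \<in> Fix" and kR: "k \<in> carrier R" using k KP KR by auto
  note ea = embed_left[OF a] and eb = embed_left[OF b]
  have val: "a x \<in> carrier R" "b x \<in> carrier R" if "x \<in> Fix" for x
    using Fix_R[OF EndD(1)[OF a that]] Fix_R[OF EndD(1)[OF b that]] by auto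
  show "eL (\<lambda>x\<in>Fix. \<ominus> a x) = \<ominus>\<^bsub>E\<^esub> eL a"
  proof (rule embed_left(3)[OF End_uminus[OF sFix KP a]])
    show "\<ominus>\<^bsub>E\<^esub> eL a \<in> End R (carrier R) K" using E.a_inv_closed[of "eL a"] ea(1) by simp
    fix x y assume x: "x \<in> Fix" and y: "y \<in> S"
    show "(\<ominus>\<^bsub>E\<^esub> eL a) (x \<otimes> y) = (\<lambda>x\<in>Fix. \<ominus> a x) x \<otimes> y"
      unfolding End_ring_a_inv[OF carrier_is_subring KR ea(1)]
      using ea(2)[OF x y] val(1)[OF x] x y product_closed[OF x y] Fix_R[OF x] S_R[OF y]
      by (simp add: l_minus r_minus)
  qed
  show "eL (\<lambda>x\<in>Fix. a x \<oplus> b x) = eL a \<oplus>\<^bsub>E\<^esub> eL b"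
  proof (rule embed_left(3)[OF End_add[OF sFix KP a b]])
    show "eL a \<oplus>\<^bsub>E\<^esub> eL b \<in> End R (carrier R) K" using E.a_closed[of "eL a" "eL b"] ea(1) eb(1) by simp
    fix x y assume x: "x \<in> Fix" and y: "y \<in> S"
    show "(eL a \<oplus>\<^bsub>E\<^esub> eL b) (x \<otimes> y) = (\<lambda>x\<in>Fix. a x \<oplus> b x) x \<otimes> y"
      using ea(2)[OF x y] eb(2)[OF x y] val[OF x] x y product_closed[OF x y] Fix_R[OF x] S_R[OF y]
      by (simp add: l_distr r_distr)
  qed
  have c: "compose Fix (mult_op R Fix k) a \<in> End R Fix K"
    using EP.m_closed[of "mult_op R Fix k" a] mult_op_End[OF sFix KP kP] a by simp
  show "eL (compose Fix (mult_op R Fix k) a) = mult_op R (carrier R) k \<otimes>\<^bsub>E\<^esub> eL a"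
  proof (rule embed_left(3)[OF c])
    show "mult_op R (carrier R) k \<otimes>\<^bsub>E\<^esub> eL a \<in> End R (carrier R) K"
      using E.m_closed[of "mult_op R (carrier R) k" "eL a"] mult_op_End[OF carrier_is_subring KR kR] ea(1) by simp
    fix x y assume x: "x \<in> Fix" and y: "y \<in> S"
    have "eL a (x \<otimes> y) \<in> carrier R" using EndD(1)[OF ea(1) product_closed[OF x y]] .
    then show "(mult_op R (carrier R) k \<otimes>\<^bsub>E\<^esub> eL a) (x \<otimes> y) = compose Fix (mult_op R Fix k) a x \<otimes> y"
      using ea(2)[OF x y] EndD(1)[OF a x] val(1)[OF x] x y product_closed[OF x y] Fix_R[OF x] S_R[OF y] kR
      by (simp add: compose_def mult_op_def m_assoc m_lcomm)
  qed
qed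

lemma embed_left_image:
  assumes N: "K \<subseteq> N" "N \<subseteq> Fix"
  shows "subgroup (eL ` End R Fix N) (add_monoid E)"
    and "k \<in> K \<Longrightarrow> a \<in> eL ` End R Fix N \<Longrightarrow> mult_op R (carrier R) k \<otimes>\<^bsub>E\<^esub> a \<in> eL ` End R Fix N"
proof -
  interpret E: ring E by (rule E_ring)
  interpret EP: ring "End_ring R Fix N" by (rule End_ring_is_ring[OF sFix N(2)])
  have aK: "a \<in> End R Fix K" if "a \<in> End R Fix N" for a using that End_mono[OF N(1)] by blast
  have one: "\<one> \<in> K" using subringE(3)[OF subfieldE(1)[OF K]] .
  show "subgroup (eL ` End R Fix N) (add_monoid E)"
  proof (rule E.add.subgroupI)
    show "eL ` End R Fix N \<subseteq> carrier E" using embed_left(1)[OF aK] by auto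
    show "eL ` End R Fix N \<noteq> {}" using EP.zero_closed by auto
    fix u assume "u \<in> eL ` End R Fix N"
    then obtain a where a: "a \<in> End R Fix N" "u = eL a" by blast
    show "\<ominus>\<^bsub>E\<^esub> u \<in> eL ` End R Fix N"
      unfolding a(2) embed_left_ops(1)[OF aK[OF a(1)] aK[OF a(1)] one, symmetric]
      by (rule imageI, rule End_uminus[OF sFix N(2) a(1)])
    fix v assume "v \<in> eL ` End R Fix N"
    then obtain b where b: "b \<in> End R Fix N" "v = eL b" by blast
    show "u \<oplus>\<^bsub>E\<^esub> v \<in> eL ` End R Fix N"
      unfolding a(2) b(2) embed_left_ops(2)[OF aK[OF a(1)] aK[OF b(1)] one, symmetric]
      by (rule imageI, rule End_add[OF sFix N(2) a(1) b(1)])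
  qed
  assume k: "k \<in> K" and "a \<in> eL ` End R Fix N"
  then obtain b where b: "b \<in> End R Fix N" "a = eL b" by blast
  have kP: "k \<in> Fix" using k N by auto
  show "mult_op R (carrier R) k \<otimes>\<^bsub>E\<^esub> a \<in> eL ` End R Fix N"
    unfolding b(2) embed_left_ops(3)[OF aK[OF b(1)] aK[OF b(1)] k, symmetric]
    by (rule imageI) (use EP.m_closed[of "mult_op R Fix k" b] mult_op_End[OF sFix N(2) kP] b(1) in simp)
qed

lemma embed_right_ops:
  assumes a: "a \<in> End R S K" and b: "b \<in> End R S K" and k: "k \<in> K"
  shows "eR (\<lambda>x\<in>S. \<ominus> a x) = \<ominus>\<^bsub>E\<^esub> eR a"
    and "eR (\<lambda>x\<in>S. a x \<oplus> b x) = eR a \<oplus>\<^bsub>E\<^esub> eR b"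
    and "eR (compose S (mult_op R S k) a) = mult_op R (carrier R) k \<otimes>\<^bsub>E\<^esub> eR a"
proof -
  interpret E: ring E by (rule E_ring)
  have KP: "K \<subseteq> S" by (rule K_S)
  interpret EP: ring "End_ring R S K" by (rule End_ring_is_ring[OF sS KP])
  have kP: "k \<in> S" and kR: "k \<in> carrier R" using k KP KR by auto
  note ea = embed_right[OF a] and eb = embed_right[OF b]
  have val: "a x \<in> carrier R" "b x \<in> carrier R" if "x \<in> S" for x
    using S_R[OF EndD(1)[OF a that]] S_R[OF EndD(1)[OF b that]] by auto
  show "eR (\<lambda>x\<in>S. \<ominus> a x) = \<ominus>\<^bsub>E\<^esub> eR a"
  proof (rule embed_right(3)[OF End_uminus[OF sS KP a]])
    show "\<ominus>\<^bsub>E\<^esub> eR a \<in> End R (carrier R) K" using E.a_inv_closed[of "eR a"] ea(1) by simp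
    fix x y assume x: "x \<in> Fix" and y: "y \<in> S"
    show "(\<ominus>\<^bsub>E\<^esub> eR a) (x \<otimes> y) = x \<otimes> (\<lambda>x\<in>S. \<ominus> a x) y"
      unfolding End_ring_a_inv[OF carrier_is_subring KR ea(1)]
      using ea(2)[OF x y] val(1)[OF y] x y product_closed[OF x y] Fix_R[OF x] S_R[OF y]
      by (simp add: l_minus r_minus)
  qed
  show "eR (\<lambda>x\<in>S. a x \<oplus> b x) = eR a \<oplus>\<^bsub>E\<^esub> eR b"
  proof (rule embed_right(3)[OF End_add[OF sS KP a b]])
    show "eR a \<oplus>\<^bsub>E\<^esub> eR b \<in> End R (carrier R) K" using E.a_closed[of "eR a" "eR b"] ea(1) eb(1) by simp
    fix x y assume x: "x \<in> Fix" and y: "y \<in> S"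
    show "(eR a \<oplus>\<^bsub>E\<^esub> eR b) (x \<otimes> y) = x \<otimes> (\<lambda>x\<in>S. a x \<oplus> b x) y"
      using ea(2)[OF x y] eb(2)[OF x y] val[OF y] x y product_closed[OF x y] Fix_R[OF x] S_R[OF y]
      by (simp add: l_distr r_distr)
  qed
  have c: "compose S (mult_op R S k) a \<in> End R S K"
    using EP.m_closed[of "mult_op R S k" a] mult_op_End[OF sS KP kP] a by simp
  show "eR (compose S (mult_op R S k) a) = mult_op R (carrier R) k \<otimes>\<^bsub>E\<^esub> eR a"
  proof (rule embed_right(3)[OF c])
    show "mult_op R (carrier R) k \<otimes>\<^bsub>E\<^esub> eR a \<in> End R (carrier R) K"
      using E.m_closed[of "mult_op R (carrier R) k" "eR a"] mult_op_End[OF carrier_is_subring KR kR] ea(1) by simp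
    fix x y assume x: "x \<in> Fix" and y: "y \<in> S"
    have "eR a (x \<otimes> y) \<in> carrier R" using EndD(1)[OF ea(1) product_closed[OF x y]] .
    then show "(mult_op R (carrier R) k \<otimes>\<^bsub>E\<^esub> eR a) (x \<otimes> y) = x \<otimes> compose S (mult_op R S k) a y"
      using ea(2)[OF x y] EndD(1)[OF a y] val(1)[OF y] x y product_closed[OF x y] Fix_R[OF x] S_R[OF y] kR
      by (simp add: compose_def mult_op_def m_assoc m_lcomm)
  qed
qed

lemma embed_right_image:
  assumes N: "K \<subseteq> N" "N \<subseteq> S"
  shows "subgroup (eR ` End R S N) (add_monoid E)"
    and "k \<in> K \<Longrightarrow> a \<in> eR ` End R S N \<Longrightarrow> mult_op R (carrier R) k \<otimes>\<^bsub>E\<^esub> a \<in> eR ` End R S N"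
proof -
  interpret E: ring E by (rule E_ring)
  interpret EP: ring "End_ring R S N" by (rule End_ring_is_ring[OF sS N(2)])
  have aK: "a \<in> End R S K" if "a \<in> End R S N" for a using that End_mono[OF N(1)] by blast
  have one: "\<one> \<in> K" using subringE(3)[OF subfieldE(1)[OF K]] .
  show "subgroup (eR ` End R S N) (add_monoid E)"
  proof (rule E.add.subgroupI)
    show "eR ` End R S N \<subseteq> carrier E" using embed_right(1)[OF aK] by auto
    show "eR ` End R S N \<noteq> {}" using EP.zero_closed by auto
    fix u assume "u \<in> eR ` End R S N"
    then obtain a where a: "a \<in> End R S N" "u = eR a" by blast
    show "\<ominus>\<^bsub>E\<^esub> u \<in> eR ` End R S N"
      unfolding a(2) embed_right_ops(1)[OF aK[OF a(1)] aK[OF a(1)] one, symmetric]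
      by (rule imageI, rule End_uminus[OF sS N(2) a(1)])
    fix v assume "v \<in> eR ` End R S N"
    then obtain b where b: "b \<in> End R S N" "v = eR b" by blast
    show "u \<oplus>\<^bsub>E\<^esub> v \<in> eR ` End R S N"
      unfolding a(2) b(2) embed_right_ops(2)[OF aK[OF a(1)] aK[OF b(1)] one, symmetric]
      by (rule imageI, rule End_add[OF sS N(2) a(1) b(1)])
  qed
  assume k: "k \<in> K" and "a \<in> eR ` End R S N"
  then obtain b where b: "b \<in> End R S N" "a = eR b" by blast
  have kP: "k \<in> S" using k N by auto
  show "mult_op R (carrier R) k \<otimes>\<^bsub>E\<^esub> a \<in> eR ` End R S N"
    unfolding b(2) embed_right_ops(3)[OF aK[OF b(1)] aK[OF b(1)] k, symmetric]
    by (rule imageI) (use EP.m_closed[of "mult_op R S k" b] mult_op_End[OF sS N(2) kP] b(1) in simp)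
qed

lemma mult_op_K_commutes:
  assumes k: "k \<in> K" and f: "f \<in> End R (carrier R) K"
  shows "mult_op R (carrier R) k \<otimes>\<^bsub>E\<^esub> f = f \<otimes>\<^bsub>E\<^esub> mult_op R (carrier R) k"
proof -
  have kR: "k \<in> carrier R" using k KR by blast
  show ?thesis
    unfolding End_ring_simps
    by (rule extensionalityI[of _ "carrier R"])
      (use EndD(1)[OF f] EndD(4)[OF f k] kR in \<open>simp_all add: compose_def mult_op_def\<close>)
qed

lemma op_tensor_eq_prod_span:
  assumes N: "K \<subseteq> N" "N \<subseteq> Fix" and \<Gamma>: "K \<subseteq> \<Gamma>" "\<Gamma> \<subseteq> S"
  shows "op_tensor R K Fix S (End R Fix N) (End R S \<Gamma>) = prod_span E (eL ` End R Fix N) (eR ` End R S \<Gamma>)"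
proof -
  interpret E: ring E by (rule E_ring)
  show ?thesis
    unfolding op_tensor_def
    using subgroup.subset[OF embed_left_image(1)[OF N]] subgroup.subset[OF embed_right_image(1)[OF \<Gamma>]]
    by (intro E.mult_image_eq_prod_span) simp_all
qed

text \<open>Linear independence of operators is reduced to that of elements: choose \<open>y\<close>
  with \<open>b i y \<noteq> \<zero>\<close> and apply \<open>linearly_disjoint\<close> to the
  values \<open>b j y\<close> in \<open>S\<close>. The coefficients obtained do not depend on the
  point \<open>x\<close>, so the relations \<open>\<Sum> c\<^sub>j a\<^sub>j(x) = 0\<close> for all
  \<open>x\<close> combine into a relation between the operators.\<close>

lemma op_tensor_iso_End:
  assumes N: "K \<subseteq> N" "N \<subseteq> Fix" and \<Gamma>: "K \<subseteq> \<Gamma>" "\<Gamma> \<subseteq> S"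
  shows "op_tensor_iso R K Fix S (End R Fix N) (End R S \<Gamma>)"
  unfolding op_tensor_iso_def op_tensor_eq_prod_span[OF N \<Gamma>]
proof -
  interpret E: ring E by (rule E_ring)
  let ?A = "eL ` End R Fix N" and ?B = "eR ` End R S \<Gamma>"
  have mK: "mult_op R (carrier R) k \<in> End R (carrier R) K" if "k \<in> K" for k
    using mult_op_End[OF carrier_is_subring KR] that KR by blast
  have aK: "a \<in> End R Fix K" if "a \<in> End R Fix N" for a using that End_mono[OF N(1)] by blast
  have bK: "b \<in> End R S K" if "b \<in> End R S \<Gamma>" for b using that End_mono[OF \<Gamma>(1)] by blast
  show "tensor_iso E (mult_op R (carrier R) ` K) ?A ?B (prod_span E ?A ?B)"
  proof (rule E.tensor_isoI)
    show "subgroup ?A (add_monoid E)" by (rule embed_left_image(1)[OF N])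
    show "subgroup ?B (add_monoid E)" by (rule embed_right_image(1)[OF \<Gamma>])
    show "mult_op R (carrier R) ` K \<subseteq> carrier E" using mK by auto
    show "k \<otimes>\<^bsub>E\<^esub> a \<in> ?A" if "k \<in> mult_op R (carrier R) ` K" "a \<in> ?A" for k a
      using that embed_left_image(2)[OF N] by blast
    show "k \<otimes>\<^bsub>E\<^esub> b \<in> ?B" if "k \<in> mult_op R (carrier R) ` K" "b \<in> ?B" for k b
      using that embed_right_image(2)[OF \<Gamma>] by blast
    show "k \<otimes>\<^bsub>E\<^esub> a = a \<otimes>\<^bsub>E\<^esub> k" if "k \<in> mult_op R (carrier R) ` K" "a \<in> ?A" for k a
      using that mult_op_K_commutes embed_left(1)[OF aK] by blast
    fix I :: "nat set" and u v i
    assume I: "finite I" and u: "\<And>i. i \<in> I \<Longrightarrow> u i \<in> ?A" and v: "\<And>i. i \<in> I \<Longrightarrow> v i \<in> ?B"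
      and sum: "(\<Oplus>\<^bsub>E\<^esub>i\<in>I. u i \<otimes>\<^bsub>E\<^esub> v i) = \<zero>\<^bsub>E\<^esub>" and i: "i \<in> I" "v i \<noteq> \<zero>\<^bsub>E\<^esub>"
    define a where "a j = (SOME a. a \<in> End R Fix N \<and> u j = eL a)" for j
    define b where "b j = (SOME b. b \<in> End R S \<Gamma> \<and> v j = eR b)" for j
    have a: "a j \<in> End R Fix N" "u j = eL (a j)" if "j \<in> I" for j
      using someI_ex[of "\<lambda>a. a \<in> End R Fix N \<and> u j = eL a"] u[OF that] unfolding a_def by blast+
    have b: "b j \<in> End R S \<Gamma>" "v j = eR (b j)" if "j \<in> I" for j
      using someI_ex[of "\<lambda>b. b \<in> End R S \<Gamma> \<and> v j = eR b"] v[OF that] unfolding b_def by blast+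
    have aE: "a j \<in> End R Fix K" and bE: "b j \<in> End R S K" if "j \<in> I" for j
      using a(1)[OF that] b(1)[OF that] aK bK by auto
    have uE: "u j \<in> End R (carrier R) K" and vE: "v j \<in> End R (carrier R) K" if "j \<in> I" for j
      using embed_left(1)[OF aE[OF that]] embed_right(1)[OF bE[OF that]] a(2)[OF that] b(2)[OF that] by auto
    have zE: "\<zero>\<^bsub>E\<^esub> \<in> End R (carrier R) K" using E.zero_closed by simp
    have "\<exists>y\<in>S. b i y \<noteq> \<zero>"
    proof (rule ccontr)
      assume "\<not> (\<exists>y\<in>S. b i y \<noteq> \<zero>)"
      then have "eR (b i) = \<zero>\<^bsub>E\<^esub>"
        by (intro embed_right(3)[OF bE[OF i(1)] zE]) (use product_closed Fix_R in simp)
      then show False using i b(2) by simp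
    qed
    then obtain y where y: "y \<in> S" "b i y \<noteq> \<zero>" by blast
    have bS: "b j y \<in> S" if "j \<in> I" for j by (rule EndD(1)[OF bE[OF that] y(1)])
    obtain c where c: "\<forall>j\<in>I. c j \<in> K" "c i = \<one>"
      "\<forall>a. (\<forall>j\<in>I. a j \<in> Fix) \<longrightarrow> (\<Oplus>j\<in>I. a j \<otimes> b j y) = \<zero> \<longrightarrow> (\<Oplus>j\<in>I. c j \<otimes> a j) = \<zero>"
      using linearly_disjoint[of I "\<lambda>j. b j y" i, OF I bS i(1) y(2)] by blast
    have aF: "a j x \<in> Fix" if "j \<in> I" "x \<in> Fix" for j x by (rule EndD(1)[OF aE[OF that(1)] that(2)])
    have rel: "(\<Oplus>j\<in>I. c j \<otimes> a j x) = \<zero>" if x: "x \<in> Fix" for x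
    proof -
      have uvE: "u j \<otimes>\<^bsub>E\<^esub> v j \<in> End R (carrier R) K" if "j \<in> I" for j
        using E.m_closed[of "u j" "v j"] uE[OF that] vE[OF that] by simp
      have "(\<Oplus>j\<in>I. a j x \<otimes> b j y) = (\<Oplus>j\<in>I. (u j \<otimes>\<^bsub>E\<^esub> v j) (x \<otimes> y))"
      proof (rule finsum_cong'[OF refl])
        show "(\<lambda>j. (u j \<otimes>\<^bsub>E\<^esub> v j) (x \<otimes> y)) \<in> I \<rightarrow> carrier R"
          by (rule Pi_I, rule EndD(1)[OF uvE product_closed[OF x y(1)]])
        show "a j x \<otimes> b j y = (u j \<otimes>\<^bsub>E\<^esub> v j) (x \<otimes> y)" if "j \<in> I" for j
          unfolding a(2)[OF that] b(2)[OF that] by (rule embed_product[OF aE[OF that] bE[OF that] x y(1), symmetric])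
      qed
      also have "\<dots> = (\<Oplus>\<^bsub>E\<^esub>j\<in>I. u j \<otimes>\<^bsub>E\<^esub> v j) (x \<otimes> y)"
        by (rule End_ring_finsum[OF carrier_is_subring KR I uvE product_closed[OF x y(1)], symmetric])
      also have "\<dots> = \<zero>" unfolding sum using product_closed[OF x y(1)] by simp
      finally have "(\<Oplus>j\<in>I. a j x \<otimes> b j y) = \<zero>" .
      then show ?thesis using c(3)[rule_format, of "\<lambda>j. a j x"] aF[OF _ x] by simp
    qed
    let ?c = "\<lambda>j. mult_op R (carrier R) (c j)"
    have cu: "?c j \<otimes>\<^bsub>E\<^esub> u j \<in> End R (carrier R) K" if "j \<in> I" for j
      using E.m_closed[of "?c j" "u j"] mK c(1) uE that by simp
    have "(\<Oplus>\<^bsub>E\<^esub>j\<in>I. ?c j \<otimes>\<^bsub>E\<^esub> u j) = \<zero>\<^bsub>E\<^esub>"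
    proof (rule End_product_eqI[OF _ zE])
      show "(\<Oplus>\<^bsub>E\<^esub>j\<in>I. ?c j \<otimes>\<^bsub>E\<^esub> u j) \<in> End R (carrier R) K"
        using E.finsum_closed[of "\<lambda>j. ?c j \<otimes>\<^bsub>E\<^esub> u j" I] cu by simp
      fix x y assume x: "x \<in> Fix" and y: "y \<in> S"
      have cR: "c j \<in> carrier R" if "j \<in> I" for j using c(1) KR that by blast
      have "(\<Oplus>\<^bsub>E\<^esub>j\<in>I. ?c j \<otimes>\<^bsub>E\<^esub> u j) (x \<otimes> y) = (\<Oplus>j\<in>I. (?c j \<otimes>\<^bsub>E\<^esub> u j) (x \<otimes> y))"
        by (rule End_ring_finsum[OF carrier_is_subring KR I cu product_closed[OF x y]])
      also have "\<dots> = (\<Oplus>j\<in>I. c j \<otimes> a j x \<otimes> y)"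
      proof (rule finsum_cong'[OF refl])
        show "(\<lambda>j. c j \<otimes> a j x \<otimes> y) \<in> I \<rightarrow> carrier R" using cR aF[OF _ x] Fix_R S_R[OF y] by auto
        show "(?c j \<otimes>\<^bsub>E\<^esub> u j) (x \<otimes> y) = c j \<otimes> a j x \<otimes> y" if "j \<in> I" for j
          using embed_left(2)[OF aE[OF that] x y] a(2)[OF that] product_closed[OF x y] cR[OF that]
            Fix_R[OF aF[OF that x]] S_R[OF y]
          by (simp add: compose_def mult_op_def m_assoc)
      qed
      also have "\<dots> = (\<Oplus>j\<in>I. c j \<otimes> a j x) \<otimes> y"
        by (rule finsum_ldistr[OF I S_R[OF y], symmetric]) (use cR aF[OF _ x] Fix_R in auto)
      also have "\<dots> = \<zero>" using rel[OF x] S_R[OF y] by simp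
      finally show "(\<Oplus>\<^bsub>E\<^esub>j\<in>I. ?c j \<otimes>\<^bsub>E\<^esub> u j) (x \<otimes> y) = \<zero>\<^bsub>E\<^esub> (x \<otimes> y)"
        using product_closed[OF x y] by simp
    qed
    moreover have "?c i = \<one>\<^bsub>E\<^esub>" using c(2) by (auto simp: mult_op_def)
    moreover have "\<forall>j\<in>I. ?c j \<in> mult_op R (carrier R) ` K" using c(1) by blast
    ultimately show "\<exists>c. (\<forall>j\<in>I. c j \<in> mult_op R (carrier R) ` K) \<and>
        (\<Oplus>\<^bsub>E\<^esub>j\<in>I. c j \<otimes>\<^bsub>E\<^esub> u j) = \<zero>\<^bsub>E\<^esub> \<and> c i = \<one>\<^bsub>E\<^esub>" by (intro exI[of _ ?c] conjI)
  qed
qed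

text \<open>With this, linearity over a compositum can be tested on products of the two factors; it
  also makes the centralizer of an algebra an additive group.\<close>

lemma linearity_subgroup:
  assumes f: "f \<in> End R (carrier R) K"
  shows "subgroup {m \<in> carrier R. \<forall>z\<in>carrier R. f (m \<otimes> z) = m \<otimes> f z} (add_monoid R)" (is "subgroup ?M _")
proof (rule add.subgroupI)
  have f0: "f \<zero> = \<zero>" by (rule End_zero[OF f add_sub(1)])
  have fR: "f z \<in> carrier R" if "z \<in> carrier R" for z by (rule EndD(1)[OF f that])
  have fneg: "f (\<ominus> z) = \<ominus> f z" if z: "z \<in> carrier R" for z
  proof -
    have "f (\<ominus> z) \<oplus> f z = \<zero>" using EndD(3)[OF f a_inv_closed[OF z] z] f0 z by (simp add: l_neg)
    then show ?thesis using minus_equality[of "f (\<ominus> z)" "f z"] fR[OF z] fR[OF a_inv_closed[OF z]] by simp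
  qed
  show "?M \<subseteq> carrier R" by blast
  have "\<zero> \<in> ?M" using f0 fR by simp
  then show "?M \<noteq> {}" by blast
  fix m assume "m \<in> ?M"
  then have m: "m \<in> carrier R" "\<And>z. z \<in> carrier R \<Longrightarrow> f (m \<otimes> z) = m \<otimes> f z" by auto
  have "f (\<ominus> m \<otimes> z) = \<ominus> m \<otimes> f z" if z: "z \<in> carrier R" for z
    using fneg[of "m \<otimes> z"] m(1) m(2)[OF z] fR[OF z] z by (simp add: l_minus)
  then show "\<ominus> m \<in> ?M" using m(1) by simp
  fix n assume "n \<in> ?M"
  then have n: "n \<in> carrier R" "\<And>z. z \<in> carrier R \<Longrightarrow> f (n \<otimes> z) = n \<otimes> f z" by auto
  have "f ((m \<oplus> n) \<otimes> z) = (m \<oplus> n) \<otimes> f z" if z: "z \<in> carrier R" for z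
    using EndD(3)[OF f, of "m \<otimes> z" "n \<otimes> z"] m(1) n(1) m(2)[OF z] n(2)[OF z] fR[OF z] z by (simp add: l_distr)
  then show "m \<oplus> n \<in> ?M" using m(1) n(1) by simp
qed

text \<open>One inclusion is linearity over each of the two fields. For the other, an operator
  linear over both is determined by its finitely many values on products of a basis of
  \<open>Fix\<close> over \<open>N\<close> with a basis of \<open>S\<close> over \<Gamma>, and these
  values are split into the two factors.\<close>

lemma op_tensor_End:
  assumes N: "subfield N R" "K \<subseteq> N" "N \<subseteq> Fix" and \<Gamma>: "subfield \<Gamma> R" "K \<subseteq> \<Gamma>" "\<Gamma> \<subseteq> S"
  shows "op_tensor R K Fix S (End R Fix N) (End R S \<Gamma>) = End R (carrier R) (compositum R N \<Gamma>)"
proof -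
  interpret E: ring E by (rule E_ring)
  define C where "C = compositum R N \<Gamma>"
  have C: "C = prod_span R N \<Gamma>" unfolding C_def by (rule tensor_iso_fields(2)[OF N \<Gamma>])
  have NR: "N \<subseteq> carrier R" and GR: "\<Gamma> \<subseteq> carrier R" by (rule subfieldE(3)[OF N(1)], rule subfieldE(3)[OF \<Gamma>(1)])
  have NC: "N \<subseteq> C" and GC: "\<Gamma> \<subseteq> C" unfolding C_def compositum_def by (auto intro: generate_field.incl)
  have CR: "C \<subseteq> carrier R" unfolding C_def compositum_def by (rule generate_field_incl) (use NR GR in blast)
  have KC: "K \<subseteq> C" using N(2) NC by blast
  let ?A = "eL ` End R Fix N" and ?B = "eR ` End R S \<Gamma>"
  have aK: "a \<in> End R Fix K" if "a \<in> End R Fix N" for a using that End_mono[OF N(2)] by blast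
  have bK: "b \<in> End R S K" if "b \<in> End R S \<Gamma>" for b using that End_mono[OF \<Gamma>(2)] by blast
  have AR: "?A \<subseteq> carrier E" and BR: "?B \<subseteq> carrier E" using embed_left(1)[OF aK] embed_right(1)[OF bK] by auto
  have "prod_span E ?A ?B \<subseteq> End R (carrier R) C"
  proof (rule E.prod_span_subset[OF End_subgroup[OF carrier_is_subring KC CR]])
    fix u v assume "u \<in> ?A" "v \<in> ?B"
    then obtain a b where a: "a \<in> End R Fix N" "u = eL a" and b: "b \<in> End R S \<Gamma>" "v = eR b" by blast
    define f where "f = u \<otimes>\<^bsub>E\<^esub> v"
    have f: "f \<in> End R (carrier R) K"
      using E.m_closed[of u v] embed_left(1)[OF aK[OF a(1)]] embed_right(1)[OF bK[OF b(1)]] a(2) b(2) by (simp add: f_def)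
    have fxy: "f (x \<otimes> y) = a x \<otimes> b y" if "x \<in> Fix" "y \<in> S" for x y
      unfolding f_def a(2) b(2) by (rule embed_product[OF aK[OF a(1)] bK[OF b(1)] that])
    have ax: "a x \<in> carrier R" if "x \<in> Fix" for x using Fix_R[OF EndD(1)[OF a(1) that]] .
    have yb: "b y \<in> carrier R" if "y \<in> S" for y using S_R[OF EndD(1)[OF b(1) that]] .
    \<comment> \<open>Commutation of \<open>f\<close> with multiplication by \<open>m\<close> is an
      equality of \<open>K\<close>-linear operators and may be tested on products. There an element
      of \<open>N\<close> is absorbed by the first factor, an element of \<Gamma> by the
      second.\<close>
    have lin: "f (m \<otimes> z) = m \<otimes> f z"
      if m: "m \<in> carrier R" and z: "z \<in> carrier R"
        and prod: "\<And>x y. x \<in> Fix \<Longrightarrow> y \<in> S \<Longrightarrow> f (m \<otimes> (x \<otimes> y)) = m \<otimes> f (x \<otimes> y)" for m z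
    proof -
      have mE: "mult_op R (carrier R) m \<in> End R (carrier R) K" by (rule mult_op_End[OF carrier_is_subring KR m])
      have "f \<otimes>\<^bsub>E\<^esub> mult_op R (carrier R) m = mult_op R (carrier R) m \<otimes>\<^bsub>E\<^esub> f"
      proof (rule End_product_eqI)
        show "f \<otimes>\<^bsub>E\<^esub> mult_op R (carrier R) m \<in> End R (carrier R) K"
          "mult_op R (carrier R) m \<otimes>\<^bsub>E\<^esub> f \<in> End R (carrier R) K"
          using E.m_closed[of f "mult_op R (carrier R) m"] E.m_closed[of "mult_op R (carrier R) m" f] f mE by simp_all
        fix x y assume xy: "x \<in> Fix" "y \<in> S"
        show "(f \<otimes>\<^bsub>E\<^esub> mult_op R (carrier R) m) (x \<otimes> y) = (mult_op R (carrier R) m \<otimes>\<^bsub>E\<^esub> f) (x \<otimes> y)"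
          using prod[OF xy] product_closed[OF xy] m EndD(1)[OF f product_closed[OF xy]]
          by (simp add: compose_def mult_op_def)
      qed
      from fun_cong[OF this, of z] show ?thesis using m z EndD(1)[OF f z] by (simp add: compose_def mult_op_def)
    qed
    have nlin: "f (n \<otimes> z) = n \<otimes> f z" if n: "n \<in> N" and z: "z \<in> carrier R" for n z
    proof (rule lin[OF _ z])
      show nR: "n \<in> carrier R" using n NR by blast
      fix x y assume xy: "x \<in> Fix" "y \<in> S"
      have nx: "n \<otimes> x \<in> Fix" using subringE(6)[OF sFix] n N(3) xy(1) by blast
      have "n \<otimes> (x \<otimes> y) = (n \<otimes> x) \<otimes> y" using nR Fix_R[OF xy(1)] S_R[OF xy(2)] by (simp add: m_assoc)
      then show "f (n \<otimes> (x \<otimes> y)) = n \<otimes> f (x \<otimes> y)"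
        using fxy[OF nx xy(2)] fxy[OF xy] EndD(4)[OF a(1) n xy(1)] nR ax[OF xy(1)] yb[OF xy(2)] by (simp add: m_assoc)
    qed
    have glin: "f (g \<otimes> z) = g \<otimes> f z" if g: "g \<in> \<Gamma>" and z: "z \<in> carrier R" for g z
    proof (rule lin[OF _ z])
      show gR: "g \<in> carrier R" using g GR by blast
      fix x y assume xy: "x \<in> Fix" "y \<in> S"
      have gy: "g \<otimes> y \<in> S" using subringE(6)[OF sS] g \<Gamma>(3) xy(2) by blast
      have "g \<otimes> (x \<otimes> y) = x \<otimes> (g \<otimes> y)" using gR Fix_R[OF xy(1)] S_R[OF xy(2)] by (simp add: m_lcomm)
      then show "f (g \<otimes> (x \<otimes> y)) = g \<otimes> f (x \<otimes> y)"
        using fxy[OF xy(1) gy] fxy[OF xy] EndD(4)[OF b(1) g xy(2)] gR ax[OF xy(1)] yb[OF xy(2)] by (simp add: m_lcomm)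
    qed
    have "C \<subseteq> {m \<in> carrier R. \<forall>z\<in>carrier R. f (m \<otimes> z) = m \<otimes> f z}"
      unfolding C
    proof (rule prod_span_subset[OF linearity_subgroup[OF f]])
      fix n g assume n: "n \<in> N" and g: "g \<in> \<Gamma>"
      have R: "n \<in> carrier R" "g \<in> carrier R" using n g NR GR by auto
      have "f (n \<otimes> g \<otimes> z) = n \<otimes> g \<otimes> f z" if z: "z \<in> carrier R" for z
        using nlin[OF n, of "g \<otimes> z"] glin[OF g z] R z EndD(1)[OF f z] by (simp add: m_assoc)
      then show "n \<otimes> g \<in> {m \<in> carrier R. \<forall>z\<in>carrier R. f (m \<otimes> z) = m \<otimes> f z}" using R by simp
    qed
    then have "f \<in> End R (carrier R) C"
      by (intro EndI) (use EndD[OF f] in auto)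
    then show "u \<otimes>\<^bsub>E\<^esub> v \<in> End R (carrier R) C" by (simp add: f_def)
  qed
  moreover have "End R (carrier R) C \<subseteq> prod_span E ?A ?B"
  proof
    fix f assume f: "f \<in> End R (carrier R) C"
    have fK: "f \<in> End R (carrier R) K" using f End_mono[OF KC] by blast
    have finN: "finite_dimension N Fix"
      by (rule finite_dimension_over_intermediate[OF K N(1,2) sFix N(3) finite_Aut_intermediate(2)[OF Fix_subfield K_Fix]])
    have finG: "finite_dimension \<Gamma> S"
      by (rule finite_dimension_over_intermediate[OF K \<Gamma>(1,2) sS \<Gamma>(3) finite_Aut_intermediate(2)[OF S_subfield K_S]])
    obtain n :: nat and e T where e: "\<And>i. i < n \<Longrightarrow> e i \<in> Fix" and T: "\<And>i. i < n \<Longrightarrow> T i \<in> End R Fix N"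
      and TN: "\<And>i x. i < n \<Longrightarrow> x \<in> Fix \<Longrightarrow> T i x \<in> N" and Te: "\<And>x. x \<in> Fix \<Longrightarrow> x = (\<Oplus>i\<in>{..<n}. T i x \<otimes> e i)"
      by (rule exists_dual_basis[OF N(1) sFix N(3) finN]) (rule that)
    obtain m :: nat and d Q where d: "\<And>j. j < m \<Longrightarrow> d j \<in> S" and Q: "\<And>j. j < m \<Longrightarrow> Q j \<in> End R S \<Gamma>"
      and QG: "\<And>j y. j < m \<Longrightarrow> y \<in> S \<Longrightarrow> Q j y \<in> \<Gamma>" and Qd: "\<And>y. y \<in> S \<Longrightarrow> y = (\<Oplus>j\<in>{..<m}. Q j y \<otimes> d j)"
      by (rule exists_dual_basis[OF \<Gamma>(1) sS \<Gamma>(3) finG]) (rule that)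
    obtain l :: nat and U V where UV: "\<And>i. U i \<in> S" "\<And>i. V i \<in> S"
      "\<And>z. z \<in> carrier R \<Longrightarrow> z = (\<Oplus>i\<in>{..<l}. U i \<otimes> Tr (V i \<otimes> z))"
      by (rule exists_S_family) (rule that)
    have eR': "\<And>i. i < n \<Longrightarrow> e i \<in> carrier R" and dR: "\<And>j. j < m \<Longrightarrow> d j \<in> carrier R" using e d Fix_R S_R by auto
    have fed: "f (e i \<otimes> d j) \<in> carrier R" if "i < n" "j < m" for i j
      by (rule EndD(1)[OF f product_closed[OF e[OF that(1)] d[OF that(2)]]])
    \<comment> \<open>In \<open>f(x y) = \<Sum> T\<^sub>i(x) Q\<^sub>j(y) f(e\<^sub>i
      d\<^sub>j)\<close> the last factor belongs to neither side. Its expansion by the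
      \<open>U k\<close> separates it: the fixed coefficient \<open>c i j k\<close> goes into the
      left operator, \<open>U k\<close> into the right one.\<close>
    define c where "c i j k = Tr (V k \<otimes> f (e i \<otimes> d j))" for i j k
    have c: "c i j k \<in> Fix" if "i < n" "j < m" for i j k
      unfolding c_def using Tr_Fix S_R[OF UV(2)] fed[OF that] by simp
    define a where "a i j k = compose Fix (mult_op R Fix (c i j k)) (T i)" for i j k
    define b where "b j k = compose S (mult_op R S (U k)) (Q j)" for j k
    interpret EF: ring "End_ring R Fix N" by (rule End_ring_is_ring[OF sFix N(3)])
    interpret ES: ring "End_ring R S \<Gamma>" by (rule End_ring_is_ring[OF sS \<Gamma>(3)])
    have a: "a i j k \<in> End R Fix N" if "i < n" "j < m" for i j k
      using EF.m_closed[of "mult_op R Fix (c i j k)" "T i"] mult_op_End[OF sFix N(3) c[OF that]] T[OF that(1)] by (simp add: a_def)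
    have b: "b j k \<in> End R S \<Gamma>" if "j < m" for j k
      using ES.m_closed[of "mult_op R S (U k)" "Q j"] mult_op_End[OF sS \<Gamma>(3) UV(1)] Q[OF that] by (simp add: b_def)
    define h where "h i j k = eL (a i j k) \<otimes>\<^bsub>E\<^esub> eR (b j k)" for i j k
    have hE: "h i j k \<in> End R (carrier R) K" if "i < n" "j < m" for i j k
      using E.m_closed[of "eL (a i j k)" "eR (b j k)"] embed_left(1)[OF aK[OF a[OF that]]] embed_right(1)[OF bK[OF b[OF that(2)]]]
      by (simp add: h_def)
    define g where "g = (\<Oplus>\<^bsub>E\<^esub>i\<in>{..<n}. \<Oplus>\<^bsub>E\<^esub>j\<in>{..<m}. \<Oplus>\<^bsub>E\<^esub>k\<in>{..<l}. h i j k)"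
    have sgP: "subgroup (prod_span E ?A ?B) (add_monoid E)" by (rule E.prod_span_subgroup[OF AR BR])
    have gP: "g \<in> prod_span E ?A ?B"
      unfolding g_def
    proof (rule E.finsum_in_subgroup[OF sgP], rule E.finsum_in_subgroup[OF sgP], rule E.finsum_in_subgroup[OF sgP])
      fix i j k assume "i \<in> {..<n}" "j \<in> {..<m}"
      then show "h i j k \<in> prod_span E ?A ?B"
        unfolding h_def using a b by (intro E.prod_in_prod_span imageI) auto
    qed
    have gE: "g \<in> End R (carrier R) K" using gP subgroup.subset[OF sgP] by auto
    have h3: "(\<Oplus>\<^bsub>E\<^esub>k\<in>{..<l}. h i j k) \<in> End R (carrier R) K" if "i < n" "j < m" for i j
      using E.finsum_closed[of "h i j" "{..<l}"] hE[OF that] by simp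
    have h2: "(\<Oplus>\<^bsub>E\<^esub>j\<in>{..<m}. \<Oplus>\<^bsub>E\<^esub>k\<in>{..<l}. h i j k) \<in> End R (carrier R) K" if "i < n" for i
      using E.finsum_closed[of "\<lambda>j. \<Oplus>\<^bsub>E\<^esub>k\<in>{..<l}. h i j k" "{..<m}"] h3[OF that] by auto
    have "f = g"
    proof (rule End_product_eqI[OF fK gE])
      fix x y assume x: "x \<in> Fix" and y: "y \<in> S"
      note xy = product_closed[OF x y]
      have xR: "x \<in> carrier R" and yR: "y \<in> carrier R" by (rule Fix_R[OF x], rule S_R[OF y])
      have TR: "T i x \<in> carrier R" if "i < n" for i using TN[OF that x] NR by blast
      have QR: "Q j y \<in> carrier R" if "j < m" for j using QG[OF that y] GR by blast
      have fey: "f (e i \<otimes> y) = (\<Oplus>j\<in>{..<m}. Q j y \<otimes> f (e i \<otimes> d j))" if i: "i < n" for i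
      proof -
        have "e i \<otimes> y = e i \<otimes> (\<Oplus>j\<in>{..<m}. Q j y \<otimes> d j)" using Qd[OF y] by simp
        also have "\<dots> = (\<Oplus>j\<in>{..<m}. e i \<otimes> (Q j y \<otimes> d j))"
          by (rule finsum_rdistr) (use eR'[OF i] QR dR in auto)
        also have "\<dots> = (\<Oplus>j\<in>{..<m}. Q j y \<otimes> (e i \<otimes> d j))"
          by (rule finsum_cong'[OF refl]) (use eR'[OF i] QR dR in \<open>auto simp: m_lcomm\<close>)
        finally have "f (e i \<otimes> y) = f (\<Oplus>j\<in>{..<m}. Q j y \<otimes> (e i \<otimes> d j))" by simp
        also have "\<dots> = (\<Oplus>j\<in>{..<m}. f (Q j y \<otimes> (e i \<otimes> d j)))"
          by (rule End_sum[OF f add_sub(1)]) (use eR'[OF i] QR dR in auto)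
        also have "\<dots> = (\<Oplus>j\<in>{..<m}. Q j y \<otimes> f (e i \<otimes> d j))"
        proof (rule finsum_cong'[OF refl])
          show "(\<lambda>j. Q j y \<otimes> f (e i \<otimes> d j)) \<in> {..<m} \<rightarrow> carrier R" using QR fed[OF i] by auto
          show "f (Q j y \<otimes> (e i \<otimes> d j)) = Q j y \<otimes> f (e i \<otimes> d j)" if "j \<in> {..<m}" for j
            by (rule EndD(4)[OF f]) (use that QG y GC eR'[OF i] dR in auto)
        qed
        finally show ?thesis .
      qed
      have feyR: "f (e i \<otimes> y) \<in> carrier R" if "i < n" for i by (rule EndD(1)[OF f product_closed[OF e[OF that] y]])
      have "x \<otimes> y = (\<Oplus>i\<in>{..<n}. T i x \<otimes> e i) \<otimes> y" using Te[OF x] by simp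
      also have "\<dots> = (\<Oplus>i\<in>{..<n}. T i x \<otimes> e i \<otimes> y)"
        by (rule finsum_ldistr) (use yR eR' TR in auto)
      also have "\<dots> = (\<Oplus>i\<in>{..<n}. T i x \<otimes> (e i \<otimes> y))"
        by (rule finsum_cong'[OF refl]) (use yR eR' TR in \<open>auto simp: m_assoc\<close>)
      finally have "f (x \<otimes> y) = f (\<Oplus>i\<in>{..<n}. T i x \<otimes> (e i \<otimes> y))" by simp
      also have "\<dots> = (\<Oplus>i\<in>{..<n}. f (T i x \<otimes> (e i \<otimes> y)))"
        by (rule End_sum[OF f add_sub(1)]) (use yR eR' TR in auto)
      also have "\<dots> = (\<Oplus>i\<in>{..<n}. T i x \<otimes> f (e i \<otimes> y))"
      proof (rule finsum_cong'[OF refl])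
        show "(\<lambda>i. T i x \<otimes> f (e i \<otimes> y)) \<in> {..<n} \<rightarrow> carrier R" using TR feyR by auto
        show "f (T i x \<otimes> (e i \<otimes> y)) = T i x \<otimes> f (e i \<otimes> y)" if "i \<in> {..<n}" for i
          by (rule EndD(4)[OF f]) (use that TN x NC eR' yR in auto)
      qed
      finally have fxy: "f (x \<otimes> y) = (\<Oplus>i\<in>{..<n}. T i x \<otimes> f (e i \<otimes> y))" .
      have hxy: "(\<Oplus>k\<in>{..<l}. h i j k (x \<otimes> y)) = T i x \<otimes> (Q j y \<otimes> f (e i \<otimes> d j))" if i: "i < n" and j: "j < m" for i j
      proof -
        have cR: "c i j k \<in> carrier R" for k by (rule Fix_R[OF c[OF i j]])
        have UR: "U k \<in> carrier R" for k by (rule S_R[OF UV(1)])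
        have "(\<Oplus>k\<in>{..<l}. h i j k (x \<otimes> y)) = (\<Oplus>k\<in>{..<l}. (T i x \<otimes> Q j y) \<otimes> (U k \<otimes> c i j k))"
        proof (rule finsum_cong'[OF refl])
          show "(\<lambda>k. (T i x \<otimes> Q j y) \<otimes> (U k \<otimes> c i j k)) \<in> {..<l} \<rightarrow> carrier R" using TR[OF i] QR[OF j] UR cR by auto
          fix k
          have "h i j k (x \<otimes> y) = a i j k x \<otimes> b j k y"
            unfolding h_def by (rule embed_product[OF aK[OF a[OF i j]] bK[OF b[OF j]] x y])
          also have "a i j k x = c i j k \<otimes> T i x"
            using x EndD(1)[OF T[OF i] x] by (simp add: a_def compose_def mult_op_def)
          also have "b j k y = U k \<otimes> Q j y"
            using y EndD(1)[OF Q[OF j] y] by (simp add: b_def compose_def mult_op_def)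
          finally show "h i j k (x \<otimes> y) = (T i x \<otimes> Q j y) \<otimes> (U k \<otimes> c i j k)"
            using TR[OF i] QR[OF j] UR[of k] cR[of k] by (simp add: m_ac)
        qed
        also have "\<dots> = (T i x \<otimes> Q j y) \<otimes> (\<Oplus>k\<in>{..<l}. U k \<otimes> c i j k)"
          by (rule finsum_rdistr[symmetric]) (use TR[OF i] QR[OF j] UR cR in auto)
        also have "(\<Oplus>k\<in>{..<l}. U k \<otimes> c i j k) = f (e i \<otimes> d j)"
          unfolding c_def by (rule UV(3)[OF fed[OF i j], symmetric])
        finally show ?thesis using TR[OF i] QR[OF j] fed[OF i j] by (simp add: m_assoc)
      qed
      have "g (x \<otimes> y) = (\<Oplus>i\<in>{..<n}. (\<Oplus>\<^bsub>E\<^esub>j\<in>{..<m}. \<Oplus>\<^bsub>E\<^esub>k\<in>{..<l}. h i j k) (x \<otimes> y))"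
        unfolding g_def by (rule End_ring_finsum[OF carrier_is_subring KR _ _ xy]) (use h2 in auto)
      also have "\<dots> = (\<Oplus>i\<in>{..<n}. T i x \<otimes> f (e i \<otimes> y))"
      proof (rule finsum_cong'[OF refl])
        show "(\<lambda>i. T i x \<otimes> f (e i \<otimes> y)) \<in> {..<n} \<rightarrow> carrier R" using TR feyR by auto
        fix i assume "i \<in> {..<n}"
        then have i: "i < n" by simp
        have "(\<Oplus>\<^bsub>E\<^esub>j\<in>{..<m}. \<Oplus>\<^bsub>E\<^esub>k\<in>{..<l}. h i j k) (x \<otimes> y) =
            (\<Oplus>j\<in>{..<m}. (\<Oplus>\<^bsub>E\<^esub>k\<in>{..<l}. h i j k) (x \<otimes> y))"
          by (rule End_ring_finsum[OF carrier_is_subring KR _ _ xy]) (use h3[OF i] in auto)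
        also have "\<dots> = (\<Oplus>j\<in>{..<m}. T i x \<otimes> (Q j y \<otimes> f (e i \<otimes> d j)))"
        proof (rule finsum_cong'[OF refl])
          show "(\<lambda>j. T i x \<otimes> (Q j y \<otimes> f (e i \<otimes> d j))) \<in> {..<m} \<rightarrow> carrier R" using TR[OF i] QR fed[OF i] by auto
          fix j assume "j \<in> {..<m}"
          then have j: "j < m" by simp
          have "(\<Oplus>\<^bsub>E\<^esub>k\<in>{..<l}. h i j k) (x \<otimes> y) = (\<Oplus>k\<in>{..<l}. h i j k (x \<otimes> y))"
            by (rule End_ring_finsum[OF carrier_is_subring KR _ hE[OF i j] xy]) simp
          then show "(\<Oplus>\<^bsub>E\<^esub>k\<in>{..<l}. h i j k) (x \<otimes> y) = T i x \<otimes> (Q j y \<otimes> f (e i \<otimes> d j))"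
            using hxy[OF i j] by simp
        qed
        also have "\<dots> = T i x \<otimes> f (e i \<otimes> y)"
          unfolding fey[OF i] by (rule finsum_rdistr[symmetric]) (use TR[OF i] QR fed[OF i] in auto)
        finally show "(\<Oplus>\<^bsub>E\<^esub>j\<in>{..<m}. \<Oplus>\<^bsub>E\<^esub>k\<in>{..<l}. h i j k) (x \<otimes> y) = T i x \<otimes> f (e i \<otimes> y)" .
      qed
      finally show "f (x \<otimes> y) = g (x \<otimes> y)" using fxy by simp
    qed
    then show "f \<in> prod_span E ?A ?B" using gP by simp
  qed
  ultimately show ?thesis
    unfolding op_tensor_eq_prod_span[OF N(2,3) \<Gamma>(2,3)] C_def by blast
qed

end

section \<open>Differential operators on a purely inseparable extension\<close>

lemma funpow_invariant:
  assumes "\<And>x. Q x \<Longrightarrow> Q (f x)" "Q x"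
  shows "Q ((f ^^ n) x)"
  by (induction n) (use assms in auto)

context cring begin

text \<open>The inner derivation given by multiplication with \<open>b\<close>, in the sign of
  \<open>diff_ops_upto\<close>, written pointwise so that it can be iterated and compared by
  evaluation.\<close>

definition ad :: "'a set \<Rightarrow> 'a \<Rightarrow> ('a \<Rightarrow> 'a) \<Rightarrow> 'a \<Rightarrow> 'a"
  where "ad P b f = (\<lambda>x\<in>P. f (b \<otimes> x) \<ominus> b \<otimes> f x)"

lemma ad_eq:
  assumes P: "subring P R" and N: "N \<subseteq> P" and f: "f \<in> End R P N" and b: "b \<in> P"
  shows "f \<otimes>\<^bsub>End_ring R P N\<^esub> mult_op R P b \<ominus>\<^bsub>End_ring R P N\<^esub> mult_op R P b \<otimes>\<^bsub>End_ring R P N\<^esub> f = ad P b f"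
proof -
  interpret E: ring "End_ring R P N" by (rule End_ring_is_ring[OF P N])
  have m: "mult_op R P b \<in> End R P N" by (rule mult_op_End[OF P N b])
  have mf: "compose P (mult_op R P b) f \<in> End R P N" using E.m_closed[of "mult_op R P b" f] m f by simp
  show ?thesis
    unfolding a_minus_def End_ring_simps End_ring_a_inv[OF P N mf]
    by (rule extensionalityI[of _ P])
      (use subringE(6)[OF P b] EndD(1)[OF f] in \<open>simp_all add: minus_eq ad_def compose_def mult_op_def\<close>)
qed

lemma ad_End:
  assumes P: "subring P R" and N: "N \<subseteq> P" and f: "f \<in> End R P N" and b: "b \<in> P"
  shows "ad P b f \<in> End R P N"
proof -
  interpret E: ring "End_ring R P N" by (rule End_ring_is_ring[OF P N])
  have "mult_op R P b \<in> carrier (End_ring R P N)" "f \<in> carrier (End_ring R P N)"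
    using mult_op_End[OF P N b] f by simp_all
  then have "f \<otimes>\<^bsub>End_ring R P N\<^esub> mult_op R P b \<ominus>\<^bsub>End_ring R P N\<^esub> mult_op R P b \<otimes>\<^bsub>End_ring R P N\<^esub> f \<in> carrier (End_ring R P N)"
    by (intro E.minus_closed E.m_closed)
  then show ?thesis unfolding ad_eq[OF assms] by simp
qed

lemma diff_ops_upto_Suc:
  assumes P: "subring P R" and N: "N \<subseteq> P"
  shows "diff_ops_upto R P N (Suc i) = {f \<in> End R P N. \<forall>b\<in>P. ad P b f \<in> diff_ops_upto R P N i}"
  unfolding diff_ops_upto.simps using ad_eq[OF P N] by (auto simp del: End_ring_simps)

lemma diff_ops_upto_End:
  assumes P: "subring P R" and N: "N \<subseteq> P"
  shows "diff_ops_upto R P N i \<subseteq> End R P N"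
  by (cases i) (use mult_op_End[OF P N] in auto)

lemma ad_mult_op:
  assumes P: "subring P R" and a: "a \<in> P" and b: "b \<in> P"
  shows "ad P b (mult_op R P a) = mult_op R P \<zero>"
  by (rule extensionalityI[of _ P])
    (use subringE(1)[OF P] subringE(6)[OF P b] a b in
      \<open>auto simp: ad_def mult_op_def m_lcomm subset_iff minus_eq r_neg\<close>)

lemma diff_ops_upto_mono:
  assumes P: "subring P R" and N: "N \<subseteq> P"
  shows "diff_ops_upto R P N i \<subseteq> diff_ops_upto R P N (Suc i)"
proof (induction i)
  case 0
  show ?case
    unfolding diff_ops_upto_Suc[OF P N]
    using ad_mult_op[OF P] mult_op_End[OF P N] subringE(2)[OF P] by auto
next
  case (Suc i)
  then show ?case unfolding diff_ops_upto_Suc[OF P N] by blast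
qed

lemma diff_ops_upto_mono_le:
  assumes P: "subring P R" and N: "N \<subseteq> P" and le: "i \<le> j"
  shows "diff_ops_upto R P N i \<subseteq> diff_ops_upto R P N j"
  using le by (induction rule: dec_induct) (use diff_ops_upto_mono[OF P N] in blast)+

lemma ad_diff_ops_upto:
  assumes P: "subring P R" and N: "N \<subseteq> P" and f: "f \<in> diff_ops_upto R P N i" and b: "b \<in> P"
  shows "ad P b f \<in> diff_ops_upto R P N i"
  using diff_ops_upto_mono[OF P N, of i] f b unfolding diff_ops_upto_Suc[OF P N] by blast

lemma ad_diff_ops:
  assumes P: "subring P R" and N: "N \<subseteq> P" and f: "f \<in> diff_ops R P N" and b: "b \<in> P"
  shows "ad P b f \<in> diff_ops R P N"
  using f ad_diff_ops_upto[OF P N _ b] unfolding diff_ops_def by blast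

lemma diff_ops_upto_add:
  assumes P: "subring P R" and N: "N \<subseteq> P" and f: "f \<in> diff_ops_upto R P N i" and g: "g \<in> diff_ops_upto R P N i"
  shows "(\<lambda>x\<in>P. f x \<oplus> g x) \<in> diff_ops_upto R P N i"
  using f g
proof (induction i arbitrary: f g)
  case 0
  then obtain a b where ab: "a \<in> P" "b \<in> P" "f = mult_op R P a" "g = mult_op R P b" by auto
  have "(\<lambda>x\<in>P. f x \<oplus> g x) = mult_op R P (a \<oplus> b)"
    using ab subringE(1)[OF P] by (auto simp: mult_op_def l_distr subset_iff)
  then show ?case using subringE(7)[OF P ab(1,2)] by simp
next
  case (Suc i)
  have f: "f \<in> End R P N" and g: "g \<in> End R P N" using Suc.prems unfolding diff_ops_upto_Suc[OF P N] by auto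
  have PR: "x \<in> carrier R" if "x \<in> P" for x using that subringE(1)[OF P] by blast
  have lin: "ad P b (\<lambda>x\<in>P. f x \<oplus> g x) = (\<lambda>x\<in>P. ad P b f x \<oplus> ad P b g x)" if b: "b \<in> P" for b
    unfolding ad_def
  proof (rule restrict_ext)
    fix x assume x: "x \<in> P"
    have bx: "b \<otimes> x \<in> P" by (rule subringE(6)[OF P b x])
    note cl = PR[OF EndD(1)[OF f x]] PR[OF EndD(1)[OF g x]] PR[OF EndD(1)[OF f bx]] PR[OF EndD(1)[OF g bx]] PR[OF b]
    show "(\<lambda>x\<in>P. f x \<oplus> g x) (b \<otimes> x) \<ominus> b \<otimes> (\<lambda>x\<in>P. f x \<oplus> g x) x =
        (\<lambda>x\<in>P. f (b \<otimes> x) \<ominus> b \<otimes> f x) x \<oplus> (\<lambda>x\<in>P. g (b \<otimes> x) \<ominus> b \<otimes> g x) x"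
      using x bx cl by (simp add: minus_eq r_distr minus_add a_ac)
  qed
  have mem: "(\<lambda>x\<in>P. ad P b f x \<oplus> ad P b g x) \<in> diff_ops_upto R P N i" if "b \<in> P" for b
    by (rule Suc.IH) (use Suc.prems that in \<open>auto simp: diff_ops_upto_Suc[OF P N] simp del: diff_ops_upto.simps\<close>)
  show ?case
    unfolding diff_ops_upto_Suc[OF P N]
  proof (intro CollectI conjI ballI)
    show "(\<lambda>x\<in>P. f x \<oplus> g x) \<in> End R P N" by (rule End_add[OF P N f g])
    show "ad P b (\<lambda>x\<in>P. f x \<oplus> g x) \<in> diff_ops_upto R P N i" if b: "b \<in> P" for b
      unfolding lin[OF b] by (rule mem[OF b])
  qed
qed

lemma diff_ops_upto_scalar:
  assumes P: "subring P R" and N: "N \<subseteq> P" and f: "f \<in> diff_ops_upto R P N i" and c: "c \<in> N"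
  shows "(\<lambda>x\<in>P. c \<otimes> f x) \<in> diff_ops_upto R P N i"
  using f
proof (induction i arbitrary: f)
  case 0
  then obtain a where a: "a \<in> P" "f = mult_op R P a" by auto
  have cP: "c \<in> P" using c N by blast
  have "(\<lambda>x\<in>P. c \<otimes> f x) = mult_op R P (c \<otimes> a)"
    using a cP subringE(1)[OF P] by (auto simp: mult_op_def m_assoc subset_iff)
  then show ?case using subringE(6)[OF P cP a(1)] by simp
next
  case (Suc i)
  have f: "f \<in> End R P N" using Suc.prems unfolding diff_ops_upto_Suc[OF P N] by auto
  have PR: "x \<in> carrier R" if "x \<in> P" for x using that subringE(1)[OF P] by blast
  have cP: "c \<in> P" using c N by blast
  interpret E: ring "End_ring R P N" by (rule End_ring_is_ring[OF P N])
  have "(\<lambda>x\<in>P. c \<otimes> f x) = compose P (mult_op R P c) f"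
    using EndD(1)[OF f] by (auto simp: compose_def mult_op_def)
  then have cf: "(\<lambda>x\<in>P. c \<otimes> f x) \<in> End R P N"
    using E.m_closed[of "mult_op R P c" f] mult_op_End[OF P N cP] f by simp
  have lin: "ad P b (\<lambda>x\<in>P. c \<otimes> f x) = (\<lambda>x\<in>P. c \<otimes> ad P b f x)" if b: "b \<in> P" for b
    unfolding ad_def
  proof (rule restrict_ext)
    fix x assume x: "x \<in> P"
    have bx: "b \<otimes> x \<in> P" by (rule subringE(6)[OF P b x])
    note cl = PR[OF EndD(1)[OF f x]] PR[OF EndD(1)[OF f bx]] PR[OF b] PR[OF cP]
    show "(\<lambda>x\<in>P. c \<otimes> f x) (b \<otimes> x) \<ominus> b \<otimes> (\<lambda>x\<in>P. c \<otimes> f x) x = c \<otimes> (\<lambda>x\<in>P. f (b \<otimes> x) \<ominus> b \<otimes> f x) x"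
      using x bx cl by (simp add: minus_eq r_distr r_minus m_lcomm)
  qed
  have mem: "(\<lambda>x\<in>P. c \<otimes> ad P b f x) \<in> diff_ops_upto R P N i" if "b \<in> P" for b
    by (rule Suc.IH) (use Suc.prems that in \<open>auto simp: diff_ops_upto_Suc[OF P N] simp del: diff_ops_upto.simps\<close>)
  show ?case
    unfolding diff_ops_upto_Suc[OF P N]
  proof (intro CollectI conjI ballI)
    show "(\<lambda>x\<in>P. c \<otimes> f x) \<in> End R P N" by (rule cf)
    show "ad P b (\<lambda>x\<in>P. c \<otimes> f x) \<in> diff_ops_upto R P N i" if b: "b \<in> P" for b
      unfolding lin[OF b] by (rule mem[OF b])
  qed
qed

lemma diff_ops_upto_zero:
  assumes P: "subring P R" and N: "N \<subseteq> P"
  shows "(\<lambda>x\<in>P. \<zero>) \<in> diff_ops_upto R P N i"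
proof -
  have "(\<lambda>x\<in>P. \<zero>) = mult_op R P \<zero>" using subringE(1)[OF P] by (auto simp: mult_op_def subset_iff)
  then have "(\<lambda>x\<in>P. \<zero>) \<in> diff_ops_upto R P N 0" using subringE(2)[OF P] by simp
  then show ?thesis using diff_ops_upto_mono_le[OF P N, of 0 i] by blast
qed

lemma ad_commute:
  assumes P: "subring P R" and N: "N \<subseteq> P" and f: "f \<in> End R P N" and a: "a \<in> P" and b: "b \<in> P"
  shows "ad P a (ad P b f) = ad P b (ad P a f)"
  unfolding ad_def
proof (rule restrict_ext)
  have PR: "x \<in> carrier R" if "x \<in> P" for x using that subringE(1)[OF P] by blast
  fix x assume x: "x \<in> P"
  note c = subringE(6)[OF P a x] subringE(6)[OF P b x]
  have ab: "a \<otimes> (b \<otimes> x) \<in> P" "b \<otimes> (a \<otimes> x) = a \<otimes> (b \<otimes> x)"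
    using subringE(6)[OF P a c(2)] PR[OF a] PR[OF b] PR[OF x] by (auto simp: m_lcomm)
  note cl = PR[OF EndD(1)[OF f x]] PR[OF EndD(1)[OF f c(1)]] PR[OF EndD(1)[OF f c(2)]] PR[OF EndD(1)[OF f ab(1)]]
    PR[OF a] PR[OF b]
  show "(\<lambda>x\<in>P. f (b \<otimes> x) \<ominus> b \<otimes> f x) (a \<otimes> x) \<ominus> a \<otimes> (\<lambda>x\<in>P. f (b \<otimes> x) \<ominus> b \<otimes> f x) x =
      (\<lambda>x\<in>P. f (a \<otimes> x) \<ominus> a \<otimes> f x) (b \<otimes> x) \<ominus> b \<otimes> (\<lambda>x\<in>P. f (a \<otimes> x) \<ominus> a \<otimes> f x) x"
    using x c ab cl by (simp add: minus_eq r_distr r_minus minus_add minus_minus m_lcomm a_ac)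
qed

text \<open>In characteristic \<open>p\<close> the \<open>p\<close>-th power of the derivation \<open>ad b\<close> is \<open>ad (b\<^sup>p)\<close>.\<close>

lemma ad_nilpotent:
  fixes p :: nat
  assumes p: "Factorial_Ring.prime p" and char: "add_pow R p \<one> = \<zero>"
    and P: "subring P R" and N: "N \<subseteq> P" and f: "f \<in> End R P N" and b: "b \<in> P" and bN: "b [^] (p ^ e) \<in> N"
  shows "(ad P b ^^ (p ^ e)) f = (\<lambda>x\<in>P. \<zero>)"
proof -
  let ?E = "End_ring R P N"
  let ?q = "p ^ e"
  interpret E: ring ?E by (rule End_ring_is_ring[OF P N])
  have PR: "x \<in> carrier R" if "x \<in> P" for x using that subringE(1)[OF P] by blast
  have nb: "\<ominus> b \<in> P" by (rule subringE(5)[OF P b])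
  \<comment> \<open>The sign is put into \<open>x\<close>, which gives the commutator the additive
    shape of \<open>bimodule_map_prime_power\<close>.\<close>
  define x where "x = mult_op R P (\<ominus> b)"
  define y where "y = mult_op R P b"
  have xy: "x \<in> carrier ?E" "y \<in> carrier ?E" using mult_op_End[OF P N] nb b by (simp_all add: x_def y_def)
  have pow: "mult_op R P a [^]\<^bsub>?E\<^esub> n = mult_op R P (a [^] n)" if a: "a \<in> P" for a and n :: nat
  proof (induction n)
    case 0
    have "mult_op R P \<one> = (\<lambda>x\<in>P. x)" unfolding mult_op_def by (rule restrict_ext) (use PR in simp)
    then show ?case by simp
  next
    case (Suc n)
    have "compose P (mult_op R P (a [^] n)) (mult_op R P a) = mult_op R P (a [^] n \<otimes> a)"
      unfolding mult_op_def compose_def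
      by (rule restrict_ext) (use PR[OF a] PR subringE(6)[OF P a] in \<open>simp add: m_assoc\<close>)
    then show ?case using Suc by simp
  qed
  have addp: "(add_pow ?E n f) z = add_pow R n (f z)" if "f \<in> End R P N" "z \<in> P" for f z and n :: nat
    by (induction n) (use that in simp_all)
  have charE: "add_pow ?E p \<one>\<^bsub>?E\<^esub> = \<zero>\<^bsub>?E\<^esub>"
  proof (rule End_eqI)
    show "add_pow ?E p \<one>\<^bsub>?E\<^esub> \<in> End R P N" "\<zero>\<^bsub>?E\<^esub> \<in> End R P N"
      using E.add.nat_pow_closed[OF E.one_closed, of p] E.zero_closed unfolding End_ring_simps(1) .
    fix z assume z: "z \<in> P"
    have "\<one>\<^bsub>?E\<^esub> \<in> End R P N" using E.one_closed by simp
    then have "add_pow ?E p \<one>\<^bsub>?E\<^esub> z = add_pow R p z" using addp z by simp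
    also have "\<dots> = \<zero>" using add_pow_ldistr[of \<one> z p] char PR[OF z] by simp
    finally show "add_pow ?E p \<one>\<^bsub>?E\<^esub> z = \<zero>\<^bsub>?E\<^esub> z" using z by simp
  qed
  have step: "(\<lambda>z. x \<otimes>\<^bsub>?E\<^esub> z \<oplus>\<^bsub>?E\<^esub> z \<otimes>\<^bsub>?E\<^esub> y) g = ad P b g" if g: "g \<in> End R P N" for g
    by (rule extensionalityI[of _ P])
      (use PR[OF b] PR EndD(1)[OF g] subringE(6)[OF P b] in
        \<open>simp_all add: x_def y_def ad_def compose_def mult_op_def minus_eq l_minus a_comm\<close>)
  have "((\<lambda>z. x \<otimes>\<^bsub>?E\<^esub> z \<oplus>\<^bsub>?E\<^esub> z \<otimes>\<^bsub>?E\<^esub> y) ^^ n) f = (ad P b ^^ n) f \<and> (ad P b ^^ n) f \<in> End R P N" for n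
  proof (induction n)
    case 0
    then show ?case using f by simp
  next
    case (Suc n)
    then have IH: "((\<lambda>z. x \<otimes>\<^bsub>?E\<^esub> z \<oplus>\<^bsub>?E\<^esub> z \<otimes>\<^bsub>?E\<^esub> y) ^^ n) f = (ad P b ^^ n) f" "(ad P b ^^ n) f \<in> End R P N" by blast+
    show ?case
      unfolding funpow.simps comp_def IH(1) by (rule conjI[OF step[OF IH(2)] ad_End[OF P N IH(2) b]])
  qed
  then have "(ad P b ^^ ?q) f = ((\<lambda>z. x \<otimes>\<^bsub>?E\<^esub> z \<oplus>\<^bsub>?E\<^esub> z \<otimes>\<^bsub>?E\<^esub> y) ^^ ?q) f" by simp
  also have "\<dots> = x [^]\<^bsub>?E\<^esub> ?q \<otimes>\<^bsub>?E\<^esub> f \<oplus>\<^bsub>?E\<^esub> f \<otimes>\<^bsub>?E\<^esub> y [^]\<^bsub>?E\<^esub> ?q"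
    by (rule E.bimodule_map_prime_power[OF p charE xy]) (use f in simp)
  also have "\<dots> = (\<lambda>x\<in>P. \<zero>)"
  proof (rule extensionalityI[of _ P])
    fix z assume z: "z \<in> P"
    have fz: "f z \<in> carrier R" using PR[OF EndD(1)[OF f z]] .
    have cl: "b [^] ?q \<in> carrier R" "(\<ominus> b) [^] ?q \<in> carrier R" using PR[OF b] by simp_all
    \<comment> \<open>Frobenius applied to \<open>\<ominus> b \<oplus> b\<close>. As
      \<open>b [^] ?q\<close> lies in \<open>N\<close> and is pulled out by \<open>f\<close>, the
      two terms cancel.\<close>
    have "(\<ominus> b) [^] ?q \<oplus> b [^] ?q = \<zero>"
    proof -
      have "(\<ominus> b \<oplus> b) [^] ?q = (\<ominus> b) [^] ?q \<oplus> b [^] ?q"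
        by (rule frobenius_add[OF p char]) (use PR[OF b] in simp_all)
      moreover have "(\<zero>::'a) [^] ?q = \<zero>" using prime_gt_0_nat[OF p] by (intro nat_pow_zero) simp
      ultimately show ?thesis using PR[OF b] by (simp add: l_neg)
    qed
    then have "((\<ominus> b) [^] ?q) \<otimes> f z \<oplus> (b [^] ?q) \<otimes> f z = \<zero>"
      using l_distr[OF cl(2,1) fz] fz by simp
    then have "(compose P (mult_op R P ((\<ominus> b) [^] ?q)) f) z \<oplus> (compose P f (mult_op R P (b [^] ?q))) z = \<zero>"
      using z EndD(1)[OF f z] EndD(4)[OF f bN z] by (simp add: compose_def mult_op_def)
    then show "(x [^]\<^bsub>?E\<^esub> ?q \<otimes>\<^bsub>?E\<^esub> f \<oplus>\<^bsub>?E\<^esub> f \<otimes>\<^bsub>?E\<^esub> y [^]\<^bsub>?E\<^esub> ?q) z = (\<lambda>x\<in>P. \<zero>) z"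
      unfolding x_def y_def pow[OF nb] pow[OF b] End_ring_simps(2,3) using z by simp
  qed (simp_all)
  finally show ?thesis .
qed

end

text \<open>A direct bound on the order would need expansions in several commuting commutators.
  Instead an operator outside \<open>?D\<close> is replaced by iterated commutators until
  \<open>ad\<close> with each basis element brings it into \<open>?D\<close>; by
  \<open>N\<close>-linearity the same holds for every element of \<open>P\<close>, with one common
  order, so the operator was differential after all.\<close>

lemma (in field) diff_ops_eq_End:
  fixes p :: nat
  assumes p: "Factorial_Ring.prime p" and char: "add_pow R p \<one> = \<zero>"
    and N: "subfield N R" and P: "subring P R" "N \<subseteq> P" and fin: "finite_dimension N P"
    and pi: "\<And>x. x \<in> P \<Longrightarrow> \<exists>e::nat. x [^] (p ^ e) \<in> N"
  shows "diff_ops R P N = End R P N"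
proof (rule ccontr)
  let ?D = "diff_ops R P N"
  let ?U = "diff_ops_upto R P N"
  assume neq: "?D \<noteq> End R P N"
  have DE: "?D \<subseteq> End R P N" unfolding diff_ops_def using diff_ops_upto_End[OF P] by blast
  obtain n :: nat and e T where e: "\<And>i. i < n \<Longrightarrow> e i \<in> P" and T: "\<And>i x. i < n \<Longrightarrow> x \<in> P \<Longrightarrow> T i x \<in> N"
    and exp: "\<And>x. x \<in> P \<Longrightarrow> x = (\<Oplus>i\<in>{..<n}. T i x \<otimes> e i)"
    by (rule exists_dual_basis[OF N P fin]) (rule that)
  have "\<exists>f\<in>End R P N - ?D. \<forall>j<k. ad P (e j) f \<in> ?D" if "k \<le> n" for k
    using that
  proof (induction k)
    case 0
    then show ?case using neq DE by blast
  next
    case (Suc k)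
    then obtain f where f: "f \<in> End R P N" "f \<notin> ?D" "\<And>j. j < k \<Longrightarrow> ad P (e j) f \<in> ?D" by auto
    have ek: "e k \<in> P" using e Suc.prems by simp
    obtain d :: nat where d: "e k [^] (p ^ d) \<in> N" using pi[OF ek] by blast
    define g where "g i = (ad P (e k) ^^ i) f" for i
    have gE: "g i \<in> End R P N" for i
      unfolding g_def by (rule funpow_invariant[of "\<lambda>h. h \<in> End R P N"]) (use ad_End[OF P _ ek] f(1) in auto)
    have "(\<lambda>x\<in>P. \<zero>) \<in> ?D" using diff_ops_upto_zero[OF P] unfolding diff_ops_def by blast
    then have ex: "g (p ^ d) \<in> ?D"
      unfolding g_def using ad_nilpotent[OF p char P f(1) ek d] by simp
    \<comment> \<open>Nilpotency puts some iterate into \<open>?D\<close>. The one just before the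
      first such iterate is still outside, while its commutator with \<open>e k\<close> is
      inside.\<close>
    define i where "i = (LEAST i. g i \<in> ?D)"
    have iD: "g i \<in> ?D" unfolding i_def by (rule LeastI[of "\<lambda>i. g i \<in> ?D", OF ex])
    then have "i \<noteq> 0" using f(2) by (auto simp: g_def intro: Nat.gr0I)
    then obtain i' where i': "i = Suc i'" using not0_implies_Suc by blast
    then have notD: "g i' \<notin> ?D" using not_less_Least[of i' "\<lambda>i. g i \<in> ?D"] unfolding i_def[symmetric] by simp
    have "ad P (e j) (g i') \<in> ?D" if j: "j < Suc k" for j
    proof (cases "j = k")
      case True
      then show ?thesis using iD unfolding i' g_def by simp
    next
      case False
      then have "j < k" using j by simp
      have ej: "e j \<in> P" using e j Suc.prems by simp
      \<comment> \<open>The conditions already achieved for \<open>j < k\<close> survive, since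
        \<open>ad\<close> with \<open>e j\<close> commutes with \<open>ad\<close> with
        \<open>e k\<close>, and \<open>?D\<close> is stable under the latter.\<close>
      have "ad P (e j) (g l) = (ad P (e k) ^^ l) (ad P (e j) f)" for l
      proof (induction l)
        case (Suc l)
        have "ad P (e j) (g (Suc l)) = ad P (e k) (ad P (e j) (g l))"
          unfolding g_def funpow.simps comp_def by (rule ad_commute[OF P _ ej ek]) (use gE g_def in simp)
        then show ?case using Suc by simp
      qed (simp add: g_def)
      then show ?thesis
        using funpow_invariant[of "\<lambda>h. h \<in> ?D", OF ad_diff_ops[OF P _ ek] f(3)[OF \<open>j < k\<close>]] by simp
    qed
    then show ?case using gE notD by blast
  qed
  then obtain f where f: "f \<in> End R P N" "f \<notin> ?D" and fj: "\<And>j. j < n \<Longrightarrow> ad P (e j) f \<in> ?D" by blast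
  \<comment> \<open>Finitely many differential operators have a common order, because the filtration
    increases.\<close>
  have "\<exists>i. \<forall>j<k. ad P (e j) f \<in> ?U i" if "k \<le> n" for k
    using that
  proof (induction k)
    case (Suc k)
    then obtain i where i: "\<forall>j<k. ad P (e j) f \<in> ?U i" by auto
    obtain i' where i': "ad P (e k) f \<in> ?U i'" using fj[of k] Suc.prems unfolding diff_ops_def by auto
    have "\<forall>j<Suc k. ad P (e j) f \<in> ?U (max i i')"
      using i i' diff_ops_upto_mono_le[OF P, of i "max i i'"] diff_ops_upto_mono_le[OF P, of i' "max i i'"]
      by (auto simp: less_Suc_eq)
    then show ?case ..
  qed simp
  then obtain i where i: "\<And>j. j < n \<Longrightarrow> ad P (e j) f \<in> ?U i" by blast
  have PR: "x \<in> carrier R" if "x \<in> P" for x using that subringE(1)[OF P(1)] by blast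
  have NR: "x \<in> carrier R" if "x \<in> N" for x using that P(2) PR by blast
  have "ad P l f \<in> ?U i" if l: "l \<in> P" for l
  proof -
    have TR: "T j l \<in> carrier R" if "j < n" for j using NR[OF T[OF that l]] .
    have eR: "e j \<in> carrier R" if "j < n" for j using PR[OF e[OF that]] .
    have part: "(\<lambda>x\<in>P. \<Oplus>j\<in>{..<k}. T j l \<otimes> ad P (e j) f x) \<in> ?U i" if "k \<le> n" for k
      using that
    proof (induction k)
      case 0
      have eq: "(\<lambda>x\<in>P. \<Oplus>j\<in>{..<0}. T j l \<otimes> ad P (e j) f x) = (\<lambda>x\<in>P. \<zero>)" by (rule restrict_ext) simp
      show ?case unfolding eq by (rule diff_ops_upto_zero[OF P])
    next
      case (Suc k)
      have k: "k < n" using Suc.prems by simp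
      have cl: "ad P (e j) f x \<in> carrier R" if "j < n" "x \<in> P" for j x
        using PR[OF EndD(1)[OF ad_End[OF P f(1) e[OF that(1)]] that(2)]] .
      have eq: "(\<lambda>x\<in>P. \<Oplus>j\<in>{..<Suc k}. T j l \<otimes> ad P (e j) f x) =
          (\<lambda>x\<in>P. (\<lambda>x\<in>P. T k l \<otimes> ad P (e k) f x) x \<oplus> (\<lambda>x\<in>P. \<Oplus>j\<in>{..<k}. T j l \<otimes> ad P (e j) f x) x)"
      proof (rule restrict_ext)
        fix x assume x: "x \<in> P"
        have "(\<Oplus>j\<in>insert k {..<k}. T j l \<otimes> ad P (e j) f x) =
            T k l \<otimes> ad P (e k) f x \<oplus> (\<Oplus>j\<in>{..<k}. T j l \<otimes> ad P (e j) f x)"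
          by (rule finsum_insert) (use TR cl x k in auto)
        then show "(\<Oplus>j\<in>{..<Suc k}. T j l \<otimes> ad P (e j) f x) =
            (\<lambda>x\<in>P. T k l \<otimes> ad P (e k) f x) x \<oplus> (\<lambda>x\<in>P. \<Oplus>j\<in>{..<k}. T j l \<otimes> ad P (e j) f x) x"
          using x by (simp add: lessThan_Suc)
      qed
      have "(\<lambda>x\<in>P. \<Oplus>j\<in>{..<k}. T j l \<otimes> ad P (e j) f x) \<in> ?U i" by (rule Suc.IH) (use k in simp)
      then show ?case
        unfolding eq by (rule diff_ops_upto_add[OF P diff_ops_upto_scalar[OF P i[OF k] T[OF k l]]])
    qed
    \<comment> \<open>Because \<open>f\<close> is \<open>N\<close>-linear, \<open>ad P l f\<close>
      depends linearly over \<open>N\<close> on \<open>l\<close>, and so it is determined by the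
      basis elements.\<close>
    have "ad P l f = (\<lambda>x\<in>P. \<Oplus>j\<in>{..<n}. T j l \<otimes> ad P (e j) f x)"
      unfolding ad_def[of P l]
    proof (rule restrict_ext)
      fix x assume x: "x \<in> P"
      have fx: "f x \<in> carrier R" using PR[OF EndD(1)[OF f(1) x]] .
      have ex: "e j \<otimes> x \<in> P" if "j < n" for j by (rule subringE(6)[OF P(1) e[OF that] x])
      have fex: "f (e j \<otimes> x) \<in> carrier R" if "j < n" for j using PR[OF EndD(1)[OF f(1) ex[OF that]]] .
      have Tl: "T j l \<otimes> (e j \<otimes> x) \<in> P" if "j < n" for j
        using subringE(6)[OF P(1) _ ex[OF that]] T[OF that l] P(2) by blast
      have "l \<otimes> x = (\<Oplus>j\<in>{..<n}. T j l \<otimes> e j) \<otimes> x" using exp[OF l] by simp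
      also have "\<dots> = (\<Oplus>j\<in>{..<n}. T j l \<otimes> e j \<otimes> x)" by (rule finsum_ldistr) (use PR[OF x] TR eR in auto)
      also have "\<dots> = (\<Oplus>j\<in>{..<n}. T j l \<otimes> (e j \<otimes> x))"
        by (rule finsum_cong'[OF refl]) (use PR[OF x] TR eR in \<open>auto simp: m_assoc\<close>)
      finally have "f (l \<otimes> x) = f (\<Oplus>j\<in>{..<n}. T j l \<otimes> (e j \<otimes> x))" by simp
      also have "\<dots> = (\<Oplus>j\<in>{..<n}. f (T j l \<otimes> (e j \<otimes> x)))"
        by (rule End_sum[OF f(1) subring.axioms(1)[OF P(1)]]) (use Tl in auto)
      also have "\<dots> = (\<Oplus>j\<in>{..<n}. T j l \<otimes> f (e j \<otimes> x))"
      proof (rule finsum_cong'[OF refl])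
        show "(\<lambda>j. T j l \<otimes> f (e j \<otimes> x)) \<in> {..<n} \<rightarrow> carrier R" using TR fex by auto
        show "f (T j l \<otimes> (e j \<otimes> x)) = T j l \<otimes> f (e j \<otimes> x)" if "j \<in> {..<n}" for j
          by (rule EndD(4)[OF f(1) T[OF _ l] ex]) (use that in simp_all)
      qed
      also have "\<dots> = (\<Oplus>j\<in>{..<n}. T j l \<otimes> ad P (e j) f x \<oplus> T j l \<otimes> e j \<otimes> f x)"
      proof (rule finsum_cong'[OF refl])
        show "(\<lambda>j. T j l \<otimes> ad P (e j) f x \<oplus> T j l \<otimes> e j \<otimes> f x) \<in> {..<n} \<rightarrow> carrier R"
          using TR fex eR fx x by (auto simp: ad_def)
        fix j assume "j \<in> {..<n}"
        then have j: "j < n" by simp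
        have "T j l \<otimes> ad P (e j) f x \<oplus> T j l \<otimes> e j \<otimes> f x = T j l \<otimes> (ad P (e j) f x \<oplus> e j \<otimes> f x)"
          using TR[OF j] fex[OF j] eR[OF j] fx x by (simp add: ad_def r_distr m_assoc)
        also have "ad P (e j) f x \<oplus> e j \<otimes> f x = f (e j \<otimes> x)"
          using fex[OF j] eR[OF j] fx x by (simp add: ad_def minus_eq a_assoc l_neg)
        finally show "T j l \<otimes> f (e j \<otimes> x) = T j l \<otimes> ad P (e j) f x \<oplus> T j l \<otimes> e j \<otimes> f x" by simp
      qed
      also have "\<dots> = (\<Oplus>j\<in>{..<n}. T j l \<otimes> ad P (e j) f x) \<oplus> (\<Oplus>j\<in>{..<n}. T j l \<otimes> e j \<otimes> f x)"
        by (rule finsum_addf) (use TR fex eR fx x in \<open>auto simp: ad_def\<close>)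
      also have "(\<Oplus>j\<in>{..<n}. T j l \<otimes> e j \<otimes> f x) = (\<Oplus>j\<in>{..<n}. T j l \<otimes> e j) \<otimes> f x"
        by (rule finsum_ldistr[symmetric]) (use TR eR fx in auto)
      also have "(\<Oplus>j\<in>{..<n}. T j l \<otimes> e j) = l" by (rule exp[OF l, symmetric])
      finally have eq: "f (l \<otimes> x) = (\<Oplus>j\<in>{..<n}. T j l \<otimes> ad P (e j) f x) \<oplus> l \<otimes> f x" .
      have "(\<Oplus>j\<in>{..<n}. T j l \<otimes> ad P (e j) f x) \<in> carrier R"
        by (rule finsum_closed) (use TR fex eR fx x in \<open>auto simp: ad_def\<close>)
      then show "f (l \<otimes> x) \<ominus> l \<otimes> f x = (\<Oplus>j\<in>{..<n}. T j l \<otimes> ad P (e j) f x)"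
        unfolding eq using PR[OF l] fx by (simp add: minus_eq a_assoc r_neg)
    qed
    then show ?thesis using part[of n] by simp
  qed
  then have "f \<in> ?U (Suc i)" unfolding diff_ops_upto_Suc[OF P] using f(1) by blast
  then show False using f(2) unfolding diff_ops_def by blast
qed

text \<open>For a retraction \<open>T\<close> of \<open>P\<close> onto \<open>N\<close>, the
  operator \<open>T - id\<close> kills \<open>\<one>\<close>, and it kills \<open>x\<close> only if
  \<open>x = T x \<in> N\<close>. Conversely an \<open>N\<close>-linear operator that kills
  \<open>\<one>\<close> kills all of \<open>N\<close>.\<close>

lemma (in field) killed_by_diff_ops_plus:
  assumes N: "subfield N R" and P: "subring P R" "N \<subseteq> P" and fin: "finite_dimension N P"
    and D: "diff_ops R P N = End R P N"
  shows "killed_by R P (diff_ops_plus R P N) = N"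
proof (rule equalityI; rule subsetI)
  have PR: "x \<in> carrier R" if "x \<in> P" for x using that subringE(1)[OF P(1)] by blast
  have one: "\<one> \<in> P" by (rule subringE(3)[OF P(1)])
  fix x assume "x \<in> killed_by R P (diff_ops_plus R P N)"
  then have x: "x \<in> P" and kill: "\<And>d. d \<in> End R P N \<Longrightarrow> d \<one> = \<zero> \<Longrightarrow> d x = \<zero>"
    by (auto simp: killed_by_def diff_ops_plus_def D)
  obtain T where T: "T \<in> End R P N" "\<And>x. x \<in> P \<Longrightarrow> T x \<in> N" "T \<one> = \<one>"
    by (rule exists_retraction[OF N P fin]) (rule that)
  interpret E: ring "End_ring R P N" by (rule End_ring_is_ring[OF P])
  define d where "d = T \<ominus>\<^bsub>End_ring R P N\<^esub> \<one>\<^bsub>End_ring R P N\<^esub>"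
  have d: "d \<in> End R P N" using E.minus_closed[of T "\<one>\<^bsub>End_ring R P N\<^esub>"] T(1) E.one_closed by (simp add: d_def)
  have oE: "(\<lambda>x\<in>P. x) \<in> End R P N" using E.one_closed by simp
  have dx: "d y = T y \<ominus> y" if "y \<in> P" for y
    using that by (simp add: d_def a_minus_def End_ring_a_inv[OF P oE])
  have "T x \<ominus> x = \<zero>" using kill[OF d] dx[OF one] dx[OF x] T(3) by (simp add: minus_eq r_neg)
  then have "T x = x" using PR[OF x] PR[OF EndD(1)[OF T(1) x]] r_right_minus_eq by blast
  then show "x \<in> N" using T(2)[OF x] by simp
next
  fix x assume x: "x \<in> N"
  have "d x = \<zero>" if d: "d \<in> End R P N" "d \<one> = \<zero>" for d
    using EndD(4)[OF d(1) x subringE(3)[OF P(1)]] d(2) x P(2) subringE(1)[OF P(1)] by auto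
  then show "x \<in> killed_by R P (diff_ops_plus R P N)"
    using x P(2) by (auto simp: killed_by_def diff_ops_plus_def D)
qed

section \<open>The crossed product of a Galois extension\<close>

lemma (in ring) Aut_subset_End: "Aut R M K \<subseteq> End R M K" if "K \<subseteq> M"
proof
  fix g assume g: "g \<in> Aut R M K"
  show "g \<in> End R M K"
  proof (rule EndI)
    show "g (k \<otimes> x) = k \<otimes> g x" if "k \<in> K" "x \<in> M" for k x
      using AutD(7)[OF g, of k x] AutD(4)[OF g that(1)] that \<open>K \<subseteq> M\<close> by auto
  qed (use AutD(1,5,6)[OF g] in auto)
qed

lemma Aut_mono: "K \<subseteq> K' \<Longrightarrow> Aut R M K' \<subseteq> Aut R M K"
  by (auto simp: Aut_def)

lemma (in ring) mult_op_compose_apply: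
  assumes "h \<in> Aut R M K" "x \<in> M"
  shows "compose M (mult_op R M c) h x = c \<otimes> h x"
  using AutD(5)[OF assms] assms(2) by (simp add: compose_def mult_op_def)

text \<open>Apply \<open>h\<close> to the defining relation at the automorphism
  \<open>h\<^sup>-\<^sup>1 k\<close>. This turns the relation at the identity into orthogonality of
  any two automorphisms.\<close>

lemma (in field) dual_family_shift:
  assumes M: "subfield M R" "K \<subseteq> M" and uv: "dual_family M K n u v" and h: "h \<in> Aut R M K" and k: "k \<in> Aut R M K"
  shows "(\<Oplus>i\<in>{..<n}. h (u i) \<otimes> k (v i)) = (if k = h then \<one> else \<zero>)"
proof -
  have sM: "subring M R" by (rule subfieldE(1)[OF M(1)])
  have MR: "\<And>x. x \<in> M \<Longrightarrow> x \<in> carrier R" using subfieldE(3)[OF M(1)] by blast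
  have u: "u i \<in> M" and v: "v i \<in> M" for i using uv by (auto simp: dual_family_def)
  obtain h' where h': "h' \<in> Aut R M K" "\<And>x. x \<in> M \<Longrightarrow> h' (h x) = x" "\<And>x. x \<in> M \<Longrightarrow> h (h' x) = x"
    by (rule Aut_inverse[OF sM M(2) h]) (rule that)
  have g: "compose M h' k \<in> Aut R M K" by (rule Aut_compose[OF sM M(2) h'(1) k])
  have iff: "compose M h' k = (\<lambda>x\<in>M. x) \<longleftrightarrow> k = h"
  proof
    assume "compose M h' k = (\<lambda>x\<in>M. x)"
    then have eq: "compose M h' k x = (\<lambda>x\<in>M. x) x" for x by simp
    have "k x = h x" if "x \<in> M" for x
      using h'(3)[OF AutD(5)[OF k that]] eq[of x] that by (simp add: compose_def)
    then show "k = h" by (intro extensionalityI[OF AutD(1)[OF k] AutD(1)[OF h]])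
  next
    assume "k = h"
    show "compose M h' k = (\<lambda>x\<in>M. x)"
      unfolding compose_def \<open>k = h\<close> by (rule restrict_ext) (rule h'(2))
  qed
  have hE: "h \<in> End R M K" using Aut_subset_End[OF M(2)] h by blast
  have gM: "compose M h' k (v i) \<in> M" for i by (rule AutD(5)[OF g v])
  have "(\<Oplus>i\<in>{..<n}. h (u i) \<otimes> k (v i)) = (\<Oplus>i\<in>{..<n}. h (u i \<otimes> compose M h' k (v i)))"
  proof (rule finsum_cong'[OF refl])
    show "(\<lambda>i. h (u i \<otimes> compose M h' k (v i))) \<in> {..<n} \<rightarrow> carrier R"
      using MR[OF AutD(5)[OF h subringE(6)[OF sM u gM]]] by simp
    show "h (u i) \<otimes> k (v i) = h (u i \<otimes> compose M h' k (v i))" for i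
      using AutD(7)[OF h u gM] h'(3)[OF AutD(5)[OF k v]] v by (simp add: compose_def)
  qed
  also have "\<dots> = h (\<Oplus>i\<in>{..<n}. u i \<otimes> compose M h' k (v i))"
    by (rule End_sum[OF hE subring.axioms(1)[OF sM], symmetric]) (use subringE(6)[OF sM u gM] in auto)
  also have "(\<Oplus>i\<in>{..<n}. u i \<otimes> compose M h' k (v i)) = (if k = h then \<one> else \<zero>)"
    using uv g unfolding dual_family_def iff[symmetric] by blast
  also have "h \<dots> = (if k = h then \<one> else \<zero>)" using AutD(8)[OF h] Aut_zero_minus(1)[OF h sM] by simp
  finally show ?thesis .
qed

text \<open>Evaluate the relation at the \<open>v i\<close>, multiply by \<open>h (u i)\<close> and
  sum over \<open>i\<close>: by orthogonality only \<open>c h\<close> survives.\<close>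

lemma (in field) dedekind_independence:
  assumes M: "subfield M R" "K \<subseteq> M" and fin: "finite (Aut R M K)"
    and T: "T \<subseteq> Aut R M K" and c: "\<And>g. g \<in> T \<Longrightarrow> c g \<in> carrier R"
    and zero: "\<And>x. x \<in> M \<Longrightarrow> (\<Oplus>g\<in>T. c g \<otimes> g x) = \<zero>" and h: "h \<in> T"
  shows "c h = \<zero>"
proof -
  have MR: "\<And>x. x \<in> M \<Longrightarrow> x \<in> carrier R" using subfieldE(3)[OF M(1)] by blast
  have finT: "finite T" by (rule finite_subset[OF T fin])
  obtain n u v where uv: "dual_family M K n u v" by (rule exists_dual_family[OF M fin])
  have u: "u i \<in> M" and v: "v i \<in> M" for i using uv by (auto simp: dual_family_def)
  have hA: "h \<in> Aut R M K" using h T by blast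
  have gR: "g x \<in> carrier R" if "g \<in> T" "x \<in> M" for g x by (rule MR[OF AutD(5)[OF subsetD[OF T that(1)] that(2)]])
  have huR: "h (u i) \<in> carrier R" for i by (rule gR[OF h u])
  have gvR: "g (v i) \<in> carrier R" if "g \<in> T" for g i by (rule gR[OF that v])
  have "\<zero> = (\<Oplus>i\<in>{..<n}. h (u i) \<otimes> (\<Oplus>g\<in>T. c g \<otimes> g (v i)))"
    unfolding zero[OF v] using huR by (simp add: finsum_zero)
  also have "\<dots> = (\<Oplus>i\<in>{..<n}. \<Oplus>g\<in>T. h (u i) \<otimes> (c g \<otimes> g (v i)))"
  proof (rule finsum_cong'[OF refl])
    have cl: "(\<lambda>g. c g \<otimes> g (v i)) \<in> T \<rightarrow> carrier R" for i using c gvR by blast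
    show eq: "h (u i) \<otimes> (\<Oplus>g\<in>T. c g \<otimes> g (v i)) = (\<Oplus>g\<in>T. h (u i) \<otimes> (c g \<otimes> g (v i)))" for i
      by (rule finsum_rdistr[OF finT huR cl])
    show "(\<lambda>i. \<Oplus>g\<in>T. h (u i) \<otimes> (c g \<otimes> g (v i))) \<in> {..<n} \<rightarrow> carrier R"
      unfolding eq[symmetric] using huR finsum_closed[OF cl] by blast
  qed
  also have "\<dots> = (\<Oplus>g\<in>T. \<Oplus>i\<in>{..<n}. h (u i) \<otimes> (c g \<otimes> g (v i)))"
    by (rule finsum_swap[OF _ finT]) (use huR c gvR in \<open>simp_all\<close>)
  also have "\<dots> = (\<Oplus>g\<in>T. if h = g then c g else \<zero>)"
  proof (rule finsum_cong'[OF refl])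
    show "(\<lambda>g. if h = g then c g else \<zero>) \<in> T \<rightarrow> carrier R" using c by auto
    fix g assume g: "g \<in> T"
    have gA: "g \<in> Aut R M K" using g T by blast
    have "(\<Oplus>i\<in>{..<n}. h (u i) \<otimes> (c g \<otimes> g (v i))) = (\<Oplus>i\<in>{..<n}. c g \<otimes> (h (u i) \<otimes> g (v i)))"
      by (rule finsum_cong'[OF refl]) (use huR c[OF g] gvR[OF g] in \<open>auto simp: m_lcomm\<close>)
    also have "\<dots> = c g \<otimes> (\<Oplus>i\<in>{..<n}. h (u i) \<otimes> g (v i))"
      by (rule finsum_rdistr[symmetric]) (use huR c[OF g] gvR[OF g] in auto)
    finally show "(\<Oplus>i\<in>{..<n}. h (u i) \<otimes> (c g \<otimes> g (v i))) = (if h = g then c g else \<zero>)"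
      unfolding dual_family_shift[OF M uv hA gA] using c[OF g] by auto
  qed
  also have "\<dots> = c h" by (rule finsum_singleton[OF h finT]) (use c in blast)
  finally show ?thesis by simp
qed

lemma (in field) crossed_direct_Aut:
  assumes M: "subfield M R" "K \<subseteq> M" and fin: "finite (Aut R M K)" and H: "H \<subseteq> Aut R M K"
  shows "crossed_direct (End_ring R M K) (mult_op R M ` M) H"
  unfolding crossed_direct_def
proof (intro allI impI ballI)
  let ?E = "End_ring R M K"
  have sM: "subring M R" by (rule subfieldE(1)[OF M(1)])
  have MR: "\<And>x. x \<in> M \<Longrightarrow> x \<in> carrier R" using subfieldE(3)[OF M(1)] by blast
  interpret E: ring ?E by (rule End_ring_is_ring[OF sM M(2)])
  fix T d h
  assume *: "finite T \<and> T \<subseteq> H \<and> d \<in> T \<rightarrow> mult_op R M ` M \<and> (\<Oplus>\<^bsub>?E\<^esub>h\<in>T. d h \<otimes>\<^bsub>?E\<^esub> h) = \<zero>\<^bsub>?E\<^esub>"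
    and h: "h \<in> T"
  then have T: "T \<subseteq> Aut R M K" "finite T" using H by auto
  obtain c where c: "\<And>g. g \<in> T \<Longrightarrow> c g \<in> M \<and> d g = mult_op R M (c g)"
  proof -
    have "\<forall>g\<in>T. \<exists>a. a \<in> M \<and> d g = mult_op R M a" using * by blast
    then show ?thesis using bchoice[of T "\<lambda>g a. a \<in> M \<and> d g = mult_op R M a"] that by blast
  qed
  have dg: "d g \<otimes>\<^bsub>?E\<^esub> g \<in> End R M K" if "g \<in> T" for g
    using E.m_closed[of "d g" g] mult_op_End[OF sM M(2)] c[OF that] Aut_subset_End[OF M(2)] T that by auto
  have "(\<Oplus>g\<in>T. c g \<otimes> g x) = \<zero>" if x: "x \<in> M" for x
  proof -
    have "(\<Oplus>g\<in>T. c g \<otimes> g x) = (\<Oplus>g\<in>T. (d g \<otimes>\<^bsub>?E\<^esub> g) x)"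
    proof (rule finsum_cong'[OF refl])
      show "(\<lambda>g. (d g \<otimes>\<^bsub>?E\<^esub> g) x) \<in> T \<rightarrow> carrier R"
        by (rule Pi_I, rule MR, rule EndD(1)[OF dg x])
      show "c g \<otimes> g x = (d g \<otimes>\<^bsub>?E\<^esub> g) x" if "g \<in> T" for g
        using mult_op_compose_apply[OF subsetD[OF T(1) that] x] c[OF that] by simp
    qed
    also have "\<dots> = (\<Oplus>\<^bsub>?E\<^esub>g\<in>T. d g \<otimes>\<^bsub>?E\<^esub> g) x"
      by (rule End_ring_finsum[OF sM M(2) T(2) dg x, symmetric])
    also have "\<dots> = \<zero>\<^bsub>?E\<^esub> x" using * by simp
    finally show ?thesis using x by simp
  qed
  then have "c h = \<zero>" using dedekind_independence[OF M fin T(1) _ _ h, of c] c MR by blast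
  then have "d h = mult_op R M \<zero>" using c[OF h] by simp
  then show "d h \<otimes>\<^bsub>?E\<^esub> h = \<zero>\<^bsub>?E\<^esub>"
    using MR AutD(5)[OF subsetD[OF T(1) h]] by (auto simp: compose_def mult_op_def)
qed

text \<open>Expand \<open>f x\<close> by means of \<open>x = \<Sum> u\<^sub>i Tr (v\<^sub>i x)\<close>; linearity over \<open>N\<close> forces \<open>c g (g y - y) = 0\<close> for \<open>y \<in> N\<close>.\<close>

lemma (in field) End_expansion:
  assumes M: "subfield M R" "K \<subseteq> M" and fin: "finite (Aut R M K)" and fixed: "fixed_by M (Aut R M K) \<subseteq> K"
    and N: "K \<subseteq> N" "N \<subseteq> M" and f: "f \<in> End R M N"
  obtains c where "\<And>g. g \<in> Aut R M K \<Longrightarrow> c g \<in> M"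
    "\<And>g. g \<in> Aut R M K \<Longrightarrow> g \<notin> Aut R M N \<Longrightarrow> c g = \<zero>"
    "\<And>x. x \<in> M \<Longrightarrow> f x = (\<Oplus>g\<in>Aut R M K. c g \<otimes> g x)"
proof -
  let ?A = "Aut R M K"
  have sM: "subring M R" by (rule subfieldE(1)[OF M(1)])
  have MR: "\<And>x. x \<in> M \<Longrightarrow> x \<in> carrier R" using subfieldE(3)[OF M(1)] by blast
  obtain n u v where uv: "dual_family M K n u v" by (rule exists_dual_family[OF M fin])
  have u: "u i \<in> M" and v: "v i \<in> M" for i using uv by (auto simp: dual_family_def)
  have fK: "f \<in> End R M K" using f End_mono[OF N(1)] by blast
  have gR: "g x \<in> carrier R" if "g \<in> ?A" "x \<in> M" for g x by (rule MR[OF AutD(5)[OF that]])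
  have fu: "f (u i) \<in> M" for i by (rule EndD(1)[OF f u])
  \<comment> \<open>The coefficient of \<open>g x\<close> after \<open>f\<close> is applied to the
    expansion of \<open>x\<close> and the traces are written out; by \<open>fixed\<close> these
    traces lie in \<open>K\<close>, so \<open>f\<close> pulls them out.\<close>
  define c where "c g = (\<Oplus>i\<in>{..<n}. f (u i) \<otimes> g (v i))" for g
  have cM: "c g \<in> M" if g: "g \<in> ?A" for g
    unfolding c_def
    by (rule finsum_in_subgroup[OF subring.axioms(1)[OF sM]]) (rule subringE(6)[OF sM fu AutD(5)[OF g v]])
  have exp: "f x = (\<Oplus>g\<in>?A. c g \<otimes> g x)" if x: "x \<in> M" for x
  proof -
    have vx: "v i \<otimes> x \<in> M" for i by (rule subringE(6)[OF sM v x])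
    have tr: "trace_on M K (v i \<otimes> x) \<in> K" for i using trace_on_fixed[OF M fin vx] fixed by blast
    have trM: "trace_on M K (v i \<otimes> x) \<in> M" for i using tr M(2) by blast
    have "f x = f (\<Oplus>i\<in>{..<n}. trace_on M K (v i \<otimes> x) \<otimes> u i)"
    proof -
      have "x = (\<Oplus>i\<in>{..<n}. u i \<otimes> trace_on M K (v i \<otimes> x))" by (rule dual_family_expansion[OF M fin uv x])
      also have "\<dots> = (\<Oplus>i\<in>{..<n}. trace_on M K (v i \<otimes> x) \<otimes> u i)"
        by (rule finsum_cong'[OF refl]) (use MR[OF trM] MR[OF u] in \<open>auto simp: m_comm\<close>)
      finally show ?thesis by simp
    qed
    also have "\<dots> = (\<Oplus>i\<in>{..<n}. f (trace_on M K (v i \<otimes> x) \<otimes> u i))"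
      by (rule End_sum[OF fK subring.axioms(1)[OF sM]]) (use subringE(6)[OF sM trM u] in auto)
    also have "\<dots> = (\<Oplus>i\<in>{..<n}. \<Oplus>g\<in>?A. f (u i) \<otimes> g (v i) \<otimes> g x)"
    proof (rule finsum_cong'[OF refl])
      have cl: "(\<lambda>g. f (u i) \<otimes> g (v i) \<otimes> g x) \<in> ?A \<rightarrow> carrier R" for i
        using MR[OF fu] gR v x by auto
      show "(\<lambda>i. \<Oplus>g\<in>?A. f (u i) \<otimes> g (v i) \<otimes> g x) \<in> {..<n} \<rightarrow> carrier R" using finsum_closed[OF cl] by auto
      fix i
      have "f (trace_on M K (v i \<otimes> x) \<otimes> u i) = trace_on M K (v i \<otimes> x) \<otimes> f (u i)" by (rule EndD(4)[OF fK tr u])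
      also have "\<dots> = f (u i) \<otimes> (\<Oplus>g\<in>?A. g (v i \<otimes> x))"
        using MR[OF trM] MR[OF fu] by (simp add: m_comm trace_on_def)
      also have "\<dots> = (\<Oplus>g\<in>?A. f (u i) \<otimes> g (v i \<otimes> x))"
        by (rule finsum_rdistr[OF fin MR[OF fu]]) (use gR vx in auto)
      also have "\<dots> = (\<Oplus>g\<in>?A. f (u i) \<otimes> g (v i) \<otimes> g x)"
      proof (rule finsum_cong'[OF refl cl])
        show "f (u i) \<otimes> g (v i \<otimes> x) = f (u i) \<otimes> g (v i) \<otimes> g x" if "g \<in> ?A" for g
          using AutD(7)[OF that v x, of i] MR[OF fu] gR[OF that v] gR[OF that x] by (simp add: m_assoc)
      qed
      finally show "f (trace_on M K (v i \<otimes> x) \<otimes> u i) = (\<Oplus>g\<in>?A. f (u i) \<otimes> g (v i) \<otimes> g x)" .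
    qed
    also have "\<dots> = (\<Oplus>g\<in>?A. \<Oplus>i\<in>{..<n}. f (u i) \<otimes> g (v i) \<otimes> g x)"
      by (rule finsum_swap) (use fin MR[OF fu] gR v x in auto)
    also have "\<dots> = (\<Oplus>g\<in>?A. c g \<otimes> g x)"
    proof (rule finsum_cong'[OF refl])
      show "(\<lambda>g. c g \<otimes> g x) \<in> ?A \<rightarrow> carrier R" using MR[OF cM] gR x by auto
      show "(\<Oplus>i\<in>{..<n}. f (u i) \<otimes> g (v i) \<otimes> g x) = c g \<otimes> g x" if g: "g \<in> ?A" for g
        unfolding c_def by (rule finsum_ldistr[symmetric]) (use MR[OF fu] gR[OF g v] gR[OF g x] in auto)
    qed
    finally show ?thesis .
  qed
  have "c g = \<zero>" if g: "g \<in> ?A" "g \<notin> Aut R M N" for g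
  proof -
    obtain y where y: "y \<in> N" "g y \<noteq> y" using g unfolding Aut_def by blast
    have yM: "y \<in> M" using y(1) N(2) by blast
    \<comment> \<open>The coefficients of \<open>f(y x) - y f(x)\<close>, to which independence of
      the automorphisms is applied.\<close>
    define e where "e h = c h \<otimes> (h y \<ominus> y)" for h
    have eR: "e h \<in> carrier R" if "h \<in> ?A" for h using MR[OF cM[OF that]] gR[OF that yM] MR[OF yM] by (simp add: e_def)
    have "(\<Oplus>h\<in>?A. e h \<otimes> h x) = \<zero>" if x: "x \<in> M" for x
    proof -
      have yx: "y \<otimes> x \<in> M" by (rule subringE(6)[OF sM yM x])
      have cl1: "(\<lambda>h. e h \<otimes> h x) \<in> ?A \<rightarrow> carrier R" using eR gR x by auto
      have cl2: "(\<lambda>h. y \<otimes> (c h \<otimes> h x)) \<in> ?A \<rightarrow> carrier R" using MR[OF cM] MR[OF yM] gR x by auto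
      have "f (y \<otimes> x) = (\<Oplus>h\<in>?A. e h \<otimes> h x \<oplus> y \<otimes> (c h \<otimes> h x))"
        unfolding exp[OF yx]
      proof (rule finsum_cong'[OF refl])
        show "(\<lambda>h. e h \<otimes> h x \<oplus> y \<otimes> (c h \<otimes> h x)) \<in> ?A \<rightarrow> carrier R" using cl1 cl2 by (auto simp: Pi_iff)
        fix h assume h: "h \<in> ?A"
        note R = MR[OF cM[OF h]] gR[OF h yM] gR[OF h x] MR[OF yM]
        have "e h \<otimes> h x \<oplus> y \<otimes> (c h \<otimes> h x) = c h \<otimes> ((h y \<ominus> y) \<oplus> y) \<otimes> h x"
          using R by (simp add: e_def l_distr r_distr m_ac minus_eq)
        also have "(h y \<ominus> y) \<oplus> y = h y" using R by (simp add: minus_eq a_assoc l_neg)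
        finally show "c h \<otimes> h (y \<otimes> x) = e h \<otimes> h x \<oplus> y \<otimes> (c h \<otimes> h x)"
          using AutD(7)[OF h yM x] R by (simp add: m_assoc)
      qed
      also have "\<dots> = (\<Oplus>h\<in>?A. e h \<otimes> h x) \<oplus> (\<Oplus>h\<in>?A. y \<otimes> (c h \<otimes> h x))" by (rule finsum_addf[OF cl1 cl2])
      also have "(\<Oplus>h\<in>?A. y \<otimes> (c h \<otimes> h x)) = y \<otimes> f x"
        unfolding exp[OF x] by (rule finsum_rdistr[symmetric]) (use fin MR[OF cM] MR[OF yM] gR x in auto)
      finally have "y \<otimes> f x = (\<Oplus>h\<in>?A. e h \<otimes> h x) \<oplus> y \<otimes> f x" using EndD(4)[OF f y(1) x] by simp
      then show ?thesis
        using finsum_closed[OF cl1] MR[OF yM] MR[OF EndD(1)[OF f x]] add.l_cancel_one'[of "y \<otimes> f x" "\<Oplus>h\<in>?A. e h \<otimes> h x"]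
          add.r_cancel_one'[of "y \<otimes> f x" "\<Oplus>h\<in>?A. e h \<otimes> h x"] by simp
    qed
    note zero = this
    have "e g = \<zero>"
      by (rule dedekind_independence[where c=e, OF M fin subset_refl]) (erule eR, erule zero, rule g(1))
    then show ?thesis
      using y(2) MR[OF cM[OF g(1)]] gR[OF g(1) yM] MR[OF yM] by (simp add: e_def integral_iff)
  qed
  then show ?thesis using that[of c] cM exp by blast
qed

text \<open>Multiplications and automorphisms over \<open>N\<close> are \<open>N\<close>-linear.
  Conversely the expansion of an \<open>N\<close>-linear operator has zero coefficients at
  automorphisms that move \<open>N\<close>, so every summand is zero or of the required
  form.\<close>

lemma (in field) crossed_eq_End:
  assumes M: "subfield M R" "K \<subseteq> M" and fin: "finite (Aut R M K)" and fixed: "fixed_by M (Aut R M K) \<subseteq> K"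
    and N: "K \<subseteq> N" "N \<subseteq> M"
  shows "crossed (End_ring R M K) (mult_op R M ` M) (Aut R M N) = End R M N"
  unfolding crossed_eq_prod_span
proof
  let ?E = "End_ring R M K"
  let ?A = "Aut R M K"
  have sM: "subring M R" by (rule subfieldE(1)[OF M(1)])
  have MR: "\<And>x. x \<in> M \<Longrightarrow> x \<in> carrier R" using subfieldE(3)[OF M(1)] by blast
  interpret E: ring ?E by (rule End_ring_is_ring[OF sM M(2)])
  have mE: "mult_op R M ` M \<subseteq> carrier ?E" using mult_op_End[OF sM M(2)] by auto
  have AE: "Aut R M N \<subseteq> carrier ?E" using Aut_mono[OF N(1)] Aut_subset_End[OF M(2)] by simp blast
  show "prod_span ?E (mult_op R M ` M) (Aut R M N) \<subseteq> End R M N"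
  proof (rule E.prod_span_subset[OF End_subgroup[OF sM N]])
    interpret EN: ring "End_ring R M N" by (rule End_ring_is_ring[OF sM N(2)])
    fix a g assume "a \<in> mult_op R M ` M" "g \<in> Aut R M N"
    then show "a \<otimes>\<^bsub>?E\<^esub> g \<in> End R M N"
      using EN.m_closed[of a g] mult_op_End[OF sM N(2)] Aut_subset_End[OF N(2)] by auto
  qed
  have sg: "subgroup (prod_span ?E (mult_op R M ` M) (Aut R M N)) (add_monoid ?E)"
    by (rule E.prod_span_subgroup[OF mE AE])
  show "End R M N \<subseteq> prod_span ?E (mult_op R M ` M) (Aut R M N)"
  proof
    fix f assume f: "f \<in> End R M N"
    obtain c where c: "\<And>g. g \<in> ?A \<Longrightarrow> c g \<in> M" "\<And>g. g \<in> ?A \<Longrightarrow> g \<notin> Aut R M N \<Longrightarrow> c g = \<zero>"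
      "\<And>x. x \<in> M \<Longrightarrow> f x = (\<Oplus>g\<in>?A. c g \<otimes> g x)"
      by (rule End_expansion[OF M fin fixed N f]) (rule that)
    define d where "d g = mult_op R M (c g) \<otimes>\<^bsub>?E\<^esub> g" for g
    have dE: "d g \<in> End R M K" if "g \<in> ?A" for g
      using E.m_closed[of "mult_op R M (c g)" g] mult_op_End[OF sM M(2) c(1)[OF that]] Aut_subset_End[OF M(2)] that
      by (auto simp: d_def)
    have dP: "d g \<in> prod_span ?E (mult_op R M ` M) (Aut R M N)" if g: "g \<in> ?A" for g
    proof (cases "g \<in> Aut R M N")
      case True
      then show ?thesis unfolding d_def by (intro E.prod_in_prod_span imageI c(1)[OF g])
    next
      case False
      have "d g = \<zero>\<^bsub>?E\<^esub>"
        by (rule extensionalityI[of _ M])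
          (use MR[OF AutD(5)[OF g]] AutD(5)[OF g] in \<open>simp_all add: d_def c(2)[OF g False] compose_def mult_op_def\<close>)
      then show ?thesis using subgroup.one_closed[OF sg] by simp
    qed
    have sumP: "(\<Oplus>\<^bsub>?E\<^esub>g\<in>?A. d g) \<in> prod_span ?E (mult_op R M ` M) (Aut R M N)"
      by (rule E.finsum_in_subgroup[OF sg dP])
    have "f = (\<Oplus>\<^bsub>?E\<^esub>g\<in>?A. d g)"
    proof (rule End_eqI[OF f])
      show "(\<Oplus>\<^bsub>?E\<^esub>g\<in>?A. d g) \<in> End R M K" using subgroup.subset[OF sg] sumP by auto
      fix x assume x: "x \<in> M"
      have "(\<Oplus>\<^bsub>?E\<^esub>g\<in>?A. d g) x = (\<Oplus>g\<in>?A. d g x)" by (rule End_ring_finsum[OF sM M(2) fin dE x])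
      also have "\<dots> = (\<Oplus>g\<in>?A. c g \<otimes> g x)"
      proof (rule finsum_cong'[OF refl])
        have "c g \<otimes> g x \<in> carrier R" if "g \<in> ?A" for g using MR[OF c(1)[OF that]] MR[OF AutD(5)[OF that x]] by simp
        then show "(\<lambda>g. c g \<otimes> g x) \<in> ?A \<rightarrow> carrier R" by blast
        show "d g x = c g \<otimes> g x" if "g \<in> ?A" for g
          unfolding d_def End_ring_simps(2) by (rule mult_op_compose_apply[OF that x])
      qed
      finally show "f x = (\<Oplus>\<^bsub>?E\<^esub>g\<in>?A. d g) x" using c(3)[OF x] by simp
    qed
    then show "f \<in> prod_span ?E (mult_op R M ` M) (Aut R M N)" using sumP by simp
  qed
qed

text \<open>The Galois correspondence without counting degrees: an \<open>N\<close>-linear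
  \<open>f\<close> is a combination of automorphisms over \<open>N\<close>, so
  \<open>f x = x f(1)\<close> for an \<open>x\<close> fixed by these, and the retraction test puts
  \<open>x\<close> into \<open>N\<close>.\<close>

lemma (in field) fixed_by_Aut_intermediate:
  assumes M: "subfield M R" "K \<subseteq> M" and finA: "finite (Aut R M K)" and fixed: "fixed_by M (Aut R M K) \<subseteq> K"
    and N: "subfield N R" "K \<subseteq> N" "N \<subseteq> M" and fin: "finite_dimension N M"
  shows "fixed_by M (Aut R M N) = N"
proof (rule equalityI; rule subsetI)
  let ?A = "Aut R M K"
  have sM: "subring M R" by (rule subfieldE(1)[OF M(1)])
  have MR: "\<And>x. x \<in> M \<Longrightarrow> x \<in> carrier R" using subfieldE(3)[OF M(1)] by blast
  have one: "\<one> \<in> M" by (rule subringE(3)[OF sM])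
  have gR: "g y \<in> carrier R" if "g \<in> ?A" "y \<in> M" for g y by (rule MR[OF AutD(5)[OF that]])
  fix x assume "x \<in> fixed_by M (Aut R M N)"
  then have x: "x \<in> M" "\<And>g. g \<in> Aut R M N \<Longrightarrow> g x = x" by (auto simp: fixed_by_def)
  show "x \<in> N"
  proof (rule commutes_with_End[OF N(1) sM N(3) fin x(1)])
    fix f assume f: "f \<in> End R M N"
    obtain c where c: "\<And>g. g \<in> ?A \<Longrightarrow> c g \<in> M" "\<And>g. g \<in> ?A \<Longrightarrow> g \<notin> Aut R M N \<Longrightarrow> c g = \<zero>"
      "\<And>x. x \<in> M \<Longrightarrow> f x = (\<Oplus>g\<in>?A. c g \<otimes> g x)"
      by (rule End_expansion[OF M finA fixed N(2,3) f]) (rule that)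
    have "f x = (\<Oplus>g\<in>?A. x \<otimes> (c g \<otimes> g \<one>))"
      unfolding c(3)[OF x(1)]
    proof (rule finsum_cong'[OF refl])
      show "(\<lambda>g. x \<otimes> (c g \<otimes> g \<one>)) \<in> ?A \<rightarrow> carrier R" using MR[OF x(1)] MR[OF c(1)] gR[OF _ one] by auto
      fix g assume g: "g \<in> ?A"
      show "c g \<otimes> g x = x \<otimes> (c g \<otimes> g \<one>)"
      proof (cases "g \<in> Aut R M N")
        case True
        then show ?thesis using x(2)[OF True] AutD(8)[OF g] MR[OF x(1)] MR[OF c(1)[OF g]] by (simp add: m_comm)
      next
        case False
        then show ?thesis using c(2)[OF g False] MR[OF x(1)] MR[OF AutD(5)[OF g one]] MR[OF AutD(5)[OF g x(1)]] by simp
      qed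
    qed
    also have "\<dots> = x \<otimes> (\<Oplus>g\<in>?A. c g \<otimes> g \<one>)"
      by (rule finsum_rdistr[symmetric]) (use finA MR[OF x(1)] MR[OF c(1)] gR[OF _ one] in auto)
    finally show "f x = x \<otimes> f \<one>" using c(3)[OF one] by simp
  qed
next
  fix x assume "x \<in> N"
  then show "x \<in> fixed_by M (Aut R M N)" using N(3) AutD(4) by (auto simp: fixed_by_def)
qed

lemma (in field) End_determines_subfield:
  assumes K: "subfield K R" "finite_dimension K (carrier R)" and M: "subfield M R" "K \<subseteq> M"
    and x: "x \<in> carrier R" and lin: "\<And>f. f \<in> End R (carrier R) M \<Longrightarrow> f x = x \<otimes> f \<one>"
  shows "x \<in> M"
  by (rule commutes_with_End[OF M(1) carrier_is_subring subfieldE(3)[OF M(1)] _ x lin])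
    (rule finite_dimension_over_intermediate[OF K(1) M carrier_is_subring subfieldE(3)[OF M(1)] K(2)])

section \<open>The purely inseparable factor, the Galois factor and stable subfields\<close>

context normal_extension begin

lemma End_inj:
  assumes M: "subfield M R" "K \<subseteq> M" and N: "subfield N R" "K \<subseteq> N" and eq: "End R (carrier R) M \<subseteq> End R (carrier R) N"
  shows "N \<subseteq> M"
proof
  fix x assume x: "x \<in> N"
  then have xR: "x \<in> carrier R" using subfieldE(3)[OF N(1)] by blast
  show "x \<in> M"
  proof (rule End_determines_subfield[OF K fin M xR])
    fix f assume "f \<in> End R (carrier R) M"
    then have "f \<in> End R (carrier R) N" using eq by blast
    from EndD(4)[OF this x one_closed] show "f x = x \<otimes> f \<one>" using xR by simp
  qed
qed

lemma diff_ops_Fix: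
  assumes N: "subfield N R" "K \<subseteq> N" "N \<subseteq> Fix"
  shows "diff_ops R Fix N = End R Fix N" and "killed_by R Fix (diff_ops_plus R Fix N) = N"
proof -
  have fin': "finite_dimension N Fix"
    by (rule finite_dimension_over_intermediate[OF K N(1,2) sFix N(3) finite_Aut_intermediate(2)[OF Fix_subfield K_Fix]])
  show D: "diff_ops R Fix N = End R Fix N"
  proof (rule diff_ops_eq_End[OF p char N(1) sFix N(3) fin'])
    show "\<exists>e::nat. x [^] (p ^ e) \<in> N" if "x \<in> Fix" for x using uniform_exponent that N(2) by blast
  qed
  show "killed_by R Fix (diff_ops_plus R Fix N) = N"
    by (rule killed_by_diff_ops_plus[OF N(1) sFix N(3) fin' D])
qed

lemma crossed_S:
  assumes \<Gamma>: "subfield \<Gamma> R" "K \<subseteq> \<Gamma>" "\<Gamma> \<subseteq> S"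
  shows "crossed (End_ring R S K) (mult_op R S ` S) (Aut R S \<Gamma>) = End R S \<Gamma>"
    and "crossed_direct (End_ring R S K) (mult_op R S ` S) (Aut R S \<Gamma>)"
    and "fixed_by S (Aut R S \<Gamma>) = \<Gamma>"
proof -
  note S = S_subfield K_S
  note finA = finite_Aut_intermediate(1)[OF S]
  have fixed: "fixed_by S (Aut R S K) \<subseteq> K"
    using fixed_by_Aut_stable[OF S S_stable] S_Fix by (auto simp: fixed_by_def)
  show "crossed (End_ring R S K) (mult_op R S ` S) (Aut R S \<Gamma>) = End R S \<Gamma>"
    by (rule crossed_eq_End[OF S finA fixed \<Gamma>(2,3)])
  show "crossed_direct (End_ring R S K) (mult_op R S ` S) (Aut R S \<Gamma>)"
    by (rule crossed_direct_Aut[OF S finA Aut_mono[OF \<Gamma>(2)]])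
  have "finite_dimension \<Gamma> S"
    by (rule finite_dimension_over_intermediate[OF K \<Gamma>(1,2) sS \<Gamma>(3) finite_Aut_intermediate(2)[OF S]])
  then show "fixed_by S (Aut R S \<Gamma>) = \<Gamma>"
    by (rule fixed_by_Aut_intermediate[OF S finA fixed \<Gamma>])
qed

lemma identity_Aut: "(\<lambda>x\<in>carrier R. x) \<in> G"
  by (rule Aut_id[OF KR]) simp_all

lemma normal_fields_iff:
  assumes "P \<subseteq> carrier R"
  shows "M \<in> normal_fields R P K \<longleftrightarrow> subfield M R \<and> K \<subseteq> M \<and> M \<subseteq> P \<and> stable M"
  unfolding normal_fields_def intermediate_fields_def using normal_iff_stable by auto

text \<open>All conjugates of an element of a stable \<open>M\<close> lie in \<open>M\<close>, so
  the condition on conjugates in \<open>gal_part_eq\<close> shrinks to membership.\<close>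

lemma stable_pi_gal:
  assumes M: "subfield M R" "K \<subseteq> M" "stable M" and rc: "ring_char R = p"
  shows "pi_part R M K = M \<inter> Fix" "gal_part R M K = M \<inter> S"
proof -
  show "pi_part R M K = M \<inter> Fix" by (rule pi_part_eq[OF M(1,2) rc])
  show "gal_part R M K = M \<inter> S"
    unfolding gal_part_eq[OF M(1,2)]
    using M(3) identity_Aut S_R unfolding stable_def by force
qed

lemma stable_carrier: "stable (carrier R)"
  unfolding stable_def by (intro ballI) (rule AutD(5))

lemma stable_eq_compositum:
  assumes M: "subfield M R" "K \<subseteq> M" "stable M"
  shows "M = compositum R (M \<inter> Fix) (M \<inter> S)"
proof
  note MFix = subfield_inter[OF M(1) Fix_subfield] and MS = subfield_inter[OF M(1) S_subfield]
  have c: "compositum R (M \<inter> Fix) (M \<inter> S) = prod_span R (M \<inter> Fix) (M \<inter> S)"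
    by (rule tensor_iso_fields(2)[OF MFix _ _ MS]) (use M(2) K_Fix K_S in auto)
  show "compositum R (M \<inter> Fix) (M \<inter> S) \<subseteq> M"
    unfolding compositum_def by (rule generate_field_min_subfield1) (use M(1) Fix_R S_R in auto)
  show "M \<subseteq> compositum R (M \<inter> Fix) (M \<inter> S)"
  proof
    fix x assume x: "x \<in> M"
    obtain n :: nat and a b where ab: "\<And>i. a i \<in> M \<inter> Fix" "\<And>i. b i \<in> M \<inter> S" "x = (\<Oplus>i\<in>{..<n}. a i \<otimes> b i)"
      by (rule stable_decomposition[OF M x]) (rule that)
    show "x \<in> compositum R (M \<inter> Fix) (M \<inter> S)"
      unfolding c ab(3) by (rule sum_in_prod_span) (use ab(1,2) Fix_R S_R in auto)
  qed
qed

text \<open>An automorphism fixes the factors from \<open>N\<close> and moves those from \<Gamma>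
  inside \<Gamma>; sums of products go to sums of products.\<close>

lemma compositum_stable:
  assumes N: "subfield N R" "K \<subseteq> N" "N \<subseteq> Fix" and \<Gamma>: "subfield \<Gamma> R" "K \<subseteq> \<Gamma>" "\<Gamma> \<subseteq> S" "stable \<Gamma>"
  shows "stable (compositum R N \<Gamma>)"
  unfolding stable_def
proof (intro ballI)
  note c = tensor_iso_fields(2)[OF N \<Gamma>(1-3)]
  fix g x assume g: "g \<in> G" and x: "x \<in> compositum R N \<Gamma>"
  have NR: "N \<subseteq> carrier R" and GR: "\<Gamma> \<subseteq> carrier R" by (rule subfieldE(3)[OF N(1)], rule subfieldE(3)[OF \<Gamma>(1)])
  obtain n :: nat and a b where ab: "\<And>i. a i \<in> N" "\<And>i. b i \<in> \<Gamma>" "x = (\<Oplus>i\<in>{..<n}. a i \<otimes> b i)"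
  proof (rule prod_span_sumE[OF NR _ _ GR _ x[unfolded c]])
    show "N \<noteq> {}" "\<Gamma> \<noteq> {}"
      using subringE(4)[OF subfieldE(1)[OF N(1)]] subringE(4)[OF subfieldE(1)[OF \<Gamma>(1)]] by auto
    show "\<ominus> a \<in> N" if "a \<in> N" for a using subringE(5)[OF subfieldE(1)[OF N(1)] that] .
  qed (rule that)
  have R: "a i \<in> carrier R" "b i \<in> carrier R" for i using ab(1,2) NR GR by auto
  have gE: "g \<in> End R (carrier R) K" using Aut_subset_End[OF KR] g by blast
  have gb: "g (b i) \<in> \<Gamma>" for i using \<Gamma>(4) g ab(2) unfolding stable_def by blast
  have ga: "g (a i) = a i" for i using ab(1)[of i] N(3) g unfolding fixed_by_def by blast
  have "g x = (\<Oplus>i\<in>{..<n}. g (a i \<otimes> b i))"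
    unfolding ab(3) by (rule End_sum[OF gE add_sub(1)]) (use R in auto)
  also have "\<dots> = (\<Oplus>i\<in>{..<n}. a i \<otimes> g (b i))"
  proof (rule finsum_cong'[OF refl])
    show "(\<lambda>i. a i \<otimes> g (b i)) \<in> {..<n} \<rightarrow> carrier R" using R gb GR by blast
    show "g (a i \<otimes> b i) = a i \<otimes> g (b i)" for i using AutD(7)[OF g R] ga by simp
  qed
  finally have gx: "g x = (\<Oplus>i\<in>{..<n}. a i \<otimes> g (b i))" .
  show "g x \<in> compositum R N \<Gamma>"
    unfolding c gx by (rule sum_in_prod_span[OF NR GR]) (use ab(1) gb in auto)
qed

section \<open>Automorphism-invariant algebras\<close>

text \<open>The conjugate of \<open>a\<close> is linear over \<open>g m\<close> because the inverse
  of \<open>g\<close> carries \<open>g m\<close> back to \<open>m\<close>. The auxiliary fact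
  \<open>inc\<close> is stated for any pair of mutually inverse automorphisms, so that exchanging
  them gives the reverse inclusion.\<close>

lemma Aut_conjugate_End:
  assumes g: "g \<in> G" and M: "M \<subseteq> carrier R" "K \<subseteq> M"
  shows "(\<lambda>a. g \<otimes>\<^bsub>E\<^esub> a \<otimes>\<^bsub>E\<^esub> inv\<^bsub>E\<^esub> g) ` End R (carrier R) M = End R (carrier R) (g ` M)"
proof -
  interpret E: ring E by (rule E_ring)
  have inc: "g \<otimes>\<^bsub>E\<^esub> a \<otimes>\<^bsub>E\<^esub> h \<in> End R (carrier R) (g ` M)"
    if g: "g \<in> G" and h: "h \<in> G" "\<And>x. x \<in> carrier R \<Longrightarrow> h (g x) = x" "\<And>x. x \<in> carrier R \<Longrightarrow> g (h x) = x"
      and M: "M \<subseteq> carrier R" and a: "a \<in> End R (carrier R) M" for g h M a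
  proof (rule EndI)
    have val: "(g \<otimes>\<^bsub>E\<^esub> a \<otimes>\<^bsub>E\<^esub> h) x = g (a (h x))" if "x \<in> carrier R" for x
      using that AutD(5)[OF h(1) that] by (simp add: compose_def)
    show "g \<otimes>\<^bsub>E\<^esub> a \<otimes>\<^bsub>E\<^esub> h \<in> extensional (carrier R)" by (simp add: compose_def)
    show "(g \<otimes>\<^bsub>E\<^esub> a \<otimes>\<^bsub>E\<^esub> h) x \<in> carrier R" if "x \<in> carrier R" for x
      unfolding val[OF that] by (rule AutD(5)[OF g EndD(1)[OF a AutD(5)[OF h(1) that]]])
    show "(g \<otimes>\<^bsub>E\<^esub> a \<otimes>\<^bsub>E\<^esub> h) (x \<oplus> y) = (g \<otimes>\<^bsub>E\<^esub> a \<otimes>\<^bsub>E\<^esub> h) x \<oplus> (g \<otimes>\<^bsub>E\<^esub> a \<otimes>\<^bsub>E\<^esub> h) y"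
      if xy: "x \<in> carrier R" "y \<in> carrier R" for x y
    proof -
      note hx = AutD(5)[OF h(1) xy(1)] and hy = AutD(5)[OF h(1) xy(2)]
      show ?thesis
        unfolding val[OF xy(1)] val[OF xy(2)] val[OF a_closed[OF xy]] AutD(6)[OF h(1) xy] EndD(3)[OF a hx hy]
        by (rule AutD(6)[OF g EndD(1)[OF a hx] EndD(1)[OF a hy]])
    qed
    show "(g \<otimes>\<^bsub>E\<^esub> a \<otimes>\<^bsub>E\<^esub> h) (m \<otimes> x) = m \<otimes> (g \<otimes>\<^bsub>E\<^esub> a \<otimes>\<^bsub>E\<^esub> h) x" if "m \<in> g ` M" and x: "x \<in> carrier R" for m x
    proof -
      obtain n where n: "n \<in> M" "m = g n" using \<open>m \<in> g ` M\<close> by blast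
      have nR: "n \<in> carrier R" using n(1) M by blast
      have mR: "m \<in> carrier R" using AutD(5)[OF g nR] n(2) by simp
      have hm: "h m = n" using h(2)[OF nR] n(2) by simp
      note hx = AutD(5)[OF h(1) x]
      show ?thesis
        unfolding val[OF x] val[OF m_closed[OF mR x]] AutD(7)[OF h(1) mR x] hm EndD(4)[OF a n(1) hx]
        unfolding n(2)
        by (rule AutD(7)[OF g nR EndD(1)[OF a hx]])
    qed
  qed
  obtain h where h: "h \<in> G" "\<And>x. x \<in> carrier R \<Longrightarrow> h (g x) = x" "\<And>x. x \<in> carrier R \<Longrightarrow> g (h x) = x"
    by (rule Aut_inverse[OF carrier_is_subring KR g]) (rule that)
  have gE: "g \<in> carrier E" and hE: "h \<in> carrier E" using Aut_subset_End[OF KR] g h(1) by auto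
  have gh: "g \<otimes>\<^bsub>E\<^esub> h = \<one>\<^bsub>E\<^esub>" "h \<otimes>\<^bsub>E\<^esub> g = \<one>\<^bsub>E\<^esub>"
    unfolding End_ring_simps compose_def by (rule restrict_ext, rule h(3), assumption, rule restrict_ext, rule h(2))
  \<comment> \<open>The inverse meant is the one in the ring \<open>E\<close>; two-sided inverses
    being unique, it is the inverse automorphism.\<close>
  have inv: "inv\<^bsub>E\<^esub> g = h" using E.inv_unique'[OF gE hE gh] by simp
  have "(\<lambda>x. h (g x)) ` M = (\<lambda>x. x) ` M" by (rule image_cong[OF refl]) (rule h(2)[OF subsetD[OF M(1)]])
  then have hgM: "h ` g ` M = M" by (simp add: image_image)
  have gMR: "g ` M \<subseteq> carrier R" using AutD(5)[OF g] M(1) by blast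
  show ?thesis
    unfolding inv
  proof
    show "(\<lambda>a. g \<otimes>\<^bsub>E\<^esub> a \<otimes>\<^bsub>E\<^esub> h) ` End R (carrier R) M \<subseteq> End R (carrier R) (g ` M)"
    proof
      fix b assume "b \<in> (\<lambda>a. g \<otimes>\<^bsub>E\<^esub> a \<otimes>\<^bsub>E\<^esub> h) ` End R (carrier R) M"
      then obtain a where a: "a \<in> End R (carrier R) M" "b = g \<otimes>\<^bsub>E\<^esub> a \<otimes>\<^bsub>E\<^esub> h" by blast
      show "b \<in> End R (carrier R) (g ` M)" unfolding a(2) by (rule inc[OF g h M(1) a(1)])
    qed
    show "End R (carrier R) (g ` M) \<subseteq> (\<lambda>a. g \<otimes>\<^bsub>E\<^esub> a \<otimes>\<^bsub>E\<^esub> h) ` End R (carrier R) M"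
    proof
      fix f assume f: "f \<in> End R (carrier R) (g ` M)"
      define a where "a = h \<otimes>\<^bsub>E\<^esub> f \<otimes>\<^bsub>E\<^esub> g"
      have a: "a \<in> End R (carrier R) M"
        using inc[OF h(1) g h(3) h(2) gMR f] unfolding hgM a_def by simp
      have "f \<in> End R (carrier R) K"
      proof -
        have "k \<in> g ` M" if "k \<in> K" for k
          by (rule image_eqI[of _ g k]) (use AutD(4)[OF g that] that M(2) in auto)
        then have "K \<subseteq> g ` M" by blast
        then show ?thesis using f End_mono by blast
      qed
      then have fE: "f \<in> carrier E" by simp
      have "g \<otimes>\<^bsub>E\<^esub> a \<otimes>\<^bsub>E\<^esub> h = (g \<otimes>\<^bsub>E\<^esub> h) \<otimes>\<^bsub>E\<^esub> f \<otimes>\<^bsub>E\<^esub> (g \<otimes>\<^bsub>E\<^esub> h)"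
        using gE hE fE unfolding a_def by (simp only: E.m_assoc E.m_closed)
      also have "\<dots> = f" unfolding gh using fE by (simp only: E.l_one E.r_one)
      finally show "f \<in> (\<lambda>a. g \<otimes>\<^bsub>E\<^esub> a \<otimes>\<^bsub>E\<^esub> h) ` End R (carrier R) M" by (rule image_eqI[OF sym a])
    qed
  qed
qed

text \<open>By \<open>jacobson_bourbaki\<close> an invariant algebra is the endomorphism algebra of
  the field \<open>M\<close> over which all of it is linear; what has to be seen is that
  \<open>M\<close> lies in \<open>F\<close> and is stable. Conversely conjugation by
  \<open>g\<close> preserves the algebra of a stable \<open>M\<close>, as \<open>g\<close> maps
  \<open>M\<close> onto itself.\<close>

lemma invariant_algebras_eq:
  assumes F: "subfield F R" "K \<subseteq> F"
  shows "invariant_algebras R F K = End R (carrier R) ` normal_fields R F K"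
proof -
  interpret E: ring E by (rule E_ring)
  have FR: "F \<subseteq> carrier R" by (rule subfieldE(3)[OF F(1)])
  have cF: "centralizer E (mult_op R (carrier R) ` F) = End R (carrier R) F"
    by (rule centralizer_mult_op[OF carrier_is_subring F(2) FR])
  show ?thesis
  proof (rule equalityI; rule subsetI)
    fix A assume "A \<in> invariant_algebras R F K"
    then have A: "subring A E" "mult_op R (carrier R) ` carrier R \<subseteq> A" "End R (carrier R) F \<subseteq> A"
      and conj: "\<And>g. g \<in> G \<Longrightarrow> (\<lambda>a. g \<otimes>\<^bsub>E\<^esub> a \<otimes>\<^bsub>E\<^esub> inv\<^bsub>E\<^esub> g) ` A = A"
      unfolding invariant_algebras_def Let_def cF by auto
    define M where "M = {x \<in> carrier R. \<forall>a\<in>A. \<forall>y\<in>carrier R. a (x \<otimes> y) = x \<otimes> a y}"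
    have AM: "A = End R (carrier R) M" unfolding M_def by (rule jacobson_bourbaki[OF K fin A(1,2)])
    have AE: "a \<in> End R (carrier R) K" if "a \<in> A" for a using subringE(1)[OF A(1)] that by auto
    have MI: "x \<in> M" if "x \<in> carrier R" "\<And>a y. a \<in> A \<Longrightarrow> y \<in> carrier R \<Longrightarrow> a (x \<otimes> y) = x \<otimes> a y" for x
      using that unfolding M_def by blast
    have MR: "x \<in> carrier R" if "x \<in> M" for x using that unfolding M_def by blast
    have MD: "a (x \<otimes> y) = x \<otimes> a y" if "x \<in> M" "a \<in> A" "y \<in> carrier R" for x a y using that unfolding M_def by blast
    have KM: "K \<subseteq> M"
    proof
      fix k assume k: "k \<in> K"
      show "k \<in> M" by (rule MI) (use k KR EndD(4)[OF AE k] in auto)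
    qed
    have aR: "a y \<in> carrier R" if "a \<in> A" "y \<in> carrier R" for a y by (rule EndD(1)[OF AE[OF that(1)] that(2)])
    have gr: "M = (\<Inter>a\<in>A. {x \<in> carrier R. \<forall>y\<in>carrier R. a (x \<otimes> y) = x \<otimes> a y})"
      using subringE(4)[OF A(1)] unfolding M_def by auto
    have sg: "subgroup M (add_monoid R)"
      unfolding gr
      by (rule add.subgroups_Inter) (use linearity_subgroup[OF AE] subringE(4)[OF A(1)] in auto)
    have sM: "subring M R"
    proof (rule subringI)
      show "M \<subseteq> carrier R" using MR by blast
      show "\<one> \<in> M" by (rule MI) (use aR in auto)
      show "\<ominus> h \<in> M" if "h \<in> M" for h using subgroup.m_inv_closed[OF sg that] by (simp add: a_inv_def)
      show "h \<oplus> h' \<in> M" if "h \<in> M" "h' \<in> M" for h h' using subgroup.m_closed[OF sg that] by simp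
      show "h \<otimes> h' \<in> M" if h: "h \<in> M" "h' \<in> M" for h h'
      proof (rule MI)
        fix a y assume ay: "a \<in> A" "y \<in> carrier R"
        show "a (h \<otimes> h' \<otimes> y) = h \<otimes> h' \<otimes> a y"
          using MD[OF h(1) ay(1), of "h' \<otimes> y"] MD[OF h(2) ay] MR[OF h(1)] MR[OF h(2)] ay(2) aR[OF ay]
          by (simp add: m_assoc)
      qed (use MR h in simp)
    qed
    have M: "subfield M R" by (rule algebraic_subring_is_subfield[OF K sM KM alg[OF MR]])
    \<comment> \<open>The centralizer of \<open>F\<close> is the algebra of \<open>F\<close>-linear
      operators, and it is contained in \<open>A\<close>; passing to subfields reverses
      inclusions.\<close>
    have MF: "M \<subseteq> F" by (rule End_inj[OF F M KM]) (use A(3) AM in simp)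
    have MRs: "M \<subseteq> carrier R" using MR by blast
    have "stable M"
      unfolding stable_def
    proof (intro ballI)
      fix g x assume g: "g \<in> G" and x: "x \<in> M"
      \<comment> \<open>So every operator of \<open>A\<close> is linear over \<open>g x\<close>, and
        \<open>M\<close> consists of all elements with that property.\<close>
      have "A = End R (carrier R) (g ` M)"
        using Aut_conjugate_End[OF g MRs KM] conj[OF g] unfolding AM[symmetric] by simp
      then have "a \<in> End R (carrier R) (g ` M)" if "a \<in> A" for a using that by blast
      from EndD(4)[OF this imageI[OF x]] show "g x \<in> M" by (intro MI AutD(5)[OF g MR[OF x]])
    qed
    then show "A \<in> End R (carrier R) ` normal_fields R F K"
      unfolding AM using M KM MF normal_fields_iff[OF FR] by blast
  next
    fix A assume "A \<in> End R (carrier R) ` normal_fields R F K"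
    then obtain M where M: "subfield M R" "K \<subseteq> M" "M \<subseteq> F" "stable M" and A: "A = End R (carrier R) M"
      using normal_fields_iff[OF FR] by blast
    have MR: "M \<subseteq> carrier R" by (rule subfieldE(3)[OF M(1)])
    interpret EM: ring "End_ring R (carrier R) M" by (rule End_ring_is_ring[OF carrier_is_subring MR])
    have sgA: "subgroup A (add_monoid E)" unfolding A by (rule End_subgroup[OF carrier_is_subring M(2) MR])
    have mult: "a \<otimes>\<^bsub>E\<^esub> b \<in> A" if "a \<in> A" "b \<in> A" for a b
      using EM.m_closed[of a b] that unfolding A by simp
    have mA: "mult_op R (carrier R) x \<in> A" if "x \<in> carrier R" for x
      unfolding A by (rule mult_op_End[OF carrier_is_subring MR that])
    have "subring A E"
    proof (rule E.subringI)
      show "A \<subseteq> carrier E" using subgroup.subset[OF sgA] by simp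
      show "\<one>\<^bsub>E\<^esub> \<in> A" using EM.one_closed unfolding A by simp
      show "\<ominus>\<^bsub>E\<^esub> a \<in> A" if "a \<in> A" for a using subgroup.m_inv_closed[OF sgA that] by (simp add: a_inv_def)
      show "a \<oplus>\<^bsub>E\<^esub> b \<in> A" if "a \<in> A" "b \<in> A" for a b using subgroup.m_closed[OF sgA that] by simp
    qed (rule mult)
    moreover have "subalgebra (mult_op R (carrier R) ` K) A E"
      using sgA mult mA KR by (intro subalgebra.intro) (auto simp: subalgebra_axioms_def)
    moreover have "mult_op R (carrier R) ` carrier R \<subseteq> A" using mA by blast
    moreover have "End R (carrier R) F \<subseteq> A" unfolding A by (rule End_mono[OF M(3)])
    moreover have "(\<lambda>a. g \<otimes>\<^bsub>E\<^esub> a \<otimes>\<^bsub>E\<^esub> inv\<^bsub>E\<^esub> g) ` A = A" if g: "g \<in> G" for g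
    proof -
      obtain h where h: "h \<in> G" "\<And>x. x \<in> carrier R \<Longrightarrow> h (g x) = x" "\<And>x. x \<in> carrier R \<Longrightarrow> g (h x) = x"
        by (rule Aut_inverse[OF carrier_is_subring KR g]) (rule that)
      have "M \<subseteq> g ` M"
      proof
        fix x assume x: "x \<in> M"
        have "h x \<in> M" using M(4) h(1) x unfolding stable_def by blast
        moreover have "x = g (h x)" using h(3) x MR by auto
        ultimately show "x \<in> g ` M" by blast
      qed
      moreover have "g ` M \<subseteq> M" using M(4) g unfolding stable_def by blast
      ultimately have "g ` M = M" by blast
      then show ?thesis unfolding A using Aut_conjugate_End[OF g MR M(2)] by simp
    qed
    ultimately show "A \<in> invariant_algebras R F K"
      unfolding invariant_algebras_def Let_def cF by blast
  qed
qed

lemma bij_betw_End: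
  assumes F: "subfield F R" "K \<subseteq> F"
  shows "bij_betw (End R (carrier R)) (normal_fields R F K) (invariant_algebras R F K)"
proof -
  have FR: "F \<subseteq> carrier R" by (rule subfieldE(3)[OF F(1)])
  have "inj_on (End R (carrier R)) (normal_fields R F K)"
  proof (rule inj_onI)
    fix M N assume "M \<in> normal_fields R F K" "N \<in> normal_fields R F K" "End R (carrier R) M = End R (carrier R) N"
    then show "M = N" using normal_fields_iff[OF FR] End_inj[of M N] End_inj[of N M] by blast
  qed
  then show ?thesis unfolding bij_betw_def invariant_algebras_eq[OF F] by simp
qed

text \<open>Commuting with all multiplications makes \<open>f\<close> the multiplication by
  \<open>f \<one>\<close>; commuting with the other \<open>M\<close>-linear operators forces
  \<open>f \<one> \<in> M\<close>, by the retraction test.\<close>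

lemma centralizer_End:
  assumes M: "subfield M R" "K \<subseteq> M"
  shows "centralizer E (End R (carrier R) M) = mult_op R (carrier R) ` M"
proof (rule equalityI; rule subsetI)
  let ?m = "mult_op R (carrier R)"
  have MR: "M \<subseteq> carrier R" by (rule subfieldE(3)[OF M(1)])
  fix f assume "f \<in> centralizer E (End R (carrier R) M)"
  then have f: "f \<in> End R (carrier R) K"
    and comm: "\<And>a. a \<in> End R (carrier R) M \<Longrightarrow> compose (carrier R) f a = compose (carrier R) a f"
    by (auto simp: centralizer_def)
  have comm': "f (a x) = a (f x)" if "a \<in> End R (carrier R) M" "x \<in> carrier R" for a x
    using fun_cong[OF comm[OF that(1)], of x] that(2) by (simp add: compose_def)
  have f1: "f \<one> \<in> carrier R" by (rule EndD(1)[OF f one_closed])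
  have fx: "f x = f \<one> \<otimes> x" if x: "x \<in> carrier R" for x
    using comm'[OF mult_op_End[OF carrier_is_subring MR x] one_closed] x f1 by (simp add: mult_op_def m_comm)
  have "f \<one> \<in> M"
  proof (rule End_determines_subfield[OF K fin M f1])
    fix a assume a: "a \<in> End R (carrier R) M"
    have "a (f \<one>) = f (a \<one>)" using comm'[OF a one_closed] by simp
    then show "a (f \<one>) = f \<one> \<otimes> a \<one>" using fx[OF EndD(1)[OF a one_closed]] by simp
  qed
  moreover have "f = ?m (f \<one>)"
    by (rule extensionalityI[OF EndD(2)[OF f]]) (simp_all add: mult_op_def fx[symmetric])
  ultimately show "f \<in> ?m ` M" by blast
next
  let ?m = "mult_op R (carrier R)"
  have MR: "M \<subseteq> carrier R" by (rule subfieldE(3)[OF M(1)])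
  fix f assume "f \<in> ?m ` M"
  then obtain x where x: "x \<in> M" "f = ?m x" by blast
  then have xR: "x \<in> carrier R" using MR by blast
  have "compose (carrier R) f a = compose (carrier R) a f" if a: "a \<in> End R (carrier R) M" for a
    by (rule extensionalityI[of _ "carrier R"])
      (use EndD(1)[OF a] EndD(4)[OF a x(1)] xR in \<open>simp_all add: x(2) compose_def mult_op_def\<close>)
  moreover have "f \<in> End R (carrier R) K" unfolding x(2) by (rule mult_op_End[OF carrier_is_subring KR xR])
  ultimately show "f \<in> centralizer E (End R (carrier R) M)" by (simp add: centralizer_def)
qed

text \<open>The intersections are not computed. Operators on a factor that are linear over
  \<open>M \<inter> Fix\<close> or \<open>M \<inter> S\<close> embed into the algebra, as tensors
  with an identity, which bounds the invariants from above. From below, an \<open>f\<close> in the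
  algebra satisfies \<open>f x = x f(1)\<close> for \<open>x \<in> M\<close>, with
  \<open>f(1)\<close> equal to 0 for the embedded differential operators and to 1 for the embedded
  automorphisms.\<close>

lemma invariants_of_End:
  assumes M: "subfield M R" "K \<subseteq> M" "stable M"
  shows "killed_by R Fix (End R (carrier R) M \<inter> eL ` diff_ops_plus R Fix K) = M \<inter> Fix"
    and "fixed_by S (End R (carrier R) M \<inter> eR ` Aut R S K) = M \<inter> S"
proof -
  let ?A = "End R (carrier R) M"
  interpret E: ring E by (rule E_ring)
  have MR: "M \<subseteq> carrier R" by (rule subfieldE(3)[OF M(1)])
  have MF: "subfield (M \<inter> Fix) R" "K \<subseteq> M \<inter> Fix" "M \<inter> Fix \<subseteq> Fix"
    using subfield_inter[OF M(1) Fix_subfield] M(2) K_Fix by auto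
  have MS: "subfield (M \<inter> S) R" "K \<subseteq> M \<inter> S" "M \<inter> S \<subseteq> S"
    using subfield_inter[OF M(1) S_subfield] M(2) K_S by auto
  have A: "?A = prod_span E (eL ` End R Fix (M \<inter> Fix)) (eR ` End R S (M \<inter> S))"
    using op_tensor_End[OF MF MS] unfolding op_tensor_eq_prod_span[OF MF(2,3) MS(2,3)] stable_eq_compositum[OF M, symmetric] by simp
  have aK: "a \<in> End R Fix K" if "a \<in> End R Fix (M \<inter> Fix)" for a using that End_mono[OF MF(2)] by blast
  have bK: "b \<in> End R S K" if "b \<in> End R S (M \<inter> S)" for b using that End_mono[OF MS(2)] by blast
  have idF: "(\<lambda>x\<in>Fix. x) \<in> End R Fix (M \<inter> Fix)" and idS: "(\<lambda>x\<in>S. x) \<in> End R S (M \<inter> S)"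
    using ring.ring_simprules(6)[OF End_ring_is_ring[OF sFix MF(3)]] ring.ring_simprules(6)[OF End_ring_is_ring[OF sS MS(3)]] by simp_all
  have oE: "\<one>\<^bsub>E\<^esub> \<in> End R (carrier R) K" using E.one_closed unfolding End_ring_simps(1) .
  have eL1: "eL (\<lambda>x\<in>Fix. x) = \<one>\<^bsub>E\<^esub>"
    by (rule embed_left(3)[OF aK[OF idF] oE]) (use product_closed in simp)
  have eR1: "eR (\<lambda>x\<in>S. x) = \<one>\<^bsub>E\<^esub>"
    by (rule embed_right(3)[OF bK[OF idS] oE]) (use product_closed in simp)
  have oneF: "\<one> \<in> Fix" and oneS: "\<one> \<in> S" by (rule subringE(3)[OF sFix], rule subringE(3)[OF sS])
  have eLA: "eL a \<in> ?A" if a: "a \<in> End R Fix (M \<inter> Fix)" for a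
  proof -
    have "eL a \<otimes>\<^bsub>E\<^esub> eR (\<lambda>x\<in>S. x) \<in> ?A"
      unfolding A by (rule E.prod_in_prod_span[OF imageI[OF a] imageI[OF idS]])
    moreover have "eL a \<in> carrier E" using embed_left(1)[OF aK[OF a]] unfolding End_ring_simps(1) .
    ultimately show ?thesis unfolding eR1 by (simp only: E.r_one)
  qed
  have eRA: "eR b \<in> ?A" if b: "b \<in> End R S (M \<inter> S)" for b
  proof -
    have "eL (\<lambda>x\<in>Fix. x) \<otimes>\<^bsub>E\<^esub> eR b \<in> ?A"
      unfolding A by (rule E.prod_in_prod_span[OF imageI[OF idF] imageI[OF b]])
    moreover have "eR b \<in> carrier E" using embed_right(1)[OF bK[OF b]] unfolding End_ring_simps(1) .
    ultimately show ?thesis unfolding eL1 by (simp only: E.l_one)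
  qed
  have DK: "diff_ops R Fix K = End R Fix K" and DM: "diff_ops R Fix (M \<inter> Fix) = End R Fix (M \<inter> Fix)"
    by (rule diff_ops_Fix(1)[OF K subset_refl K_Fix], rule diff_ops_Fix(1)[OF MF])
  show "killed_by R Fix (?A \<inter> eL ` diff_ops_plus R Fix K) = M \<inter> Fix"
  proof (rule equalityI; rule subsetI)
    fix x assume x: "x \<in> killed_by R Fix (?A \<inter> eL ` diff_ops_plus R Fix K)"
    then have xF: "x \<in> Fix" by (simp add: killed_by_def)
    have "d x = \<zero>" if d: "d \<in> diff_ops_plus R Fix (M \<inter> Fix)" for d
    proof -
      have dE: "d \<in> End R Fix (M \<inter> Fix)" "d \<one> = \<zero>" using d DM by (auto simp: diff_ops_plus_def)
      have "d \<in> diff_ops_plus R Fix K" using aK[OF dE(1)] dE(2) by (simp add: diff_ops_plus_def DK)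
      then have "eL d x = \<zero>" using x eLA[OF dE(1)] unfolding killed_by_def by blast
      moreover have "eL d (x \<otimes> \<one>) = d x \<otimes> \<one>" by (rule embed_left(2)[OF aK[OF dE(1)] xF oneS])
      ultimately show ?thesis using Fix_R[OF xF] Fix_R[OF EndD(1)[OF dE(1) xF]] by simp
    qed
    then have "x \<in> killed_by R Fix (diff_ops_plus R Fix (M \<inter> Fix))" using xF by (simp add: killed_by_def)
    then show "x \<in> M \<inter> Fix" unfolding diff_ops_Fix(2)[OF MF] .
  next
    fix x assume x: "x \<in> M \<inter> Fix"
    have xR: "x \<in> carrier R" using x MR by blast
    have "f x = \<zero>" if f: "f \<in> ?A" "f \<in> eL ` diff_ops_plus R Fix K" for f
    proof -
      obtain d where d: "d \<in> End R Fix K" "d \<one> = \<zero>" "f = eL d" using f(2) DK by (auto simp: diff_ops_plus_def)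
      have "f \<one> = \<zero>" using embed_left(2)[OF d(1) oneF oneS] d(2,3) by simp
      then show ?thesis using EndD(4)[OF f(1) _ one_closed, of x] x xR by simp
    qed
    then show "x \<in> killed_by R Fix (?A \<inter> eL ` diff_ops_plus R Fix K)" using x by (simp add: killed_by_def)
  qed
  show "fixed_by S (?A \<inter> eR ` Aut R S K) = M \<inter> S"
  proof (rule equalityI; rule subsetI)
    fix x assume x: "x \<in> fixed_by S (?A \<inter> eR ` Aut R S K)"
    then have xS: "x \<in> S" by (simp add: fixed_by_def)
    have "h x = x" if h: "h \<in> Aut R S (M \<inter> S)" for h
    proof -
      have hE: "h \<in> End R S (M \<inter> S)" using Aut_subset_End[OF MS(3)] h by blast
      have "h \<in> Aut R S K" using Aut_mono[OF MS(2)] h by blast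
      then have "eR h x = x" using x eRA[OF hE] unfolding fixed_by_def by blast
      moreover have "eR h (\<one> \<otimes> x) = \<one> \<otimes> h x" by (rule embed_right(2)[OF bK[OF hE] oneF xS])
      ultimately show ?thesis using S_R[OF xS] S_R[OF EndD(1)[OF hE xS]] by simp
    qed
    then have "x \<in> fixed_by S (Aut R S (M \<inter> S))" using xS by (simp add: fixed_by_def)
    then show "x \<in> M \<inter> S" unfolding crossed_S(3)[OF MS] .
  next
    fix x assume x: "x \<in> M \<inter> S"
    have xR: "x \<in> carrier R" using x MR by blast
    have "f x = x" if f: "f \<in> ?A" "f \<in> eR ` Aut R S K" for f
    proof -
      obtain h where h: "h \<in> Aut R S K" "f = eR h" using f(2) by blast
      have hE: "h \<in> End R S K" using Aut_subset_End[OF K_S] h(1) by blast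
      have "f \<one> = \<one>" using embed_right(2)[OF hE oneF oneS] AutD(8)[OF h(1)] h(2) by simp
      then show ?thesis using EndD(4)[OF f(1) _ one_closed, of x] x xR by simp
    qed
    then show "x \<in> fixed_by S (?A \<inter> eR ` Aut R S K)" using x by (simp add: fixed_by_def)
  qed
qed

end

section \<open>The correspondence for F inside its normal closure\<close>

theorem theorem1p2:
  fixes L :: "('a, 'm) ring_scheme"
    and K F Lpi Lgal Fpi Fgal :: "'a set"
    and p :: nat
    and E Epi Egal :: "('a \<Rightarrow> 'a) ring"
    and m :: "'a \<Rightarrow> 'a \<Rightarrow> 'a"
    and T :: "('a \<Rightarrow> 'a) set \<Rightarrow> ('a \<Rightarrow> 'a) set \<Rightarrow> ('a \<Rightarrow> 'a) set"
    and T_iso :: "('a \<Rightarrow> 'a) set \<Rightarrow> ('a \<Rightarrow> 'a) set \<Rightarrow> bool"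
    and Cr :: "'a set \<Rightarrow> ('a \<Rightarrow> 'a) set"
    and C :: "'a set \<Rightarrow> ('a \<Rightarrow> 'a) set"
  assumes field_L: "field L"
    and subfield_K: "subfield K L"
    and subfield_F: "subfield F L"
    and K_le_F: "K \<subseteq> F"
    and finite_ext: "ring.finite_dimension L K F"
    and char_p: "ring_char L = p" "p > 0"
    and normal_closure_L: "normal_closure L F K"
  defines "Lpi \<equiv> pi_part L (carrier L) K"
    and "Lgal \<equiv> gal_part L (carrier L) K"
    and "Fpi \<equiv> pi_part L F K"
    and "Fgal \<equiv> gal_part L F K"
    and "E \<equiv> End_ring L (carrier L) K"
    and "Epi \<equiv> End_ring L Lpi K"
    and "Egal \<equiv> End_ring L Lgal K"
    and "m \<equiv> mult_op L (carrier L)"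
    and "T \<equiv> op_tensor L K Lpi Lgal"
    and "T_iso \<equiv> op_tensor_iso L K Lpi Lgal"
    and "Cr \<equiv> (\<lambda>\<Gamma>. crossed Egal (mult_op L Lgal ` Lgal) (Aut L Lgal \<Gamma>))"
    and "C \<equiv> (\<lambda>M. centralizer E (m ` M))"
  shows "
    \<comment> \<open>(1)\<close>
    (\<forall>M \<in> normal_fields L F K.
        pi_part L M K = M \<inter> Lpi \<and> gal_part L M K = M \<inter> Lgal \<and>
        M = compositum L (pi_part L M K) (gal_part L M K) \<and>
        tensor_iso L K (pi_part L M K) (gal_part L M K) M) \<and>
    (\<forall>N \<in> intermediate_fields L Fpi K. \<forall>\<Gamma> \<in> normal_fields L Fgal K.
        tensor_iso L K N \<Gamma> (compositum L N \<Gamma>)) \<and>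
    (normal_fields L F K =
        {compositum L N \<Gamma> | N \<Gamma>. N \<in> intermediate_fields L Fpi K \<and> \<Gamma> \<in> normal_fields L Fgal K}) \<and>
    \<comment> \<open>(2)\<close>
    (\<forall>N \<in> intermediate_fields L Fpi K. \<forall>\<Gamma> \<in> normal_fields L Fgal K.
        crossed_direct Egal (mult_op L Lgal ` Lgal) (Aut L Lgal \<Gamma>) \<and>
        T_iso (diff_ops L Lpi N) (Cr \<Gamma>) \<and> T_iso (End L Lpi N) (Cr \<Gamma>) \<and>
        T (diff_ops L Lpi N) (Cr \<Gamma>) = T (End L Lpi N) (Cr \<Gamma>)) \<and>
    (invariant_algebras L F K =
        {T (diff_ops L Lpi N) (Cr \<Gamma>) | N \<Gamma>.
           N \<in> intermediate_fields L Fpi K \<and> \<Gamma> \<in> normal_fields L Fgal K}) \<and>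
    \<comment> \<open>(3)\<close>
    (\<forall>M \<in> normal_fields L F K. \<forall>Mpi Mgal. Mpi = pi_part L M K \<and> Mgal = gal_part L M K \<longrightarrow>
        C M = T (centralizer Epi (mult_op L Lpi ` Mpi)) (centralizer Egal (mult_op L Lgal ` Mgal)) \<and>
        T (centralizer Epi (mult_op L Lpi ` Mpi)) (centralizer Egal (mult_op L Lgal ` Mgal)) =
          T (End L Lpi Mpi) (End L Lgal Mgal) \<and>
        T (End L Lpi Mpi) (End L Lgal Mgal) = T (diff_ops L Lpi Mpi) (Cr Mgal) \<and>
        T_iso (centralizer Epi (mult_op L Lpi ` Mpi)) (centralizer Egal (mult_op L Lgal ` Mgal)) \<and>
        T_iso (End L Lpi Mpi) (End L Lgal Mgal) \<and>
        T_iso (diff_ops L Lpi Mpi) (Cr Mgal) \<and>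
        crossed_direct Egal (mult_op L Lgal ` Lgal) (Aut L Lgal Mgal)) \<and>
    (bij_betw C (normal_fields L F K) (invariant_algebras L F K)) \<and>
    (\<forall>A \<in> invariant_algebras L F K.
        \<forall>P Q. P = killed_by L Lpi (A \<inter> embed_left L K Lpi Lgal ` diff_ops_plus L Lpi K) \<and>
              Q = fixed_by Lgal (A \<inter> embed_right L K Lpi Lgal ` Aut L Lgal K) \<longrightarrow>
          centralizer E A = m ` the_inv_into (normal_fields L F K) C A \<and>
          centralizer E A = m ` compositum L P Q \<and>
          tensor_iso L K P Q (compositum L P Q)) \<and>
    (\<forall>N \<in> intermediate_fields L Fpi K. \<forall>\<Gamma> \<in> normal_fields L Fgal K.
        \<forall>P Q. P = killed_by L Lpi (diff_ops_plus L Lpi N) \<and> Q = fixed_by Lgal (Aut L Lgal \<Gamma>) \<longrightarrow>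
          the_inv_into (normal_fields L F K) C (T (diff_ops L Lpi N) (Cr \<Gamma>)) = compositum L P Q \<and>
          tensor_iso L K P Q (compositum L P Q))"
proof -
  interpret field L by (rule field_L)
  have clF: "normal_ext L (carrier L) K" using normal_closure_L by (simp add: normal_closure_def)
  have finL: "finite_dimension K (carrier L)"
    by (rule normal_closure_finite_dimension[OF subfield_K finite_ext K_le_F normal_closure_L])
  interpret X: normal_extension L K p
    by (intro normal_extension.intro normal_extension_axioms.intro field_L subfield_K clF finL
      ring_char_prime[OF char_p])
  note rc = char_p(1)
  have FL: "F \<subseteq> carrier L" by (rule subfieldE(3)[OF subfield_F])
  \<comment> \<open>\<open>L\<close> is stable under its own automorphisms, so the description of
    the two parts of a stable field applies to it.\<close>
  have Lpi: "Lpi = X.Fix" and Lgal: "Lgal = X.S"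
    using X.stable_pi_gal[OF carrier_is_subfield X.KR X.stable_carrier rc] X.Fix_R X.S_R
    unfolding Lpi_def Lgal_def by auto
  have Fpi: "Fpi = F \<inter> X.Fix" unfolding Fpi_def by (rule X.pi_part_eq[OF subfield_F K_le_F rc])
  have Fgal: "Fgal = {x \<in> X.S. \<forall>g\<in>X.G. g x \<in> F}" unfolding Fgal_def by (rule X.gal_part_eq[OF subfield_F K_le_F])
  \<comment> \<open>The condition on all automorphisms contains the one for the identity.\<close>
  have FgalF: "Fgal \<subseteq> F" using X.identity_Aut X.S_R unfolding Fgal by force
  have N: "subfield N L" "K \<subseteq> N" "N \<subseteq> X.Fix" "N \<subseteq> F" if "N \<in> intermediate_fields L Fpi K" for N
    using that unfolding intermediate_fields_def Fpi by auto
  have \<Gamma>: "subfield \<Gamma> L" "K \<subseteq> \<Gamma>" "\<Gamma> \<subseteq> X.S" "X.stable \<Gamma>" "\<Gamma> \<subseteq> F" if "\<Gamma> \<in> normal_fields L Fgal K" for \<Gamma>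
    using that FgalF FL X.normal_fields_iff[of Fgal \<Gamma>] unfolding Fgal by auto
  have M: "subfield M L" "K \<subseteq> M" "M \<subseteq> F" "X.stable M" if "M \<in> normal_fields L F K" for M
    using that X.normal_fields_iff[OF FL] by auto
  have Mpi: "subfield (M \<inter> X.Fix) L" "K \<subseteq> M \<inter> X.Fix" "M \<inter> X.Fix \<subseteq> X.Fix" "M \<inter> X.Fix \<in> intermediate_fields L Fpi K"
    and Mgal: "subfield (M \<inter> X.S) L" "K \<subseteq> M \<inter> X.S" "M \<inter> X.S \<subseteq> X.S" "M \<inter> X.S \<in> normal_fields L Fgal K"
    if M': "M \<in> normal_fields L F K" for M
  proof -
    show s: "subfield (M \<inter> X.Fix) L" "K \<subseteq> M \<inter> X.Fix" "M \<inter> X.Fix \<subseteq> X.Fix"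
      and t: "subfield (M \<inter> X.S) L" "K \<subseteq> M \<inter> X.S" "M \<inter> X.S \<subseteq> X.S"
      using subfield_inter[OF M(1)[OF M'] X.Fix_subfield] subfield_inter[OF M(1)[OF M'] X.S_subfield]
        M(2)[OF M'] X.K_Fix X.K_S by auto
    show "M \<inter> X.Fix \<in> intermediate_fields L Fpi K"
      using s M(3)[OF M'] unfolding intermediate_fields_def Fpi by auto
    have "X.stable (M \<inter> X.S)" using M(4)[OF M'] X.S_stable unfolding X.stable_def by blast
    \<comment> \<open>Stability of \<open>M\<close> keeps all conjugates in \<open>M\<close>, hence
      in \<open>F\<close>. For a field between \<open>K\<close> and \<open>F\<close> that is not
      stable this can fail, since \<open>Fgal\<close> may be smaller than
      \<open>F \<inter> X.S\<close>.\<close>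
    moreover have "M \<inter> X.S \<subseteq> Fgal" using M(3,4)[OF M'] unfolding Fgal X.stable_def by blast
    ultimately show "M \<inter> X.S \<in> normal_fields L Fgal K"
      using t X.normal_fields_iff[of Fgal "M \<inter> X.S"] FgalF FL by blast
  qed
  have parts: "pi_part L M K = M \<inter> X.Fix" "gal_part L M K = M \<inter> X.S" if "M \<in> normal_fields L F K" for M
    using X.stable_pi_gal[OF M(1,2,4)[OF that] rc] by auto
  have MC: "M = compositum L (M \<inter> X.Fix) (M \<inter> X.S)" if "M \<in> normal_fields L F K" for M
    by (rule X.stable_eq_compositum[OF M(1,2,4)[OF that]])
  have iso: "tensor_iso L K N \<Gamma> (compositum L N \<Gamma>)"
    if "N \<in> intermediate_fields L Fpi K" "\<Gamma> \<in> normal_fields L Fgal K" for N \<Gamma>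
    by (rule X.tensor_iso_fields(1)[OF N(1-3)[OF that(1)] \<Gamma>(1-3)[OF that(2)]])
  have comp: "compositum L N \<Gamma> \<in> normal_fields L F K"
    if "N \<in> intermediate_fields L Fpi K" "\<Gamma> \<in> normal_fields L Fgal K" for N \<Gamma>
  proof -
    have sub: "N \<union> \<Gamma> \<subseteq> carrier L" using N(4)[OF that(1)] \<Gamma>(5)[OF that(2)] FL by blast
    have "subfield (compositum L N \<Gamma>) L" unfolding compositum_def by (rule generate_field_is_subfield[OF sub])
    moreover have "K \<subseteq> compositum L N \<Gamma>"
      using N(2)[OF that(1)] unfolding compositum_def by (auto intro: generate_field.incl)
    moreover have "compositum L N \<Gamma> \<subseteq> F"
      unfolding compositum_def
      by (rule generate_field_min_subfield1[OF sub subfield_F]) (use N(4)[OF that(1)] \<Gamma>(5)[OF that(2)] in blast)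
    moreover have "X.stable (compositum L N \<Gamma>)"
      by (rule X.compositum_stable[OF N(1-3)[OF that(1)] \<Gamma>(1-4)[OF that(2)]])
    ultimately show ?thesis using X.normal_fields_iff[OF FL] by blast
  qed
  have normal_eq: "normal_fields L F K =
      {compositum L N \<Gamma> | N \<Gamma>. N \<in> intermediate_fields L Fpi K \<and> \<Gamma> \<in> normal_fields L Fgal K}"
    using comp MC Mpi(4) Mgal(4) by blast
  have D: "diff_ops L Lpi N = End L Lpi N" if "N \<in> intermediate_fields L Fpi K" for N
    unfolding Lpi by (rule X.diff_ops_Fix(1)[OF N(1-3)[OF that]])
  have Cr: "Cr \<Gamma> = End L Lgal \<Gamma>" and Cd: "crossed_direct Egal (mult_op L Lgal ` Lgal) (Aut L Lgal \<Gamma>)"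
    if "\<Gamma> \<in> normal_fields L Fgal K" for \<Gamma>
    unfolding Cr_def Egal_def Lgal using X.crossed_S(1,2)[OF \<Gamma>(1-3)[OF that]] by auto
  have TE: "T (End L Lpi N) (End L Lgal \<Gamma>) = End L (carrier L) (compositum L N \<Gamma>)"
    and TiE: "T_iso (End L Lpi N) (End L Lgal \<Gamma>)"
    if "N \<in> intermediate_fields L Fpi K" "\<Gamma> \<in> normal_fields L Fgal K" for N \<Gamma>
    unfolding T_def T_iso_def Lpi Lgal
    by (rule X.op_tensor_End[OF N(1-3)[OF that(1)] \<Gamma>(1-3)[OF that(2)]],
      rule X.op_tensor_iso_End[OF N(2,3)[OF that(1)] \<Gamma>(2,3)[OF that(2)]])
  have cE: "C M = End L (carrier L) M" if "M \<in> normal_fields L F K" for M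
    unfolding C_def E_def m_def
    by (rule centralizer_mult_op[OF carrier_is_subring M(2)[OF that]]) (use M(3)[OF that] FL in blast)
  have cpi: "centralizer Epi (mult_op L Lpi ` (M \<inter> X.Fix)) = End L Lpi (M \<inter> X.Fix)"
    and cgal: "centralizer Egal (mult_op L Lgal ` (M \<inter> X.S)) = End L Lgal (M \<inter> X.S)"
    if "M \<in> normal_fields L F K" for M
    unfolding Epi_def Egal_def Lpi Lgal
    by (rule centralizer_mult_op[OF X.sFix Mpi(2,3)[OF that]], rule centralizer_mult_op[OF X.sS Mgal(2,3)[OF that]])
  have TM: "T (End L Lpi (M \<inter> X.Fix)) (End L Lgal (M \<inter> X.S)) = C M" if "M \<in> normal_fields L F K" for M
    unfolding TE[OF Mpi(4)[OF that] Mgal(4)[OF that]] MC[OF that, symmetric] cE[OF that] ..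
  have inv_eq: "invariant_algebras L F K = C ` normal_fields L F K"
    unfolding X.invariant_algebras_eq[OF subfield_F K_le_F] by (rule image_cong[OF refl]) (simp add: cE)
  have bij: "bij_betw C (normal_fields L F K) (invariant_algebras L F K)"
    using bij_betw_cong[of "normal_fields L F K" C "End L (carrier L)"] cE X.bij_betw_End[OF subfield_F K_le_F] by blast
  have the_inv: "the_inv_into (normal_fields L F K) C (C M) = M" if "M \<in> normal_fields L F K" for M
    by (rule the_inv_into_f_f[OF bij_betw_imp_inj_on[OF bij] that])
  have inv_T: "invariant_algebras L F K =
      {T (diff_ops L Lpi N) (Cr \<Gamma>) | N \<Gamma>. N \<in> intermediate_fields L Fpi K \<and> \<Gamma> \<in> normal_fields L Fgal K}"
  proof (rule equalityI; rule subsetI)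
    fix A assume "A \<in> invariant_algebras L F K"
    then obtain M where M': "M \<in> normal_fields L F K" "A = C M" unfolding inv_eq by blast
    have "A = T (diff_ops L Lpi (M \<inter> X.Fix)) (Cr (M \<inter> X.S))"
      unfolding D[OF Mpi(4)[OF M'(1)]] Cr[OF Mgal(4)[OF M'(1)]] TM[OF M'(1)] by (rule M'(2))
    then show "A \<in> {T (diff_ops L Lpi N) (Cr \<Gamma>) | N \<Gamma>. N \<in> intermediate_fields L Fpi K \<and> \<Gamma> \<in> normal_fields L Fgal K}"
      using Mpi(4)[OF M'(1)] Mgal(4)[OF M'(1)] by blast
  next
    fix A assume "A \<in> {T (diff_ops L Lpi N) (Cr \<Gamma>) | N \<Gamma>. N \<in> intermediate_fields L Fpi K \<and> \<Gamma> \<in> normal_fields L Fgal K}"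
    then obtain N \<Gamma> where n: "N \<in> intermediate_fields L Fpi K" "\<Gamma> \<in> normal_fields L Fgal K" "A = T (diff_ops L Lpi N) (Cr \<Gamma>)"
      by blast
    have "A = C (compositum L N \<Gamma>)" unfolding n(3) D[OF n(1)] Cr[OF n(2)] TE[OF n(1,2)] cE[OF comp[OF n(1,2)]] ..
    then show "A \<in> invariant_algebras L F K" unfolding inv_eq using comp[OF n(1,2)] by blast
  qed
  show ?thesis
  proof (intro conjI)
    show "\<forall>M \<in> normal_fields L F K.
        pi_part L M K = M \<inter> Lpi \<and> gal_part L M K = M \<inter> Lgal \<and>
        M = compositum L (pi_part L M K) (gal_part L M K) \<and>
        tensor_iso L K (pi_part L M K) (gal_part L M K) M"
      unfolding Lpi Lgal
    proof
      fix M assume M': "M \<in> normal_fields L F K"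
      show "pi_part L M K = M \<inter> X.Fix \<and> gal_part L M K = M \<inter> X.S \<and>
        M = compositum L (pi_part L M K) (gal_part L M K) \<and>
        tensor_iso L K (pi_part L M K) (gal_part L M K) M"
        using iso[OF Mpi(4)[OF M'] Mgal(4)[OF M']] MC[OF M'] parts[OF M'] by simp
    qed
    show "\<forall>N \<in> intermediate_fields L Fpi K. \<forall>\<Gamma> \<in> normal_fields L Fgal K.
        tensor_iso L K N \<Gamma> (compositum L N \<Gamma>)"
      using iso by blast
    show "normal_fields L F K =
        {compositum L N \<Gamma> | N \<Gamma>. N \<in> intermediate_fields L Fpi K \<and> \<Gamma> \<in> normal_fields L Fgal K}"
      by (rule normal_eq)
    show "\<forall>N \<in> intermediate_fields L Fpi K. \<forall>\<Gamma> \<in> normal_fields L Fgal K.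
        crossed_direct Egal (mult_op L Lgal ` Lgal) (Aut L Lgal \<Gamma>) \<and>
        T_iso (diff_ops L Lpi N) (Cr \<Gamma>) \<and> T_iso (End L Lpi N) (Cr \<Gamma>) \<and>
        T (diff_ops L Lpi N) (Cr \<Gamma>) = T (End L Lpi N) (Cr \<Gamma>)"
      using Cd TiE D Cr by simp
    show "invariant_algebras L F K =
        {T (diff_ops L Lpi N) (Cr \<Gamma>) | N \<Gamma>.
           N \<in> intermediate_fields L Fpi K \<and> \<Gamma> \<in> normal_fields L Fgal K}"
      by (rule inv_T)
    show "\<forall>M \<in> normal_fields L F K. \<forall>Mpi Mgal. Mpi = pi_part L M K \<and> Mgal = gal_part L M K \<longrightarrow>
        C M = T (centralizer Epi (mult_op L Lpi ` Mpi)) (centralizer Egal (mult_op L Lgal ` Mgal)) \<and>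
        T (centralizer Epi (mult_op L Lpi ` Mpi)) (centralizer Egal (mult_op L Lgal ` Mgal)) =
          T (End L Lpi Mpi) (End L Lgal Mgal) \<and>
        T (End L Lpi Mpi) (End L Lgal Mgal) = T (diff_ops L Lpi Mpi) (Cr Mgal) \<and>
        T_iso (centralizer Epi (mult_op L Lpi ` Mpi)) (centralizer Egal (mult_op L Lgal ` Mgal)) \<and>
        T_iso (End L Lpi Mpi) (End L Lgal Mgal) \<and>
        T_iso (diff_ops L Lpi Mpi) (Cr Mgal) \<and>
        crossed_direct Egal (mult_op L Lgal ` Lgal) (Aut L Lgal Mgal)"
    proof (intro ballI allI impI, elim conjE)
      fix M P Q assume M': "M \<in> normal_fields L F K" and P: "P = pi_part L M K" and Q: "Q = gal_part L M K"
      show "C M = T (centralizer Epi (mult_op L Lpi ` P)) (centralizer Egal (mult_op L Lgal ` Q)) \<and>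
        T (centralizer Epi (mult_op L Lpi ` P)) (centralizer Egal (mult_op L Lgal ` Q)) =
          T (End L Lpi P) (End L Lgal Q) \<and>
        T (End L Lpi P) (End L Lgal Q) = T (diff_ops L Lpi P) (Cr Q) \<and>
        T_iso (centralizer Epi (mult_op L Lpi ` P)) (centralizer Egal (mult_op L Lgal ` Q)) \<and>
        T_iso (End L Lpi P) (End L Lgal Q) \<and>
        T_iso (diff_ops L Lpi P) (Cr Q) \<and>
        crossed_direct Egal (mult_op L Lgal ` Lgal) (Aut L Lgal Q)"
        unfolding P Q parts[OF M'] cpi[OF M'] cgal[OF M'] D[OF Mpi(4)[OF M']] Cr[OF Mgal(4)[OF M']] TM[OF M']
        using TiE[OF Mpi(4)[OF M'] Mgal(4)[OF M']] Cd[OF Mgal(4)[OF M']] by blast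
    qed
    show "bij_betw C (normal_fields L F K) (invariant_algebras L F K)" by (rule bij)
    show "\<forall>A \<in> invariant_algebras L F K.
        \<forall>P Q. P = killed_by L Lpi (A \<inter> embed_left L K Lpi Lgal ` diff_ops_plus L Lpi K) \<and>
              Q = fixed_by Lgal (A \<inter> embed_right L K Lpi Lgal ` Aut L Lgal K) \<longrightarrow>
          centralizer E A = m ` the_inv_into (normal_fields L F K) C A \<and>
          centralizer E A = m ` compositum L P Q \<and>
          tensor_iso L K P Q (compositum L P Q)"
      unfolding Lpi Lgal
    proof (intro ballI allI impI, elim conjE)
      fix A P Q assume A: "A \<in> invariant_algebras L F K"
        and P: "P = killed_by L X.Fix (A \<inter> X.eL ` diff_ops_plus L X.Fix K)"
        and Q: "Q = fixed_by X.S (A \<inter> X.eR ` Aut L X.S K)"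
      obtain M where M': "M \<in> normal_fields L F K" "A = C M" using A unfolding inv_eq by blast
      \<comment> \<open>An invariant algebra is \<open>C M\<close>, so its invariants in the two
        factors are the two parts of \<open>M\<close>, whose compositum is \<open>M\<close>
        again.\<close>
      have PM: "P = M \<inter> X.Fix" and QM: "Q = M \<inter> X.S"
        unfolding P Q M'(2) cE[OF M'(1)] by (rule X.invariants_of_End[OF M(1,2,4)[OF M'(1)]])+
      have "centralizer E A = m ` M"
        unfolding M'(2) cE[OF M'(1)] E_def m_def by (rule X.centralizer_End[OF M(1,2)[OF M'(1)]])
      then show "centralizer E A = m ` the_inv_into (normal_fields L F K) C A \<and>
          centralizer E A = m ` compositum L P Q \<and> tensor_iso L K P Q (compositum L P Q)"
        unfolding PM QM M'(2) the_inv[OF M'(1)]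
        using MC[OF M'(1)] iso[OF Mpi(4)[OF M'(1)] Mgal(4)[OF M'(1)]] by simp
    qed
    show "\<forall>N \<in> intermediate_fields L Fpi K. \<forall>\<Gamma> \<in> normal_fields L Fgal K.
        \<forall>P Q. P = killed_by L Lpi (diff_ops_plus L Lpi N) \<and> Q = fixed_by Lgal (Aut L Lgal \<Gamma>) \<longrightarrow>
          the_inv_into (normal_fields L F K) C (T (diff_ops L Lpi N) (Cr \<Gamma>)) = compositum L P Q \<and>
          tensor_iso L K P Q (compositum L P Q)"
    proof (intro ballI allI impI, elim conjE)
      fix N \<Gamma> P Q assume n: "N \<in> intermediate_fields L Fpi K" "\<Gamma> \<in> normal_fields L Fgal K"
        and P: "P = killed_by L Lpi (diff_ops_plus L Lpi N)" and Q: "Q = fixed_by Lgal (Aut L Lgal \<Gamma>)"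
      have PN: "P = N" unfolding P Lpi by (rule X.diff_ops_Fix(2)[OF N(1-3)[OF n(1)]])
      have QG: "Q = \<Gamma>" unfolding Q Lgal by (rule X.crossed_S(3)[OF \<Gamma>(1-3)[OF n(2)]])
      have "T (diff_ops L Lpi N) (Cr \<Gamma>) = C (compositum L N \<Gamma>)"
        unfolding D[OF n(1)] Cr[OF n(2)] TE[OF n] cE[OF comp[OF n]] ..
      then show "the_inv_into (normal_fields L F K) C (T (diff_ops L Lpi N) (Cr \<Gamma>)) = compositum L P Q \<and>
          tensor_iso L K P Q (compositum L P Q)"
        unfolding PN QG using the_inv[OF comp[OF n]] iso[OF n] by simp
    qed
  qed
qed

end
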